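(* Let $(\Sigma,g)$ be a Riemann surface, where $g$ is a metric with conformal conical (not necessarily distinct) points $p_1,\dots,p_n$, $n\ge2$, of orders $-1<\beta_1\le\cdots\le\beta_n<0$, respectively. Let $\gamma\colon[0,1]\to\Sigma$ be a continuous, immersed, not necessarily closed curve such that there is a partition $0=s_1<\cdots<s_n=1$ with $\gamma(s_j)=p_j$ for $1\le j\le n$, the image $\gamma([0,1]\setminus\{s_1,\dots,s_n\})$ meets no singular point of $\Sigma$, and $\gamma$ is $C^\infty$-smooth on each $[s_j,s_{j+1}]$, $1\le j\le n-1$. Let $\Gamma\colon[0,1]\times[0,T]\to\Sigma$ be the solution of the degenerate curve shortening flow starting at $\gamma$. Then for each $\varepsilon>0$ there exists a time $T_\varepsilon\in(0,T]$ such that for the solution $\Gamma$ on $[0,T_\varepsilon]$, close to $p_j$, $j\in\{1,\dots,n\}$ (i.e. for $s$ close to $s_j$), the pointwise estimate $$|\mathbf{k}_g|_g\le\begin{cases}c_j\,|s-s_j|^{1+\beta_j-\varepsilon}&\text{if }\beta_n\le-1/2,\\ c_j\,|s-s_j|^{-\beta_n\frac{1+\beta_j}{1+\beta_n}-\varepsilon}&\text{if }\beta_n>-1/2,\end{cases}$$ holds, where $c_j\ge0$ is a constant depending only on $\varepsilon$ and $T_\varepsilon$, $\mathbf{k}_g$ is the geodesic curvature vector of the evolved curve $s\mapsto\Gamma(s,t)$, and $|\cdot|_g$ is the norm with respect to $g$.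
   Context: A Riemann surface $\Sigma$ is an oriented two-dimensional manifold with its complex structure, equipped with a complete Riemannian metric $g_0$. A metric $g$, (weakly) conformal to $g_0$ and a smooth Riemannian metric away from finitely many points, has a conformal conical (singular) point $p$ of order $\beta$ if there is a complex chart $z\colon U\to\mathbb{C}$ of $\Sigma$ around $p$ (conformal coordinate chart) with $z(p)=0$ and $g=e^{2h}|z|^{2\beta}|dz|^2$, where $h$ is a real analytic function on $U$. The geodesic curvature vector of an immersed curve is $\mathbf{k}_g=\nabla_{\tau_g}\tau_g$, where $\tau_g$ is the $g$-unit tangent and $\nabla$ the Levi-Civita connection of $g$ away from the singular points. The solution of the degenerate curve shortening flow starting at $\gamma$ is the unique (for some $T>0$) map $\Gamma\colon[0,1]\times[0,T]\to\Sigma$, represented as a graph over $\gamma$, which is continuous on $[0,1]\times[0,T]$, $C^\infty$-smooth on $(s_j,s_{j+1})\times(0,T)$, $C^1$-smooth on $[s_j,s_{j+1}]\times[0,T]$, satisfies $\Gamma(s_j,t)=p_j$ for all $j$ and $t$, $\Gamma(\cdot,0)=\gamma$, and $\Gamma_t^\perp=\mathbf{k}_g$ on $[0,1]\times(0,T)$ (at $s=s_j$ in the sense of one-sided limits), $\{\cdot\}^\perp$ being the orthogonal projection onto the normal space of the evolved curve. "Graph over $\gamma$" means that on each $[s_j,s_{j+1}]\times[0,T]$ one has $\Gamma(s,t)=F_j(s,w_j(s,t))$ with $w_j(\cdot,0)=0$, where $F_j\colon[s_j,s_{j+1}]\times(-\varepsilon_0,\varepsilon_0)\to\Sigma$ is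 a fixed smooth immersion with $F_j(\cdot,0)=\gamma$ obtained by gluing local graphs, which for $s$ near the endpoints has, in conformal coordinate charts around the singular points, the form $F_j(s,y)=\gamma(s)+y\xi(s)$, $\xi$ being the unit normal of $\gamma$ with respect to the Euclidean metric of the chart. *)

theory Defs
  imports "HOL-Analysis.Analysis" "HOL-Library.Extended_Nat"
begin

section \<open>Differentiability classes\<close>

text \<open>
  \<open>D [b\<^sub>1, \<dots>, b\<^sub>m]\<close> is the iterated partial derivative of \<open>f\<close> in the basis directions
  \<open>b\<^sub>m, \<dots>, b\<^sub>1\<close>.  All derivatives are taken within \<open>S\<close>, i.e. they are one-sided at boundary points.
  The definition is meant for sets on which derivatives within \<open>S\<close> are unique, such as open sets and
  convex sets with nonempty interior (intervals, rectangles).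
\<close>

definition Ck_on :: "enat \<Rightarrow> 'a::euclidean_space set \<Rightarrow> ('a \<Rightarrow> 'b::real_normed_vector) \<Rightarrow> bool" where
  "Ck_on k S f \<longleftrightarrow>
    (\<exists>D :: 'a list \<Rightarrow> 'a \<Rightarrow> 'b.
      (\<forall>x\<in>S. D [] x = f x) \<and>
      (\<forall>bs. set bs \<subseteq> Basis \<and> enat (length bs) < k \<longrightarrow>
        (\<forall>x\<in>S. (D bs has_derivative (\<lambda>h. \<Sum>b\<in>Basis. (h \<bullet> b) *\<^sub>R D (b # bs) x)) (at x within S))) \<and>
      (\<forall>bs. set bs \<subseteq> Basis \<and> enat (length bs) \<le> k \<longrightarrow> continuous_on S (D bs)))"

definition real_analytic_on :: "(complex \<Rightarrow> real) \<Rightarrow> complex set \<Rightarrow> bool" where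
  "real_analytic_on h S \<longleftrightarrow>
    (\<forall>w\<in>S. \<exists>a :: nat \<times> nat \<Rightarrow> real. \<exists>r>0. \<forall>z\<in>ball w r.
      ((\<lambda>(k, l). a (k, l) * Re (z - w) ^ k * Im (z - w) ^ l) has_sum h z) UNIV)"


section \<open>Riemann surfaces\<close>

text \<open>
  A chart is a pair \<open>(U, z)\<close>; the values of \<open>z\<close> outside \<open>U\<close> are irrelevant.
  A complex structure is a maximal holomorphic atlas, so that its members are exactly the
  complex charts of the surface.
\<close>

type_synonym 'a chart = "'a set \<times> ('a \<Rightarrow> complex)"

definition is_chart :: "'a::topological_space chart \<Rightarrow> bool" where
  "is_chart c \<longleftrightarrow> (case c of (U, z) \<Rightarrow>
    open U \<and> open (z ` U) \<and> homeomorphism U (z ` U) z (inv_into U z))"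

definition transition :: "'a chart \<Rightarrow> 'a chart \<Rightarrow> complex \<Rightarrow> complex" where
  "transition c c' = snd c' \<circ> inv_into (fst c) (snd c)"

definition compatible :: "'a chart \<Rightarrow> 'a chart \<Rightarrow> bool" where
  "compatible c c' \<longleftrightarrow>
    transition c c' holomorphic_on (snd c ` (fst c \<inter> fst c')) \<and>
    transition c' c holomorphic_on (snd c' ` (fst c \<inter> fst c'))"

definition complex_structure :: "'a::topological_space chart set \<Rightarrow> bool" where
  "complex_structure A \<longleftrightarrow>
    (\<forall>c\<in>A. is_chart c) \<and> (\<Union>c\<in>A. fst c) = UNIV \<and>
    (\<forall>c\<in>A. \<forall>c'\<in>A. compatible c c') \<and>
    (\<forall>c. is_chart c \<and> (\<forall>c'\<in>A. compatible c c') \<longrightarrow> c \<in> A)"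

definition Ck_map_on ::
  "enat \<Rightarrow> 'a::topological_space chart set \<Rightarrow> 'm::euclidean_space set \<Rightarrow> ('m \<Rightarrow> 'a) \<Rightarrow> bool" where
  "Ck_map_on k A S f \<longleftrightarrow>
    (\<forall>x\<in>S. \<forall>c\<in>A. f x \<in> fst c \<longrightarrow>
      (\<exists>r>0. f ` (S \<inter> ball x r) \<subseteq> fst c \<and> Ck_on k (S \<inter> ball x r) (snd c \<circ> f)))"

definition immersion_on ::
  "'a::topological_space chart set \<Rightarrow> 'm::euclidean_space set \<Rightarrow> ('m \<Rightarrow> 'a) \<Rightarrow> bool" where
  "immersion_on A S f \<longleftrightarrow>
    (\<forall>x\<in>S. \<forall>c\<in>A. f x \<in> fst c \<longrightarrow>
      (\<exists>f'. ((snd c \<circ> f) has_derivative f') (at x within S) \<and> inj f'))"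


section \<open>Riemannian metrics\<close>

text \<open>
  A metric tensor is given by its coordinate representations: for a chart \<open>c = (U, z)\<close> and
  \<open>x \<in> z ` U\<close>, \<open>g c x u v\<close> is the inner product of the tangent vectors at the point \<open>q\<close> with
  \<open>z q = x\<close> whose coordinate vectors are \<open>u, v \<in> \<real>\<^sup>2 = \<complex>\<close>.
\<close>

type_synonym 'a metric_tensor = "'a chart \<Rightarrow> complex \<Rightarrow> complex \<Rightarrow> complex \<Rightarrow> real"

definition riemannian_metric_on ::
  "'a::topological_space chart set \<Rightarrow> 'a set \<Rightarrow> 'a metric_tensor \<Rightarrow> bool" where
  "riemannian_metric_on A W g \<longleftrightarrow>
    (\<forall>c\<in>A. \<forall>q\<in>fst c \<inter> W.
      bilinear (g c (snd c q)) \<and>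
      (\<forall>u v. g c (snd c q) u v = g c (snd c q) v u) \<and>
      (\<forall>u. u \<noteq> 0 \<longrightarrow> g c (snd c q) u u > 0)) \<and>
    (\<forall>c\<in>A. \<forall>u v. Ck_on \<infinity> (snd c ` (fst c \<inter> W)) (\<lambda>x. g c x u v)) \<and>
    (\<forall>c\<in>A. \<forall>c'\<in>A. \<forall>q\<in>fst c \<inter> fst c' \<inter> W. \<forall>u v.
      g c (snd c q) u v =
      g c' (snd c' q) (deriv (transition c c') (snd c q) * u) (deriv (transition c c') (snd c q) * v))"

text \<open>
  The metric induces the complex structure: multiplication by \<open>\<i>\<close> is an isometry of each
  tangent space.
\<close>

definition hermitian :: "'a chart set \<Rightarrow> 'a metric_tensor \<Rightarrow> bool" where
  "hermitian A g \<longleftrightarrow>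
    (\<forall>c\<in>A. \<forall>q\<in>fst c. \<forall>u v. g c (snd c q) (\<i> * u) (\<i> * v) = g c (snd c q) u v)"

definition conformal_on ::
  "'a chart set \<Rightarrow> 'a set \<Rightarrow> 'a metric_tensor \<Rightarrow> 'a metric_tensor \<Rightarrow> bool" where
  "conformal_on A W g g' \<longleftrightarrow>
    (\<exists>\<rho>. \<forall>q\<in>W. \<rho> q > 0 \<and>
      (\<forall>c\<in>A. q \<in> fst c \<longrightarrow> (\<forall>u v. g c (snd c q) u v = \<rho> q * g' c (snd c q) u v)))"

definition tensor_norm :: "(complex \<Rightarrow> complex \<Rightarrow> complex \<Rightarrow> real) \<Rightarrow> complex \<Rightarrow> complex \<Rightarrow> real" where
  "tensor_norm G x v = sqrt (G x v v)"

definition curve_speed :: "'a chart set \<Rightarrow> 'a metric_tensor \<Rightarrow> (real \<Rightarrow> 'a) \<Rightarrow> real \<Rightarrow> real" where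
  "curve_speed A g \<sigma> s =
    (let c = (SOME c. c \<in> A \<and> \<sigma> s \<in> fst c)
     in tensor_norm (g c) (snd c (\<sigma> s)) (vector_derivative (snd c \<circ> \<sigma>) (at s)))"

definition piecewise_C1_curve :: "'a::topological_space chart set \<Rightarrow> (real \<Rightarrow> 'a) \<Rightarrow> bool" where
  "piecewise_C1_curve A \<sigma> \<longleftrightarrow>
    (\<exists>m. \<exists>r :: nat \<Rightarrow> real. strict_mono_on {0..m} r \<and> r 0 = 0 \<and> r m = 1 \<and>
      (\<forall>i<m. Ck_map_on 1 A {r i..r (Suc i)} \<sigma>))"

definition riemannian_dist ::
  "'a::topological_space chart set \<Rightarrow> 'a metric_tensor \<Rightarrow> 'a \<Rightarrow> 'a \<Rightarrow> real" where
  "riemannian_dist A g a b =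
    Inf {integral {0..1} (curve_speed A g \<sigma>) | \<sigma>. piecewise_C1_curve A \<sigma> \<and> \<sigma> 0 = a \<and> \<sigma> 1 = b}"

definition riemann_surface :: "'a::topological_space chart set \<Rightarrow> 'a metric_tensor \<Rightarrow> bool" where
  "riemann_surface A g0 \<longleftrightarrow>
    connected (UNIV :: 'a set) \<and> complex_structure A \<and>
    riemannian_metric_on A UNIV g0 \<and> hermitian A g0 \<and>
    Metric_space.mcomplete UNIV (riemannian_dist A g0)"


section \<open>Conical points\<close>

definition conical_chart ::
  "'a chart set \<Rightarrow> 'a metric_tensor \<Rightarrow> 'a \<Rightarrow> real \<Rightarrow> 'a chart \<Rightarrow> bool" where
  "conical_chart A g p \<beta> c \<longleftrightarrow>
    c \<in> A \<and> p \<in> fst c \<and> snd c p = 0 \<and>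
    (\<exists>h. real_analytic_on h (snd c ` fst c) \<and>
      (\<forall>x\<in>snd c ` fst c - {0}. \<forall>u v.
        g c x u v = exp (2 * h x) * norm x powr (2 * \<beta>) * (u \<bullet> v)))"

definition conical_point :: "'a chart set \<Rightarrow> 'a metric_tensor \<Rightarrow> 'a \<Rightarrow> real \<Rightarrow> bool" where
  "conical_point A g p \<beta> \<longleftrightarrow> (\<exists>c. conical_chart A g p \<beta> c)"


section \<open>Geodesic curvature\<close>

text \<open>
  Here \<open>G\<close> is a metric in coordinates and \<open>x\<close> a curve in coordinates.  The Christoffel symbols of
  the Levi-Civita connection are encoded as the vector \<open>\<nabla>\<^sub>u v\<close> for constant coordinate vector fields
  \<open>u, v\<close>, determined by the Koszul formula (Lie brackets of constant fields vanish).
\<close>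

definition levi_civita ::
  "(complex \<Rightarrow> complex \<Rightarrow> complex \<Rightarrow> real) \<Rightarrow> complex \<Rightarrow> complex \<Rightarrow> complex \<Rightarrow> complex" where
  "levi_civita G x u v =
    (THE a. \<forall>b. 2 * G x a b =
      frechet_derivative (\<lambda>y. G y v b) (at x) u +
      frechet_derivative (\<lambda>y. G y u b) (at x) v -
      frechet_derivative (\<lambda>y. G y u v) (at x) b)"

definition covariant_deriv ::
  "(complex \<Rightarrow> complex \<Rightarrow> complex \<Rightarrow> real) \<Rightarrow> (real \<Rightarrow> complex) \<Rightarrow> (real \<Rightarrow> complex) \<Rightarrow> real \<Rightarrow> complex" where
  "covariant_deriv G x V s =
    vector_derivative V (at s) + levi_civita G (x s) (vector_derivative x (at s)) (V s)"

definition unit_tangent ::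
  "(complex \<Rightarrow> complex \<Rightarrow> complex \<Rightarrow> real) \<Rightarrow> (real \<Rightarrow> complex) \<Rightarrow> real \<Rightarrow> complex" where
  "unit_tangent G x s =
    vector_derivative x (at s) /\<^sub>R tensor_norm G (x s) (vector_derivative x (at s))"

text \<open>\<open>\<nabla>\<^sub>\<tau> \<tau>\<close> is the covariant derivative of \<open>\<tau>\<close> along the curve, divided by the speed.\<close>

definition geodesic_curvature ::
  "(complex \<Rightarrow> complex \<Rightarrow> complex \<Rightarrow> real) \<Rightarrow> (real \<Rightarrow> complex) \<Rightarrow> real \<Rightarrow> complex" where
  "geodesic_curvature G x s =
    covariant_deriv G x (unit_tangent G x) s /\<^sub>R tensor_norm G (x s) (vector_derivative x (at s))"

definition normal_part ::
  "(complex \<Rightarrow> complex \<Rightarrow> complex \<Rightarrow> real) \<Rightarrow> (real \<Rightarrow> complex) \<Rightarrow> real \<Rightarrow> complex \<Rightarrow> complex" where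
  "normal_part G x s v = v - G (x s) v (unit_tangent G x s) *\<^sub>R unit_tangent G x s"


section \<open>Degenerate curve shortening flow\<close>

definition slice_curvature ::
  "'a metric_tensor \<Rightarrow> (real \<times> real \<Rightarrow> 'a) \<Rightarrow> 'a chart \<Rightarrow> real \<Rightarrow> real \<Rightarrow> complex" where
  "slice_curvature g \<Gamma> c r t = geodesic_curvature (g c) (\<lambda>r. snd c (\<Gamma> (r, t))) r"

definition normal_velocity ::
  "'a metric_tensor \<Rightarrow> (real \<times> real \<Rightarrow> 'a) \<Rightarrow> 'a chart \<Rightarrow> real \<Rightarrow> real \<Rightarrow> complex" where
  "normal_velocity g \<Gamma> c r t =
    normal_part (g c) (\<lambda>r. snd c (\<Gamma> (r, t))) r (vector_derivative (\<lambda>t. snd c (\<Gamma> (r, t))) (at t))"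

text \<open>
  Near an endpoint \<open>e\<close> of \<open>I\<close> the map \<open>F\<close> is \<open>(r, y) \<mapsto> \<gamma> r + y \<xi> r\<close> in a conformal chart around the
  singular point \<open>p\<close>.  The unit normal \<open>\<xi>\<close> is the tangent rotated by a quarter turn; the opposite
  choice amounts to replacing \<open>y\<close> by \<open>-y\<close>.
\<close>

definition straight_end ::
  "'a chart set \<Rightarrow> 'a metric_tensor \<Rightarrow> (real \<Rightarrow> 'a) \<Rightarrow> real set \<Rightarrow> real \<Rightarrow> 'a \<Rightarrow> real \<Rightarrow> real \<Rightarrow>
    (real \<times> real \<Rightarrow> 'a) \<Rightarrow> bool" where
  "straight_end A g \<gamma> I e p \<beta> \<epsilon>0 F \<longleftrightarrow>
    (\<exists>c \<delta>. conical_chart A g p \<beta> c \<and> \<delta> > 0 \<and>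
      (\<forall>r\<in>I. \<bar>r - e\<bar> < \<delta> \<longrightarrow>
        \<gamma> r \<in> fst c \<and>
        (\<forall>y. \<bar>y\<bar> < \<epsilon>0 \<longrightarrow>
          F (r, y) \<in> fst c \<and>
          snd c (F (r, y)) =
            snd c (\<gamma> r) + y *\<^sub>R (\<i> * sgn (vector_derivative (snd c \<circ> \<gamma>) (at r within I))))))"

definition graph_coordinates ::
  "'a::topological_space chart set \<Rightarrow> 'a metric_tensor \<Rightarrow> (real \<Rightarrow> 'a) \<Rightarrow> real \<Rightarrow> real \<Rightarrow>
    'a \<Rightarrow> real \<Rightarrow> 'a \<Rightarrow> real \<Rightarrow> real \<Rightarrow> (real \<times> real \<Rightarrow> 'a) \<Rightarrow> bool" where
  "graph_coordinates A g \<gamma> a b p \<beta> q \<beta>' \<epsilon>0 F \<longleftrightarrow>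
    \<epsilon>0 > 0 \<and>
    Ck_map_on \<infinity> A ({a..b} \<times> {-\<epsilon>0<..<\<epsilon>0}) F \<and>
    immersion_on A ({a..b} \<times> {-\<epsilon>0<..<\<epsilon>0}) F \<and>
    (\<forall>r\<in>{a..b}. F (r, 0) = \<gamma> r) \<and>
    straight_end A g \<gamma> {a..b} a p \<beta> \<epsilon>0 F \<and>
    straight_end A g \<gamma> {a..b} b q \<beta>' \<epsilon>0 F"

definition graph_over ::
  "'a::topological_space chart set \<Rightarrow> 'a metric_tensor \<Rightarrow> (real \<Rightarrow> 'a) \<Rightarrow> real \<Rightarrow> real \<Rightarrow>
    'a \<Rightarrow> real \<Rightarrow> 'a \<Rightarrow> real \<Rightarrow> real \<Rightarrow> (real \<times> real \<Rightarrow> 'a) \<Rightarrow> bool" where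
  "graph_over A g \<gamma> a b p \<beta> q \<beta>' T \<Gamma> \<longleftrightarrow>
    (\<exists>\<epsilon>0 F w. graph_coordinates A g \<gamma> a b p \<beta> q \<beta>' \<epsilon>0 F \<and>
      continuous_on ({a..b} \<times> {0..T}) w \<and>
      w ` ({a..b} \<times> {0..T}) \<subseteq> {-\<epsilon>0<..<\<epsilon>0} \<and>
      (\<forall>r\<in>{a..b}. w (r, 0) = 0) \<and>
      (\<forall>r\<in>{a..b}. \<forall>t\<in>{0..T}. \<Gamma> (r, t) = F (r, w (r, t))))"

text \<open>
  \<open>S\<close> is the set of singular points of \<open>g\<close>.  At an endpoint of \<open>[a, b]\<close> the flow equation means that
  the one-sided limits of both sides exist and agree, in every chart around that point.
\<close>

definition flow_equation ::
  "'a chart set \<Rightarrow> 'a metric_tensor \<Rightarrow> 'a set \<Rightarrow> real \<Rightarrow> real \<Rightarrow> real \<Rightarrow> (real \<times> real \<Rightarrow> 'a) \<Rightarrow> bool" where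
  "flow_equation A g S a b T \<Gamma> \<longleftrightarrow>
    (\<forall>t\<in>{0<..<T}.
      (\<forall>r\<in>{a<..<b}. \<Gamma> (r, t) \<notin> S \<and>
        (\<forall>c\<in>A. \<Gamma> (r, t) \<in> fst c \<longrightarrow> normal_velocity g \<Gamma> c r t = slice_curvature g \<Gamma> c r t)) \<and>
      (\<forall>e\<in>{a, b}. \<forall>c\<in>A. \<Gamma> (e, t) \<in> fst c \<longrightarrow>
        (\<exists>L. ((\<lambda>r. normal_velocity g \<Gamma> c r t) \<longlongrightarrow> L) (at e within {a<..<b}) \<and>
             ((\<lambda>r. slice_curvature g \<Gamma> c r t) \<longlongrightarrow> L) (at e within {a<..<b}))))"

definition degenerate_csf ::
  "'a::topological_space chart set \<Rightarrow> 'a metric_tensor \<Rightarrow> 'a set \<Rightarrow> nat \<Rightarrow> (nat \<Rightarrow> 'a) \<Rightarrow> (nat \<Rightarrow> real) \<Rightarrow>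
    (nat \<Rightarrow> real) \<Rightarrow> (real \<Rightarrow> 'a) \<Rightarrow> real \<Rightarrow> (real \<times> real \<Rightarrow> 'a) \<Rightarrow> bool" where
  "degenerate_csf A g S n p \<beta> s \<gamma> T \<Gamma> \<longleftrightarrow>
    T > 0 \<and>
    continuous_on ({0..1} \<times> {0..T}) \<Gamma> \<and>
    (\<forall>j\<in>{1..n}. \<forall>t\<in>{0..T}. \<Gamma> (s j, t) = p j) \<and>
    (\<forall>r\<in>{0..1}. \<Gamma> (r, 0) = \<gamma> r) \<and>
    (\<forall>j\<in>{1..<n}.
      Ck_map_on \<infinity> A ({s j<..<s (Suc j)} \<times> {0<..<T}) \<Gamma> \<and>
      Ck_map_on 1 A ({s j..s (Suc j)} \<times> {0..T}) \<Gamma> \<and>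
      graph_over A g \<gamma> (s j) (s (Suc j)) (p j) (\<beta> j) (p (Suc j)) (\<beta> (Suc j)) T \<Gamma> \<and>
      flow_equation A g S (s j) (s (Suc j)) T \<Gamma>)"

end

theory Submission
  imports Defs
begin

text \<open>
  In a conical chart the evolved arc is a curve \<open>z(r,t)\<close> issuing from the origin. The angle \<open>\<omega>\<close>
  between the curve and the ray through \<open>z\<close> satisfies a parabolic equation in which the cone produces
  a restoring term, so that \<open>K |z| powr \<kappa>\<close> is a barrier for \<open>\<omega>\<close> as long as \<open>\<kappa> \<le> 1\<close> and
  \<open>\<kappa> < 2 (1 + \<beta>)\<close>. A second application of the maximum principle, to a combination of \<open>k\<^sup>2 (1 + 8 \<omega>\<^sup>2)\<close>
  and \<open>|z| powr (- 2 (1 + \<beta>)) \<omega>\<^sup>2\<close>, turns this into the bound \<open>k = O(r powr (\<kappa> - (1 + \<beta>)))\<close> for the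
  curvature. Both exponents of the theorem are at most \<open>min (- \<beta>) (1 + \<beta>) - \<epsilon>\<close>, which a suitable
  \<open>\<kappa>\<close> exceeds.
\<close>

section \<open>A parabolic maximum principle\<close>

text \<open>The equation degenerates at the vertex, and \<open>\<Gamma>\<close> is only C^1 up to
  the vertex and up to time 0, so no bound for the curvature is available there in advance. The
  curvature is therefore represented by the normal speed \<open>k\<close>, which is continuous down
  to time 0 and of order |z|^(b - 1), b = 1 + \<open>\<beta>\<close>, because z_t is bounded. Both
  barriers carry an extra term with a factor \<open>\<delta>\<close> that wins near the vertex:
  \<open>\<delta>\<close> itself for the angle, which tends to 0 there, and \<open>\<delta>\<close>
  |z|^(-2) for k^2. All other constants are independent of \<open>\<delta>\<close>, which finally
  tends to 0. In the coordinate log z the cone becomes a cylindrical end, and the reaction term of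
  the angle is - b^2 |q|^2 sin (2 \<open>\<omega>\<close>) with an error O(|z| |q|^2), where |q|^2
  is of order |z|^(-2 b). Testing it against |z|^\<open>\<kappa>\<close> leaves the factor 2 b^2 + b
  \<open>\<kappa>\<close> - \<open>\<kappa>\<close>^2 = (2 b - \<open>\<kappa>\<close>) (b +
  \<open>\<kappa>\<close>), which has to be positive; \<open>\<kappa>\<close> \<le> 1 lets the
  barrier absorb the error and the initial data.\<close>

text \<open>
  The second-order jet of \<open>f\<close> at \<open>(r, t)\<close> seen by an operator of the form
  \<open>\<partial>\<^sub>t - a \<partial>\<^sub>r - e\<^sup>-\<^sup>2 \<partial>\<^sub>r\<^sub>r\<close>: \<open>d\<close> is the derivative \<open>e\<^sup>-\<^sup>1 \<partial>\<^sub>r f\<close> with respect to arc length, \<open>l\<close> the value of the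
  operator.  For the flow, \<open>e\<close> is the speed and the operator is \<open>\<partial>\<^sub>t - \<partial>\<^sub>s\<^sub>s\<close> along the normal motion.
\<close>

definition jet :: "real \<Rightarrow> real \<Rightarrow> (real \<Rightarrow> real \<Rightarrow> real) \<Rightarrow> real \<Rightarrow> real \<Rightarrow> real \<Rightarrow> real \<Rightarrow> bool" where
  "jet a e f r t d l \<longleftrightarrow> (\<exists>f1 f11 f2.
     (\<forall>\<^sub>F x in nhds r. ((\<lambda>x. f x t) has_real_derivative f1 x) (at x)) \<and>
     (f1 has_real_derivative f11) (at r) \<and>
     (f r has_real_derivative f2) (at t) \<and>
     d = f1 r / e \<and> l = f2 - a * f1 r - f11 / e\<^sup>2)"

lemma jetI:
  assumes "open X" "r \<in> X"
    and "\<And>x. x \<in> X \<Longrightarrow> ((\<lambda>x. f x t) has_real_derivative f1 x) (at x)"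
    and "(f1 has_real_derivative f11) (at r)"
    and "(f r has_real_derivative f2) (at t)"
    and "d = f1 r / e" "l = f2 - a * f1 r - f11 / e\<^sup>2"
  shows "jet a e f r t d l"
proof -
  have "\<forall>\<^sub>F x in nhds r. x \<in> X"
    using assms(1,2) by (simp add: eventually_nhds_in_open)
  then have "\<forall>\<^sub>F x in nhds r. ((\<lambda>x. f x t) has_real_derivative f1 x) (at x)"
    by eventually_elim (use assms(3) in auto)
  then show ?thesis
    unfolding jet_def using assms(4-7) by blast
qed

lemma jet_const: "jet a e (\<lambda>r t. c) r t 0 0"
  by (rule jetI[of UNIV _ _ _ "\<lambda>_. 0" 0 0]) auto

lemma jet_add:
  assumes "jet a e f r t d l" "jet a e g r t d' l'"
  shows "jet a e (\<lambda>r t. f r t + g r t) r t (d + d') (l + l')"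
proof -
  from assms(1) obtain f1 f11 f2 where f:
    "\<forall>\<^sub>F x in nhds r. ((\<lambda>x. f x t) has_real_derivative f1 x) (at x)"
    "(f1 has_real_derivative f11) (at r)" "(f r has_real_derivative f2) (at t)"
    "d = f1 r / e" "l = f2 - a * f1 r - f11 / e\<^sup>2"
    unfolding jet_def by blast
  from assms(2) obtain g1 g11 g2 where g:
    "\<forall>\<^sub>F x in nhds r. ((\<lambda>x. g x t) has_real_derivative g1 x) (at x)"
    "(g1 has_real_derivative g11) (at r)" "(g r has_real_derivative g2) (at t)"
    "d' = g1 r / e" "l' = g2 - a * g1 r - g11 / e\<^sup>2"
    unfolding jet_def by blast
  have "\<forall>\<^sub>F x in nhds r. ((\<lambda>x. f x t + g x t) has_real_derivative f1 x + g1 x) (at x)"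
    using f(1) g(1) by eventually_elim (auto intro: DERIV_add)
  moreover have "((\<lambda>x. f1 x + g1 x) has_real_derivative f11 + g11) (at r)"
    using f(2) g(2) by (rule DERIV_add)
  moreover have "((\<lambda>t. f r t + g r t) has_real_derivative f2 + g2) (at t)"
    using f(3) g(3) by (rule DERIV_add)
  ultimately show ?thesis
    unfolding jet_def
    by (intro exI[of _ "\<lambda>x. f1 x + g1 x"] exI[of _ "f11 + g11"] exI[of _ "f2 + g2"] conjI)
       (auto simp: f g algebra_simps add_divide_distrib)
qed

text \<open>The heat operator is not a derivation: the second derivative leaves the cross term - 2 d
  d'. The evolution of every composite barrier is assembled from this rule, so that no second
  derivative of a barrier has to be computed by hand.\<close>

lemma jet_mult:
  assumes "jet a e f r t d l" "jet a e g r t d' l'"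
  shows "jet a e (\<lambda>r t. f r t * g r t) r t
    (d * g r t + f r t * d') (l * g r t + f r t * l' - 2 * d * d')"
proof -
  from assms(1) obtain f1 f11 f2 where f:
    "\<forall>\<^sub>F x in nhds r. ((\<lambda>x. f x t) has_real_derivative f1 x) (at x)"
    "(f1 has_real_derivative f11) (at r)" "(f r has_real_derivative f2) (at t)"
    "d = f1 r / e" "l = f2 - a * f1 r - f11 / e\<^sup>2"
    unfolding jet_def by blast
  from assms(2) obtain g1 g11 g2 where g:
    "\<forall>\<^sub>F x in nhds r. ((\<lambda>x. g x t) has_real_derivative g1 x) (at x)"
    "(g1 has_real_derivative g11) (at r)" "(g r has_real_derivative g2) (at t)"
    "d' = g1 r / e" "l' = g2 - a * g1 r - g11 / e\<^sup>2"
    unfolding jet_def by blast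
  have fr: "((\<lambda>x. f x t) has_real_derivative f1 r) (at r)"
    using f(1) by (rule eventually_nhds_x_imp_x)
  have gr: "((\<lambda>x. g x t) has_real_derivative g1 r) (at r)"
    using g(1) by (rule eventually_nhds_x_imp_x)
  have "\<forall>\<^sub>F x in nhds r. ((\<lambda>x. f x t * g x t) has_real_derivative f1 x * g x t + f x t * g1 x) (at x)"
    using f(1) g(1) by eventually_elim (auto intro!: derivative_eq_intros)
  moreover have "((\<lambda>x. f1 x * g x t + f x t * g1 x) has_real_derivative
      f11 * g r t + 2 * (f1 r * g1 r) + f r t * g11) (at r)"
    using f(2) g(2) fr gr by (auto intro!: derivative_eq_intros)
  moreover have "((\<lambda>t. f r t * g r t) has_real_derivative f2 * g r t + f r t * g2) (at t)"
    using f(3) g(3) by (auto intro!: derivative_eq_intros)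
  ultimately show ?thesis
    unfolding jet_def
    by (intro exI[of _ "\<lambda>x. f1 x * g x t + f x t * g1 x"]
        exI[of _ "f11 * g r t + 2 * (f1 r * g1 r) + f r t * g11"]
        exI[of _ "f2 * g r t + f r t * g2"] conjI)
       (auto simp: f g algebra_simps add_divide_distrib power2_eq_square)
qed

lemma jet_cmult:
  assumes "jet a e f r t d l"
  shows "jet a e (\<lambda>r t. c * f r t) r t (c * d) (c * l)"
  using jet_mult[OF jet_const[of a e c] assms] by simp

text \<open>Powers |z|^p enter the barriers as \<open>exp (p * \<xi>)\<close> with
  \<open>\<xi>\<close> = ln |z|; this is the chain rule for them.\<close>

lemma jet_exp:
  assumes "jet a e f r t d l"
  shows "jet a e (\<lambda>r t. exp (f r t)) r t (exp (f r t) * d) (exp (f r t) * (l - d\<^sup>2))"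
proof -
  from assms obtain f1 f11 f2 where f:
    "\<forall>\<^sub>F x in nhds r. ((\<lambda>x. f x t) has_real_derivative f1 x) (at x)"
    "(f1 has_real_derivative f11) (at r)" "(f r has_real_derivative f2) (at t)"
    "d = f1 r / e" "l = f2 - a * f1 r - f11 / e\<^sup>2"
    unfolding jet_def by blast
  have fr: "((\<lambda>x. f x t) has_real_derivative f1 r) (at r)"
    using f(1) by (rule eventually_nhds_x_imp_x)
  have "\<forall>\<^sub>F x in nhds r. ((\<lambda>x. exp (f x t)) has_real_derivative exp (f x t) * f1 x) (at x)"
    using f(1) by eventually_elim (auto intro!: derivative_eq_intros)
  moreover have "((\<lambda>x. exp (f x t) * f1 x) has_real_derivative
      exp (f r t) * (f11 + (f1 r)\<^sup>2)) (at r)"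
    using f(2) fr by (auto intro!: derivative_eq_intros simp: algebra_simps power2_eq_square)
  moreover have "((\<lambda>t. exp (f r t)) has_real_derivative exp (f r t) * f2) (at t)"
    using f(3) by (auto intro!: derivative_eq_intros)
  ultimately show ?thesis
    unfolding jet_def
    by (intro exI[of _ "\<lambda>x. exp (f x t) * f1 x"]
        exI[of _ "exp (f r t) * (f11 + (f1 r)\<^sup>2)"] exI[of _ "exp (f r t) * f2"] conjI)
       (auto simp: f algebra_simps add_divide_distrib power_divide)
qed

text \<open>In time only the past is compared, because at a first contact \<open>f\<close> may well
  grow afterwards. That suffices for a nonnegative time derivative, while the first space derivative
  vanishes and the second one is nonpositive.\<close>

lemma jet_at_maximum:
  assumes jet: "jet a e f r t d l" and "e \<noteq> 0"
    and space: "\<forall>\<^sub>F x in nhds r. f x t \<le> f r t"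
    and time: "\<forall>\<^sub>F x in at_left t. f r x \<le> f r t"
  shows "d = 0" "l \<ge> 0"
proof -
  from jet obtain f1 f11 f2 where f:
    "\<forall>\<^sub>F x in nhds r. ((\<lambda>x. f x t) has_real_derivative f1 x) (at x)"
    "(f1 has_real_derivative f11) (at r)" "(f r has_real_derivative f2) (at t)"
    "d = f1 r / e" "l = f2 - a * f1 r - f11 / e\<^sup>2"
    unfolding jet_def by blast
  have fr: "((\<lambda>x. f x t) has_real_derivative f1 r) (at r)"
    using f(1) by (rule eventually_nhds_x_imp_x)
  from space f(1) have "\<forall>\<^sub>F x in nhds r. f x t \<le> f r t \<and> ((\<lambda>x. f x t) has_real_derivative f1 x) (at x)"
    by (rule eventually_conj)
  then obtain \<eta> where \<eta>: "\<eta> > 0" "\<And>x. dist x r < \<eta> \<Longrightarrow> f x t \<le> f r t"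
      "\<And>x. dist x r < \<eta> \<Longrightarrow> ((\<lambda>x. f x t) has_real_derivative f1 x) (at x)"
    unfolding eventually_nhds_metric by blast
  have f1: "f1 r = 0"
    by (rule DERIV_local_max[OF fr \<eta>(1)]) (use \<eta>(2) in \<open>auto simp: dist_real_def abs_minus_commute\<close>)
  have f11: "f11 \<le> 0"
  proof (rule ccontr)
    assume "\<not> f11 \<le> 0"
    then obtain \<delta> where \<delta>: "\<delta> > 0" "\<And>h. 0 < h \<Longrightarrow> h < \<delta> \<Longrightarrow> f1 r < f1 (r + h)"
      using DERIV_pos_inc_right[OF f(2)] by auto
    define h where "h = min \<delta> \<eta> / 2"
    have h: "0 < h" "h < \<delta>" "h < \<eta>"
      using \<delta>(1) \<eta>(1) by (auto simp: h_def min_def)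
    have "f r t < f (r + h) t"
    proof (rule DERIV_pos_imp_increasing_open[of r "r + h" "\<lambda>x. f x t"])
      show "\<exists>y. ((\<lambda>x. f x t) has_real_derivative y) (at x) \<and> 0 < y" if "r < x" "x < r + h" for x
        using \<eta>(3)[of x] \<delta>(2)[of "x - r"] that h f1 by (auto simp: dist_real_def)
      show "continuous_on {r..r + h} (\<lambda>x. f x t)"
        using \<eta>(3) h by (intro continuous_at_imp_continuous_on ballI DERIV_isCont[OF \<eta>(3)]) (auto simp: dist_real_def)
    qed (use h in auto)
    with \<eta>(2)[of "r + h"] h show False
      by (auto simp: dist_real_def)
  qed
  have f2: "f2 \<ge> 0"
  proof (rule ccontr)
    assume "\<not> f2 \<ge> 0"
    then obtain \<delta> where \<delta>: "\<delta> > 0" "\<And>h. 0 < h \<Longrightarrow> h < \<delta> \<Longrightarrow> f r t < f r (t - h)"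
      using DERIV_neg_dec_left[OF f(3)] by auto
    obtain y where y: "y < t" "\<And>x. y < x \<Longrightarrow> x < t \<Longrightarrow> f r x \<le> f r t"
      using time unfolding eventually_at_left_field by blast
    define h where "h = min \<delta> (t - y) / 2"
    have h: "0 < h" "h < \<delta>" "h < t - y"
      using \<delta>(1) y(1) by (auto simp: h_def min_def field_simps)
    show False
      using \<delta>(2)[OF h(1,2)] y(2)[of "t - h"] h by auto
  qed
  show "d = 0"
    using f f1 by simp
  show "l \<ge> 0"
    using f(5) f1 f2 divide_nonpos_nonneg[OF f11, of "e\<^sup>2"] by simp
qed

text \<open>The domain is open at r = 0; \<open>tip\<close> replaces the missing boundary condition
  and confines the points with \<open>f\<close> \<ge> 0 to a compact rectangle, so that an earliest
  one exists. No equation for \<open>f\<close> is needed: at each zero some operator, whose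
  coefficients may depend on the point, has to be negative on \<open>f\<close>.\<close>

lemma maximum_principle:
  fixes f :: "real \<Rightarrow> real \<Rightarrow> real"
  assumes continuous: "continuous_on ({0<..\<rho>} \<times> {0..\<tau>}) (\<lambda>x. f (fst x) (snd x))"
    and init: "\<And>r. 0 < r \<Longrightarrow> r \<le> \<rho> \<Longrightarrow> f r 0 < 0"
    and side: "\<And>t. 0 \<le> t \<Longrightarrow> t \<le> \<tau> \<Longrightarrow> f \<rho> t < 0"
    and tip: "\<eta> > 0" "\<And>r t. 0 < r \<Longrightarrow> r < \<eta> \<Longrightarrow> r \<le> \<rho> \<Longrightarrow> 0 \<le> t \<Longrightarrow> t \<le> \<tau> \<Longrightarrow> f r t < 0"
    and contact: "\<And>r t. 0 < r \<Longrightarrow> r < \<rho> \<Longrightarrow> 0 < t \<Longrightarrow> t \<le> \<tau> \<Longrightarrow> f r t = 0 \<Longrightarrow>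
      \<exists>a e d l. e \<noteq> 0 \<and> jet a e f r t d l \<and> l < 0"
    and r: "0 < r" "r \<le> \<rho>" and t: "0 \<le> t" "t \<le> \<tau>"
  shows "f r t < 0"
proof (rule ccontr)
  assume neg: "\<not> f r t < 0"
  have cont: "continuous_on ({0<..\<rho>} \<times> {0..\<tau>}) (\<lambda>(r, t). f r t)"
    using continuous by (simp add: case_prod_beta')
  let ?R = "{min \<eta> \<rho>..\<rho>} \<times> {0..\<tau>}"
  have sub: "?R \<subseteq> {0<..\<rho>} \<times> {0..\<tau>}"
    using tip(1) r by auto
  have contR: "continuous_on ?R (\<lambda>(r, t). f r t)"
    by (rule continuous_on_subset[OF cont sub])
  define X where "X = {x \<in> ?R. 0 \<le> (\<lambda>(r, t). f r t) x}"
  have X_eq: "X = ?R \<inter> (\<lambda>(r, t). f r t) -` {0..}"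
    by (auto simp: X_def)
  have "closed X"
    unfolding X_eq
    by (rule continuous_closed_preimage[OF contR]) (auto intro!: closed_Times)
  have "compact X"
    unfolding compact_eq_bounded_closed
    using \<open>closed X\<close> by (auto simp: X_def intro: bounded_subset[OF bounded_Times[OF bounded_closed_interval bounded_closed_interval], of _ "min \<eta> \<rho>" \<rho> 0 \<tau>])
  have in_X: "(r', t') \<in> X" if "\<not> f r' t' < 0" "0 < r'" "r' \<le> \<rho>" "0 \<le> t'" "t' \<le> \<tau>" for r' t'
  proof -
    have "\<eta> \<le> r'" using tip(2)[of r' t'] that by (meson not_le)
    then show ?thesis using that by (simp add: X_def min.coboundedI1)
  qed
  then have "(r, t) \<in> X"
    using neg r t by blast
  obtain y where y: "y \<in> X" "\<And>x. x \<in> X \<Longrightarrow> snd y \<le> snd x"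
  proof -
    have "continuous_on X snd"
      by (intro continuous_intros)
    then show ?thesis
      using that continuous_attains_inf[OF \<open>compact X\<close>, of snd] \<open>(r, t) \<in> X\<close> by blast
  qed
  obtain r0 t0 where y_eq: "y = (r0, t0)" by (cases y)
  have r0: "0 < r0" "r0 \<le> \<rho>" and t0: "0 \<le> t0" "t0 \<le> \<tau>" and ge: "f r0 t0 \<ge> 0"
    using y(1) tip(1) r unfolding X_def y_eq by auto
  have "r0 \<noteq> \<rho>" "t0 \<noteq> 0"
    using side[OF t0] init[OF r0] ge by auto
  then have lt: "r0 < \<rho>" "0 < t0" using r0 t0 by auto
  have earlier: "f r' t' < 0" if "0 < r'" "r' \<le> \<rho>" "0 \<le> t'" "t' < t0" for r' t'
  proof (rule ccontr)
    assume "\<not> f r' t' < 0"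
    then have "(r', t') \<in> X"
      using that t0 in_X by simp
    with y(2)[of "(r', t')"] that show False by (auto simp: y_eq)
  qed
  \<comment> \<open>\<open>earlier\<close> speaks only of times before \<open>t0\<close>; at
    \<open>t0\<close> itself the weak inequality is their limit, taken separately for each
    r.\<close>
  have le0: "f r' t0 \<le> 0" if "0 < r'" "r' \<le> \<rho>" for r'
  proof -
    have "continuous_on {0..t0} (\<lambda>t. (\<lambda>(r, t). f r t) (r', t))"
      by (rule continuous_on_compose2[OF cont])
        (use that t0 in \<open>auto intro!: continuous_intros\<close>)
    then have "((\<lambda>t. f r' t) \<longlongrightarrow> f r' t0) (at t0 within {0..t0})"
      using t0 by (auto simp: continuous_on_def)
    then have lim: "((\<lambda>t. f r' t) \<longlongrightarrow> f r' t0) (at_left t0)"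
      using lt(2) by (simp add: at_within_Icc_at_left)
    have "\<forall>\<^sub>F t in at_left t0. f r' t \<le> 0"
      unfolding eventually_at_left_field
      using lt(2) earlier[OF that] by (intro exI[of _ 0]) (auto simp: less_imp_le)
    then show ?thesis
      using tendsto_upperbound[OF lim] by simp
  qed
  have zero: "f r0 t0 = 0"
    using le0[OF r0] ge by simp
  obtain a e d l where jet: "e \<noteq> 0" "jet a e f r0 t0 d l" "l < 0"
    using contact[OF r0(1) lt(1,2) t0(2) zero] by blast
  have "\<forall>\<^sub>F x in nhds r0. x \<in> {0<..<\<rho>}"
    using r0 lt by (intro eventually_nhds_in_open) auto
  then have "\<forall>\<^sub>F x in nhds r0. f x t0 \<le> f r0 t0"
    by eventually_elim (use le0 zero in auto)
  moreover have "\<forall>\<^sub>F x in at_left t0. f r0 x \<le> f r0 t0"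
    unfolding eventually_at_left_field
    using lt(2) earlier[OF r0] zero by (intro exI[of _ 0]) (auto simp: less_imp_le)
  ultimately have "l \<ge> 0"
    by (rule jet_at_maximum(2)[OF jet(2,1)])
  with jet(3) show False by simp
qed

section \<open>Evolution equations near a conical point\<close>

lemma has_vector_derivative_compose:
  assumes "(g has_vector_derivative g') (at x)" "(f has_derivative f') (at (g x))"
  shows "((\<lambda>x. f (g x)) has_vector_derivative f' g') (at x)"
proof -
  have "((\<lambda>x. f (g x)) has_derivative (\<lambda>y. f' (y *\<^sub>R g'))) (at x)"
    using has_derivative_compose[of g "\<lambda>y. y *\<^sub>R g'" x UNIV f f'] assms
    by (simp add: has_vector_derivative_def)
  then show ?thesis
    using linear_scale[OF has_derivative_linear[OF assms(2)]]
    by (simp add: has_vector_derivative_def)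
qed

lemma has_real_derivative_ln_norm:
  fixes f :: "real \<Rightarrow> complex"
  assumes f: "(f has_vector_derivative f') (at x)" and "f x \<noteq> 0"
  shows "((\<lambda>x. ln (norm (f x))) has_real_derivative Re (f' / f x)) (at x)"
proof -
  have "((\<lambda>x. norm (f x)) has_vector_derivative inner f' (sgn (f x))) (at x)"
    by (rule has_vector_derivative_compose[OF f has_derivative_norm]) fact
  then have "((\<lambda>x. norm (f x)) has_real_derivative inner f' (sgn (f x))) (at x)"
    by (simp add: has_real_derivative_iff_has_vector_derivative)
  then have "((\<lambda>x. ln (norm (f x))) has_real_derivative inner f' (sgn (f x)) / norm (f x)) (at x)"
    using \<open>f x \<noteq> 0\<close> by (auto intro!: derivative_eq_intros)
  moreover have "inner f' (sgn (f x)) / norm (f x) = Re (f' / f x)"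
    using \<open>f x \<noteq> 0\<close>
    by (simp add: sgn_div_norm inner_complex_def Re_divide cmod_power2 power2_eq_square[of "norm _", symmetric]
        divide_simps)
  ultimately show ?thesis by simp
qed

lemma has_real_derivative_Arg:
  fixes f :: "real \<Rightarrow> complex"
  assumes f: "(f has_vector_derivative f') (at x)" and "Re (f x) > 0"
  shows "((\<lambda>x. Im (Ln (f x))) has_real_derivative Im (f' / f x)) (at x)"
proof -
  have nz: "f x \<notin> \<real>\<^sub>\<le>\<^sub>0"
    using assms(2) by (auto simp: complex_nonpos_Reals_iff)
  have "(Ln has_field_derivative inverse (f x)) (at (f x))"
    using nz by (rule has_field_derivative_Ln)
  then have "((\<lambda>x. Ln (f x)) has_vector_derivative f' / f x) (at x)"
    using has_vector_derivative_compose[OF f]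
    by (fastforce simp: has_field_derivative_def field_simps)
  then show ?thesis
    by (simp add: has_real_derivative_iff_has_vector_derivative
        bounded_linear.has_vector_derivative[OF bounded_linear_Im])
qed

lemma has_real_derivative_Im:
  "(f has_vector_derivative f') F \<Longrightarrow> ((\<lambda>x. Im (f x)) has_real_derivative Im f') F"
  by (simp add: has_real_derivative_iff_has_vector_derivative
      bounded_linear.has_vector_derivative[OF bounded_linear_Im])

lemma has_real_derivative_Re:
  "(f has_vector_derivative f') F \<Longrightarrow> ((\<lambda>x. Re (f x)) has_real_derivative Re f') F"
  by (simp add: has_real_derivative_iff_has_vector_derivative
      bounded_linear.has_vector_derivative[OF bounded_linear_Re])

text \<open>Keeping f / g inside the derivative is what makes repeated differentiation manageable:
  the derivative of P = z_r / z is again a quotient by z that contains P.\<close>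

lemma has_vector_derivative_quotient:
  fixes f g :: "real \<Rightarrow> complex"
  assumes "(f has_vector_derivative f') (at x)" "(g has_vector_derivative g') (at x)" "g x \<noteq> 0"
  shows "((\<lambda>x. f x / g x) has_vector_derivative (f' - f x / g x * g') / g x) (at x)"
proof -
  have "((\<lambda>x. inverse (g x)) has_vector_derivative - (inverse (g x) * g' * inverse (g x))) (at x)"
    using has_vector_derivative_compose[OF assms(2) has_derivative_inverse'[OF assms(3)]] by simp
  from has_vector_derivative_mult[OF assms(1) this] show ?thesis
    using assms(3) by (simp add: divide_inverse algebra_simps)
qed

text \<open>
  In a conformal chart \<open>z\<close> around the conical point the metric is \<open>e\<^sup>2\<^sup>h |z|\<^sup>2\<^sup>b\<^sup>-\<^sup>2 |dz|\<^sup>2\<close>.  We work in the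
  cylindrical coordinate \<open>log z\<close>, in which the curve has velocity \<open>P = z\<^sub>r / z\<close>, the variation field is
  \<open>Q = z\<^sub>t / z\<close>, and the metric is \<open>e\<^sup>2\<^sup>\<psi> |d log z|\<^sup>2\<close> with \<open>\<psi> = h + b ln |z|\<close>; \<open>H\<close> is the conjugate of
  the gradient of \<open>h\<close>.
\<close>

locale cone_flow =
  fixes z P Q Pr Qr Prr Qrr :: "real \<Rightarrow> real \<Rightarrow> complex"
    and h :: "complex \<Rightarrow> real" and H A :: "complex \<Rightarrow> complex" and B :: "complex \<Rightarrow> real"
    and b \<rho> \<tau> :: real
  assumes z_r: "\<And>r t. 0 < r \<Longrightarrow> r < \<rho> \<Longrightarrow> 0 < t \<Longrightarrow> t < \<tau> \<Longrightarrow>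
      ((\<lambda>r. z r t) has_vector_derivative P r t * z r t) (at r)"
    and z_t: "\<And>r t. 0 < r \<Longrightarrow> r < \<rho> \<Longrightarrow> 0 < t \<Longrightarrow> t < \<tau> \<Longrightarrow>
      ((\<lambda>t. z r t) has_vector_derivative Q r t * z r t) (at t)"
    and P_r: "\<And>r t. 0 < r \<Longrightarrow> r < \<rho> \<Longrightarrow> 0 < t \<Longrightarrow> t < \<tau> \<Longrightarrow>
      ((\<lambda>r. P r t) has_vector_derivative Pr r t) (at r)"
    and P_t: "\<And>r t. 0 < r \<Longrightarrow> r < \<rho> \<Longrightarrow> 0 < t \<Longrightarrow> t < \<tau> \<Longrightarrow>
      ((\<lambda>t. P r t) has_vector_derivative Qr r t) (at t)"
    and Q_r: "\<And>r t. 0 < r \<Longrightarrow> r < \<rho> \<Longrightarrow> 0 < t \<Longrightarrow> t < \<tau> \<Longrightarrow>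
      ((\<lambda>r. Q r t) has_vector_derivative Qr r t) (at r)"
    and Pr_r: "\<And>r t. 0 < r \<Longrightarrow> r < \<rho> \<Longrightarrow> 0 < t \<Longrightarrow> t < \<tau> \<Longrightarrow>
      ((\<lambda>r. Pr r t) has_vector_derivative Prr r t) (at r)"
    and Pr_t: "\<And>r t. 0 < r \<Longrightarrow> r < \<rho> \<Longrightarrow> 0 < t \<Longrightarrow> t < \<tau> \<Longrightarrow>
      ((\<lambda>t. Pr r t) has_vector_derivative Qrr r t) (at t)"
    and Qr_r: "\<And>r t. 0 < r \<Longrightarrow> r < \<rho> \<Longrightarrow> 0 < t \<Longrightarrow> t < \<tau> \<Longrightarrow>
      ((\<lambda>r. Qr r t) has_vector_derivative Qrr r t) (at r)"
    and z_nz: "\<And>r t. 0 < r \<Longrightarrow> r < \<rho> \<Longrightarrow> 0 \<le> t \<Longrightarrow> t < \<tau> \<Longrightarrow> z r t \<noteq> 0"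
    and P_pos: "\<And>r t. 0 < r \<Longrightarrow> r < \<rho> \<Longrightarrow> 0 \<le> t \<Longrightarrow> t < \<tau> \<Longrightarrow> Re (P r t) > 0"
    and h_deriv: "\<And>r t. 0 < r \<Longrightarrow> r < \<rho> \<Longrightarrow> 0 < t \<Longrightarrow> t < \<tau> \<Longrightarrow>
      (h has_derivative (\<lambda>v. Re (H (z r t) * v))) (at (z r t))"
    and H_deriv: "\<And>r t. 0 < r \<Longrightarrow> r < \<rho> \<Longrightarrow> 0 < t \<Longrightarrow> t < \<tau> \<Longrightarrow>
      (H has_derivative (\<lambda>v. A (z r t) * v + of_real (B (z r t)) * cnj v)) (at (z r t))"
    and flow_eq: "\<And>r t. 0 < r \<Longrightarrow> r < \<rho> \<Longrightarrow> 0 < t \<Longrightarrow> t < \<tau> \<Longrightarrow>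
      Im (Pr r t / P r t) + Im ((of_real b + H (z r t) * z r t) * P r t) =
      (exp (h (z r t) + b * ln (norm (z r t)) + ln (norm (P r t))))\<^sup>2 * Im (Q r t / P r t)"
begin

text \<open>The conjugate gradient of the conformal exponent \<psi> with respect to log z; the
  constant b is the contribution of the cone. Its differential in log z is w \<mapsto>
  \<open>U\<close> w + \<open>W\<close> cnj w.\<close>

definition G where "G r t = of_real b + H (z r t) * z r t"
definition U where "U r t = A (z r t) * (z r t)\<^sup>2 + H (z r t) * z r t"
text \<open>Half the Laplacian of \<psi> in the coordinate log z. Hence \<open>W * |q|^2\<close> is
  minus one half of the Gauss curvature.\<close>

definition W where "W r t = B (z r t) * (norm (z r t))\<^sup>2"
definition \<xi> where "\<xi> r t = ln (norm (z r t))"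
text \<open>The speed with respect to the metric, namely e^\<psi> |P|, written as a single
  exponential so that its logarithmic derivative \<open>lr\<close> is a sum.\<close>

definition ell where "ell r t = exp (h (z r t) + b * \<xi> r t + ln (norm (P r t)))"
definition lr where "lr r t = Re (G r t * P r t) + Re (Pr r t / P r t)"
text \<open>The unit tangent expressed in log z, so that |q| = e^(-\<psi>).\<close>

definition q where "q r t = P r t / of_real (ell r t)"
definition a where "a r t = ell r t * Re (Q r t / P r t)"
text \<open>The normal speed, which the flow equates with the curvature for positive times. It needs
  only first derivatives of z and therefore makes sense at time 0, too.\<close>

definition k where "k r t = ell r t * Im (Q r t / P r t)"
text \<open>The argument of z_r / z is the angle between the curve and the ray through z. As Re P is
  positive, the principal branch is smooth.\<close>

definition \<omega> where "\<omega> r t = Im (Ln (P r t))"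
definition jr where "jr r t = (Qr r t - Q r t / P r t * Pr r t) / P r t"
definition kr where "kr r t = ell r t * lr r t * Im (Q r t / P r t) + ell r t * Im (jr r t)"
definition ar where "ar r t = ell r t * lr r t * Re (Q r t / P r t) + ell r t * Re (jr r t)"
text \<open>With this coefficient the operator of \<open>jet\<close> is \<partial>_t - a
  \<partial>_s - \<partial>_s^2, where s is arc length: the first summand removes the tangential
  motion, which the flow leaves free, and the second one converts the second r-derivative into the
  second arc length derivative.\<close>

definition drift where "drift r t = a r t / ell r t - lr r t / (ell r t)\<^sup>2"

lemma ell_pos: "ell r t > 0"
  by (simp add: ell_def)

section \<open>Evolution equations for ln |z|, the angle and the curvature\<close>

context
  fixes t assumes t: "0 < t" "t < \<tau>"
begin

lemma P_nz: "0 < r \<Longrightarrow> r < \<rho> \<Longrightarrow> P r t \<noteq> 0"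
  using P_pos[of r t] t by auto

lemma ell_r:
  assumes r: "0 < r" "r < \<rho>"
  shows "((\<lambda>r. ell r t) has_real_derivative ell r t * lr r t) (at r)"
proof -
  note [derivative_intros] =
    has_vector_derivative_compose[OF z_r[OF r t] h_deriv[OF r t],
      folded has_real_derivative_iff_has_vector_derivative]
    has_real_derivative_ln_norm[OF z_r[OF r t]] has_real_derivative_ln_norm[OF P_r[OF r t]]
  show ?thesis
    unfolding ell_def \<xi>_def
    using z_nz[OF r _ t(2)] P_nz[OF r] t
    by (auto intro!: derivative_eq_intros simp: lr_def G_def algebra_simps)
qed

lemma ell_t:
  assumes r: "0 < r" "r < \<rho>"
  shows "((\<lambda>t. ell r t) has_real_derivative ell r t * (Re (G r t * Q r t) + Re (Qr r t / P r t))) (at t)"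
proof -
  note [derivative_intros] =
    has_vector_derivative_compose[OF z_t[OF r t] h_deriv[OF r t],
      folded has_real_derivative_iff_has_vector_derivative]
    has_real_derivative_ln_norm[OF z_t[OF r t]] has_real_derivative_ln_norm[OF P_t[OF r t]]
  show ?thesis
    unfolding ell_def \<xi>_def
    using z_nz[OF r _ t(2)] P_nz[OF r] t
    by (auto intro!: derivative_eq_intros simp: G_def algebra_simps)
qed

lemma G_r:
  assumes r: "0 < r" "r < \<rho>"
  shows "((\<lambda>r. G r t) has_vector_derivative U r t * P r t + of_real (W r t) * cnj (P r t)) (at r)"
proof -
  have "((\<lambda>r. H (z r t)) has_vector_derivative
      A (z r t) * (P r t * z r t) + of_real (B (z r t)) * cnj (P r t * z r t)) (at r)"
    by (rule has_vector_derivative_compose[OF z_r[OF r t] H_deriv[OF r t]])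
  note D = has_vector_derivative_add[OF has_vector_derivative_const[of "of_real b"]
      has_vector_derivative_mult[OF this z_r[OF r t]]]
  have W: "complex_of_real (W r t) = of_real (B (z r t)) * (z r t * cnj (z r t))"
    by (simp only: W_def of_real_mult complex_norm_square)
  show ?thesis
    unfolding G_def
    by (rule has_vector_derivative_eq_rhs[OF D]) (simp add: U_def W algebra_simps power2_eq_square)
qed

lemma G_t:
  assumes r: "0 < r" "r < \<rho>"
  shows "((\<lambda>t. G r t) has_vector_derivative U r t * Q r t + of_real (W r t) * cnj (Q r t)) (at t)"
proof -
  have "((\<lambda>t. H (z r t)) has_vector_derivative
      A (z r t) * (Q r t * z r t) + of_real (B (z r t)) * cnj (Q r t * z r t)) (at t)"
    by (rule has_vector_derivative_compose[OF z_t[OF r t] H_deriv[OF r t]])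
  note D = has_vector_derivative_add[OF has_vector_derivative_const[of "of_real b"]
      has_vector_derivative_mult[OF this z_t[OF r t]]]
  have W: "complex_of_real (W r t) = of_real (B (z r t)) * (z r t * cnj (z r t))"
    by (simp only: W_def of_real_mult complex_norm_square)
  show ?thesis
    unfolding G_def
    by (rule has_vector_derivative_eq_rhs[OF D]) (simp add: U_def W algebra_simps power2_eq_square)
qed

lemma j_r:
  assumes r: "0 < r" "r < \<rho>"
  shows "((\<lambda>r. Q r t / P r t) has_vector_derivative jr r t) (at r)"
  unfolding jr_def by (rule has_vector_derivative_quotient[OF Q_r[OF r t] P_r[OF r t] P_nz[OF r]])

lemma k_r:
  assumes r: "0 < r" "r < \<rho>"
  shows "((\<lambda>r. k r t) has_real_derivative kr r t) (at r)"
  unfolding k_def kr_def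
  by (rule derivative_eq_intros ell_r[OF r] has_real_derivative_Im[OF j_r[OF r]])+ simp

lemma a_r:
  assumes r: "0 < r" "r < \<rho>"
  shows "((\<lambda>r. a r t) has_real_derivative ar r t) (at r)"
  unfolding a_def ar_def
  by (rule derivative_eq_intros ell_r[OF r] has_real_derivative_Re[OF j_r[OF r]])+ simp

text \<open>Existence is all that is asked for: it makes \<open>kr\<close> differentiable, and the
  second derivative of \<open>k\<close> cancels in \<open>jet_k\<close>.\<close>

lemma lr_r:
  assumes r: "0 < r" "r < \<rho>"
  shows "\<exists>D. ((\<lambda>r. lr r t) has_real_derivative D) (at r)"
  unfolding lr_def
  using DERIV_add[OF has_real_derivative_Re[OF has_vector_derivative_mult[OF G_r[OF r] P_r[OF r t]]]
      has_real_derivative_Re[OF has_vector_derivative_quotient[OF Pr_r[OF r t] P_r[OF r t] P_nz[OF r]]]]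
  by blast

lemma kr_r:
  assumes r: "0 < r" "r < \<rho>"
  shows "\<exists>D. ((\<lambda>r. kr r t) has_real_derivative D) (at r)"
proof -
  obtain D where D: "((\<lambda>r. lr r t) has_real_derivative D) (at r)"
    using lr_r[OF r] by blast
  note j = j_r[OF r]
  have "((\<lambda>r. Qr r t - Q r t / P r t * Pr r t) has_vector_derivative
      Qrr r t - (Q r t / P r t * Prr r t + jr r t * Pr r t)) (at r)"
    by (rule has_vector_derivative_diff[OF Qr_r[OF r t] has_vector_derivative_mult[OF j Pr_r[OF r t]]])
  from DERIV_add[OF DERIV_mult[OF DERIV_mult[OF ell_r[OF r] D] has_real_derivative_Im[OF j]]
      DERIV_mult[OF ell_r[OF r]
        has_real_derivative_Im[OF has_vector_derivative_quotient[OF this P_r[OF r t] P_nz[OF r]]]]]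
  show ?thesis
    unfolding kr_def jr_def by blast
qed

text \<open>The left side is the r-derivative of the angle. It differs from speed times curvature by
  the derivative of \<psi> normal to the curve, as for any conformal metric.\<close>

lemma flow_curvature:
  assumes r: "0 < r" "r < \<rho>"
  shows "Im (Pr r t / P r t) = ell r t * k r t - Im (G r t * P r t)"
  using flow_eq[OF r t] by (simp add: k_def ell_def \<xi>_def G_def power2_eq_square)

text \<open>The pair (\<open>lr\<close>, \<open>ell * k\<close>) is the covariant logarithmic
  derivative P_r / P + G P of the velocity, and (\<open>a\<close>, \<open>k\<close>) is the
  variation field in the moving frame. In these quantities the evolution equations become algebraic
  identities.\<close>

lemma frame:
  assumes r: "0 < r" "r < \<rho>"
  shows "P r t = of_real (ell r t) * q r t"
    and "Pr r t = P r t * (Complex (lr r t) (ell r t * k r t) - G r t * P r t)"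
    and "Q r t = q r t * Complex (a r t) (k r t)"
    and "Qr r t = P r t * (Complex (ar r t) (kr r t) / of_real (ell r t)
      + Complex (a r t) (k r t) * (\<i> * of_real (k r t) - G r t * q r t))"
proof -
  have e: "ell r t \<noteq> 0" using ell_pos[of r t] by simp
  show P: "P r t = of_real (ell r t) * q r t"
    using e by (simp add: q_def)
  have "Pr r t / P r t = Complex (lr r t) (ell r t * k r t) - G r t * P r t"
    using flow_curvature[OF r] by (simp add: complex_eq_iff lr_def)
  then show Pr: "Pr r t = P r t * (Complex (lr r t) (ell r t * k r t) - G r t * P r t)"
    using P_nz[OF r] by (simp add: field_simps)
  define J where "J = Q r t / P r t"
  have Q_eq: "Q r t = P r t * J"
    using P_nz[OF r] by (simp add: J_def)
  have j: "Complex (a r t) (k r t) = of_real (ell r t) * J"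
    by (simp add: complex_eq_iff a_def k_def flip: J_def)
  then show "Q r t = q r t * Complex (a r t) (k r t)"
    unfolding Q_eq P by simp
  have "Complex (ar r t) (kr r t) = of_real (ell r t) * (of_real (lr r t) * J + jr r t)"
    by (simp add: complex_eq_iff ar_def kr_def algebra_simps flip: J_def)
  then have jr': "Complex (ar r t) (kr r t) / of_real (ell r t) = of_real (lr r t) * J + jr r t"
    using e by simp
  have I: "Complex (lr r t) (ell r t * k r t) = of_real (lr r t) + \<i> * of_real (ell r t) * of_real (k r t)"
    by (simp add: complex_eq_iff)
  have "Qr r t = P r t * jr r t + J * Pr r t"
    using P_nz[OF r] by (simp add: jr_def flip: J_def)
  also have "\<dots> = P r t * (Complex (ar r t) (kr r t) / of_real (ell r t)
      + Complex (a r t) (k r t) * (\<i> * of_real (k r t) - G r t * q r t))"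
    unfolding jr' j Pr I unfolding P by (simp add: algebra_simps)
  finally show "Qr r t = \<dots>" .
qed

lemma frame_normalized:
  assumes r: "0 < r" "r < \<rho>"
  shows "Pr r t / of_real ((ell r t)\<^sup>2) =
      q r t * (of_real (lr r t / ell r t) + \<i> * of_real (k r t) - G r t * q r t)"
    and "Im (G r t * P r t) = ell r t * Im (G r t * q r t)"
    and "Qr r t / P r t = Complex (ar r t) (kr r t) / of_real (ell r t)
      + Complex (a r t) (k r t) * (\<i> * of_real (k r t) - G r t * q r t)"
    and "((U r t * P r t + of_real (W r t) * cnj (P r t)) * P r t + G r t * Pr r t) / of_real ((ell r t)\<^sup>2) =
      U r t * (q r t)\<^sup>2 + of_real (W r t * (norm (q r t))\<^sup>2)
      + G r t * q r t * (of_real (lr r t / ell r t) + \<i> * of_real (k r t) - G r t * q r t)"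
proof -
  have e: "ell r t \<noteq> 0" using ell_pos[of r t] by simp
  have I: "Complex (lr r t) (ell r t * k r t) = of_real (lr r t) + \<i> * of_real (ell r t) * of_real (k r t)"
    by (simp add: complex_eq_iff)
  have "Pr r t = of_real ((ell r t)\<^sup>2) *
      (q r t * (of_real (lr r t / ell r t) + \<i> * of_real (k r t) - G r t * q r t))"
    unfolding frame(2)[OF r] I unfolding frame(1)[OF r]
    using e by (simp add: field_simps power2_eq_square)
  then show Pr: "Pr r t / of_real ((ell r t)\<^sup>2) =
      q r t * (of_real (lr r t / ell r t) + \<i> * of_real (k r t) - G r t * q r t)"
    by (subst nonzero_divide_eq_eq) (use e in \<open>auto simp: mult_ac\<close>)
  have "G r t * P r t = of_real (ell r t) * (G r t * q r t)"
    unfolding frame(1)[OF r] by simp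
  then show "Im (G r t * P r t) = ell r t * Im (G r t * q r t)"
    by (metis Im_complex_of_real Re_complex_of_real add.right_neutral mult_zero_left times_complex.sel(2))
  show "Qr r t / P r t = Complex (ar r t) (kr r t) / of_real (ell r t)
      + Complex (a r t) (k r t) * (\<i> * of_real (k r t) - G r t * q r t)"
    using frame(4)[OF r] P_nz[OF r] by simp
  have "(U r t * P r t + of_real (W r t) * cnj (P r t)) * P r t =
      of_real ((ell r t)\<^sup>2) * (U r t * (q r t)\<^sup>2 + of_real (W r t * (norm (q r t))\<^sup>2))"
    unfolding frame(1)[OF r] of_real_mult complex_norm_square
    by (simp add: algebra_simps power2_eq_square)
  then have "(U r t * P r t + of_real (W r t) * cnj (P r t)) * P r t / of_real ((ell r t)\<^sup>2) =
      U r t * (q r t)\<^sup>2 + of_real (W r t * (norm (q r t))\<^sup>2)"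
    by (subst nonzero_divide_eq_eq) (use e in \<open>auto simp: mult_ac\<close>)
  then show "((U r t * P r t + of_real (W r t) * cnj (P r t)) * P r t + G r t * Pr r t) / of_real ((ell r t)\<^sup>2) =
      U r t * (q r t)\<^sup>2 + of_real (W r t * (norm (q r t))\<^sup>2)
      + G r t * q r t * (of_real (lr r t / ell r t) + \<i> * of_real (k r t) - G r t * q r t)"
    unfolding add_divide_distrib times_divide_eq_right[symmetric, of "G r t"] Pr by (simp add: mult.assoc)
qed

text \<open>Along a curve moving by its curvature the heat operator of a fixed function is minus its
  Hessian in the tangent direction. As \<open>\<xi>\<close> is a coordinate of log z, this Hessian
  is a pure Christoffel term, and the Christoffel vector of (q, q) is G q^2.\<close>

lemma jet_\<xi>:
  assumes r: "0 < r" "r < \<rho>"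
  shows "jet (drift r t) (ell r t) \<xi> r t (Re (q r t)) (Re (G r t * (q r t)\<^sup>2))"
proof (rule jetI[of "{0<..<\<rho>}" r _ t "\<lambda>r. Re (P r t)" "Re (Pr r t)" "Re (Q r t)"])
  have e: "ell r t \<noteq> 0" using ell_pos[of r t] by simp
  show "((\<lambda>r. \<xi> r t) has_real_derivative Re (P x t)) (at x)" if "x \<in> {0<..<\<rho>}" for x
    using has_real_derivative_ln_norm[OF z_r[of x t]] z_nz[of x t] that t by (simp add: \<xi>_def)
  show "((\<lambda>t. \<xi> r t) has_real_derivative Re (Q r t)) (at t)"
    using has_real_derivative_ln_norm[OF z_t[of r t]] z_nz[of r t] r t by (simp add: \<xi>_def)
  show "((\<lambda>r. Re (P r t)) has_real_derivative Re (Pr r t)) (at r)"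
    by (rule has_real_derivative_Re[OF P_r[OF r t]])
  show "Re (q r t) = Re (P r t) / ell r t"
    by (simp add: q_def)
  show "Re (G r t * (q r t)\<^sup>2) = Re (Q r t) - drift r t * Re (P r t) - Re (Pr r t) / (ell r t)\<^sup>2"
  proof -
    have alg: "Re X = Re (y * Complex c m) - (c / e - n / e\<^sup>2) * (e * Re y)
        - Re (of_real (n / e) * y + \<i> * of_real m * y - X)" if "e \<noteq> 0" for X y :: complex and c m n e :: real
      using that by (simp add: power2_eq_square algebra_simps)
    have "Re (P r t) = ell r t * Re (q r t)"
      unfolding frame(1)[OF r] by simp
    moreover have "Re (Pr r t) / (ell r t)\<^sup>2 = Re (of_real (lr r t / ell r t) * q r t
        + \<i> * of_real (k r t) * q r t - G r t * (q r t)\<^sup>2)"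
      unfolding Re_divide_of_real[symmetric] frame_normalized(1)[OF r]
      by (simp only: ring_distribs power2_eq_square mult_ac)
    ultimately show ?thesis
      unfolding frame(3)[OF r] drift_def using alg[OF e] by simp
  qed
qed (use r in auto)

text \<open>Near the vertex G is close to b, so the main term is - b^2 Im (q^2) = - b^2 |q|^2 sin (2
  \<open>\<omega>\<close>), which turns the curve back towards the ray. The Laplacian part
  \<open>W\<close> drops out because it contributes only the real number W |P|^2.\<close>

lemma jet_\<omega>:
  assumes r: "0 < r" "r < \<rho>"
  shows "jet (drift r t) (ell r t) \<omega> r t (k r t - Im (G r t * q r t))
    (Im ((U r t - (G r t)\<^sup>2) * (q r t)\<^sup>2))"
proof (rule jetI[of "{0<..<\<rho>}" r _ t "\<lambda>r. ell r t * k r t - Im (G r t * P r t)"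
      "ell r t * lr r t * k r t + ell r t * kr r t
        - Im ((U r t * P r t + of_real (W r t) * cnj (P r t)) * P r t + G r t * Pr r t)"
      "Im (Qr r t / P r t)"])
  have e: "ell r t \<noteq> 0" using ell_pos[of r t] by simp
  show "((\<lambda>r. \<omega> r t) has_real_derivative ell x t * k x t - Im (G x t * P x t)) (at x)"
    if "x \<in> {0<..<\<rho>}" for x
    using has_real_derivative_Arg[OF P_r[of x t]] P_pos[of x t] that t
    by (simp add: \<omega>_def flow_curvature)
  show "((\<lambda>t. \<omega> r t) has_real_derivative Im (Qr r t / P r t)) (at t)"
    using has_real_derivative_Arg[OF P_t[of r t]] P_pos[of r t] r t by (simp add: \<omega>_def)
  show "((\<lambda>r. ell r t * k r t - Im (G r t * P r t)) has_real_derivative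
      ell r t * lr r t * k r t + ell r t * kr r t
        - Im ((U r t * P r t + of_real (W r t) * cnj (P r t)) * P r t + G r t * Pr r t)) (at r)"
    using DERIV_diff[OF DERIV_mult[OF ell_r[OF r] k_r[OF r]]
        has_real_derivative_Im[OF has_vector_derivative_mult[OF G_r[OF r] P_r[OF r t]]]]
    by (simp add: algebra_simps)
  show "k r t - Im (G r t * q r t) = (ell r t * k r t - Im (G r t * P r t)) / ell r t"
    using e unfolding frame_normalized(2)[OF r] by (simp add: field_simps)
  have alg: "Im (V - X\<^sup>2) = Im (Complex c' m' / of_real e + Complex c m * (\<i> * of_real m - X))
      - (c / e - n / e\<^sup>2) * (e * m - e * Im X)
      - (e * n * m + e * m') / e\<^sup>2 + Im (V + of_real N + X * (of_real (n / e) + \<i> * of_real m - X))"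
    if "e \<noteq> 0" for X V :: complex and c m n e N c' m' :: real
    using that by (simp add: power2_eq_square algebra_simps add_divide_distrib)
  show "Im ((U r t - (G r t)\<^sup>2) * (q r t)\<^sup>2) = Im (Qr r t / P r t)
      - drift r t * (ell r t * k r t - Im (G r t * P r t))
      - (ell r t * lr r t * k r t + ell r t * kr r t
        - Im ((U r t * P r t + of_real (W r t) * cnj (P r t)) * P r t + G r t * Pr r t)) / (ell r t)\<^sup>2"
    unfolding diff_divide_distrib[of _ "Im _"] Im_divide_of_real[symmetric] frame_normalized(2-4)[OF r] drift_def
    using alg[OF e, of "U r t * (q r t)\<^sup>2" "G r t * q r t" "ar r t" "kr r t" "a r t" "k r t" "lr r t" "W r t * (norm (q r t))\<^sup>2"]
    by (simp add: left_diff_distrib power_mult_distrib)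
qed (use r in auto)

lemma Gq_r:
  assumes r: "0 < r" "r < \<rho>"
  shows "((\<lambda>r. G r t * q r t) has_vector_derivative of_real (ell r t) *
    (U r t * (q r t)\<^sup>2 + of_real (W r t * (norm (q r t))\<^sup>2)
      + G r t * q r t * (\<i> * of_real (k r t) - G r t * q r t))) (at r)"
proof -
  have e: "ell r t \<noteq> 0" using ell_pos[of r t] by simp
  have "((\<lambda>r. complex_of_real (ell r t)) has_vector_derivative of_real (ell r t * lr r t)) (at r)"
    by (rule bounded_linear.has_vector_derivative[OF bounded_linear_of_real
        ell_r[OF r, unfolded has_real_derivative_iff_has_vector_derivative]])
  then have "((\<lambda>r. q r t) has_vector_derivative
      (Pr r t - q r t * of_real (ell r t * lr r t)) / of_real (ell r t)) (at r)"
    using has_vector_derivative_quotient[OF P_r[OF r t]] e by (fastforce simp: q_def)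
  moreover have "Pr r t = of_real ((ell r t)\<^sup>2) *
      (q r t * (of_real (lr r t / ell r t) + \<i> * of_real (k r t) - G r t * q r t))"
    using frame_normalized(1)[OF r] e by (subst (asm) nonzero_divide_eq_eq) (auto simp: mult_ac)
  then have "(Pr r t - q r t * of_real (ell r t * lr r t)) / of_real (ell r t) =
      of_real (ell r t) * (q r t * (\<i> * of_real (k r t) - G r t * q r t))"
    using e by (simp add: nonzero_divide_eq_eq) (simp add: field_simps power2_eq_square)
  ultimately have q: "((\<lambda>r. q r t) has_vector_derivative
      of_real (ell r t) * (q r t * (\<i> * of_real (k r t) - G r t * q r t))) (at r)"
    by simp
  show ?thesis
    by (rule has_vector_derivative_eq_rhs[OF has_vector_derivative_mult[OF G_r[OF r] q]],
        unfold frame(1)[OF r] of_real_mult complex_norm_square)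
      (simp add: algebra_simps power2_eq_square)
qed

text \<open>Since W |q|^2 is minus half the Gauss curvature, this is the classical equation k_t =
  k_ss + k^3 + (Gauss curvature) k. The arc length derivative stays existential, because the barrier
  inequality for the curvature holds for every value of it.\<close>

lemma jet_k:
  assumes r: "0 < r" "r < \<rho>"
  shows "\<exists>ks. jet (drift r t) (ell r t) k r t ks
    (k r t ^ 3 - 2 * k r t * (W r t * (norm (q r t))\<^sup>2))"
proof -
  have e: "ell r t \<noteq> 0" using ell_pos[of r t] by simp
  obtain D where D: "((\<lambda>r. kr r t) has_real_derivative D) (at r)"
    using kr_r[OF r] by blast
  define X where "X = G r t * q r t"
  define V where "V = U r t * (q r t)\<^sup>2"
  define n where "n = W r t * (norm (q r t))\<^sup>2"
  define Xs where "Xs = V + of_real n + X * (\<i> * of_real (k r t) - X)"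
  define v where "v = Qr r t / P r t"
  \<comment> \<open>The mixed derivative of log P: it is at once the r-derivative of P_t / P and the
    t-derivative of P_r / P. Through the frame the first reading involves the second derivative of
    \<open>k\<close>; through the flow equation the second one involves its time derivative.
    Comparing them gives the evolution equation.\<close>
  define v' where "v' = (Qrr r t - Qr r t / P r t * Pr r t) / P r t"
  note X_r = Gq_r[OF r, folded X_def V_def n_def, folded Xs_def]
  have v_eq: "v = Complex (ar r t) (kr r t) / of_real (ell r t) + Complex (a r t) (k r t) * (\<i> * of_real (k r t) - X)"
    unfolding v_def X_def by (rule frame_normalized(3)[OF r])
  have "((\<lambda>r. Im (Qr r t / P r t)) has_real_derivative Im v') (at r)"
    unfolding v'_def
    by (rule has_real_derivative_Im[OF has_vector_derivative_quotient[OF Qr_r[OF r t] P_r[OF r t] P_nz[OF r]]])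
  then have "((\<lambda>r. kr r t / ell r t + a r t * k r t
      - (a r t * Im (G r t * q r t) + k r t * Re (G r t * q r t))) has_real_derivative Im v') (at r)"
    by (rule has_field_derivative_transform_within_open[of _ _ _ "{0<..<\<rho>}"])
      (use r in \<open>auto simp: frame_normalized(3) algebra_simps simp del: times_divide_eq_right\<close>)
  moreover have "((\<lambda>r. kr r t / ell r t + a r t * k r t
      - (a r t * Im (G r t * q r t) + k r t * Re (G r t * q r t))) has_real_derivative
      (D * ell r t - kr r t * (ell r t * lr r t)) / (ell r t * ell r t)
      + (ar r t * k r t + kr r t * a r t)
      - (ar r t * Im X + Im (of_real (ell r t) * Xs) * a r t
        + (kr r t * Re X + Re (of_real (ell r t) * Xs) * k r t))) (at r)"
    unfolding X_def
    by (rule DERIV_diff[OF DERIV_add[OF DERIV_divide[OF D ell_r[OF r] e] DERIV_mult[OF a_r[OF r] k_r[OF r]]]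
      DERIV_add[OF DERIV_mult[OF a_r[OF r] has_real_derivative_Im[OF X_r]]
        DERIV_mult[OF k_r[OF r] has_real_derivative_Re[OF X_r]]]])
  ultimately have v': "Im v' = (D * ell r t - kr r t * (ell r t * lr r t)) / (ell r t * ell r t)
      + (ar r t * k r t + kr r t * a r t)
      - (ar r t * Im X + Im (of_real (ell r t) * Xs) * a r t
        + (kr r t * Re X + Re (of_real (ell r t) * Xs) * k r t))"
    by (rule DERIV_unique)
  define Y where "Y = (U r t * Q r t + of_real (W r t) * cnj (Q r t)) * P r t + G r t * Qr r t"
  have "((\<lambda>t. Pr r t / P r t) has_vector_derivative v') (at t)"
    using has_vector_derivative_quotient[OF Pr_t[OF r t] P_t[OF r t] P_nz[OF r]]
    by (simp add: v'_def mult.commute)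
  moreover have "((\<lambda>t. G r t * P r t) has_vector_derivative Y) (at t)"
    using has_vector_derivative_mult[OF G_t[OF r] P_t[OF r t]] by (simp add: Y_def add.commute)
  ultimately have "((\<lambda>t. (Im (Pr r t / P r t) + Im (G r t * P r t)) / ell r t) has_real_derivative
      ((Im v' + Im Y) * ell r t - (Im (Pr r t / P r t) + Im (G r t * P r t))
        * (ell r t * (Re (G r t * Q r t) + Re v))) / (ell r t * ell r t)) (at t)"
    unfolding v_def by (intro DERIV_divide DERIV_add has_real_derivative_Im ell_t[OF r] e)
  also have "Im (Pr r t / P r t) + Im (G r t * P r t) = ell r t * k r t"
    using flow_curvature[OF r] by simp
  finally have "((\<lambda>t. k r t) has_real_derivative
      ((Im v' + Im Y) * ell r t - ell r t * k r t * (ell r t * (Re (G r t * Q r t) + Re v))) / (ell r t * ell r t)) (at t)"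
    by (rule has_field_derivative_transform_within_open[of _ _ _ "{0<..<\<tau>}"])
      (use r t cone_flow.flow_curvature[OF cone_flow_axioms] ell_pos[of r] in \<open>auto simp: less_imp_neq[symmetric]\<close>)
  moreover have "Y = of_real (ell r t) * (V * Complex (a r t) (k r t)
      + of_real n * Complex (a r t) (- k r t) + X * v)"
  proof -
    have cnj: "cnj (Complex (a r t) (k r t)) = Complex (a r t) (- k r t)"
      by (simp add: complex_eq_iff)
    have "Qr r t = P r t * v"
      using P_nz[OF r] by (simp add: v_def)
    then show ?thesis
      unfolding Y_def frame(3)[OF r] X_def V_def n_def of_real_mult complex_norm_square complex_cnj_mult cnj
      unfolding frame(1)[OF r] by (simp add: algebra_simps power2_eq_square)
  qed
  moreover have "G r t * Q r t = X * Complex (a r t) (k r t)"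
    unfolding X_def frame(3)[OF r] by simp
  ultimately have k_t: "((\<lambda>t. k r t) has_real_derivative Im v' / ell r t
      + Im (V * Complex (a r t) (k r t) + of_real n * Complex (a r t) (- k r t) + X * v)
      - k r t * (Re (X * Complex (a r t) (k r t)) + Re v)) (at t)" (is "(_ has_real_derivative ?kt) _")
    using e by (simp add: add_divide_distrib diff_divide_distrib del: times_complex.sel(1))
  \<comment> \<open>In the frame the second derivative \<open>D\<close>, the tangential speed, its
    derivative and the stretching \<open>l\<close> all cancel, and so do X and V.\<close>
  have alg: "m ^ 3 - 2 * m * n =
      ((D * e - m' * (e * l)) / (e * e) + (c' * m + m' * c)
        - (c' * Im X + Im (of_real e * Xs) * c + (m' * Re X + Re (of_real e * Xs) * m))) / e
      + Im (V * Complex c m + of_real n * Complex c (- m) + X * v)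
      - m * (Re (X * Complex c m) + Re v) - (c / e - l / e\<^sup>2) * m' - D / e\<^sup>2"
    if "e \<noteq> 0" "Xs = V + of_real n + X * (\<i> * of_real m - X)"
      "v = Complex c' m' / of_real e + Complex c m * (\<i> * of_real m - X)"
    for X V Xs v :: complex and m n D e m' l c' c :: real
    unfolding that(2,3) using that(1)
    by (simp add: power2_eq_square power3_eq_cube algebra_simps add_divide_distrib diff_divide_distrib)
  have "jet (drift r t) (ell r t) k r t (kr r t / ell r t) (k r t ^ 3 - 2 * k r t * n)"
    by (rule jetI[of "{0<..<\<rho>}" r k t "\<lambda>r. kr r t" D ?kt, OF _ _ _ D k_t])
      (use r alg[OF e Xs_def v_eq] in \<open>auto intro: k_r simp: drift_def v'\<close>)
  then show ?thesis
    unfolding n_def by blast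
qed

end

end

section \<open>Barriers for the angle and the curvature\<close>

text \<open>
  The differential inequality at a point of contact for the second barrier: there
  \<open>Z = k\<^sup>2 (1 + 8 \<omega>\<^sup>2) + \<Lambda> |z|\<^sup>-\<^sup>2\<^sup>b \<omega>\<^sup>2 - K |z|\<^sup>2\<^sup>\<kappa>\<^sup>-\<^sup>2\<^sup>b - \<delta> |z|\<^sup>-\<^sup>2\<close> vanishes.  Since \<open>\<omega>\<^sub>s\<close> is close to \<open>k\<close>, the factor
  \<open>1 + 8 \<omega>\<^sup>2\<close> absorbs the reaction term \<open>2 k\<^sup>4\<close>, and the term with \<open>\<Lambda>\<close> absorbs all terms of the
  order \<open>|z|\<^sup>-\<^sup>2\<^sup>b k\<^sup>2\<close>.  Here \<open>y = \<omega>\<close>, \<open>E = |z|\<^sup>-\<^sup>2\<^sup>b\<close>, \<open>X = |z|\<^sup>2\<^sup>\<kappa>\<close>, \<open>Y = |z|\<^sup>-\<^sup>2\<close>, \<open>m = |q|\<^sup>2\<close>; a suffix \<open>s\<close> marks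
  the arc length derivative and a prefix \<open>L\<close> the heat operator.
\<close>

lemma curvature_barrier_inequality:
  fixes k y ks ys Lk Ly m E Es LE X LX Y LY \<Lambda> K \<delta> N c R M n :: real
  assumes Lk: "Lk = k ^ 3 - 2 * k * n" "\<bar>n\<bar> \<le> M * m"
    and y: "\<bar>y\<bar> \<le> 1/100" "y\<^sup>2 \<le> N * X"
    and Ly: "\<bar>y * Ly\<bar> \<le> N * m * X"
    and ys: "(ys - k)\<^sup>2 \<le> N * m * X"
    and m: "0 \<le> m" "m \<le> c * E" and E: "0 < E" and X: "0 < X" "X \<le> 1" and Y: "0 < Y"
    and LE: "\<bar>LE\<bar> \<le> 8 * m * E" "Es\<^sup>2 \<le> 4 * E\<^sup>2 * m"
    and LX: "\<bar>LX\<bar> \<le> 8 * m * (E * X)" and LY: "\<bar>LY\<bar> \<le> 8 * m * Y"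
    and pos: "1 \<le> N" "0 < c" "0 \<le> M" "0 < \<delta>"
    and \<Lambda>: "\<Lambda> \<ge> 5 * M * c + 16 * N * c + 16 * c"
    and K: "K \<ge> 3 * \<Lambda> * N + 100000 * N * c"
    and contact: "k\<^sup>2 * (1 + 8 * y\<^sup>2) + \<Lambda> * (E * y\<^sup>2) = K * (E * X) + \<delta> * Y"
  shows "(2 * k * Lk - 2 * ks\<^sup>2) * (1 + 8 * y\<^sup>2) + k\<^sup>2 * (8 * (2 * y * Ly - 2 * ys\<^sup>2))
    - 2 * (2 * k * ks) * (16 * y * ys)
    + \<Lambda> * (LE * y\<^sup>2 + E * (2 * y * Ly - 2 * ys\<^sup>2) - 2 * Es * (2 * y * ys))
    - K * LX - \<delta> * LY < 0"
proof -
  have Nc: "0 < N * c" and \<Lambda>0: "0 < \<Lambda>"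
  proof -
    show "0 < N * c" using pos by simp
    have "0 \<le> 5 * M * c" "0 \<le> 16 * N * c" using pos by auto
    then show "0 < \<Lambda>" using \<Lambda> pos by linarith
  qed
  \<comment> \<open>The assumption on \<open>K\<close> says \<open>K\<close> \<ge>
    \<open>\<Lambda> * N + R\<close>. The first part pays for the \<open>\<Lambda>\<close> term in
    the contact equation, so R E X is left below a multiple of k^2. This makes every error of order
    N c E X a small fraction of k^2.\<close>
  define R where R: "R = 100000 * N * c + 2 * \<Lambda> * N"
  have \<Lambda>N: "0 \<le> \<Lambda> * N" using \<Lambda>0 pos by simp
  have R0: "0 < R" using Nc \<Lambda>N unfolding R by linarith
  have EX: "0 < E * X" using E X by simp
  have "\<Lambda> * N + R \<le> K" using K unfolding R by linarith
  then have "(\<Lambda> * N + R) * (E * X) \<le> K * (E * X)"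
    by (rule mult_right_mono) (use EX in simp)
  then have KX: "\<Lambda> * N * (E * X) + R * (E * X) \<le> K * (E * X)"
    by (simp only: distrib_right)
  have y2: "8 * y\<^sup>2 \<le> 1/1000"
    using power_mono[of "\<bar>y\<bar>" "1/100" 2] y(1) by (simp add: power2_eq_square)
  have k2: "0 \<le> k\<^sup>2" by simp
  have k8: "k\<^sup>2 * (1 + 8 * y\<^sup>2) \<le> (1001/1000) * k\<^sup>2"
    using mult_left_mono[OF y2 k2] by (simp add: algebra_simps)
  have Ey: "\<Lambda> * (E * y\<^sup>2) \<le> \<Lambda> * N * (E * X)"
  proof -
    have "E * y\<^sup>2 \<le> E * (N * X)" using y(2) E by simp
    then show ?thesis using mult_left_mono[of "E * y\<^sup>2" "E * (N * X)" \<Lambda>] \<Lambda>0 by (simp add: mult_ac)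
  qed
  have RX: "R * (E * X) + \<delta> * Y \<le> (1001/1000) * k\<^sup>2"
    using contact k8 Ey KX by linarith
  have \<delta>Y: "0 < \<delta> * Y" using pos Y by simp
  have RX': "R * (E * X) \<le> (1001/1000) * k\<^sup>2" using RX \<delta>Y by linarith
  have kpos: "0 < k\<^sup>2"
    using RX \<delta>Y mult_pos_pos[OF R0 EX] by linarith
  have small1: "100000 * (N * c * (E * X)) \<le> (1001/1000) * k\<^sup>2"
  proof -
    have "100000 * (N * c * (E * X)) \<le> R * (E * X)"
      unfolding R using \<Lambda>N EX mult_nonneg_nonneg[of "2 * (\<Lambda> * N)" "E * X"] by (simp add: algebra_simps)
    then show ?thesis using RX' by linarith
  qed
  have small2: "2 * (\<Lambda> * N * (E * X)) \<le> (1001/1000) * k\<^sup>2"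
  proof -
    have "2 * (\<Lambda> * N * (E * X)) \<le> R * (E * X)"
      unfolding R using Nc EX mult_nonneg_nonneg[of "100000 * (N * c)" "E * X"] by (simp add: algebra_simps)
    then show ?thesis using RX' by linarith
  qed
  have NmX: "N * m * X \<le> N * c * (E * X)"
    using mult_right_mono[OF mult_left_mono[OF m(2), of N], of X] pos X by (simp add: mult_ac)
  have NmXk: "N * m * X \<le> k\<^sup>2 / 10000"
    using NmX small1 k2 by linarith
  then have NmXk': "N * m * X \<le> (1/80) * k\<^sup>2"
    using k2 by linarith
  have NmX0: "0 \<le> N * m * X" using pos m X by simp
  have NmX1: "N * m * X \<le> N * c * E"
    using mult_mono[OF mult_left_mono[OF m(2), of N] X(2)] pos m X E by (simp add: mult_ac)
  \<comment> \<open>The derivative of the angle agrees with k up to one percent; from here on the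
    negative terms with ys^2 count as negative terms with k^2.\<close>
  have ysk: "\<bar>ys - k\<bar> \<le> \<bar>k\<bar> / 100"
  proof (rule power2_le_imp_le)
    show "\<bar>ys - k\<bar>\<^sup>2 \<le> (\<bar>k\<bar> / 100)\<^sup>2"
    proof -
      have "(ys - k)\<^sup>2 \<le> k\<^sup>2 / 10000"
        using ys NmXk by linarith
      then show ?thesis by (simp add: power_divide)
    qed
  qed simp
  have ys_up: "\<bar>ys\<bar> \<le> (101/100) * \<bar>k\<bar>" and ys_lo: "(99/100) * \<bar>k\<bar> \<le> \<bar>ys\<bar>"
    using ysk by linarith+
  have ys2: "(49/50) * k\<^sup>2 \<le> ys\<^sup>2"
  proof -
    have "((99/100) * \<bar>k\<bar>)\<^sup>2 \<le> \<bar>ys\<bar>\<^sup>2" by (rule power_mono[OF ys_lo]) simp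
    then have "(9801/10000) * k\<^sup>2 \<le> ys\<^sup>2"
      unfolding power_mult_distrib power2_abs by (simp add: power_divide)
    then show ?thesis using k2 by linarith
  qed
  have Ek: "0 < E * k\<^sup>2" using E kpos by simp
  have k_abs: "k\<^sup>2 = \<bar>k\<bar> * \<bar>k\<bar>" by (simp add: power2_eq_square)
  have k4: "0 \<le> k\<^sup>2 * k\<^sup>2" by simp
  have mk: "m * k\<^sup>2 \<le> c * (E * k\<^sup>2)"
    using mult_right_mono[OF m(2) k2] by (simp add: mult_ac)
  \<comment> \<open>The reaction 2 k^4, enlarged by the factor 1001/1000 that bounds 1 + 8 y^2, plus
    a Gauss curvature term of order E k^2. All of - 2 ks^2 is kept for the cross term in
    \<open>T4\<close>.\<close>
  have T1: "(2 * k * Lk - 2 * ks\<^sup>2) * (1 + 8 * y\<^sup>2) \<le> (1001/500) * (k\<^sup>2 * k\<^sup>2) + (1001/250) * (M * c * (E * k\<^sup>2)) - 2 * ks\<^sup>2"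
  proof -
    have "- n \<le> M * m" using Lk(2) by linarith
    then have "4 * k\<^sup>2 * (- n) \<le> 4 * k\<^sup>2 * (M * m)" by (rule mult_left_mono) simp
    also have "\<dots> = 4 * M * (m * k\<^sup>2)" by simp
    also have "\<dots> \<le> 4 * M * (c * (E * k\<^sup>2))"
      using mk pos by (intro mult_left_mono) auto
    finally have n: "4 * k\<^sup>2 * (- n) \<le> 4 * (M * c * (E * k\<^sup>2))" by (simp only: mult.assoc)
    have "2 * k * Lk = 2 * (k\<^sup>2 * k\<^sup>2) + 4 * k\<^sup>2 * (- n)"
      unfolding Lk(1) by (simp add: algebra_simps power2_eq_square power3_eq_cube)
    then have "2 * k * Lk \<le> 2 * (k\<^sup>2 * k\<^sup>2) + 4 * (M * c * (E * k\<^sup>2))" using n by linarith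
    then have "2 * k * Lk * (1 + 8 * y\<^sup>2) \<le> (2 * (k\<^sup>2 * k\<^sup>2) + 4 * (M * c * (E * k\<^sup>2))) * (1 + 8 * y\<^sup>2)"
      by (rule mult_right_mono) simp
    also have "\<dots> \<le> (2 * (k\<^sup>2 * k\<^sup>2) + 4 * (M * c * (E * k\<^sup>2))) * (1001/1000)"
      using y2 pos Ek by (intro mult_left_mono) auto
    finally have 1: "2 * k * Lk * (1 + 8 * y\<^sup>2) \<le> (2 * (k\<^sup>2 * k\<^sup>2) + 4 * (M * c * (E * k\<^sup>2))) * (1001/1000)" .
    have "2 * ks\<^sup>2 * 1 \<le> 2 * ks\<^sup>2 * (1 + 8 * y\<^sup>2)"
      by (intro mult_left_mono) auto
    with 1 show ?thesis by (simp add: left_diff_distrib)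
  qed
  have Ly': "y * Ly \<le> N * m * X" "y * Ly \<le> N * c * E" using Ly NmX1 by linarith+
  \<comment> \<open>The decisive term: 16 k^2 ys^2 is at least 16 * (49/50) k^4 = (392/25) k^4, far
    more than the reaction in \<open>T1\<close>.\<close>
  have T2: "k\<^sup>2 * (8 * (2 * y * Ly - 2 * ys\<^sup>2)) \<le> 16 * (N * c * (E * k\<^sup>2)) - (392/25) * (k\<^sup>2 * k\<^sup>2)"
  proof -
    have "2 * y * Ly - 2 * ys\<^sup>2 \<le> 2 * (N * c * E) - (49/25) * k\<^sup>2"
      using Ly'(2) ys2 by linarith
    then have "k\<^sup>2 * (8 * (2 * y * Ly - 2 * ys\<^sup>2)) \<le> k\<^sup>2 * (8 * (2 * (N * c * E) - (49/25) * k\<^sup>2))"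
      by (intro mult_left_mono) auto
    then show ?thesis by (simp add: algebra_simps)
  qed
  \<comment> \<open>With |y| \<le> 1/100 and |ys| \<le> (101/100) |k| the cross term is at most 64 *
    (101/10000) |ks| k^2 = (404/625) |ks| k^2, which is split by completing a square; (202/625)^2 <
    1/5.\<close>
  have T4: "- 2 * (2 * k * ks) * (16 * y * ys) \<le> ks\<^sup>2 + (1/5) * (k\<^sup>2 * k\<^sup>2)"
  proof -
    have "\<bar>y\<bar> * \<bar>ys\<bar> \<le> (1/100) * ((101/100) * \<bar>k\<bar>)"
      using y(1) ys_up by (intro mult_mono) auto
    then have "64 * (\<bar>k\<bar> * \<bar>ks\<bar>) * (\<bar>y\<bar> * \<bar>ys\<bar>) \<le> 64 * (\<bar>k\<bar> * \<bar>ks\<bar>) * ((1/100) * ((101/100) * \<bar>k\<bar>))"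
      by (intro mult_left_mono) auto
    also have "\<dots> = (404/625) * (\<bar>ks\<bar> * k\<^sup>2)" unfolding k_abs by simp
    also have "\<dots> \<le> ks\<^sup>2 + (1/5) * (k\<^sup>2 * k\<^sup>2)"
    proof -
      have "(404/625) * (u * v) \<le> u * u + (1/5) * (v * v)" for u v :: real
      proof -
        have "(u - (202/625) * v) * (u - (202/625) * v)
            = u * u - (404/625) * (u * v) + (40804/390625) * (v * v)"
          by (simp add: algebra_simps)
        then show ?thesis
          using zero_le_square[of "u - (202/625) * v"] zero_le_square[of v] by linarith
      qed
      from this[of "\<bar>ks\<bar>" "k\<^sup>2"] show ?thesis by (simp add: power2_eq_square)
    qed
    finally have "64 * (\<bar>k\<bar> * \<bar>ks\<bar>) * (\<bar>y\<bar> * \<bar>ys\<bar>) \<le> ks\<^sup>2 + (1/5) * (k\<^sup>2 * k\<^sup>2)" .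
    moreover have "- 2 * (2 * k * ks) * (16 * y * ys) \<le> 64 * (\<bar>k\<bar> * \<bar>ks\<bar>) * (\<bar>y\<bar> * \<bar>ys\<bar>)"
      using abs_ge_minus_self[of "64 * (k * ks) * (y * ys)"] by (simp add: abs_mult mult_ac)
    ultimately show ?thesis by linarith
  qed
  have T5: "LE * y\<^sup>2 \<le> (1/10) * (E * k\<^sup>2)"
  proof -
    have "LE * y\<^sup>2 \<le> (8 * m * E) * (N * X)"
      using LE(1) y(2) m E by (intro mult_mono) auto
    also have "\<dots> = 8 * E * (N * m * X)" by simp
    also have "\<dots> \<le> 8 * E * ((1/80) * k\<^sup>2)"
      using E by (intro mult_left_mono NmXk') auto
    finally show ?thesis by simp
  qed
  \<comment> \<open>The gain from the summand with \<open>\<Lambda>\<close>: - 2 E ys^2 is nearly -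
    2 E k^2, and the reaction of the angle is negligible by \<open>small1\<close>.\<close>
  have T6: "E * (2 * y * Ly - 2 * ys\<^sup>2) \<le> - (93/50) * (E * k\<^sup>2)"
  proof -
    have "2 * y * Ly - 2 * ys\<^sup>2 \<le> - (93/50) * k\<^sup>2"
      using Ly'(1) NmX small1 ys2 k2 by linarith
    from mult_left_mono[OF this, of E] E show ?thesis by (simp add: mult_ac)
  qed
  have T8: "- 2 * Es * (2 * y * ys) \<le> (1/10) * (E * k\<^sup>2)"
  proof -
    have "(\<bar>Es\<bar> * \<bar>y\<bar>)\<^sup>2 \<le> (4 * E\<^sup>2 * m) * (N * X)"
      unfolding power_mult_distrib using LE(2) y(2) m by (intro mult_mono) auto
    also have "\<dots> = 4 * E\<^sup>2 * (N * m * X)" by simp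
    also have "\<dots> \<le> 4 * E\<^sup>2 * (k\<^sup>2 / 10000)"
      by (intro mult_left_mono NmXk) auto
    also have "\<dots> = (E * \<bar>k\<bar> / 50)\<^sup>2" by (simp add: power_mult_distrib power_divide)
    finally have "\<bar>Es\<bar> * \<bar>y\<bar> \<le> E * \<bar>k\<bar> / 50"
      by (rule power2_le_imp_le) (use E in simp)
    then have "4 * ((\<bar>Es\<bar> * \<bar>y\<bar>) * \<bar>ys\<bar>) \<le> 4 * ((E * \<bar>k\<bar> / 50) * ((101/100) * \<bar>k\<bar>))"
      using ys_up E by (intro mult_left_mono mult_mono) auto
    also have "\<dots> = (101/1250) * (E * k\<^sup>2)" unfolding k_abs by simp
    finally have "4 * ((\<bar>Es\<bar> * \<bar>y\<bar>) * \<bar>ys\<bar>) \<le> (1/10) * (E * k\<^sup>2)" using Ek by linarith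
    moreover have "- 2 * Es * (2 * y * ys) \<le> 4 * ((\<bar>Es\<bar> * \<bar>y\<bar>) * \<bar>ys\<bar>)"
      using abs_ge_minus_self[of "4 * (Es * y * ys)"] by (simp add: abs_mult mult_ac)
    ultimately show ?thesis by linarith
  qed
  \<comment> \<open>On the contact set the two comparison terms together are at most 2 k^2. Their
    heat operators thus cost O(m k^2) = O(c E k^2) with a factor independent of \<open>K\<close> and
    \<open>\<delta>\<close>, which is why \<open>\<Lambda>\<close> can be fixed before
    \<open>K\<close>.\<close>
  have T9: "- K * LX - \<delta> * LY \<le> 16 * (c * (E * k\<^sup>2))"
  proof -
    have K0: "0 \<le> K" using K \<Lambda>N R0 unfolding R by linarith
    have "- K * LX \<le> K * (8 * m * (E * X))"
      using mult_left_mono[OF _ K0, of "- LX" "8 * m * (E * X)"] LX by simp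
    moreover have "- \<delta> * LY \<le> \<delta> * (8 * m * Y)"
      using mult_left_mono[of "- LY" "8 * m * Y" \<delta>] LY pos by simp
    ultimately have "- K * LX - \<delta> * LY \<le> 8 * m * (K * (E * X) + \<delta> * Y)"
      by (simp add: algebra_simps)
    also have "\<dots> \<le> 8 * m * (2 * k\<^sup>2)"
    proof (rule mult_left_mono)
      show "K * (E * X) + \<delta> * Y \<le> 2 * k\<^sup>2"
        using contact k8 Ey small2 k2 by linarith
    qed (use m in simp)
    also have "\<dots> \<le> 16 * (c * (E * k\<^sup>2))" using mk by simp
    finally show ?thesis .
  qed
  \<comment> \<open>The balance of order E k^2: the \<open>\<Lambda>\<close> terms give - (8/5)
    \<open>\<Lambda>\<close> E k^2, and by the choice of \<open>\<Lambda>\<close> all other terms of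
    this order amount to at most \<open>\<Lambda>\<close> E k^2. The balance of order k^4 is
    1001/500 + 1/5 < 392/25.\<close>
  have "\<Lambda> * (LE * y\<^sup>2 + E * (2 * y * Ly - 2 * ys\<^sup>2) - 2 * Es * (2 * y * ys)) \<le> \<Lambda> * (- (8/5) * (E * k\<^sup>2))"
    using T5 T6 T8 Ek \<Lambda>0 by (intro mult_left_mono) linarith+
  moreover have "(5 * M * c + 16 * N * c + 16 * c) * (E * k\<^sup>2) \<le> \<Lambda> * (E * k\<^sup>2)"
    using \<Lambda> Ek by (intro mult_right_mono) auto
  then have "5 * (M * c * (E * k\<^sup>2)) + 16 * (N * c * (E * k\<^sup>2)) + 16 * (c * (E * k\<^sup>2)) \<le> \<Lambda> * (E * k\<^sup>2)"
    by (simp add: algebra_simps)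
  moreover have "0 < \<Lambda> * (E * k\<^sup>2)" "0 \<le> M * c * (E * k\<^sup>2)"
    using \<Lambda>0 Ek pos by auto
  moreover have "0 \<le> ks\<^sup>2" by simp
  ultimately show ?thesis
    using T1 T2 T4 T9 k4 by linarith
qed

text \<open>The restoring force is linear in the angle up to a relative loss measured by the same
  \<open>\<eta>\<close> that bounds the angle: the mean value theorem reduces the sine to the
  cosine, and 1 - cos (2 w) = 2 (sin w)^2 is quadratically small.\<close>

lemma sin_double_lower_bound:
  fixes w \<eta> :: real
  assumes "0 \<le> w" "w \<le> \<eta>" "\<eta> \<le> 1/100"
  shows "2 * w * (1 - \<eta>) \<le> sin (2 * w)" and "1 - \<eta> \<le> cos (2 * w)"
proof -
  have w: "sin w \<le> w" "0 \<le> sin w"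
    using assms pi_gt3 by (auto intro!: sin_x_le_x sin_ge_zero)
  have "(sin w)\<^sup>2 \<le> w * (1/100)"
    unfolding power2_eq_square using assms w by (intro mult_mono) auto
  then show c: "1 - \<eta> \<le> cos (2 * w)"
    unfolding cos_double_sin using assms by simp
  show "2 * w * (1 - \<eta>) \<le> sin (2 * w)"
  proof (cases "w = 0")
    case False
    then obtain u where u: "0 < u" "u < 2 * w" "sin (2 * w) - sin 0 = (2 * w - 0) * cos u"
      using MVT2[of 0 "2 * w" sin cos] assms(1) by (auto intro: derivative_eq_intros)
    have "cos (2 * w) \<le> cos u"
      using u assms pi_gt3 by (intro cos_monotone_0_pi_le) auto
    then have "2 * w * (1 - \<eta>) \<le> 2 * w * cos u"
      using c assms by (intro mult_left_mono) auto
    then show ?thesis using u by simp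
  qed simp
qed

text \<open>What is known before any barrier is used: \<open>k_bound\<close> reflects a bounded
  velocity, \<open>\<omega>_tip\<close> a continuous tangent at the vertex,
  \<open>\<omega>_initial\<close> and \<open>k_initial\<close> an initial arc that is smooth up to
  its endpoint. The bound on \<open>10 * \<eta>\<close> leaves at least half of the factor (2 b -
  \<open>\<kappa>\<close>) (b + \<open>\<kappa>\<close>) after all losses caused by a nonzero angle
  and by h.\<close>

locale cone_flow_bounds = cone_flow z P Q Pr Qr Prr Qrr h H A B b \<rho> \<tau>
  for z P Q Pr Qr Prr Qrr :: "real \<Rightarrow> real \<Rightarrow> complex"
    and h :: "complex \<Rightarrow> real" and H A :: "complex \<Rightarrow> complex" and B :: "complex \<Rightarrow> real"
    and b \<rho> \<tau> :: real +
  fixes C M \<kappa> \<eta> :: real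
  assumes b: "0 < b" "b < 1" and C: "1 \<le> C" and M: "1 \<le> M"
    and \<kappa>: "0 < \<kappa>" "\<kappa> \<le> 1" "\<kappa> < 2 * b"
    and \<eta>: "0 < \<eta>" "\<eta> \<le> 1/100" "10 * \<eta> \<le> (2 * b - \<kappa>) * (b + \<kappa>)"
    and continuous_z: "continuous_on ({0<..<\<rho>} \<times> {0..<\<tau>}) (\<lambda>x. z (fst x) (snd x))"
    and continuous_P: "continuous_on ({0<..<\<rho>} \<times> {0..<\<tau>}) (\<lambda>x. P (fst x) (snd x))"
    and continuous_Q: "continuous_on ({0<..<\<rho>} \<times> {0..<\<tau>}) (\<lambda>x. Q (fst x) (snd x))"
    and continuous_h: "continuous_on ({0<..<\<rho>} \<times> {0..<\<tau>}) (\<lambda>x. h (z (fst x) (snd x)))"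
    and z_small: "\<And>r t. 0 < r \<Longrightarrow> r < \<rho> \<Longrightarrow> 0 \<le> t \<Longrightarrow> t < \<tau> \<Longrightarrow> M * norm (z r t) \<le> \<eta>"
    and h_bound: "\<And>r t. 0 < r \<Longrightarrow> r < \<rho> \<Longrightarrow> 0 \<le> t \<Longrightarrow> t < \<tau> \<Longrightarrow> \<bar>h (z r t)\<bar> \<le> M"
    and H_bound: "\<And>r t. 0 < r \<Longrightarrow> r < \<rho> \<Longrightarrow> 0 \<le> t \<Longrightarrow> t < \<tau> \<Longrightarrow> norm (H (z r t)) \<le> M"
    and A_bound: "\<And>r t. 0 < r \<Longrightarrow> r < \<rho> \<Longrightarrow> 0 \<le> t \<Longrightarrow> t < \<tau> \<Longrightarrow> norm (A (z r t)) \<le> M"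
    and B_bound: "\<And>r t. 0 < r \<Longrightarrow> r < \<rho> \<Longrightarrow> 0 \<le> t \<Longrightarrow> t < \<tau> \<Longrightarrow> \<bar>B (z r t)\<bar> \<le> M"
    and z_linear: "\<And>r t. 0 < r \<Longrightarrow> r < \<rho> \<Longrightarrow> 0 \<le> t \<Longrightarrow> t < \<tau> \<Longrightarrow> norm (z r t) \<le> C * r"
    and \<omega>_bound: "\<And>r t. 0 < r \<Longrightarrow> r < \<rho> \<Longrightarrow> 0 \<le> t \<Longrightarrow> t < \<tau> \<Longrightarrow> \<bar>\<omega> r t\<bar> \<le> \<eta>"
    and \<omega>_tip: "\<And>\<delta>. \<delta> > 0 \<Longrightarrow> \<exists>\<rho>'>0. \<forall>r t. 0 < r \<and> r < \<rho>' \<and> r < \<rho> \<and> 0 \<le> t \<and> t < \<tau> \<longrightarrow> \<bar>\<omega> r t\<bar> < \<delta>"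
    and \<omega>_initial: "\<And>r. 0 < r \<Longrightarrow> r < \<rho> \<Longrightarrow> \<bar>\<omega> r 0\<bar> \<le> C * norm (z r 0)"
    and k_bound: "\<And>r t. 0 < r \<Longrightarrow> r < \<rho> \<Longrightarrow> 0 \<le> t \<Longrightarrow> t < \<tau> \<Longrightarrow> \<bar>k r t\<bar> \<le> C * norm (z r t) powr (b - 1)"
    and k_initial: "\<And>r. 0 < r \<Longrightarrow> r < \<rho> \<Longrightarrow> \<bar>k r 0\<bar> \<le> C * norm (z r 0) powr (1 - b)"
begin

section \<open>Continuity up to time 0 and pointwise bounds for the coefficients\<close>

lemma continuous_\<xi>: "continuous_on ({0<..<\<rho>} \<times> {0..<\<tau>}) (\<lambda>x. \<xi> (fst x) (snd x))"
  unfolding \<xi>_def by (intro continuous_intros continuous_z) (auto simp: z_nz)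

lemma continuous_\<omega>: "continuous_on ({0<..<\<rho>} \<times> {0..<\<tau>}) (\<lambda>x. \<omega> (fst x) (snd x))"
proof -
  have "P (fst x) (snd x) \<notin> \<real>\<^sub>\<le>\<^sub>0" if "x \<in> {0<..<\<rho>} \<times> {0..<\<tau>}" for x
    using P_pos[of "fst x" "snd x"] that by (auto simp: mem_Times_iff complex_nonpos_Reals_iff)
  then show ?thesis
    unfolding \<omega>_def by (intro continuous_intros continuous_P) auto
qed

lemma continuous_k: "continuous_on ({0<..<\<rho>} \<times> {0..<\<tau>}) (\<lambda>x. k (fst x) (snd x))"
proof -
  have "P (fst x) (snd x) \<noteq> 0" if "x \<in> {0<..<\<rho>} \<times> {0..<\<tau>}" for x
    using P_pos[of "fst x" "snd x"] that by (auto simp: mem_Times_iff)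
  then show ?thesis
    unfolding k_def ell_def
    by (intro continuous_intros continuous_P continuous_Q continuous_h continuous_\<xi>) auto
qed

context
  fixes r t assumes r: "0 < r" "r < \<rho>" and t: "0 \<le> t" "t < \<tau>"
begin

lemma norm_z_eq: "norm (z r t) = exp (\<xi> r t)"
  using z_nz[OF r t] by (simp add: \<xi>_def)

lemma norm_z_le_1: "norm (z r t) \<le> 1" and \<xi>_nonpos: "\<xi> r t \<le> 0" and Mz: "M * exp (\<xi> r t) \<le> \<eta>"
proof -
  have "norm (z r t) \<le> M * norm (z r t)"
    using M by (simp add: mult_le_cancel_right1)
  with z_small[OF r t] \<eta> show "norm (z r t) \<le> 1" by linarith
  then show "\<xi> r t \<le> 0" by (simp add: norm_z_eq)
  show "M * exp (\<xi> r t) \<le> \<eta>"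
    using z_small[OF r t] by (simp add: norm_z_eq)
qed

text \<open>|q|^2 = e^(-2 \<psi>) is the size of the coefficients in log z; its growth like |z|^(-2
  b) at the vertex is the degeneracy of the flow.\<close>

lemma norm_q_sq: "(norm (q r t))\<^sup>2 = exp (- 2 * h (z r t)) * exp (- 2 * b * \<xi> r t)"
proof -
  have "P r t \<noteq> 0" using P_pos[OF r t] by auto
  moreover have "norm (q r t) = norm (P r t) / ell r t"
    using ell_pos[of r t] by (simp add: q_def norm_divide)
  ultimately have "norm (q r t) = exp (- h (z r t) - b * \<xi> r t)"
    by (simp add: ell_def exp_add exp_diff exp_minus field_simps)
  then show ?thesis by (simp add: power2_eq_square flip: exp_add)
qed

lemma norm_q_sq_le: "(norm (q r t))\<^sup>2 \<le> exp (2 * M) * exp (- 2 * b * \<xi> r t)"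
  unfolding norm_q_sq using h_bound[OF r t] by simp

lemma q_nz: "q r t \<noteq> 0"
  using P_pos[OF r t] ell_pos[of r t] by (auto simp: q_def)

lemma q_polar: "q r t = of_real (norm (q r t)) * Complex (cos (\<omega> r t)) (sin (\<omega> r t))"
proof -
  have "P r t \<noteq> 0" using P_pos[OF r t] by auto
  then have "P r t = exp (Ln (P r t))" by simp
  also have "\<dots> = of_real (norm (P r t)) * Complex (cos (\<omega> r t)) (sin (\<omega> r t))"
    using \<open>P r t \<noteq> 0\<close> by (simp add: exp_eq_polar cis_conv_exp[symmetric] cis.code \<omega>_def)
  finally show ?thesis
    using ell_pos[of r t] unfolding q_def norm_divide by (simp add: field_simps)
qed

lemma q_sq_polar:
  "(q r t)\<^sup>2 = of_real ((norm (q r t))\<^sup>2) * Complex (cos (2 * \<omega> r t)) (sin (2 * \<omega> r t))"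
proof -
  have "(Complex (cos (\<omega> r t)) (sin (\<omega> r t)))\<^sup>2 = Complex (cos (2 * \<omega> r t)) (sin (2 * \<omega> r t))"
    by (simp add: complex_eq_iff power2_eq_square cos_double sin_double)
  then show ?thesis
    using arg_cong[OF q_polar, of "\<lambda>x. x\<^sup>2"] by (simp add: power_mult_distrib)
qed

lemma norm_Hz: "norm (H (z r t) * z r t) \<le> M * exp (\<xi> r t)"
  unfolding norm_mult norm_z_eq using H_bound[OF r t] by simp

lemma norm_U: "norm (U r t) \<le> 2 * M * exp (\<xi> r t)"
proof -
  have "norm (A (z r t) * (z r t)\<^sup>2) \<le> M * (exp (\<xi> r t) * 1)"
    unfolding norm_mult norm_power norm_z_eq power2_eq_square
    using A_bound[OF r t] \<xi>_nonpos M by (intro mult_mono) auto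
  then show ?thesis
    unfolding U_def using norm_Hz norm_triangle_ineq[of "A (z r t) * (z r t)\<^sup>2" "H (z r t) * z r t"] by simp
qed

lemma abs_W: "\<bar>W r t\<bar> \<le> M"
proof -
  have "\<bar>W r t\<bar> \<le> M * 1\<^sup>2"
    unfolding W_def abs_mult using B_bound[OF r t] norm_z_le_1 M
    by (intro mult_mono) (auto intro: power_le_one)
  then show ?thesis by simp
qed

text \<open>With Y = H z one has U - G^2 = - b^2 + (U - 2 b Y - Y^2). The bracket is at most 5 M
  |z|: 2 M |z| from U, 2 M |z| from 2 b Y, and M |z| from Y^2 since |Y| \<le> 1.\<close>

lemma angle_reaction:
  "\<bar>Im ((U r t - (G r t)\<^sup>2) * (q r t)\<^sup>2) + b\<^sup>2 * ((norm (q r t))\<^sup>2 * sin (2 * \<omega> r t))\<bar>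
    \<le> 5 * M * exp (\<xi> r t) * (norm (q r t))\<^sup>2"
proof -
  define Y where "Y = H (z r t) * z r t"
  have Y: "norm Y \<le> M * exp (\<xi> r t)" "norm Y \<le> 1"
    using norm_Hz Mz \<eta> by (auto simp: Y_def)
  have "U r t - (G r t)\<^sup>2 = of_real (- (b\<^sup>2)) + (U r t - (2 * of_real b * Y + Y\<^sup>2))"
    by (simp add: G_def Y_def power2_eq_square algebra_simps)
  then have "(U r t - (G r t)\<^sup>2) * (q r t)\<^sup>2 =
      of_real (- (b\<^sup>2)) * (q r t)\<^sup>2 + (U r t - (2 * of_real b * Y + Y\<^sup>2)) * (q r t)\<^sup>2"
    by (simp only: distrib_right)
  then have "Im ((U r t - (G r t)\<^sup>2) * (q r t)\<^sup>2) =
      - (b\<^sup>2) * Im ((q r t)\<^sup>2) + Im ((U r t - (2 * of_real b * Y + Y\<^sup>2)) * (q r t)\<^sup>2)"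
    by (simp only: plus_complex.sel times_complex.sel Im_complex_of_real Re_complex_of_real mult_zero_left add_0_right)
  moreover have "Im ((q r t)\<^sup>2) = (norm (q r t))\<^sup>2 * sin (2 * \<omega> r t)"
    by (subst q_sq_polar) simp
  ultimately have "Im ((U r t - (G r t)\<^sup>2) * (q r t)\<^sup>2) + b\<^sup>2 * ((norm (q r t))\<^sup>2 * sin (2 * \<omega> r t)) =
      Im ((U r t - (2 * of_real b * Y + Y\<^sup>2)) * (q r t)\<^sup>2)"
    by simp
  moreover have "\<bar>Im ((U r t - (2 * of_real b * Y + Y\<^sup>2)) * (q r t)\<^sup>2)\<bar>
      \<le> norm (U r t - (2 * of_real b * Y + Y\<^sup>2)) * (norm (q r t))\<^sup>2"
    using abs_Im_le_cmod[of "(U r t - (2 * of_real b * Y + Y\<^sup>2)) * (q r t)\<^sup>2"]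
    by (simp only: norm_mult norm_power)
  moreover have "norm (U r t - (2 * of_real b * Y + Y\<^sup>2)) \<le> 5 * M * exp (\<xi> r t)"
  proof -
    have "norm (2 * of_real b * Y) \<le> 2 * norm Y"
      using b mult_right_mono[of b 1 "norm Y"] by (simp add: norm_mult)
    moreover have "norm (Y\<^sup>2) \<le> norm Y"
      using Y(2) mult_right_mono[of "norm Y" 1 "norm Y"] by (simp add: norm_mult power2_eq_square)
    ultimately show ?thesis
      using norm_U Y(1) norm_triangle_ineq4[of "U r t" "2 * of_real b * Y + Y\<^sup>2"]
        norm_triangle_ineq[of "2 * of_real b * Y" "Y\<^sup>2"] by simp
  qed
  then have "norm (U r t - (2 * of_real b * Y + Y\<^sup>2)) * (norm (q r t))\<^sup>2
      \<le> 5 * M * exp (\<xi> r t) * (norm (q r t))\<^sup>2"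
    by (rule mult_right_mono) simp
  ultimately show ?thesis by linarith
qed

text \<open>One \<open>\<eta>\<close> is lost in replacing cos (2 \<open>\<omega>\<close>) by 1, the
  other in replacing G by b.\<close>

lemma G_q_sq_lower: "Re (G r t * (q r t)\<^sup>2) \<ge> (norm (q r t))\<^sup>2 * (b - 2 * \<eta>)"
proof -
  define Y where "Y = H (z r t) * z r t"
  have "Re (G r t * (q r t)\<^sup>2) = b * Re ((q r t)\<^sup>2) + Re (Y * (q r t)\<^sup>2)"
    unfolding G_def Y_def[symmetric] distrib_right
    by (simp only: plus_complex.sel times_complex.sel Im_complex_of_real Re_complex_of_real mult_zero_left diff_0_right)
  moreover have "Re ((q r t)\<^sup>2) = (norm (q r t))\<^sup>2 * cos (2 * \<bar>\<omega> r t\<bar>)"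
    by (subst q_sq_polar) (simp add: abs_if)
  moreover have "(norm (q r t))\<^sup>2 * cos (2 * \<bar>\<omega> r t\<bar>) \<ge> (norm (q r t))\<^sup>2 * (1 - \<eta>)"
    using sin_double_lower_bound(2)[of "\<bar>\<omega> r t\<bar>" \<eta>] \<omega>_bound[OF r t] \<eta> by (intro mult_left_mono) auto
  then have "b * ((norm (q r t))\<^sup>2 * cos (2 * \<bar>\<omega> r t\<bar>)) \<ge> b * ((norm (q r t))\<^sup>2 * (1 - \<eta>))"
    by (rule mult_left_mono) (use b in simp)
  moreover have "Re (Y * (q r t)\<^sup>2) \<ge> - (\<eta> * (norm (q r t))\<^sup>2)"
  proof -
    have "norm Y * (norm (q r t))\<^sup>2 \<le> \<eta> * (norm (q r t))\<^sup>2"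
      using norm_Hz Mz by (intro mult_right_mono) (auto simp: Y_def)
    then show ?thesis
      using abs_Re_le_cmod[of "Y * (q r t)\<^sup>2"] unfolding norm_mult norm_power by linarith
  qed
  moreover have "b * ((norm (q r t))\<^sup>2 * \<eta>) \<le> 1 * ((norm (q r t))\<^sup>2 * \<eta>)"
    using b \<eta> by (intro mult_right_mono) auto
  moreover have "b * ((norm (q r t))\<^sup>2 * (1 - \<eta>)) = (norm (q r t))\<^sup>2 * b - b * ((norm (q r t))\<^sup>2 * \<eta>)"
    "(norm (q r t))\<^sup>2 * (b - 2 * \<eta>) = (norm (q r t))\<^sup>2 * b - 2 * (\<eta> * (norm (q r t))\<^sup>2)"
    "1 * ((norm (q r t))\<^sup>2 * \<eta>) = \<eta> * (norm (q r t))\<^sup>2"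
    by (simp_all add: algebra_simps)
  ultimately show ?thesis by (smt (verit))
qed

end

end

section \<open>The barrier for the angle\<close>

context cone_flow_bounds
begin

text \<open>Write X = |z|^\<open>\<kappa>\<close>. At a contact the angle is at least K X, so the
  restoring force is at least 2 b^2 (1 - \<open>\<eta>\<close>) K X |q|^2, and the barrier itself
  adds about (\<open>\<kappa>\<close> b - \<open>\<kappa>\<close>^2) K X |q|^2. The sum beats the
  error 5 M |z| |q|^2 because |z| \<le> X. The sign \<open>\<sigma>\<close> treats both bounds on
  the angle at once.\<close>

lemma angle_contact:
  assumes r: "0 < r" "r < \<rho>" and t: "0 < t" "t < \<tau>"
    and \<sigma>: "\<sigma> = 1 \<or> \<sigma> = -1" and K: "10 * M < K * ((2 * b - \<kappa>) * (b + \<kappa>))" and "0 < \<delta>" "0 < K"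
    and contact: "\<sigma> * \<omega> r t + (- K * exp (\<kappa> * \<xi> r t) + - \<delta>) = 0"
  shows "\<exists>a e d l. e \<noteq> 0 \<and> jet a e (\<lambda>r t. \<sigma> * \<omega> r t + (- K * exp (\<kappa> * \<xi> r t) + - \<delta>)) r t d l \<and> l < 0"
proof -
  have t': "0 \<le> t" using t by simp
  define m where "m = (norm (q r t))\<^sup>2"
  define X where "X = exp (\<kappa> * \<xi> r t)"
  define w where "w = \<sigma> * \<omega> r t"
  define J where "J = Im ((U r t - (G r t)\<^sup>2) * (q r t)\<^sup>2)"
  define N where "N = Re (G r t * (q r t)\<^sup>2)"
  define c0 where "c0 = (2 * b - \<kappa>) * (b + \<kappa>)"
  have m: "m > 0" using q_nz[OF r t' t(2)] by (simp add: m_def)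
  have X: "0 < X" "exp (\<xi> r t) \<le> X"
    using \<kappa> \<xi>_nonpos[OF r t' t(2)] mult_right_mono_neg[of \<kappa> 1 "\<xi> r t"] by (auto simp: X_def)
  have w: "w \<ge> K * X" "w \<le> \<eta>" "0 \<le> w"
  proof -
    show 1: "w \<ge> K * X" using contact \<open>0 < \<delta>\<close> by (simp add: w_def X_def)
    show "w \<le> \<eta>" using \<omega>_bound[OF r t' t(2)] \<sigma> by (auto simp: w_def)
    show "0 \<le> w" using 1 mult_pos_pos[OF \<open>0 < K\<close> X(1)] by linarith
  qed
  have sin_w: "\<sigma> * sin (2 * \<omega> r t) = sin (2 * w)"
    using \<sigma> by (auto simp: w_def)
  have "\<sigma> * (J + b\<^sup>2 * (m * sin (2 * \<omega> r t))) \<le> 5 * M * exp (\<xi> r t) * m"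
    using angle_reaction[OF r t' t(2), folded J_def m_def] \<sigma> by auto
  then have "\<sigma> * J + b\<^sup>2 * (m * (\<sigma> * sin (2 * \<omega> r t))) \<le> 5 * M * exp (\<xi> r t) * m"
    by (simp only: distrib_left mult.left_commute)
  moreover have "b\<^sup>2 * (m * (2 * (K * X) * (1 - \<eta>))) \<le> b\<^sup>2 * (m * sin (2 * w))"
  proof -
    have "2 * (K * X) * (1 - \<eta>) \<le> 2 * w * (1 - \<eta>)"
      using w \<eta> by (intro mult_right_mono) auto
    also have "\<dots> \<le> sin (2 * w)"
      by (rule sin_double_lower_bound(1)[OF w(3,2) \<eta>(2)])
    finally show ?thesis using m by (intro mult_left_mono) auto
  qed
  ultimately have 1: "\<sigma> * J \<le> 5 * M * exp (\<xi> r t) * m - b\<^sup>2 * (m * (2 * (K * X) * (1 - \<eta>)))"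
    unfolding sin_w by linarith
  have "\<kappa> * (m * (b - 2 * \<eta>)) - \<kappa>\<^sup>2 * m \<le> \<kappa> * N - \<kappa>\<^sup>2 * (Re (q r t))\<^sup>2"
  proof (rule diff_mono)
    show "\<kappa> * (m * (b - 2 * \<eta>)) \<le> \<kappa> * N"
      unfolding N_def m_def using G_q_sq_lower[OF r t' t(2)] \<kappa> by (intro mult_left_mono) auto
    have "(Re (q r t))\<^sup>2 \<le> m"
      unfolding m_def cmod_power2 by simp
    then show "\<kappa>\<^sup>2 * (Re (q r t))\<^sup>2 \<le> \<kappa>\<^sup>2 * m" by (intro mult_left_mono) auto
  qed
  then have 2: "K * X * (\<kappa> * (m * (b - 2 * \<eta>)) - \<kappa>\<^sup>2 * m) \<le> K * X * (\<kappa> * N - \<kappa>\<^sup>2 * (Re (q r t))\<^sup>2)"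
    using \<open>0 < K\<close> X by (intro mult_left_mono) auto
  \<comment> \<open>The losses 2 b^2 \<open>\<eta>\<close> + 2 \<open>\<kappa>\<close>
    \<open>\<eta>\<close> are at most 4 \<open>\<eta>\<close>, and 10 \<open>\<eta>\<close> \<le>
    c0.\<close>
  have c0: "c0 / 2 \<le> 2 * b\<^sup>2 * (1 - \<eta>) + \<kappa> * (b - 2 * \<eta>) - \<kappa>\<^sup>2"
  proof -
    have "b\<^sup>2 * \<eta> \<le> 1 * \<eta>" "\<kappa> * \<eta> \<le> 1 * \<eta>"
      using b \<kappa> \<eta> power_le_one[of b 2] by (intro mult_right_mono; simp)+
    moreover have "2 * b\<^sup>2 * (1 - \<eta>) + \<kappa> * (b - 2 * \<eta>) - \<kappa>\<^sup>2 = c0 - 2 * (b\<^sup>2 * \<eta>) - 2 * (\<kappa> * \<eta>)"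
      by (simp add: c0_def power2_eq_square algebra_simps)
    ultimately show ?thesis using \<eta>(3)[folded c0_def] \<eta>(1) by linarith
  qed
  have "5 * M * exp (\<xi> r t) < K * X * (2 * b\<^sup>2 * (1 - \<eta>) + \<kappa> * (b - 2 * \<eta>) - \<kappa>\<^sup>2)"
  proof -
    have "5 * M * exp (\<xi> r t) \<le> 5 * M * X"
      using X M by (intro mult_left_mono) auto
    also have "\<dots> < (K * c0 / 2) * X"
      using K[folded c0_def] X by (intro mult_strict_right_mono) auto
    also have "\<dots> = K * X * (c0 / 2)" by simp
    also have "\<dots> \<le> K * X * (2 * b\<^sup>2 * (1 - \<eta>) + \<kappa> * (b - 2 * \<eta>) - \<kappa>\<^sup>2)"
      using c0 \<open>0 < K\<close> X by (intro mult_left_mono) auto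
    finally show ?thesis .
  qed
  then have "m * (5 * M * exp (\<xi> r t)) < m * (K * X * (2 * b\<^sup>2 * (1 - \<eta>) + \<kappa> * (b - 2 * \<eta>) - \<kappa>\<^sup>2))"
    using m by simp
  moreover have "m * (K * X * (2 * b\<^sup>2 * (1 - \<eta>) + \<kappa> * (b - 2 * \<eta>) - \<kappa>\<^sup>2)) =
      b\<^sup>2 * (m * (2 * (K * X) * (1 - \<eta>))) + K * X * (\<kappa> * (m * (b - 2 * \<eta>)) - \<kappa>\<^sup>2 * m)"
    by (simp add: algebra_simps)
  ultimately have "\<sigma> * J - K * X * (\<kappa> * N - \<kappa>\<^sup>2 * (Re (q r t))\<^sup>2) < 0"
    using 1 2 by (simp only: mult.commute[of m "5 * M * exp (\<xi> r t)"])
  then have "\<sigma> * J + (- K * (X * (\<kappa> * N - (\<kappa> * Re (q r t))\<^sup>2)) + 0) < 0"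
    by (simp add: power_mult_distrib mult.assoc)
  moreover have "jet (drift r t) (ell r t) (\<lambda>r t. \<sigma> * \<omega> r t + (- K * exp (\<kappa> * \<xi> r t) + - \<delta>)) r t
      (\<sigma> * (k r t - Im (G r t * q r t)) + (- K * (X * (\<kappa> * Re (q r t))) + 0))
      (\<sigma> * J + (- K * (X * (\<kappa> * N - (\<kappa> * Re (q r t))\<^sup>2)) + 0))"
    unfolding J_def X_def N_def
    by (intro jet_add jet_cmult jet_exp jet_const jet_\<xi> jet_\<omega> r t)
  moreover have "ell r t \<noteq> 0" using ell_pos[of r t] by simp
  ultimately show ?thesis by blast
qed

text \<open>On the lateral side r = \<open>\<rho>\<^sub>1\<close> the distance to the vertex has a
  positive minimum, so a large factor \<open>K\<close> makes the barrier exceed the a priori bounds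
  there.\<close>

lemma z_lower_bound:
  assumes "0 < \<rho>\<^sub>1" "\<rho>\<^sub>1 < \<rho>" "0 \<le> \<tau>\<^sub>1" "\<tau>\<^sub>1 < \<tau>"
  shows "\<exists>x>0. x \<le> 1 \<and> (\<forall>t\<in>{0..\<tau>\<^sub>1}. x \<le> exp (\<xi> \<rho>\<^sub>1 t))"
proof -
  have "continuous_on {0..\<tau>\<^sub>1} (\<lambda>t. \<xi> (fst (\<rho>\<^sub>1, t)) (snd (\<rho>\<^sub>1, t)))"
    by (rule continuous_on_compose2[OF continuous_\<xi>])
      (use assms in \<open>auto intro!: continuous_intros\<close>)
  then have "continuous_on {0..\<tau>\<^sub>1} (\<lambda>t. exp (\<xi> \<rho>\<^sub>1 t))"
    by (intro continuous_intros) simp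
  then have "\<exists>t0\<in>{0..\<tau>\<^sub>1}. \<forall>t\<in>{0..\<tau>\<^sub>1}. exp (\<xi> \<rho>\<^sub>1 t0) \<le> exp (\<xi> \<rho>\<^sub>1 t)"
    by (intro continuous_attains_inf) (use assms in auto)
  then obtain t0 where t0: "t0 \<in> {0..\<tau>\<^sub>1}" "\<And>t. t \<in> {0..\<tau>\<^sub>1} \<Longrightarrow> exp (\<xi> \<rho>\<^sub>1 t0) \<le> exp (\<xi> \<rho>\<^sub>1 t)"
    by blast
  then show ?thesis
    using \<xi>_nonpos[of \<rho>\<^sub>1 t0] assms by (intro exI[of _ "exp (\<xi> \<rho>\<^sub>1 t0)"]) auto
qed

lemma angle_estimate:
  assumes \<rho>\<^sub>1: "0 < \<rho>\<^sub>1" "\<rho>\<^sub>1 < \<rho>" and \<tau>\<^sub>1: "0 \<le> \<tau>\<^sub>1" "\<tau>\<^sub>1 < \<tau>"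
  obtains K where "0 < K" "\<And>r t. 0 < r \<Longrightarrow> r \<le> \<rho>\<^sub>1 \<Longrightarrow> 0 \<le> t \<Longrightarrow> t \<le> \<tau>\<^sub>1 \<Longrightarrow> \<bar>\<omega> r t\<bar> \<le> K * exp (\<kappa> * \<xi> r t)"
proof -
  obtain x where x: "0 < x" "x \<le> 1" "\<And>t. 0 \<le> t \<Longrightarrow> t \<le> \<tau>\<^sub>1 \<Longrightarrow> x \<le> exp (\<xi> \<rho>\<^sub>1 t)"
    using z_lower_bound[OF \<rho>\<^sub>1 \<tau>\<^sub>1] by (meson atLeastAtMost_iff)
  define c0 where "c0 = (2 * b - \<kappa>) * (b + \<kappa>)"
  have c0: "c0 > 0" using \<kappa> b by (simp add: c0_def)
  \<comment> \<open>One summand for each requirement: 10 M / c0 for the contact inequality, C for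
    the initial time, \<open>\<eta> / x\<close> for the lateral side.\<close>
  define K where "K = 10 * M / c0 + C + \<eta> / x + 1"
  have "0 \<le> 10 * M / c0" "0 \<le> \<eta> / x" using c0 M \<eta> x by auto
  then have K: "10 * M / c0 < K" "C \<le> K" "\<eta> / x \<le> K" "0 < K"
    using C unfolding K_def by linarith+
  have Kc: "10 * M < K * c0" using K(1) c0 by (simp add: divide_less_eq)
  have X: "exp (\<xi> r t) \<le> exp (\<kappa> * \<xi> r t)" if "0 < r" "r < \<rho>" "0 \<le> t" "t < \<tau>" for r t
    using \<kappa> \<xi>_nonpos[OF that] mult_right_mono_neg[of \<kappa> 1 "\<xi> r t"] by auto
  have le: "\<sigma> * \<omega> r t < K * exp (\<kappa> * \<xi> r t) + \<delta>"
    if \<sigma>: "\<sigma> = 1 \<or> \<sigma> = -1" and \<delta>: "0 < \<delta>" and rt: "0 < r" "r \<le> \<rho>\<^sub>1" "0 \<le> t" "t \<le> \<tau>\<^sub>1" for \<sigma> \<delta> r t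
  proof -
    define f where "f = (\<lambda>r t. \<sigma> * \<omega> r t + (- K * exp (\<kappa> * \<xi> r t) + - \<delta>))"
    obtain \<rho>' where \<rho>': "\<rho>' > 0"
      "\<And>r t. 0 < r \<Longrightarrow> r < \<rho>' \<Longrightarrow> r < \<rho> \<Longrightarrow> 0 \<le> t \<Longrightarrow> t < \<tau> \<Longrightarrow> \<bar>\<omega> r t\<bar> < \<delta>"
      using \<omega>_tip[OF \<delta>] by blast
    have \<sigma>\<omega>: "\<sigma> * \<omega> r t \<le> \<bar>\<omega> r t\<bar>" for r t using \<sigma> by auto
    have KX: "0 < K * exp (\<kappa> * \<xi> r t)" for r t using K by simp
    have "f r t < 0"
    proof (rule maximum_principle[where f = f and \<rho> = \<rho>\<^sub>1 and \<tau> = \<tau>\<^sub>1 and \<eta> = \<rho>'])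
      have sub: "{0<..\<rho>\<^sub>1} \<times> {0..\<tau>\<^sub>1} \<subseteq> {0<..<\<rho>} \<times> {0..<\<tau>}"
        using \<rho>\<^sub>1 \<tau>\<^sub>1 by auto
      show "continuous_on ({0<..\<rho>\<^sub>1} \<times> {0..\<tau>\<^sub>1}) (\<lambda>x. f (fst x) (snd x))"
        unfolding f_def
        by (intro continuous_intros continuous_on_subset[OF continuous_\<omega> sub]
            continuous_on_subset[OF continuous_\<xi> sub])
      show "f r 0 < 0" if "0 < r" "r \<le> \<rho>\<^sub>1" for r
      proof -
        have r: "0 < r" "r < \<rho>" and t: "(0::real) \<le> 0" "0 < \<tau>" using that \<rho>\<^sub>1 \<tau>\<^sub>1 by auto
        have "\<bar>\<omega> r 0\<bar> \<le> C * exp (\<xi> r 0)"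
          using \<omega>_initial[OF r] by (simp add: norm_z_eq[OF r t])
        also have "\<dots> \<le> K * exp (\<kappa> * \<xi> r 0)"
          using X[OF r t] K C by (intro mult_mono) auto
        finally show ?thesis using \<sigma>\<omega>[of r 0] \<delta> unfolding f_def by linarith
      qed
      show "f \<rho>\<^sub>1 t < 0" if "0 \<le> t" "t \<le> \<tau>\<^sub>1" for t
      proof -
        have t: "0 \<le> t" "t < \<tau>" using that \<tau>\<^sub>1 by auto
        have "\<bar>\<omega> \<rho>\<^sub>1 t\<bar> \<le> (\<eta> / x) * x"
          using \<omega>_bound[OF \<rho>\<^sub>1 t] x by simp
        also have "\<dots> \<le> K * exp (\<kappa> * \<xi> \<rho>\<^sub>1 t)"
          using order_trans[OF x(3)[OF that] X[OF \<rho>\<^sub>1 t]] K x(1) by (intro mult_mono) auto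
        finally show ?thesis using \<sigma>\<omega>[of \<rho>\<^sub>1 t] \<delta> unfolding f_def by linarith
      qed
      show "f r t < 0" if "0 < r" "r < \<rho>'" "r \<le> \<rho>\<^sub>1" "0 \<le> t" "t \<le> \<tau>\<^sub>1" for r t
        using \<rho>'(2)[of r t] that \<rho>\<^sub>1 \<tau>\<^sub>1 \<sigma>\<omega>[of r t] KX[of r t] unfolding f_def by auto
      show "\<exists>a e d l. e \<noteq> 0 \<and> jet a e f r t d l \<and> l < 0"
        if "0 < r" "r < \<rho>\<^sub>1" "0 < t" "t \<le> \<tau>\<^sub>1" "f r t = 0" for r t
        unfolding f_def
        by (rule angle_contact[OF _ _ _ _ \<sigma> Kc[unfolded c0_def] \<delta> K(4)])
          (use that \<rho>\<^sub>1 \<tau>\<^sub>1 in \<open>auto simp: f_def\<close>)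
    qed (use rt \<rho>' in auto)
    then show ?thesis by (simp add: f_def)
  qed
  show thesis
  proof (rule that[OF K(4)])
    fix r t assume rt: "0 < r" "r \<le> \<rho>\<^sub>1" "0 \<le> t" "t \<le> \<tau>\<^sub>1"
    show "\<bar>\<omega> r t\<bar> \<le> K * exp (\<kappa> * \<xi> r t)"
    proof (rule field_le_epsilon)
      fix \<delta> :: real assume "0 < \<delta>"
      then show "\<bar>\<omega> r t\<bar> \<le> K * exp (\<kappa> * \<xi> r t) + \<delta>"
        using le[of 1 \<delta> r t] le[of "-1" \<delta> r t] rt by (simp add: abs_le_iff less_imp_le)
    qed
  qed
qed

section \<open>The barrier for the curvature\<close>

lemma abs_exponent_jet:
  assumes r: "0 < r" "r < \<rho>" and t: "0 \<le> t" "t < \<tau>" and p: "\<bar>p\<bar> \<le> 2"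
  shows "\<bar>p * Re (G r t * (q r t)\<^sup>2) - (p * Re (q r t))\<^sup>2\<bar> \<le> 8 * (norm (q r t))\<^sup>2"
proof -
  have "norm (G r t) \<le> 2"
    using norm_triangle_ineq[of "of_real b" "H (z r t) * z r t"] norm_Hz[OF r t] Mz[OF r t] \<eta> b
    by (simp add: G_def)
  then have "norm (G r t) * (norm (q r t))\<^sup>2 \<le> 2 * (norm (q r t))\<^sup>2"
    by (rule mult_right_mono) simp
  then have "\<bar>Re (G r t * (q r t)\<^sup>2)\<bar> \<le> 2 * (norm (q r t))\<^sup>2"
    using abs_Re_le_cmod[of "G r t * (q r t)\<^sup>2"] unfolding norm_mult norm_power by linarith
  then have "\<bar>p\<bar> * \<bar>Re (G r t * (q r t)\<^sup>2)\<bar> \<le> 2 * (2 * (norm (q r t))\<^sup>2)"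
    using p by (intro mult_mono) auto
  moreover have "(p * Re (q r t))\<^sup>2 \<le> 4 * (norm (q r t))\<^sup>2"
  proof -
    have "\<bar>p\<bar>\<^sup>2 * (Re (q r t))\<^sup>2 \<le> 2\<^sup>2 * (norm (q r t))\<^sup>2"
    proof (rule mult_mono)
      show "\<bar>p\<bar>\<^sup>2 \<le> 2\<^sup>2" using p by (intro power_mono) auto
    qed (auto simp: cmod_power2)
    then show ?thesis by (simp add: power_mult_distrib)
  qed
  moreover have "0 \<le> (p * Re (q r t))\<^sup>2" by simp
  ultimately show ?thesis unfolding abs_mult[symmetric] by linarith
qed

text \<open>The jet rules give the evolution of \<open>Z\<close>, and
  \<open>curvature_barrier_inequality\<close> gives its sign. N is chosen to dominate K1^2, (K1 +
  M)^2 and K1 (2 K1 + 5 M), which come from the angle, from the difference between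
  \<open>\<omega>_s\<close> and k, and from the angle times its reaction; \<open>exp (2 * M)\<close>
  bounds e^(-2 h) in |q|^2.\<close>

lemma curvature_contact:
  fixes \<Lambda> \<delta> K K1 N :: real
  defines "Z \<equiv> \<lambda>r t. k r t * k r t * (1 + 8 * (\<omega> r t * \<omega> r t))
      + (\<Lambda> * (exp (- 2 * b * \<xi> r t) * (\<omega> r t * \<omega> r t))
      + (- K * exp ((2 * \<kappa> - 2 * b) * \<xi> r t) + - \<delta> * exp (- 2 * \<xi> r t)))"
  assumes r: "0 < r" "r < \<rho>" and t: "0 < t" "t < \<tau>"
    and \<omega>: "\<bar>\<omega> r t\<bar> \<le> K1 * exp (\<kappa> * \<xi> r t)" and "0 < K1" "0 < \<delta>"
    and N: "N = 2 * (K1 + 5 * M)\<^sup>2"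
    and \<Lambda>: "\<Lambda> \<ge> 5 * M * exp (2 * M) + 16 * N * exp (2 * M) + 16 * exp (2 * M)"
    and K: "K \<ge> 3 * \<Lambda> * N + 100000 * N * exp (2 * M)"
    and contact: "Z r t = 0"
  shows "\<exists>a e d l. e \<noteq> 0 \<and> jet a e Z r t d l \<and> l < 0"
proof -
  have t': "0 \<le> t" using t by simp
  note rt = r t' t(2)
  define m where "m = (norm (q r t))\<^sup>2"
  define E where "E = exp (- 2 * b * \<xi> r t)"
  define X where "X = exp (2 * \<kappa> * \<xi> r t)"
  define Y where "Y = exp (- 2 * \<xi> r t)"
  define y where "y = \<omega> r t"
  define Ly where "Ly = Im ((U r t - (G r t)\<^sup>2) * (q r t)\<^sup>2)"
  define ys where "ys = k r t - Im (G r t * q r t)"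
  define jt where "jt p = p * Re (G r t * (q r t)\<^sup>2) - (p * Re (q r t))\<^sup>2" for p
  obtain ks where jk: "jet (drift r t) (ell r t) k r t ks (k r t ^ 3 - 2 * k r t * (W r t * m))"
    using jet_k[OF t r] unfolding m_def by blast
  define Lk where "Lk = k r t ^ 3 - 2 * k r t * (W r t * m)"
  have jy: "jet (drift r t) (ell r t) \<omega> r t ys Ly"
    unfolding ys_def Ly_def by (rule jet_\<omega>[OF t r])
  have jexp: "jet (drift r t) (ell r t) (\<lambda>r t. exp (p * \<xi> r t)) r t
      (exp (p * \<xi> r t) * (p * Re (q r t))) (exp (p * \<xi> r t) * jt p)" for p
    unfolding jt_def by (intro jet_exp jet_cmult jet_\<xi>[OF t r])
  \<comment> \<open>E X = |z|^(2 \<open>\<kappa>\<close> - 2 b) is the square of the desired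
    curvature bound.\<close>
  have EX: "exp ((2 * \<kappa> - 2 * b) * \<xi> r t) = E * X"
    unfolding E_def X_def exp_add[symmetric] by (simp add: algebra_simps)
  define Es where "Es = E * (- 2 * b * Re (q r t))"
  have jet: "jet (drift r t) (ell r t) Z r t
      ((ks * k r t + k r t * ks) * (1 + 8 * (\<omega> r t * \<omega> r t))
        + k r t * k r t * (0 + 8 * (ys * y + y * ys))
      + (\<Lambda> * (Es * (y * y) + E * (ys * y + y * ys))
      + (- K * (E * X * ((2 * \<kappa> - 2 * b) * Re (q r t))) + - \<delta> * (Y * (- 2 * Re (q r t))))))
      ((Lk * k r t + k r t * Lk - 2 * ks * ks) * (1 + 8 * (\<omega> r t * \<omega> r t))
        + k r t * k r t * (0 + 8 * (Ly * y + y * Ly - 2 * ys * ys))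
        - 2 * (ks * k r t + k r t * ks) * (0 + 8 * (ys * y + y * ys))
      + (\<Lambda> * (E * jt (- 2 * b) * (y * y) + E * (Ly * y + y * Ly - 2 * ys * ys) - 2 * Es * (ys * y + y * ys))
      + (- K * (E * X * jt (2 * \<kappa> - 2 * b)) + - \<delta> * (Y * jt (- 2)))))"
  proof -
    note jyy = jet_mult[OF jy jy, folded y_def]
    note jE = jexp[of "- 2 * b", folded E_def, folded Es_def]
    show ?thesis
      unfolding Z_def
      by (intro jet_add jet_cmult jet_const jyy jet_mult[OF jk jk, folded Lk_def]
          jet_mult[OF jE jyy, folded E_def y_def] jexp[of "- 2", folded Y_def] jexp[of "2 * \<kappa> - 2 * b", unfolded EX]
          jet_mult[OF jet_mult[OF jk jk, folded Lk_def] jet_add[OF jet_const jet_cmult[OF jyy]]])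
  qed
  have "0 \<le> K1 * M" "0 \<le> K1 * K1" using \<open>0 < K1\<close> M by simp_all
  moreover have "1 \<le> M * M" using M mult_mono[of 1 M 1 M] by simp
  moreover have "N = 2 * (K1 * K1) + 20 * (K1 * M) + 50 * (M * M)"
    "K1 * (2 * K1 + 5 * M) = 2 * (K1 * K1) + 5 * (K1 * M)"
    "(K1 + M)\<^sup>2 = K1 * K1 + 2 * (K1 * M) + M * M" "K1\<^sup>2 = K1 * K1"
    unfolding N by (simp_all add: power2_eq_square algebra_simps)
  ultimately have K1M: "K1 * (2 * K1 + 5 * M) \<le> N" "(K1 + M)\<^sup>2 \<le> N" "K1\<^sup>2 \<le> N" "1 \<le> N"
    by linarith+
  have X2: "exp (\<kappa> * \<xi> r t) * exp (\<kappa> * \<xi> r t) = X"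
    unfolding X_def exp_add[symmetric] by (simp add: algebra_simps)
  have Xk: "exp (\<xi> r t) \<le> exp (\<kappa> * \<xi> r t)"
    using \<kappa> \<xi>_nonpos[OF rt] mult_right_mono_neg[of \<kappa> 1 "\<xi> r t"] by auto
  have m0: "0 \<le> m" by (simp add: m_def)
  have y2: "y\<^sup>2 \<le> N * X"
  proof -
    have "\<bar>y\<bar>\<^sup>2 \<le> (K1 * exp (\<kappa> * \<xi> r t))\<^sup>2"
      using \<omega> by (intro power_mono) (auto simp: y_def)
    also have "\<dots> = K1\<^sup>2 * X" by (simp add: power2_eq_square flip: X2)
    also have "\<dots> \<le> N * X" using K1M by (intro mult_right_mono) (auto simp: X_def)
    finally show ?thesis by simp
  qed
  have sin_le: "\<bar>sin v\<bar> \<le> \<bar>v\<bar>" for v :: real by (rule abs_sin_x_le_abs_x)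
  have Ly_le: "\<bar>y * Ly\<bar> \<le> N * m * X"
  proof -
    have "\<bar>b\<^sup>2 * (m * sin (2 * y))\<bar> \<le> 1 * (m * (2 * \<bar>y\<bar>))"
      unfolding abs_mult using b m0 sin_le[of "2 * y"] by (intro mult_mono) (auto simp: power_le_one)
    also have "\<dots> \<le> m * (2 * (K1 * exp (\<kappa> * \<xi> r t)))"
    proof -
      have "2 * \<bar>y\<bar> \<le> 2 * (K1 * exp (\<kappa> * \<xi> r t))" using \<omega> by (simp add: y_def)
      from mult_left_mono[OF this m0] show ?thesis by simp
    qed
    finally have 1: "\<bar>b\<^sup>2 * (m * sin (2 * y))\<bar> \<le> m * (2 * (K1 * exp (\<kappa> * \<xi> r t)))" .
    have "5 * M * exp (\<xi> r t) * m \<le> 5 * M * exp (\<kappa> * \<xi> r t) * m"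
      using Xk M m0 by (intro mult_right_mono mult_left_mono) auto
    then have "\<bar>Ly\<bar> \<le> m * (2 * (K1 * exp (\<kappa> * \<xi> r t))) + 5 * M * exp (\<kappa> * \<xi> r t) * m"
      using 1 angle_reaction[OF rt, folded Ly_def m_def y_def] by linarith
    also have "\<dots> = m * ((2 * K1 + 5 * M) * exp (\<kappa> * \<xi> r t))" by (simp add: algebra_simps)
    finally have "\<bar>y\<bar> * \<bar>Ly\<bar> \<le> (K1 * exp (\<kappa> * \<xi> r t)) * (m * ((2 * K1 + 5 * M) * exp (\<kappa> * \<xi> r t)))"
      using \<omega> \<open>0 < K1\<close> by (intro mult_mono) (auto simp: y_def)
    also have "\<dots> = K1 * (2 * K1 + 5 * M) * (m * X)" by (simp add: algebra_simps flip: X2)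
    also have "\<dots> \<le> N * (m * X)" using K1M m0 by (intro mult_right_mono) (auto simp: X_def)
    finally show ?thesis by (simp add: abs_mult mult.assoc)
  qed
  \<comment> \<open>The difference is - Im (G q). Its part b Im q is small because |Im q| = |q| |sin
    \<open>\<omega>\<close>|, and its part with H z because |z| \<le>
    |z|^\<open>\<kappa>\<close>.\<close>
  have ys_le: "(ys - k r t)\<^sup>2 \<le> N * m * X"
  proof -
    have "G r t * q r t = of_real b * q r t + H (z r t) * z r t * q r t"
      by (simp add: G_def distrib_right)
    then have "Im (G r t * q r t) = b * Im (q r t) + Im (H (z r t) * z r t * q r t)"
      by (simp only: plus_complex.sel Im_complex_of_real Re_complex_of_real times_complex.sel(2)[of "of_real b"] mult_zero_left add_0_right)
    moreover have "\<bar>b * Im (q r t)\<bar> \<le> 1 * (norm (q r t) * \<bar>y\<bar>)"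
      unfolding abs_mult
    proof (intro mult_mono)
      show "\<bar>Im (q r t)\<bar> \<le> norm (q r t) * \<bar>y\<bar>"
        by (subst q_polar[OF rt]) (use sin_le[of y] in \<open>auto simp: y_def abs_mult intro: mult_left_mono\<close>)
    qed (use b in auto)
    moreover have "norm (q r t) * \<bar>y\<bar> \<le> norm (q r t) * (K1 * exp (\<kappa> * \<xi> r t))"
      using \<omega> by (auto simp: y_def intro: mult_left_mono)
    moreover have "\<bar>Im (H (z r t) * z r t * q r t)\<bar> \<le> norm (q r t) * (M * exp (\<kappa> * \<xi> r t))"
    proof -
      have "norm (H (z r t) * z r t) * norm (q r t) \<le> (M * exp (\<kappa> * \<xi> r t)) * norm (q r t)"
        using order_trans[OF norm_Hz[OF rt] mult_left_mono[OF Xk]] M by (intro mult_right_mono) auto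
      then show ?thesis
        using abs_Im_le_cmod[of "H (z r t) * z r t * q r t"]
        by (simp only: norm_mult[of "H (z r t) * z r t"] mult.commute[of "norm (q r t)"]) 
    qed
    ultimately have "\<bar>Im (G r t * q r t)\<bar>
        \<le> norm (q r t) * (K1 * exp (\<kappa> * \<xi> r t)) + norm (q r t) * (M * exp (\<kappa> * \<xi> r t))"
      by linarith
    also have "\<dots> = norm (q r t) * ((K1 + M) * exp (\<kappa> * \<xi> r t))" by (simp add: algebra_simps)
    finally have "\<bar>Im (G r t * q r t)\<bar>\<^sup>2 \<le> (norm (q r t) * ((K1 + M) * exp (\<kappa> * \<xi> r t)))\<^sup>2"
      by (rule power_mono) simp
    also have "\<dots> = (K1 + M)\<^sup>2 * (m * X)"
      by (simp add: m_def power_mult_distrib power2_eq_square flip: X2)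
    also have "\<dots> \<le> N * (m * X)" using K1M m0 by (intro mult_right_mono) (auto simp: X_def)
    finally have "\<bar>Im (G r t * q r t)\<bar>\<^sup>2 \<le> N * (m * X)" .
    moreover have "(ys - k r t)\<^sup>2 = \<bar>Im (G r t * q r t)\<bar>\<^sup>2"
      by (simp add: ys_def del: times_complex.sel)
    ultimately show ?thesis by (simp only: mult.assoc)
  qed
  have jt_le: "\<bar>jt p\<bar> \<le> 8 * m" if "\<bar>p\<bar> \<le> 2" for p
    unfolding jt_def m_def by (rule abs_exponent_jet[OF rt that])
  have jt_le': "\<bar>c * jt p\<bar> \<le> 8 * m * c" if "\<bar>p\<bar> \<le> 2" "0 \<le> c" for p c
    using mult_left_mono[OF jt_le[OF that(1)] that(2)] that(2) by (simp add: abs_mult mult_ac)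
  have "(2 * k r t * Lk - 2 * ks\<^sup>2) * (1 + 8 * y\<^sup>2) + (k r t)\<^sup>2 * (8 * (2 * y * Ly - 2 * ys\<^sup>2))
    - 2 * (2 * k r t * ks) * (16 * y * ys)
    + \<Lambda> * (E * jt (- 2 * b) * y\<^sup>2 + E * (2 * y * Ly - 2 * ys\<^sup>2) - 2 * Es * (2 * y * ys))
    - K * (E * X * jt (2 * \<kappa> - 2 * b)) - \<delta> * (Y * jt (- 2)) < 0"
    (is "?short < 0")
  proof (rule curvature_barrier_inequality[where M = M and m = m and N = N and c = "exp (2 * M)"])
    show "Lk = k r t ^ 3 - 2 * k r t * (W r t * m)" by (simp add: Lk_def)
    show "\<bar>W r t * m\<bar> \<le> M * m"
      using abs_W[OF rt] m0 by (simp add: abs_mult mult_right_mono)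
    show "\<bar>y\<bar> \<le> 1/100" using \<omega>_bound[OF rt] \<eta> by (simp add: y_def)
    show "m \<le> exp (2 * M) * E" unfolding m_def E_def by (rule norm_q_sq_le[OF rt])
    show "X \<le> 1" using \<kappa> \<xi>_nonpos[OF rt] by (simp add: X_def mult_nonneg_nonpos)
    show "\<bar>E * jt (- 2 * b)\<bar> \<le> 8 * m * E" "\<bar>E * X * jt (2 * \<kappa> - 2 * b)\<bar> \<le> 8 * m * (E * X)"
      "\<bar>Y * jt (- 2)\<bar> \<le> 8 * m * Y"
      using b \<kappa> by (intro jt_le'; simp add: E_def X_def Y_def)+
    have "Es\<^sup>2 = 4 * E\<^sup>2 * (b\<^sup>2 * (Re (q r t))\<^sup>2)"
      by (simp add: Es_def power_mult_distrib)
    also have "\<dots> \<le> 4 * E\<^sup>2 * (1 * m)"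
      using b by (intro mult_left_mono mult_mono) (auto simp: m_def cmod_power2 power_le_one)
    finally show "Es\<^sup>2 \<le> 4 * E\<^sup>2 * m" by simp
    show "(k r t)\<^sup>2 * (1 + 8 * y\<^sup>2) + \<Lambda> * (E * y\<^sup>2) = K * (E * X) + \<delta> * Y"
      using contact unfolding Z_def EX E_def[symmetric] Y_def[symmetric] y_def[symmetric]
      by (simp add: power2_eq_square)
  qed (use y2 Ly_le ys_le m0 M K1M \<Lambda> K \<open>0 < \<delta>\<close> in \<open>simp_all add: E_def X_def Y_def\<close>)
  moreover have "(Lk * k r t + k r t * Lk - 2 * ks * ks) * (1 + 8 * (\<omega> r t * \<omega> r t))
        + k r t * k r t * (0 + 8 * (Ly * y + y * Ly - 2 * ys * ys))
        - 2 * (ks * k r t + k r t * ks) * (0 + 8 * (ys * y + y * ys))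
      + (\<Lambda> * (E * jt (- 2 * b) * (y * y) + E * (Ly * y + y * Ly - 2 * ys * ys) - 2 * Es * (ys * y + y * ys))
      + (- K * (E * X * jt (2 * \<kappa> - 2 * b)) + - \<delta> * (Y * jt (- 2)))) = ?short"
    (is "?long = _")
  proof -
    have "Lk * k r t + k r t * Lk - 2 * ks * ks = 2 * k r t * Lk - 2 * ks\<^sup>2"
      "Ly * y + y * Ly - 2 * ys * ys = 2 * y * Ly - 2 * ys\<^sup>2"
      "2 * (ks * k r t + k r t * ks) * (0 + 8 * (ys * y + y * ys)) = 2 * (2 * k r t * ks) * (16 * y * ys)"
      "2 * Es * (ys * y + y * ys) = 2 * Es * (2 * y * ys)"
      "\<omega> r t * \<omega> r t = y\<^sup>2" "y * y = y\<^sup>2" "k r t * k r t = (k r t)\<^sup>2"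
      by (simp_all add: power2_eq_square y_def algebra_simps)
    then show ?thesis
      by (simp only: add_0_left mult_minus_left add.assoc diff_conv_add_uminus)
  qed
  ultimately have "?long < 0" by (simp only:)
  moreover have "ell r t \<noteq> 0" using ell_pos[of r t] by simp
  ultimately show ?thesis using jet by blast
qed

text \<open>For every \<open>\<delta>\<close> the function Z of \<open>curvature_contact\<close>
  stays negative. As \<open>\<Lambda>\<close> and \<open>K\<close> do not depend on
  \<open>\<delta>\<close>, the limit leaves k^2 \<le> K |z|^(2 \<open>\<kappa>\<close> - 2
  b).\<close>

lemma curvature_estimate:
  assumes \<rho>\<^sub>1: "0 < \<rho>\<^sub>1" "\<rho>\<^sub>1 < \<rho>" and \<tau>\<^sub>1: "0 \<le> \<tau>\<^sub>1" "\<tau>\<^sub>1 < \<tau>"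
  shows "\<exists>K>0. \<forall>r t. 0 < r \<and> r \<le> \<rho>\<^sub>1 \<and> 0 \<le> t \<and> t \<le> \<tau>\<^sub>1 \<longrightarrow>
    \<bar>k r t\<bar> \<le> K * norm (z r t) powr (\<kappa> - b)"
proof -
  obtain K1 where K1: "0 < K1"
    "\<And>r t. 0 < r \<Longrightarrow> r \<le> \<rho>\<^sub>1 \<Longrightarrow> 0 \<le> t \<Longrightarrow> t \<le> \<tau>\<^sub>1 \<Longrightarrow> \<bar>\<omega> r t\<bar> \<le> K1 * exp (\<kappa> * \<xi> r t)"
    by (rule angle_estimate[OF \<rho>\<^sub>1 \<tau>\<^sub>1]) blast
  obtain x where x: "0 < x" "x \<le> 1" "\<And>t. 0 \<le> t \<Longrightarrow> t \<le> \<tau>\<^sub>1 \<Longrightarrow> x \<le> exp (\<xi> \<rho>\<^sub>1 t)"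
    using z_lower_bound[OF \<rho>\<^sub>1 \<tau>\<^sub>1] by (meson atLeastAtMost_iff)
  define N where "N = 2 * (K1 + 5 * M)\<^sup>2"
  define \<Lambda> where "\<Lambda> = 5 * M * exp (2 * M) + 16 * N * exp (2 * M) + 16 * exp (2 * M)"
  \<comment> \<open>The first two summands serve the contact inequality,
    \<open>\<Lambda> * K1\<^sup>2\<close> outweighs the angle term of Z,
    \<open>2 * C\<^sup>2 / x ^ 4\<close> serves the lateral side and \<open>2 * C\<^sup>2\<close>
    the initial time.\<close>
  define K where "K = 3 * \<Lambda> * N + 100000 * N * exp (2 * M) + \<Lambda> * K1\<^sup>2 + 2 * C\<^sup>2 / x ^ 4 + 2 * C\<^sup>2 + 1"
  have N0: "0 \<le> N" by (simp add: N_def)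
  then have \<Lambda>0: "0 \<le> \<Lambda>" using M by (simp add: \<Lambda>_def)
  have "0 \<le> \<Lambda> * N" "0 \<le> N * exp (2 * M)" "0 \<le> \<Lambda> * K1\<^sup>2" "0 \<le> C\<^sup>2 / x ^ 4" "0 \<le> C\<^sup>2"
    using N0 \<Lambda>0 x by simp_all
  then have K: "K \<ge> 3 * \<Lambda> * N + 100000 * N * exp (2 * M)" "2 * C\<^sup>2 + \<Lambda> * K1\<^sup>2 \<le> K"
    "2 * C\<^sup>2 / x ^ 4 + \<Lambda> * K1\<^sup>2 \<le> K" "\<Lambda> * K1\<^sup>2 \<le> K" "0 < K"
    unfolding K_def by linarith+
  have dom: "0 < r \<and> r < \<rho> \<and> 0 \<le> t \<and> t < \<tau>" if "0 < r" "r \<le> \<rho>\<^sub>1" "0 \<le> t" "t \<le> \<tau>\<^sub>1" for r t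
    using that \<rho>\<^sub>1 \<tau>\<^sub>1 by auto
  define S where "S r t = exp ((2 * \<kappa> - 2 * b) * \<xi> r t)" for r t
  have S0: "0 < S r t" for r t by (simp add: S_def)
  have bound: "k r t * k r t * (1 + 8 * (\<omega> r t * \<omega> r t))
      + (\<Lambda> * (exp (- 2 * b * \<xi> r t) * (\<omega> r t * \<omega> r t)) + (- K * S r t + - \<delta> * exp (- 2 * \<xi> r t)))
    \<le> 2 * (k r t)\<^sup>2 + (\<Lambda> * K1\<^sup>2 - K) * S r t - \<delta> * exp (- 2 * \<xi> r t)"
    if rt: "0 < r" "r \<le> \<rho>\<^sub>1" "0 \<le> t" "t \<le> \<tau>\<^sub>1" for r t \<delta>
  proof -
    have "\<bar>\<omega> r t\<bar> \<le> 1/100" using \<omega>_bound[of r t] dom[OF rt] \<eta> by auto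
    then have "\<bar>\<omega> r t\<bar> * \<bar>\<omega> r t\<bar> \<le> (1/100) * (1/100)" by (intro mult_mono) auto
    then have "1 + 8 * (\<omega> r t * \<omega> r t) \<le> 2" by simp
    from mult_left_mono[OF this, of "k r t * k r t"]
    have 1: "k r t * k r t * (1 + 8 * (\<omega> r t * \<omega> r t)) \<le> 2 * (k r t)\<^sup>2"
      by (simp add: power2_eq_square mult.commute)
    have "\<bar>\<omega> r t\<bar> * \<bar>\<omega> r t\<bar> \<le> (K1 * exp (\<kappa> * \<xi> r t)) * (K1 * exp (\<kappa> * \<xi> r t))"
      using K1(2)[OF rt] K1(1) by (intro mult_mono) auto
    then have "exp (- 2 * b * \<xi> r t) * (\<omega> r t * \<omega> r t)
        \<le> exp (- 2 * b * \<xi> r t) * ((K1 * exp (\<kappa> * \<xi> r t)) * (K1 * exp (\<kappa> * \<xi> r t)))"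
      by (intro mult_left_mono) auto
    also have "\<dots> = K1\<^sup>2 * (exp (- 2 * b * \<xi> r t) * exp (\<kappa> * \<xi> r t) * exp (\<kappa> * \<xi> r t))"
      by (simp add: power2_eq_square)
    also have "exp (- 2 * b * \<xi> r t) * exp (\<kappa> * \<xi> r t) * exp (\<kappa> * \<xi> r t) = S r t"
      unfolding S_def exp_add[symmetric] by (simp add: algebra_simps)
    finally have "\<Lambda> * (exp (- 2 * b * \<xi> r t) * (\<omega> r t * \<omega> r t)) \<le> \<Lambda> * (K1\<^sup>2 * S r t)"
      using \<Lambda>0 by (rule mult_left_mono)
    with 1 show ?thesis by (simp add: left_diff_distrib mult.assoc)
  qed
  have k_sq: "2 * (k r t)\<^sup>2 \<le> 2 * C\<^sup>2 * exp ((2 * b - 2) * \<xi> r t)"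
    if rt: "0 < r" "r \<le> \<rho>\<^sub>1" "0 \<le> t" "t \<le> \<tau>\<^sub>1" for r t
  proof -
    have "\<bar>k r t\<bar>\<^sup>2 \<le> (C * norm (z r t) powr (b - 1))\<^sup>2"
      using k_bound[of r t] dom[OF rt] by (intro power_mono) auto
    also have "\<dots> = C\<^sup>2 * exp ((2 * b - 2) * \<xi> r t)"
      using norm_z_eq[of r t] dom[OF rt]
      by (simp add: powr_def power2_eq_square algebra_simps flip: exp_add)
    finally show ?thesis by simp
  qed
  have *: "(k r t)\<^sup>2 < K * S r t + \<delta> * exp (- 2 * \<xi> r t)"
    if \<delta>: "0 < \<delta>" and rt: "0 < r" "r \<le> \<rho>\<^sub>1" "0 \<le> t" "t \<le> \<tau>\<^sub>1" for \<delta> r t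
  proof -
    define Z where "Z = (\<lambda>r t. k r t * k r t * (1 + 8 * (\<omega> r t * \<omega> r t))
      + (\<Lambda> * (exp (- 2 * b * \<xi> r t) * (\<omega> r t * \<omega> r t))
      + (- K * exp ((2 * \<kappa> - 2 * b) * \<xi> r t) + - \<delta> * exp (- 2 * \<xi> r t))))"
    have Z_le: "Z r t \<le> 2 * (k r t)\<^sup>2 + (\<Lambda> * K1\<^sup>2 - K) * S r t - \<delta> * exp (- 2 * \<xi> r t)"
      if rt: "0 < r" "r \<le> \<rho>\<^sub>1" "0 \<le> t" "t \<le> \<tau>\<^sub>1" for r t
      using bound[OF rt, of \<delta>] by (simp add: Z_def S_def)
    \<comment> \<open>For |z| < e one has 2 C^2 |z|^(2 b - 2) < \<open>\<delta>\<close> |z|^(-2), so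
      near the vertex the crude bound on k already makes Z negative. As |z| \<le> C r, this holds
      for r < e / C.\<close>
    define e where "e = (\<delta> / (2 * C\<^sup>2)) powr (1 / (2 * b))"
    have e0: "0 < e" using \<delta> C by (simp add: e_def)
    have "Z r t < 0"
    proof (rule maximum_principle[where f = Z and \<rho> = \<rho>\<^sub>1 and \<tau> = \<tau>\<^sub>1 and \<eta> = "e / C"])
      have sub: "{0<..\<rho>\<^sub>1} \<times> {0..\<tau>\<^sub>1} \<subseteq> {0<..<\<rho>} \<times> {0..<\<tau>}"
        using \<rho>\<^sub>1 \<tau>\<^sub>1 by auto
      show "continuous_on ({0<..\<rho>\<^sub>1} \<times> {0..\<tau>\<^sub>1}) (\<lambda>x. Z (fst x) (snd x))"
        unfolding Z_def
        by (intro continuous_intros continuous_on_subset[OF continuous_\<omega> sub]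
            continuous_on_subset[OF continuous_\<xi> sub] continuous_on_subset[OF continuous_k sub])
      show "Z r 0 < 0" if "0 < r" "r \<le> \<rho>\<^sub>1" for r
      proof -
        have d: "0 < r" "r < \<rho>" "(0::real) \<le> 0" "0 < \<tau>" using that \<rho>\<^sub>1 \<tau>\<^sub>1 by auto
        have "\<bar>k r 0\<bar>\<^sup>2 \<le> (C * norm (z r 0) powr (1 - b))\<^sup>2"
          using k_initial[OF d(1,2)] by (intro power_mono) auto
        also have "\<dots> = C\<^sup>2 * exp ((2 - 2 * b) * \<xi> r 0)"
          using norm_z_eq[OF d]
          by (simp add: powr_def power2_eq_square algebra_simps flip: exp_add)
        \<comment> \<open>Here \<open>\<kappa>\<close> \<le> 1 enters: 2 - 2 b \<ge> 2
          \<open>\<kappa>\<close> - 2 b and |z| \<le> 1.\<close>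
        also have "\<dots> \<le> C\<^sup>2 * S r 0"
          using \<kappa> \<xi>_nonpos[OF d] by (auto simp: S_def intro!: mult_left_mono mult_right_mono_neg)
        finally have "2 * (k r 0)\<^sup>2 \<le> 2 * C\<^sup>2 * S r 0" by simp
        moreover have "(2 * C\<^sup>2 + \<Lambda> * K1\<^sup>2) * S r 0 \<le> K * S r 0"
          using K S0[of r 0] by (intro mult_right_mono) auto
        moreover have "0 < \<delta> * exp (- 2 * \<xi> r 0)" using \<delta> by simp
        ultimately show ?thesis
          using Z_le[of r 0] that \<tau>\<^sub>1 by (simp add: left_diff_distrib distrib_right)
      qed
      show "Z \<rho>\<^sub>1 t < 0" if t: "0 \<le> t" "t \<le> \<tau>\<^sub>1" for t
      proof -
        have d: "0 < \<rho>\<^sub>1" "\<rho>\<^sub>1 < \<rho>" "0 \<le> t" "t < \<tau>" using \<rho>\<^sub>1 \<tau>\<^sub>1 t by auto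
        \<comment> \<open>One factor x^2 \<le> |z|^2 turns the power 2 b - 2 into 2 b, which is at
          most 1; the other one is itself below |z|^2 and hence below S, because
          \<open>\<kappa>\<close> - b < 1.\<close>
        have "exp ((2 * b - 2) * \<xi> \<rho>\<^sub>1 t) * x\<^sup>2 * x\<^sup>2 \<le> S \<rho>\<^sub>1 t"
        proof -
          have "exp ((2 * b - 2) * \<xi> \<rho>\<^sub>1 t) * x\<^sup>2 \<le> exp ((2 * b - 2) * \<xi> \<rho>\<^sub>1 t) * (exp (\<xi> \<rho>\<^sub>1 t))\<^sup>2"
            using x(1) x(3)[OF t] by (intro mult_left_mono power_mono) auto
          also have "\<dots> = exp (2 * b * \<xi> \<rho>\<^sub>1 t)"
            by (simp add: power2_eq_square algebra_simps flip: exp_add)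
          also have "\<dots> \<le> 1" using b \<xi>_nonpos[OF d] by (simp add: mult_nonneg_nonpos)
          finally have "exp ((2 * b - 2) * \<xi> \<rho>\<^sub>1 t) * x\<^sup>2 * x\<^sup>2 \<le> 1 * x\<^sup>2"
            by (rule mult_right_mono) simp
          also have "\<dots> \<le> (exp (\<xi> \<rho>\<^sub>1 t))\<^sup>2"
            using x(1) x(3)[OF t] by (simp add: power_mono)
          also have "\<dots> = exp (2 * \<xi> \<rho>\<^sub>1 t)" by (simp add: power2_eq_square flip: exp_add)
          also have "\<dots> \<le> S \<rho>\<^sub>1 t"
            unfolding S_def using \<kappa> b \<xi>_nonpos[OF d] by (simp add: mult_right_mono_neg)
          finally show ?thesis .
        qed
        then have "exp ((2 * b - 2) * \<xi> \<rho>\<^sub>1 t) \<le> S \<rho>\<^sub>1 t / x ^ 4"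
          using x(1) by (simp add: pos_le_divide_eq mult.assoc flip: power_add)
        then have "2 * (k \<rho>\<^sub>1 t)\<^sup>2 \<le> 2 * C\<^sup>2 * (S \<rho>\<^sub>1 t / x ^ 4)"
          using k_sq[of \<rho>\<^sub>1 t] \<rho>\<^sub>1 t mult_left_mono[of "exp ((2 * b - 2) * \<xi> \<rho>\<^sub>1 t)" "S \<rho>\<^sub>1 t / x ^ 4" "2 * C\<^sup>2"]
          by auto
        moreover have "(2 * C\<^sup>2 / x ^ 4 + \<Lambda> * K1\<^sup>2) * S \<rho>\<^sub>1 t \<le> K * S \<rho>\<^sub>1 t"
          using K S0[of \<rho>\<^sub>1 t] by (intro mult_right_mono) auto
        moreover have "0 < \<delta> * exp (- 2 * \<xi> \<rho>\<^sub>1 t)" using \<delta> by simp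
        ultimately show ?thesis
          using Z_le[of \<rho>\<^sub>1 t] \<rho>\<^sub>1 t by (simp add: left_diff_distrib distrib_right)
      qed
      show "Z r t < 0" if rt: "0 < r" "r < e / C" "r \<le> \<rho>\<^sub>1" "0 \<le> t" "t \<le> \<tau>\<^sub>1" for r t
      proof -
        have d: "0 < r" "r < \<rho>" "0 \<le> t" "t < \<tau>" using dom[of r t] rt by auto
        have "exp (\<xi> r t) \<le> C * r" using z_linear[OF d] norm_z_eq[OF d] by simp
        also have "\<dots> < e" using rt C by (simp add: field_simps)
        finally have "exp (\<xi> r t) powr (2 * b) < e powr (2 * b)"
          using b by (intro powr_less_mono2) auto
        also have "\<dots> = \<delta> / (2 * C\<^sup>2)"
          using b \<delta> C by (simp add: e_def powr_powr)
        finally have "exp (2 * b * \<xi> r t) < \<delta> / (2 * C\<^sup>2)" by (simp add: powr_def)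
        then have "2 * C\<^sup>2 * exp (2 * b * \<xi> r t) < \<delta>" using C by (simp add: field_simps)
        then have "2 * C\<^sup>2 * exp (2 * b * \<xi> r t) * exp (- 2 * \<xi> r t) < \<delta> * exp (- 2 * \<xi> r t)"
          by simp
        moreover have "exp (2 * b * \<xi> r t) * exp (- 2 * \<xi> r t) = exp ((2 * b - 2) * \<xi> r t)"
          unfolding exp_add[symmetric] by (simp add: algebra_simps)
        ultimately have "2 * (k r t)\<^sup>2 < \<delta> * exp (- 2 * \<xi> r t)"
          using k_sq[OF rt(1,3-5)] by (simp only: mult.assoc)
        moreover have "(\<Lambda> * K1\<^sup>2 - K) * S r t \<le> 0"
          using K S0[of r t] by (intro mult_nonpos_nonneg) auto
        ultimately show ?thesis using Z_le[of r t] rt by simp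
      qed
      show "\<exists>a e d l. e \<noteq> 0 \<and> jet a e Z r t d l \<and> l < 0"
        if "0 < r" "r < \<rho>\<^sub>1" "0 < t" "t \<le> \<tau>\<^sub>1" "Z r t = 0" for r t
        unfolding Z_def
        by (rule curvature_contact[where ?K1.0 = K1 and N = N])
          (use that \<rho>\<^sub>1 \<tau>\<^sub>1 K1 \<delta> K(1) in \<open>auto simp: Z_def N_def \<Lambda>_def\<close>)
    qed (use rt e0 C in auto)
    moreover have "(k r t)\<^sup>2 \<le> k r t * k r t * (1 + 8 * (\<omega> r t * \<omega> r t))"
      using mult_left_mono[of 1 "1 + 8 * (\<omega> r t * \<omega> r t)" "k r t * k r t"] by (simp add: power2_eq_square)
    moreover have "0 \<le> \<Lambda> * (exp (- 2 * b * \<xi> r t) * (\<omega> r t * \<omega> r t))"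
      using \<Lambda>0 by simp
    ultimately show ?thesis by (simp add: Z_def S_def)
  qed
  show ?thesis
  proof (intro exI[of _ "sqrt K"] conjI allI impI)
    show "0 < sqrt K" using K by simp
    fix r t assume "0 < r \<and> r \<le> \<rho>\<^sub>1 \<and> 0 \<le> t \<and> t \<le> \<tau>\<^sub>1"
    then have rt: "0 < r" "r \<le> \<rho>\<^sub>1" "0 \<le> t" "t \<le> \<tau>\<^sub>1" by auto
    have "(k r t)\<^sup>2 \<le> K * S r t"
    proof (rule field_le_epsilon)
      fix e :: real assume "0 < e"
      then show "(k r t)\<^sup>2 \<le> K * S r t + e"
        using *[of "e / exp (- 2 * \<xi> r t)", OF _ rt] by (simp add: less_imp_le)
    qed
    also have "\<dots> = (sqrt K * exp ((\<kappa> - b) * \<xi> r t))\<^sup>2"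
      using K by (simp add: S_def power_mult_distrib power2_eq_square algebra_simps flip: exp_add)
    finally have "\<bar>k r t\<bar>\<^sup>2 \<le> (sqrt K * exp ((\<kappa> - b) * \<xi> r t))\<^sup>2" by simp
    then have "\<bar>k r t\<bar> \<le> sqrt K * exp ((\<kappa> - b) * \<xi> r t)"
      by (rule power2_le_imp_le) (use K in simp)
    then show "\<bar>k r t\<bar> \<le> sqrt K * norm (z r t) powr (\<kappa> - b)"
      using dom[OF rt] norm_z_eq[of r t] by (simp add: powr_def)
  qed
qed

end

section \<open>Curvature in conformal coordinates\<close>

text \<open>For a multiple \<rho> of the Euclidean metric the Koszul expression is, as a function of
  b, the inner product with a fixed vector whose last part is the gradient of \<rho>. Nondegeneracy
  makes that vector unique, so the description by \<open>THE\<close> takes this value.\<close>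

lemma levi_civita_conformal:
  fixes G :: "complex \<Rightarrow> complex \<Rightarrow> complex \<Rightarrow> real"
  assumes X: "open X" "p \<in> X" and G: "\<And>y u v. y \<in> X \<Longrightarrow> G y u v = \<rho> y * (u \<bullet> v)"
    and \<rho>: "(\<rho> has_derivative D) (at p)" "\<rho> p > 0"
  shows "levi_civita G p u v =
    (1 / (2 * \<rho> p)) *\<^sub>R (D u *\<^sub>R v + D v *\<^sub>R u - (u \<bullet> v) *\<^sub>R Complex (D 1) (D \<i>))"
    (is "_ = ?a")
proof -
  have lin: "linear D" using \<rho>(1) by (rule has_derivative_linear)
  have D: "D w = Complex (D 1) (D \<i>) \<bullet> w" for w
  proof -
    have "w = Re w *\<^sub>R 1 + Im w *\<^sub>R \<i>" by (simp add: complex_eq_iff)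
    then have "D w = Re w * D 1 + Im w * D \<i>"
      using linear_add[OF lin] linear_scale[OF lin] by (metis real_scaleR_def)
    then show ?thesis by (simp add: inner_complex_def mult.commute)
  qed
  have fd: "frechet_derivative (\<lambda>y. G y u v) (at p) w = D w * (u \<bullet> v)" for u v w
  proof -
    have "((\<lambda>y. \<rho> y * (u \<bullet> v)) has_derivative (\<lambda>w. D w * (u \<bullet> v))) (at p)"
      by (rule has_derivative_mult_left[OF \<rho>(1)])
    then have "((\<lambda>y. G y u v) has_derivative (\<lambda>w. D w * (u \<bullet> v))) (at p)"
      by (rule has_derivative_transform_within_open[OF _ X]) (simp add: G)
    then show ?thesis
      by (metis frechet_derivative_at)
  qed
  have char: "(\<forall>b. 2 * G p a b =
      frechet_derivative (\<lambda>y. G y v b) (at p) u +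
      frechet_derivative (\<lambda>y. G y u b) (at p) v -
      frechet_derivative (\<lambda>y. G y u v) (at p) b) \<longleftrightarrow> a = ?a" for a
  proof -
    have 1: "D u * (v \<bullet> b) + D v * (u \<bullet> b) - D b * (u \<bullet> v) = 2 * \<rho> p * (?a \<bullet> b)" for b
      using \<rho>(2) by (subst D[of b]) (simp add: inner_add_left inner_diff_left mult.commute)
    have "(\<forall>b. 2 * (\<rho> p * (a \<bullet> b)) = 2 * \<rho> p * (?a \<bullet> b)) \<longleftrightarrow> (\<forall>b. a \<bullet> b = ?a \<bullet> b)"
    proof -
      have "2 * (\<rho> p * \<alpha>) = 2 * \<rho> p * \<beta> \<longleftrightarrow> \<alpha> = \<beta>" for \<alpha> \<beta>
        using \<rho>(2) by simp
      then show ?thesis by (simp only:)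
    qed
    also have "\<dots> \<longleftrightarrow> a = ?a"
      by (metis vector_eq_rdot)
    finally show ?thesis
      unfolding fd G[OF X(2)] 1 .
  qed
  show ?thesis
    unfolding levi_civita_def char by simp
qed

context
  fixes G :: "complex \<Rightarrow> complex \<Rightarrow> complex \<Rightarrow> real" and x :: "real \<Rightarrow> complex"
    and \<rho> :: "complex \<Rightarrow> real" and X :: "complex set" and s :: real
  assumes X: "open X" "x s \<in> X" and G: "\<And>y u v. y \<in> X \<Longrightarrow> G y u v = \<rho> y * (u \<bullet> v)"
    and pos: "\<rho> (x s) > 0"
begin

lemma tensor_norm_conformal: "tensor_norm G (x s) v = sqrt (\<rho> (x s)) * norm v"
  using G[OF X(2)] by (simp add: tensor_norm_def real_sqrt_mult norm_eq_sqrt_inner)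

text \<open>A conformal metric has the Euclidean notion of orthogonality, so \<rho> cancels in the
  projection.\<close>

lemma normal_part_conformal:
  assumes x: "(x has_vector_derivative x1) (at s)" and "x1 \<noteq> 0"
  shows "normal_part G x s v = Im (v / x1) *\<^sub>R (\<i> * x1)"
proof -
  define c where "c = sqrt (\<rho> (x s)) * norm x1"
  have c: "c\<^sup>2 = \<rho> (x s) * (norm x1)\<^sup>2" "c \<noteq> 0" "(norm x1)\<^sup>2 \<noteq> 0"
    using pos \<open>x1 \<noteq> 0\<close> by (auto simp: c_def power_mult_distrib)
  have T: "unit_tangent G x s = x1 /\<^sub>R c"
    unfolding unit_tangent_def vector_derivative_at[OF x] tensor_norm_conformal c_def ..
  have "normal_part G x s v = v - (\<rho> (x s) * (v \<bullet> x1) / c\<^sup>2) *\<^sub>R x1"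
    unfolding normal_part_def T G[OF X(2)] by (simp add: power2_eq_square divide_inverse mult_ac)
  also have "\<rho> (x s) * (v \<bullet> x1) / c\<^sup>2 = (v \<bullet> x1) / (norm x1)\<^sup>2"
    unfolding c(1) using pos by simp
  also have "(v \<bullet> x1) / (norm x1)\<^sup>2 = Re (v / x1)"
    by (simp add: Re_divide inner_complex_def cmod_power2)
  also have "v - Re (v / x1) *\<^sub>R x1 = Im (v / x1) *\<^sub>R (\<i> * x1)"
  proof -
    have "v = v / x1 * x1" using \<open>x1 \<noteq> 0\<close> by simp
    also have "v / x1 = of_real (Re (v / x1)) + \<i> * of_real (Im (v / x1))"
      by (rule complex_eq)
    finally have "v = Re (v / x1) *\<^sub>R x1 + Im (v / x1) *\<^sub>R (\<i> * x1)"
      by (simp only: scaleR_conv_of_real distrib_left distrib_right mult_ac)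
    then show ?thesis by (metis add_diff_cancel_left')
  qed
  finally show ?thesis .
qed

text \<open>The transformation law of curvature under conformal change. Im (x2 / x1) is the
  derivative of the Euclidean tangent angle; the correction is the derivative of (ln \<rho>) / 2 in
  the direction i x1.\<close>

lemma geodesic_curvature_conformal:
  assumes \<rho>: "(\<rho> has_derivative D) (at (x s))"
    and x: "\<forall>\<^sub>F u in nhds s. (x has_vector_derivative x1 u) (at u)"
    and x1: "(x1 has_vector_derivative x2) (at s)" "x1 s \<noteq> 0"
  shows "geodesic_curvature G x s =
    ((Im (x2 / x1 s) - D (\<i> * x1 s) / (2 * \<rho> (x s))) / (\<rho> (x s) * (norm (x1 s))\<^sup>2)) *\<^sub>R (\<i> * x1 s)"
proof -
  have xs: "(x has_vector_derivative x1 s) (at s)"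
    using x by (rule eventually_nhds_x_imp_x)
  have lin: "linear D" using \<rho> by (rule has_derivative_linear)
  define n where "n u = \<rho> (x u) * (x1 u \<bullet> x1 u)" for u
  define n' where "n' = D (x1 s) * (x1 s \<bullet> x1 s) + \<rho> (x s) * (2 * (x1 s \<bullet> x2))"
  have n: "n s > 0" using pos x1(2) by (simp add: n_def)
  have "((\<lambda>u. \<rho> (x u)) has_real_derivative D (x1 s)) (at s)"
  proof -
    have "((\<lambda>u. \<rho> (x u)) has_derivative (\<lambda>y. D (y *\<^sub>R x1 s))) (at s)"
      using has_derivative_compose[of x "\<lambda>y. y *\<^sub>R x1 s" s UNIV \<rho> D] xs \<rho>
      by (simp add: has_vector_derivative_def)
    then show ?thesis
      by (simp add: has_field_derivative_def linear_scale[OF lin] mult.commute[of _ "D _"])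
  qed
  moreover have "((\<lambda>u. x1 u \<bullet> x1 u) has_real_derivative 2 * (x1 s \<bullet> x2)) (at s)"
    unfolding has_field_derivative_def
    by (rule has_derivative_eq_rhs[OF has_derivative_inner[OF x1(1)[unfolded has_vector_derivative_def]
          x1(1)[unfolded has_vector_derivative_def]]])
      (auto simp: fun_eq_iff inner_commute)
  ultimately have n_deriv: "(n has_real_derivative n') (at s)"
    unfolding n_def n'_def by (auto intro!: derivative_eq_intros)
  have dV: "((\<lambda>u. (1 / sqrt (n u)) *\<^sub>R x1 u) has_vector_derivative
      (1 / sqrt (n s)) *\<^sub>R x2 + (- n' / (2 * n s * sqrt (n s))) *\<^sub>R x1 s) (at s)"
  proof -
    have "((\<lambda>u. 1 / sqrt (n u)) has_real_derivative - n' / (2 * n s * sqrt (n s))) (at s)"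
      using n by (auto intro!: derivative_eq_intros n_deriv simp: field_simps power2_eq_square)
    then show ?thesis
      by (rule has_vector_derivative_scaleR) (rule x1(1))
  qed
  have "\<forall>\<^sub>F u in nhds s. (1 / sqrt (n u)) *\<^sub>R x1 u = unit_tangent G x u"
  proof -
    have "isCont x s"
      using xs by (rule has_vector_derivative_continuous)
    then have "\<forall>\<^sub>F u in nhds s. x u \<in> X"
      using X by (simp add: continuous_at_open eventually_nhds)
    with x show ?thesis
    proof eventually_elim
      case (elim u)
      then show ?case
        using G[of "x u"] vector_derivative_at[OF elim(1)]
        by (simp add: unit_tangent_def tensor_norm_def n_def divide_inverse)
    qed
  qed
  then obtain S where S: "open S" "s \<in> S" "\<And>u. u \<in> S \<Longrightarrow> (1 / sqrt (n u)) *\<^sub>R x1 u = unit_tangent G x u"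
    unfolding eventually_nhds by blast
  have V: "(unit_tangent G x has_vector_derivative
      (1 / sqrt (n s)) *\<^sub>R x2 + (- n' / (2 * n s * sqrt (n s))) *\<^sub>R x1 s) (at s)"
    by (rule has_vector_derivative_transform_within_open[OF dV S])
  have T: "unit_tangent G x s = (1 / sqrt (n s)) *\<^sub>R x1 s"
    using G[OF X(2)] vector_derivative_at[OF xs]
    by (simp add: unit_tangent_def tensor_norm_def n_def divide_inverse)
  have N: "tensor_norm G (x s) (vector_derivative x (at s)) = sqrt (n s)"
    using G[OF X(2)] vector_derivative_at[OF xs] by (simp add: tensor_norm_def n_def)
  define g where "g = Complex (D 1) (D \<i>)"
  have Dscale: "D (c *\<^sub>R w) = c * D w" for c w
    using linear_scale[OF lin] by simp
  have D: "D w = Re g * Re w + Im g * Im w" for w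
  proof -
    have "w = Re w *\<^sub>R 1 + Im w *\<^sub>R \<i>" by (simp add: complex_eq_iff)
    then have "D w = Re w * D 1 + Im w * D \<i>"
      using linear_add[OF lin] Dscale by metis
    then show ?thesis by (simp add: g_def mult.commute)
  qed
  define r where "r = \<rho> (x s)"
  have LC: "levi_civita G (x s) u v =
      (1 / (2 * r)) *\<^sub>R (D u *\<^sub>R v + D v *\<^sub>R u - (u \<bullet> v) *\<^sub>R g)" for u v
    unfolding g_def r_def by (rule levi_civita_conformal[OF X _ \<rho> pos]) (rule G)
  define w where "w = 1 / sqrt (n s)"
  have ww: "w * w = 1 / n s" using n by (simp add: w_def)
  have "levi_civita G (x s) (x1 s) (unit_tangent G x s) =
      w *\<^sub>R ((D (x1 s) / r) *\<^sub>R x1 s - ((x1 s \<bullet> x1 s) / (2 * r)) *\<^sub>R g)"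
  proof -
    have "D (x1 s) *\<^sub>R (w *\<^sub>R x1 s) + (w * D (x1 s)) *\<^sub>R x1 s = (2 * (w * D (x1 s))) *\<^sub>R x1 s"
      unfolding mult_2 scaleR_add_left scaleR_scaleR by (simp only: mult.commute)
    then show ?thesis
      unfolding LC T Dscale w_def[symmetric] by (simp add: scaleR_diff_right mult.commute)
  qed
  moreover have "- n' / (2 * n s * sqrt (n s)) = w * (- n' / (2 * n s))"
    by (simp add: w_def)
  ultimately have "geodesic_curvature G x s = w *\<^sub>R (w *\<^sub>R x2 + (w * (- n' / (2 * n s))) *\<^sub>R x1 s +
      w *\<^sub>R ((D (x1 s) / r) *\<^sub>R x1 s - ((x1 s \<bullet> x1 s) / (2 * r)) *\<^sub>R g))"
    unfolding geodesic_curvature_def covariant_deriv_def vector_derivative_at[OF V] vector_derivative_at[OF xs]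
      N[unfolded vector_derivative_at[OF xs]] w_def[symmetric]
    by (simp only: inverse_eq_divide w_def[symmetric])
  also have "\<dots> = (w * w) *\<^sub>R (x2 + (- n' / (2 * n s)) *\<^sub>R x1 s +
      ((D (x1 s) / r) *\<^sub>R x1 s - ((x1 s \<bullet> x1 s) / (2 * r)) *\<^sub>R g))"
    by (simp only: scaleR_add_right scaleR_diff_right scaleR_scaleR mult.assoc)
  also have "\<dots> = (1 / n s) *\<^sub>R x2 + (- n' / (2 * n s * n s)) *\<^sub>R x1 s +
      (D (x1 s) / (n s * r)) *\<^sub>R x1 s - ((x1 s \<bullet> x1 s) / (2 * n s * r)) *\<^sub>R g"
    unfolding ww by (simp add: scaleR_add_right scaleR_diff_right mult.commute mult.left_commute)
  also have "\<dots> = ((Im (x2 / x1 s) - D (\<i> * x1 s) / (2 * r)) / (r * (norm (x1 s))\<^sup>2)) *\<^sub>R (\<i> * x1 s)"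
  proof -
    obtain p q where pq: "x1 s = Complex p q" by (cases "x1 s")
    obtain u v where uv: "x2 = Complex u v" by (cases x2)
    obtain d e where de: "g = Complex d e" by (cases g)
    define L where "L = p\<^sup>2 + q\<^sup>2"
    have L: "L > 0" using x1(2) unfolding pq L_def
      by (auto simp: complex_eq_iff sum_power2_gt_zero_iff)
    have r: "r > 0" using pos by (simp add: r_def)
    have I: "Im (x2 / x1 s) = (v * p - u * q) / L"
      by (simp add: pq uv L_def Im_divide)
    have "(norm (x1 s))\<^sup>2 = L"
      by (simp add: pq L_def cmod_power2)
    then have nn: "n s = r * L" "x1 s \<bullet> x1 s = L" "(norm (x1 s))\<^sup>2 = L"
      by (simp_all add: n_def r_def power2_norm_eq_inner)
    define S where "S = d * p + e * q"
    have n'': "n' = S * L + 2 * r * (p * u + q * v)"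
      unfolding n'_def nn D de by (simp add: S_def pq uv r_def inner_complex_def)
    \<comment> \<open>Multiplied by 2 r^2 L^2, each component becomes a polynomial identity in the
      coordinates of the first and second derivative and of the gradient.\<close>
    have Re: "u / (r * L) - n' * p / (2 * (r * L) * (r * L)) + S * p / (r * L * r) - L * d / (2 * (r * L) * r)
      = ((v * p - u * q) / L - (e * p - d * q) / (2 * r)) / (r * L) * (- q)"
    proof -
      have "2 * r * L * u - n' * p + 2 * L * S * p - L * L * d
        = (2 * r * (v * p - u * q) - L * (e * p - d * q)) * (- q)"
        unfolding n'' L_def S_def by (simp add: power2_eq_square algebra_simps)
      then have "(2 * r * L * u - n' * p + 2 * L * S * p - L * L * d) / (2 * r * r * L * L)
        = (2 * r * (v * p - u * q) - L * (e * p - d * q)) * (- q) / (2 * r * r * L * L)" by simp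
      then show ?thesis using r L
        by (simp add: add_divide_distrib diff_divide_distrib left_diff_distrib right_diff_distrib mult_ac)
    qed
    have Im: "v / (r * L) - n' * q / (2 * (r * L) * (r * L)) + S * q / (r * L * r) - L * e / (2 * (r * L) * r)
      = ((v * p - u * q) / L - (e * p - d * q) / (2 * r)) / (r * L) * p"
    proof -
      have "2 * r * L * v - n' * q + 2 * L * S * q - L * L * e
        = (2 * r * (v * p - u * q) - L * (e * p - d * q)) * p"
        unfolding n'' L_def S_def by (simp add: power2_eq_square algebra_simps)
      then have "(2 * r * L * v - n' * q + 2 * L * S * q - L * L * e) / (2 * r * r * L * L)
        = (2 * r * (v * p - u * q) - L * (e * p - d * q)) * p / (2 * r * r * L * L)" by simp
      then show ?thesis using r L
        by (simp add: add_divide_distrib diff_divide_distrib left_diff_distrib right_diff_distrib mult_ac)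
    qed
    show ?thesis
      unfolding nn I D de using L Re Im by (simp add: S_def complex_eq_iff pq uv)
  qed
  finally show ?thesis by (simp add: r_def)
qed

end

section \<open>Regularity of real analytic functions\<close>

text \<open>A double power series enumerated by a single index. The exponents are arbitrary
  sequences, so that the termwise partial derivatives have the same form again.\<close>

definition monomial_series :: "(nat \<Rightarrow> real) \<Rightarrow> (nat \<Rightarrow> nat) \<Rightarrow> (nat \<Rightarrow> nat) \<Rightarrow> complex \<Rightarrow> real" where
  "monomial_series c p q z = (\<Sum>i. c i * Re z ^ p i * Im z ^ q i)"

lemma abs_monomial_le:
  assumes "norm z \<le> R"
  shows "\<bar>c * Re z ^ p * Im z ^ q\<bar> \<le> \<bar>c\<bar> * R ^ (p + q)"
proof -
  have "\<bar>Re z\<bar> ^ p * \<bar>Im z\<bar> ^ q \<le> R ^ p * R ^ q"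
    using assms abs_Re_le_cmod[of z] abs_Im_le_cmod[of z] by (intro mult_mono power_mono) auto
  then show ?thesis
    by (simp add: abs_mult power_abs power_add mult.assoc mult_left_mono)
qed

lemma monomial_series_summable:
  assumes "summable (\<lambda>i. \<bar>c i\<bar> * R ^ (p i + q i))" "norm z \<le> R"
  shows "summable (\<lambda>i. c i * Re z ^ p i * Im z ^ q i)"
    and "\<bar>monomial_series c p q z\<bar> \<le> (\<Sum>i. \<bar>c i\<bar> * R ^ (p i + q i))"
proof -
  have *: "norm (c i * Re z ^ p i * Im z ^ q i) \<le> \<bar>c i\<bar> * R ^ (p i + q i)" for i
    using abs_monomial_le[OF assms(2)] by simp
  show "summable (\<lambda>i. c i * Re z ^ p i * Im z ^ q i)"
    by (rule summable_comparison_test'[OF assms(1)]) (rule *)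
  have "summable (\<lambda>i. norm (c i * Re z ^ p i * Im z ^ q i))"
    by (rule summable_comparison_test'[OF assms(1)]) (use * in auto)
  then have "norm (monomial_series c p q z) \<le> (\<Sum>i. norm (c i * Re z ^ p i * Im z ^ q i))"
    unfolding monomial_series_def by (rule summable_norm)
  also have "\<dots> \<le> (\<Sum>i. \<bar>c i\<bar> * R ^ (p i + q i))"
    by (rule suminf_le) (use * assms(1) \<open>summable (\<lambda>i. norm _)\<close> in auto)
  finally show "\<bar>monomial_series c p q z\<bar> \<le> (\<Sum>i. \<bar>c i\<bar> * R ^ (p i + q i))" by simp
qed

text \<open>n (R' / R)^n is bounded, so a smaller radius pays for the factor produced by
  differentiation. Truncated subtraction in an exponent is harmless, because an exponent 0 comes
  with the coefficient 0.\<close>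

lemma derived_series_summable:
  assumes S: "summable (\<lambda>i. \<bar>c i\<bar> * R ^ (p i + q i))" and R: "0 < R'" "R' < R"
  shows "summable (\<lambda>i. \<bar>c i * real (p i)\<bar> * R' ^ (p i - 1 + q i))"
    and "summable (\<lambda>i. \<bar>c i * real (q i)\<bar> * R' ^ (p i + (q i - 1)))"
proof -
  define t where "t = R' / R"
  have t: "0 < t" "\<bar>t\<bar> < 1" using R by (auto simp: t_def)
  have "(\<lambda>n. real n * t ^ n) \<longlonglongrightarrow> 0"
    using powser_times_n_limit_0[of t] t by simp
  then obtain K where K: "\<And>n. norm (real n * t ^ n) \<le> K"
    using convergent_imp_Bseq[of "\<lambda>n. real n * t ^ n"] by (auto simp: convergent_def Bseq_def)
  have key: "real n * R' ^ n \<le> K * R ^ n" for n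
  proof -
    have "real n * t ^ n * R ^ n \<le> K * R ^ n"
      using K[of n] R by (intro mult_right_mono) auto
    then show ?thesis using R by (simp add: t_def power_divide)
  qed
  have S': "summable (\<lambda>i. K / R' * (\<bar>c i\<bar> * R ^ (p i + q i)))"
    by (rule summable_mult[OF S])
  have 1: "real m * R' ^ (m - 1 + l) \<le> K / R' * R ^ (m + l)" for m l :: nat
  proof (cases "m = 0")
    case True
    have "0 \<le> K" using K[of 0] by simp
    then show ?thesis using True R by simp
  next
    case False
    have "real m * R' ^ (m - 1 + l) * R' \<le> real (m + l) * R' ^ (m + l)"
    proof -
      have "R' ^ (m - 1 + l) * R' = R' ^ (m + l)"
        using False by (metis Suc_pred add_Suc neq0_conv One_nat_def power_Suc2)
      then show ?thesis using R by (simp add: mult.assoc mult_right_mono)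
    qed
    also have "\<dots> \<le> K * R ^ (m + l)" by (rule key)
    finally show ?thesis using R by (simp add: field_simps)
  qed
  show "summable (\<lambda>i. \<bar>c i * real (p i)\<bar> * R' ^ (p i - 1 + q i))"
  proof (rule summable_comparison_test'[OF S'])
    fix i
    show "norm (\<bar>c i * real (p i)\<bar> * R' ^ (p i - 1 + q i)) \<le> K / R' * (\<bar>c i\<bar> * R ^ (p i + q i))"
      using mult_left_mono[OF 1[of "p i" "q i"], of "\<bar>c i\<bar>"] R by (simp add: abs_mult mult_ac)
  qed
  show "summable (\<lambda>i. \<bar>c i * real (q i)\<bar> * R' ^ (p i + (q i - 1)))"
  proof (rule summable_comparison_test'[OF S'])
    fix i
    show "norm (\<bar>c i * real (q i)\<bar> * R' ^ (p i + (q i - 1))) \<le> K / R' * (\<bar>c i\<bar> * R ^ (p i + q i))"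
      using mult_left_mono[OF 1[of "q i" "p i"], of "\<bar>c i\<bar>"] R by (simp add: abs_mult mult_ac add.commute)
  qed
qed

lemma monomial_series_has_derivative:
  assumes S: "summable (\<lambda>i. \<bar>c i\<bar> * R ^ (p i + q i))" and R: "0 < R'" "R' < R" and z: "z \<in> ball 0 R'"
  shows "(monomial_series c p q has_derivative
    (\<lambda>v. monomial_series (\<lambda>i. c i * real (p i)) (\<lambda>i. p i - 1) q z * Re v +
         monomial_series (\<lambda>i. c i * real (q i)) p (\<lambda>i. q i - 1) z * Im v)) (at z)"
proof -
  define f where "f i z = c i * Re z ^ p i * Im z ^ q i" for i z
  define a where "a i z = c i * real (p i) * Re z ^ (p i - 1) * Im z ^ q i" for i z
  define b where "b i z = c i * real (q i) * Re z ^ p i * Im z ^ (q i - 1)" for i z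
  note S' = derived_series_summable[OF S R]
  \<comment> \<open>A majorant of the termwise derivatives that is uniform on the ball; its tails
    give the uniform convergence that termwise differentiation requires.\<close>
  define w where "w i = \<bar>c i * real (p i)\<bar> * R' ^ (p i - 1 + q i) + \<bar>c i * real (q i)\<bar> * R' ^ (p i + (q i - 1))" for i
  have w: "summable w" unfolding w_def by (rule summable_add[OF S'])
  have sa: "summable (\<lambda>i. a i z)" and sb: "summable (\<lambda>i. b i z)" if "z \<in> ball 0 R'" for z
    unfolding a_def b_def
    using monomial_series_summable(1)[OF S'(1), of z] monomial_series_summable(1)[OF S'(2), of z] that by auto
  have ab: "\<bar>a i z * Re v + b i z * Im v\<bar> \<le> w i * norm v" if "z \<in> ball 0 R'" for i z v
  proof -
    have z: "norm z \<le> R'" using that by simp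
    have "\<bar>a i z\<bar> * \<bar>Re v\<bar> \<le> (\<bar>c i * real (p i)\<bar> * R' ^ (p i - 1 + q i)) * norm v"
      unfolding a_def by (intro mult_mono abs_monomial_le[OF z] abs_Re_le_cmod) (use R in auto)
    moreover have "\<bar>b i z\<bar> * \<bar>Im v\<bar> \<le> (\<bar>c i * real (q i)\<bar> * R' ^ (p i + (q i - 1))) * norm v"
      unfolding b_def by (intro mult_mono abs_monomial_le[OF z] abs_Im_le_cmod) (use R in auto)
    ultimately show ?thesis
      unfolding w_def distrib_right using abs_triangle_ineq[of "a i z * Re v" "b i z * Im v"]
      by (simp only: abs_mult)
  qed
  define g' where "g' z v = (\<Sum>i. a i z) * Re v + (\<Sum>i. b i z) * Im v" for z v
  have sums: "(\<lambda>i. a i z * Re v + b i z * Im v) sums g' z v" if "z \<in> ball 0 R'" for z v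
    unfolding g'_def
    by (intro sums_add sums_mult2 summable_sums sa sb that)
  have "\<exists>g. \<forall>x\<in>ball 0 R'. (\<lambda>n. f n x) sums g x \<and> (g has_derivative g' x) (at x within ball 0 R')"
  proof (rule has_derivative_series[where f = f and f' = "\<lambda>i z v. a i z * Re v + b i z * Im v"])
    show "convex (ball (0::complex) R')" by simp
    show "(f n has_derivative (\<lambda>v. a n x * Re v + b n x * Im v)) (at x within ball 0 R')" for n x
      unfolding f_def a_def b_def
      by (auto intro!: derivative_eq_intros simp: fun_eq_iff algebra_simps)
    show "\<forall>\<^sub>F n in sequentially. \<forall>x\<in>ball 0 R'. \<forall>h.
        norm ((\<Sum>i<n. a i x * Re h + b i x * Im h) - g' x h) \<le> e * norm h" if "e > 0" for e
    proof -
      obtain N where N: "\<And>n. n \<ge> N \<Longrightarrow> norm (\<Sum>i. w (i + n)) < e"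
        using suminf_exist_split[OF \<open>e > 0\<close> w] by blast
      show ?thesis
      proof (rule eventually_sequentiallyI[of N], intro ballI allI)
        fix n x and h :: complex assume n: "N \<le> n" and x: "x \<in> ball (0::complex) R'"
        have sw: "summable (\<lambda>i. w (i + n) * norm h)"
          by (intro summable_mult2 summable_ignore_initial_segment w)
        have "g' x h - (\<Sum>i<n. a i x * Re h + b i x * Im h) = (\<Sum>i. a (i + n) x * Re h + b (i + n) x * Im h)"
          using suminf_minus_initial_segment[OF sums_summable[OF sums[OF x, of h]], of n] sums_unique[OF sums[OF x, of h]]
          by simp
        also have "norm \<dots> \<le> (\<Sum>i. w (i + n) * norm h)"
        proof -
          have sn: "summable (\<lambda>i. norm (a (i + n) x * Re h + b (i + n) x * Im h))"
            by (rule summable_comparison_test'[OF sw]) (use ab[OF x] in auto)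
          show ?thesis
            by (rule order_trans[OF summable_norm[OF sn] suminf_le[OF _ sn sw]]) (use ab[OF x] in auto)
        qed
        also have "\<dots> = (\<Sum>i. w (i + n)) * norm h"
          by (rule suminf_mult2[symmetric]) (intro summable_ignore_initial_segment w)
        also have "\<dots> \<le> e * norm h"
          using N[OF n] by (intro mult_right_mono) auto
        finally show "norm ((\<Sum>i<n. a i x * Re h + b i x * Im h) - g' x h) \<le> e * norm h"
          by (simp add: norm_minus_commute)
      qed
    qed
    show "z \<in> ball 0 R'" by (rule z)
    show "(\<lambda>n. f n z) sums monomial_series c p q z"
      unfolding f_def monomial_series_def using z R
      by (intro summable_sums monomial_series_summable(1)[OF S]) auto
  qed
  then obtain g where g: "\<And>x. x \<in> ball 0 R' \<Longrightarrow> (\<lambda>n. f n x) sums g x"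
    "\<And>x. x \<in> ball 0 R' \<Longrightarrow> (g has_derivative g' x) (at x within ball 0 R')" by blast
  have eq: "g x = monomial_series c p q x" if "x \<in> ball 0 R'" for x
    unfolding monomial_series_def f_def[symmetric] by (rule sums_unique[OF g(1)[OF that]])
  have "(g has_derivative g' z) (at z)"
    using g(2)[OF z] at_within_open[OF z open_ball] by simp
  then have "(monomial_series c p q has_derivative g' z) (at z)"
    by (rule has_derivative_transform_within_open[OF _ open_ball z]) (rule eq)
  then show ?thesis
    unfolding g'_def a_def b_def monomial_series_def .
qed

text \<open>H = h_x - i h_y is twice the Wirtinger derivative of h; A and B are the derivatives of H
  with respect to z and cnj z, and B is real because it is half the Laplacian of h.\<close>

lemma real_analytic_on_second_order:
  assumes "real_analytic_on h S" "0 \<in> S"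
  obtains R M :: real and H A :: "complex \<Rightarrow> complex" and B :: "complex \<Rightarrow> real"
  where "0 < R" "1 \<le> M"
    "\<And>z. z \<in> ball 0 R \<Longrightarrow> (h has_derivative (\<lambda>v. Re (H z * v))) (at z)"
    "\<And>z. z \<in> ball 0 R \<Longrightarrow> (H has_derivative (\<lambda>v. A z * v + of_real (B z) * cnj v)) (at z)"
    "\<And>z. z \<in> ball 0 R \<Longrightarrow> \<bar>h z\<bar> \<le> M \<and> norm (H z) \<le> M \<and> norm (A z) \<le> M \<and> \<bar>B z\<bar> \<le> M"
proof -
  obtain a :: "nat \<times> nat \<Rightarrow> real" and r where r: "r > 0"
    and h: "\<And>z. z \<in> ball 0 r \<Longrightarrow> ((\<lambda>(k, l). a (k, l) * Re z ^ k * Im z ^ l) has_sum h z) UNIV"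
    using assms unfolding real_analytic_on_def by fastforce
  define c where "c i = a (prod_decode i)" for i
  define p where "p i = fst (prod_decode i)" for i
  define q where "q i = snd (prod_decode i)" for i
  have reindex: "((\<lambda>i. c i * Re z ^ p i * Im z ^ q i) has_sum h z) UNIV" if "z \<in> ball 0 r" for z
  proof -
    have "bij_betw prod_decode UNIV (UNIV :: (nat \<times> nat) set)" by (rule bij_prod_decode)
    from has_sum_reindex_bij_betw[OF this, of "\<lambda>(k, l). a (k, l) * Re z ^ k * Im z ^ l" "h z"] h[OF that]
    show ?thesis by (simp add: c_def p_def q_def case_prod_beta')
  qed
  have h_eq: "h z = monomial_series c p q z" if "z \<in> ball 0 r" for z
    unfolding monomial_series_def by (rule sums_unique[OF has_sum_imp_sums[OF reindex[OF that]]])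
  define R1 where "R1 = r / 2"
  have S: "summable (\<lambda>i. \<bar>c i\<bar> * R1 ^ (p i + q i))"
  proof -
    \<comment> \<open>At the corner R1 + i R1 every monomial equals R1^(p + q). The unconditional
      sum there is absolute and therefore controls all terms in the ball of radius R1.\<close>
    have "Complex R1 R1 \<in> ball 0 r"
    proof -
      have "(norm (Complex R1 R1))\<^sup>2 < r\<^sup>2"
        using r by (simp add: R1_def cmod_power2 power_divide)
      then show ?thesis using r by (simp add: power2_less_imp_less)
    qed
    from reindex[OF this] have "(\<lambda>i. c i * R1 ^ p i * R1 ^ q i) summable_on UNIV"
      by (auto simp: summable_on_def)
    then have "(\<lambda>i. \<bar>c i * R1 ^ p i * R1 ^ q i\<bar>) summable_on UNIV"
      by (rule summable_on_iff_abs_summable_on_real[THEN iffD1, unfolded real_norm_def])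
    then have "summable (\<lambda>i. \<bar>c i * R1 ^ p i * R1 ^ q i\<bar>)"
      by (rule summable_on_imp_summable)
    then show ?thesis
      using r by (simp add: R1_def abs_mult power_add mult.assoc)
  qed
  \<comment> \<open>Each differentiation costs radius: R1 carries the series of h, R2 those of its
    gradient, R3 those of the second derivatives.\<close>
  define R2 where "R2 = R1 / 2"
  define R3 where "R3 = R2 / 2"
  have R: "0 < R1" "0 < R2" "R2 < R1" "0 < R3" "R3 < R2" "R1 < r"
    using r by (auto simp: R1_def R2_def R3_def)
  define hx where "hx = monomial_series (\<lambda>i. c i * real (p i)) (\<lambda>i. p i - 1) q"
  define hy where "hy = monomial_series (\<lambda>i. c i * real (q i)) p (\<lambda>i. q i - 1)"
  note Sx = derived_series_summable(1)[OF S R(2,3)] and Sy = derived_series_summable(2)[OF S R(2,3)]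
  define hxx where "hxx = monomial_series (\<lambda>i. c i * real (p i) * real (p i - 1)) (\<lambda>i. p i - 1 - 1) q"
  define hxy where "hxy = monomial_series (\<lambda>i. c i * real (p i) * real (q i)) (\<lambda>i. p i - 1) (\<lambda>i. q i - 1)"
  define hyy where "hyy = monomial_series (\<lambda>i. c i * real (q i) * real (q i - 1)) p (\<lambda>i. q i - 1 - 1)"
  have hyx: "monomial_series (\<lambda>i. c i * real (q i) * real (p i)) (\<lambda>i. p i - 1) (\<lambda>i. q i - 1) = hxy"
    by (simp add: hxy_def mult_ac)
  have dh: "(h has_derivative (\<lambda>v. hx z * Re v + hy z * Im v)) (at z)" if "z \<in> ball 0 R2" for z
  proof (rule has_derivative_transform_within_open)
    show "(monomial_series c p q has_derivative (\<lambda>v. hx z * Re v + hy z * Im v)) (at z)"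
      unfolding hx_def hy_def by (rule monomial_series_has_derivative[OF S R(2,3) that])
    show "monomial_series c p q x = h x" if "x \<in> ball 0 R2" for x
      using h_eq[of x] that R by simp
  qed (use that in auto)
  have dhx: "(hx has_derivative (\<lambda>v. hxx z * Re v + hxy z * Im v)) (at z)" if "z \<in> ball 0 R3" for z
    unfolding hx_def hxx_def hxy_def by (rule monomial_series_has_derivative[OF Sx R(4,5) that])
  have dhy: "(hy has_derivative (\<lambda>v. hxy z * Re v + hyy z * Im v)) (at z)" if "z \<in> ball 0 R3" for z
    unfolding hyx[symmetric] hyy_def hy_def by (rule monomial_series_has_derivative[OF Sy R(4,5) that])
  define H where "H z = Complex (hx z) (- hy z)" for z
  define A where "A z = Complex ((hxx z - hyy z) / 2) (- hxy z)" for z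
  define B where "B z = (hxx z + hyy z) / 2" for z
  note bounds = monomial_series_summable(2)
  obtain M1 M2 M3 M4 M5 M6 where M: "\<And>z. z \<in> ball 0 R3 \<Longrightarrow> \<bar>h z\<bar> \<le> M1 \<and> \<bar>hx z\<bar> \<le> M2 \<and> \<bar>hy z\<bar> \<le> M3
      \<and> \<bar>hxx z\<bar> \<le> M4 \<and> \<bar>hxy z\<bar> \<le> M5 \<and> \<bar>hyy z\<bar> \<le> M6"
  proof -
    have le: "norm z \<le> R1" "norm z \<le> R2" "norm z \<le> R3" "z \<in> ball 0 r" if "z \<in> ball 0 R3" for z :: complex
      using that R by auto
    show thesis
      by (rule that, intro conjI, subst h_eq[OF le(4)], assumption, rule bounds[OF S le(1)], assumption)
        (unfold hx_def hy_def hxx_def hxy_def hyy_def,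
         (rule bounds[OF Sx le(2)] bounds[OF Sy le(2)] bounds[OF derived_series_summable(1)[OF Sx R(4,5)] le(3)]
          bounds[OF derived_series_summable(2)[OF Sx R(4,5)] le(3)]
          bounds[OF derived_series_summable(2)[OF Sy R(4,5)] le(3)], assumption)+)
  qed
  have M0: "0 \<le> M1" "0 \<le> M2" "0 \<le> M3" "0 \<le> M4" "0 \<le> M5" "0 \<le> M6"
    using M[of 0] R(4) by auto
  show thesis
  proof (rule that[of R3 "1 + M1 + M2 + M3 + M4 + M5 + M6" H A B])
    show "0 < R3" by (rule R)
    show "1 \<le> 1 + M1 + M2 + M3 + M4 + M5 + M6" using M0 by simp
    fix z :: complex assume z: "z \<in> ball 0 R3"
    show "(h has_derivative (\<lambda>v. Re (H z * v))) (at z)"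
      using dh[of z] z R by (simp add: H_def)
    have "((\<lambda>z. of_real (hx z) - \<i> * of_real (hy z)) has_derivative
        (\<lambda>v. of_real (hxx z * Re v + hxy z * Im v) - \<i> * of_real (hxy z * Re v + hyy z * Im v))) (at z)"
      by (intro has_derivative_diff has_derivative_mult_right has_derivative_of_real dhx dhy z)
    moreover have "H = (\<lambda>z. of_real (hx z) - \<i> * of_real (hy z))"
      by (auto simp: H_def complex_eq_iff)
    moreover have "(\<lambda>v. of_real (hxx z * Re v + hxy z * Im v) - \<i> * of_real (hxy z * Re v + hyy z * Im v)) =
        (\<lambda>v. A z * v + of_real (B z) * cnj v)"
      by (auto simp: A_def B_def complex_eq_iff field_simps)
    ultimately show "(H has_derivative (\<lambda>v. A z * v + of_real (B z) * cnj v)) (at z)" by simp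
    have "norm (H z) \<le> \<bar>hx z\<bar> + \<bar>hy z\<bar>"
      using cmod_le[of "H z"] by (simp add: H_def)
    moreover have "norm (A z) \<le> \<bar>(hxx z - hyy z) / 2\<bar> + \<bar>hxy z\<bar>"
      using cmod_le[of "A z"] by (simp add: A_def)
    moreover have "\<bar>(u - v) / 2\<bar> \<le> \<bar>u\<bar> + \<bar>v\<bar>" "\<bar>(u + v) / 2\<bar> \<le> \<bar>u\<bar> + \<bar>v\<bar>" for u v :: real
      using abs_triangle_ineq4[of u v] abs_triangle_ineq[of u v] by simp_all
    note this[of "hxx z" "hyy z"]
    moreover have "\<bar>h z\<bar> \<le> M1" "\<bar>hx z\<bar> \<le> M2" "\<bar>hy z\<bar> \<le> M3" "\<bar>hxx z\<bar> \<le> M4" "\<bar>hxy z\<bar> \<le> M5" "\<bar>hyy z\<bar> \<le> M6"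
      using M[OF z] by auto
    ultimately show "\<bar>h z\<bar> \<le> 1 + M1 + M2 + M3 + M4 + M5 + M6 \<and> norm (H z) \<le> 1 + M1 + M2 + M3 + M4 + M5 + M6
        \<and> norm (A z) \<le> 1 + M1 + M2 + M3 + M4 + M5 + M6 \<and> \<bar>B z\<bar> \<le> 1 + M1 + M2 + M3 + M4 + M5 + M6"
      using M0 unfolding B_def by (intro conjI; argo)
  qed
qed

section \<open>Partial derivatives of smooth maps\<close>

lemma has_vector_derivative_fst_slice:
  assumes "(f has_derivative f') (at (r, t) within S)"
  shows "((\<lambda>x. f (x, t)) has_vector_derivative f' (1, 0)) (at r within {x. (x, t) \<in> S})"
proof -
  have "((\<lambda>x. (x, t)) has_derivative (\<lambda>y. (y, 0))) (at r within {x. (x, t) \<in> S})"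
    by (auto intro!: derivative_eq_intros)
  moreover have "(f has_derivative f') (at (r, t) within (\<lambda>x. (x, t)) ` {x. (x, t) \<in> S})"
    by (rule has_derivative_subset[OF assms]) auto
  ultimately have "((\<lambda>x. f (x, t)) has_derivative (\<lambda>y. f' (y, 0))) (at r within {x. (x, t) \<in> S})"
    by (rule has_derivative_in_compose)
  moreover have "(\<lambda>y. f' (y, 0)) = (\<lambda>y. y *\<^sub>R f' (1, 0))"
  proof
    show "f' (y, 0) = y *\<^sub>R f' (1, 0)" for y
      using linear_scale[OF has_derivative_linear[OF assms], of y "(1, 0)"] by simp
  qed
  ultimately show ?thesis by (simp only: has_vector_derivative_def)
qed

lemma has_vector_derivative_snd_slice:
  assumes "(f has_derivative f') (at (r, t) within S)"
  shows "((\<lambda>x. f (r, x)) has_vector_derivative f' (0, 1)) (at t within {x. (r, x) \<in> S})"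
proof -
  have "((\<lambda>x. (r, x)) has_derivative (\<lambda>y. (0, y))) (at t within {x. (r, x) \<in> S})"
    by (auto intro!: derivative_eq_intros)
  moreover have "(f has_derivative f') (at (r, t) within (\<lambda>x. (r, x)) ` {x. (r, x) \<in> S})"
    by (rule has_derivative_subset[OF assms]) auto
  ultimately have "((\<lambda>x. f (r, x)) has_derivative (\<lambda>y. f' (0, y))) (at t within {x. (r, x) \<in> S})"
    by (rule has_derivative_in_compose)
  moreover have "(\<lambda>y. f' (0, y)) = (\<lambda>y. y *\<^sub>R f' (0, 1))"
  proof
    show "f' (0, y) = y *\<^sub>R f' (0, 1)" for y
      using linear_scale[OF has_derivative_linear[OF assms], of y "(0, 1)"] by simp
  qed
  ultimately show ?thesis by (simp only: has_vector_derivative_def)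
qed

text \<open>The second difference over a square of side k is k^2 times a value of either mixed
  derivative somewhere in the square, by two applications of the mean value theorem in either order.
  Continuity compares both values with the corner.\<close>

lemma mixed_partials_equal_real:
  fixes f :: "real \<Rightarrow> real \<Rightarrow> real"
  assumes V: "open V" "(r, t) \<in> V"
    and f_r: "\<And>r t. (r, t) \<in> V \<Longrightarrow> ((\<lambda>r. f r t) has_real_derivative f1 r t) (at r)"
    and f_t: "\<And>r t. (r, t) \<in> V \<Longrightarrow> ((\<lambda>t. f r t) has_real_derivative f2 r t) (at t)"
    and f_rt: "\<And>r t. (r, t) \<in> V \<Longrightarrow> ((\<lambda>t. f1 r t) has_real_derivative f12 r t) (at t)"
    and f_tr: "\<And>r t. (r, t) \<in> V \<Longrightarrow> ((\<lambda>r. f2 r t) has_real_derivative f21 r t) (at r)"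
    and cont: "continuous_on V (\<lambda>x. f12 (fst x) (snd x))" "continuous_on V (\<lambda>x. f21 (fst x) (snd x))"
  shows "f12 r t = f21 r t"
proof -
  have near: "\<exists>\<delta>>0. \<forall>y. dist y (r, t) < \<delta> \<longrightarrow> y \<in> V \<and>
      \<bar>f12 (fst y) (snd y) - f12 r t\<bar> < e \<and> \<bar>f21 (fst y) (snd y) - f21 r t\<bar> < e" if "e > 0" for e
  proof -
    obtain \<delta>1 where \<delta>1: "\<delta>1 > 0" "\<And>y. dist y (r, t) < \<delta>1 \<Longrightarrow> y \<in> V"
      using V unfolding open_dist by blast
    have "\<exists>\<delta>>0. \<forall>y\<in>V. dist y (r, t) < \<delta> \<longrightarrow> dist (f12 (fst y) (snd y)) (f12 (fst (r, t)) (snd (r, t))) < e"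
      using cont(1) V(2) that unfolding continuous_on_iff by blast
    then obtain \<delta>2 where \<delta>2: "\<delta>2 > 0" "\<And>y. y \<in> V \<Longrightarrow> dist y (r, t) < \<delta>2 \<Longrightarrow> \<bar>f12 (fst y) (snd y) - f12 r t\<bar> < e"
      by (auto simp: dist_real_def)
    have "\<exists>\<delta>>0. \<forall>y\<in>V. dist y (r, t) < \<delta> \<longrightarrow> dist (f21 (fst y) (snd y)) (f21 (fst (r, t)) (snd (r, t))) < e"
      using cont(2) V(2) that unfolding continuous_on_iff by blast
    then obtain \<delta>3 where \<delta>3: "\<delta>3 > 0" "\<And>y. y \<in> V \<Longrightarrow> dist y (r, t) < \<delta>3 \<Longrightarrow> \<bar>f21 (fst y) (snd y) - f21 r t\<bar> < e"
      by (auto simp: dist_real_def)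
    show ?thesis
      by (rule exI[of _ "min \<delta>1 (min \<delta>2 \<delta>3)"]) (use \<delta>1 \<delta>2 \<delta>3 in auto)
  qed
  have "\<bar>f12 r t - f21 r t\<bar> \<le> 0 + e" if "e > 0" for e
  proof -
    obtain \<delta> where \<delta>: "\<delta> > 0" "\<And>y. dist y (r, t) < \<delta> \<Longrightarrow> y \<in> V \<and>
      \<bar>f12 (fst y) (snd y) - f12 r t\<bar> < e / 2 \<and> \<bar>f21 (fst y) (snd y) - f21 r t\<bar> < e / 2"
      using near[OF half_gt_zero[OF \<open>e > 0\<close>]] by blast
    define k where "k = \<delta> / 3"
    have k: "k > 0" using \<delta> by (simp add: k_def)
    have box: "dist (x, y) (r, t) < \<delta>" if "r \<le> x" "x \<le> r + k" "t \<le> y" "y \<le> t + k" for x y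
    proof -
      have "dist (x, y) (r, t) \<le> \<bar>x - r\<bar> + \<bar>y - t\<bar>"
        unfolding dist_Pair_Pair dist_real_def by (rule order_trans[OF sqrt_sum_squares_le_sum_abs]) simp
      also have "\<dots> < \<delta>" using that \<delta> by (simp add: k_def)
      finally show ?thesis .
    qed
    have inV: "(x, y) \<in> V" if "r \<le> x" "x \<le> r + k" "t \<le> y" "y \<le> t + k" for x y
      using \<delta>(2)[OF box[OF that]] by blast
    define \<Delta> where "\<Delta> = (f (r + k) (t + k) - f (r + k) t) - (f r (t + k) - f r t)"
    have "\<exists>x>r. x < r + k \<and> (f (r + k) (t + k) - f (r + k) t) - (f r (t + k) - f r t) = (r + k - r) * (f1 x (t + k) - f1 x t)"
      by (rule MVT2[of r "r + k" "\<lambda>x. f x (t + k) - f x t"]) (use k in \<open>auto intro!: DERIV_diff f_r inV\<close>)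
    then obtain x where x: "r < x" "x < r + k" "\<Delta> = k * (f1 x (t + k) - f1 x t)"
      unfolding \<Delta>_def by (metis add_diff_cancel_left')
    have "\<exists>y>t. y < t + k \<and> f1 x (t + k) - f1 x t = (t + k - t) * f12 x y"
      by (rule MVT2[of t "t + k" "f1 x"]) (use k x in \<open>auto intro!: f_rt inV\<close>)
    then obtain y where y: "t < y" "y < t + k" "f1 x (t + k) - f1 x t = k * f12 x y"
      by (metis add_diff_cancel_left')
    have "\<exists>y>t. y < t + k \<and> (f (r + k) (t + k) - f r (t + k)) - (f (r + k) t - f r t) = (t + k - t) * (f2 (r + k) y - f2 r y)"
      by (rule MVT2[of t "t + k" "\<lambda>y. f (r + k) y - f r y"]) (use k in \<open>auto intro!: DERIV_diff f_t inV\<close>)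
    moreover have "\<Delta> = (f (r + k) (t + k) - f r (t + k)) - (f (r + k) t - f r t)"
      by (simp add: \<Delta>_def)
    ultimately obtain y' where y': "t < y'" "y' < t + k" "\<Delta> = k * (f2 (r + k) y' - f2 r y')"
      by (metis add_diff_cancel_left')
    have "\<exists>x>r. x < r + k \<and> f2 (r + k) y' - f2 r y' = (r + k - r) * f21 x y'"
      by (rule MVT2[of r "r + k" "\<lambda>x. f2 x y'"]) (use k y' in \<open>auto intro!: f_tr inV\<close>)
    then obtain x' where x': "r < x'" "x' < r + k" "f2 (r + k) y' - f2 r y' = k * f21 x' y'"
      by (metis add_diff_cancel_left')
    have "k * (k * f12 x y) = k * (k * f21 x' y')"
      using x y x' y' by simp
    then have "f12 x y = f21 x' y'" using k by simp
    moreover have "\<bar>f12 x y - f12 r t\<bar> < e / 2"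
      using \<delta>(2)[OF box[of x y]] x y by auto
    moreover have "\<bar>f21 x' y' - f21 r t\<bar> < e / 2"
      using \<delta>(2)[OF box[of x' y']] x' y' by auto
    ultimately show ?thesis by linarith
  qed
  then have "\<bar>f12 r t - f21 r t\<bar> \<le> 0" by (rule field_le_epsilon)
  then show ?thesis by simp
qed

lemma mixed_partials_equal:
  fixes f :: "real \<Rightarrow> real \<Rightarrow> complex"
  assumes V: "open V" "(r, t) \<in> V"
    and f_r: "\<And>r t. (r, t) \<in> V \<Longrightarrow> ((\<lambda>r. f r t) has_vector_derivative f1 r t) (at r)"
    and f_t: "\<And>r t. (r, t) \<in> V \<Longrightarrow> ((\<lambda>t. f r t) has_vector_derivative f2 r t) (at t)"
    and f_rt: "\<And>r t. (r, t) \<in> V \<Longrightarrow> ((\<lambda>t. f1 r t) has_vector_derivative f12 r t) (at t)"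
    and f_tr: "\<And>r t. (r, t) \<in> V \<Longrightarrow> ((\<lambda>r. f2 r t) has_vector_derivative f21 r t) (at r)"
    and cont: "continuous_on V (\<lambda>x. f12 (fst x) (snd x))" "continuous_on V (\<lambda>x. f21 (fst x) (snd x))"
  shows "f12 r t = f21 r t"
proof (rule complex_eqI)
  note R = bounded_linear.has_vector_derivative[OF bounded_linear_Re, folded has_real_derivative_iff_has_vector_derivative]
  note I = bounded_linear.has_vector_derivative[OF bounded_linear_Im, folded has_real_derivative_iff_has_vector_derivative]
  show "Re (f12 r t) = Re (f21 r t)"
    by (rule mixed_partials_equal_real[OF V, of "\<lambda>r t. Re (f r t)" "\<lambda>r t. Re (f1 r t)" "\<lambda>r t. Re (f2 r t)"])
      (intro R f_r f_t f_rt f_tr continuous_intros cont; assumption)+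
  show "Im (f12 r t) = Im (f21 r t)"
    by (rule mixed_partials_equal_real[OF V, of "\<lambda>r t. Im (f r t)" "\<lambda>r t. Im (f1 r t)" "\<lambda>r t. Im (f2 r t)"])
      (intro I f_r f_t f_rt f_tr continuous_intros cont; assumption)+
qed

text \<open>The derivatives that \<open>cone_flow\<close> consumes: up to third order, at most one
  of them in t. Sharing \<open>frt\<close> and \<open>frrt\<close> between two clauses records the
  symmetry of the mixed derivatives.\<close>

definition smooth_partials ::
  "(real \<times> real) set \<Rightarrow> (real \<Rightarrow> real \<Rightarrow> complex) \<Rightarrow> (real \<Rightarrow> real \<Rightarrow> complex) \<Rightarrow> (real \<Rightarrow> real \<Rightarrow> complex) \<Rightarrow>
    (real \<Rightarrow> real \<Rightarrow> complex) \<Rightarrow> (real \<Rightarrow> real \<Rightarrow> complex) \<Rightarrow> (real \<Rightarrow> real \<Rightarrow> complex) \<Rightarrow> (real \<Rightarrow> real \<Rightarrow> complex) \<Rightarrow> bool" where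
  "smooth_partials V f fr ft frr frt frrr frrt \<longleftrightarrow> (\<forall>r t. (r, t) \<in> V \<longrightarrow>
    ((\<lambda>r. f r t) has_vector_derivative fr r t) (at r) \<and>
    ((\<lambda>t. f r t) has_vector_derivative ft r t) (at t) \<and>
    ((\<lambda>r. fr r t) has_vector_derivative frr r t) (at r) \<and>
    ((\<lambda>t. fr r t) has_vector_derivative frt r t) (at t) \<and>
    ((\<lambda>r. ft r t) has_vector_derivative frt r t) (at r) \<and>
    ((\<lambda>r. frr r t) has_vector_derivative frrr r t) (at r) \<and>
    ((\<lambda>t. frr r t) has_vector_derivative frrt r t) (at t) \<and>
    ((\<lambda>r. frt r t) has_vector_derivative frrt r t) (at r))"

lemma Basis_real_pair: "(Basis :: (real \<times> real) set) = {(1, 0), (0, 1)}"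
  by (auto simp: Basis_prod_def)

text \<open>\<open>Ck_on\<close> supplies a derivative for each list of directions, but no symmetry
  of the family in that list; \<open>sym\<close> recovers it from continuity, so that one function
  can serve as both mixed derivatives.\<close>

lemma Ck_on_smooth_partials:
  fixes f :: "real \<times> real \<Rightarrow> complex"
  assumes V: "open V" and f: "Ck_on \<infinity> V f"
  shows "\<exists>fr ft frr frt frrr frrt. smooth_partials V (\<lambda>r t. f (r, t)) fr ft frr frt frrr frrt"
proof -
  obtain D :: "(real \<times> real) list \<Rightarrow> (real \<times> real) \<Rightarrow> complex" where D_Nil: "\<forall>x\<in>V. D [] x = f x"
    and D_der: "\<forall>bs. set bs \<subseteq> Basis \<and> enat (length bs) < \<infinity> \<longrightarrow> (\<forall>x\<in>V.
      (D bs has_derivative (\<lambda>h. \<Sum>b\<in>Basis. (h \<bullet> b) *\<^sub>R D (b # bs) x)) (at x within V))"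
    and D_cont: "\<forall>bs. set bs \<subseteq> Basis \<and> enat (length bs) \<le> \<infinity> \<longrightarrow> continuous_on V (D bs)"
    using f unfolding Ck_on_def by blast
  have D0: "D [] x = f x" if "x \<in> V" for x using D_Nil that by blast
  have D: "(D bs has_derivative (\<lambda>h. \<Sum>b\<in>Basis. (h \<bullet> b) *\<^sub>R D (b # bs) x)) (at x within V)"
    if "set bs \<subseteq> Basis" "x \<in> V" for bs x
    by (rule D_der[rule_format, OF conjI[OF that(1)] that(2)]) simp
  have cont: "continuous_on V (D bs)" if "set bs \<subseteq> Basis" for bs
    by (rule D_cont[rule_format, OF conjI[OF that]]) simp
  define X :: "real \<times> real" where "X = (1, 0)"
  define Y :: "real \<times> real" where "Y = (0, 1)"
  have XY: "Basis = {X, Y}" "X \<noteq> Y" by (auto simp: X_def Y_def Basis_real_pair)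
  have D': "(D bs has_derivative (\<lambda>h. fst h *\<^sub>R D (X # bs) x + snd h *\<^sub>R D (Y # bs) x)) (at x)"
    if "set bs \<subseteq> {X, Y}" "x \<in> V" for bs x
    using D[of bs x] that at_within_open[OF that(2) V] XY(2) by (simp add: XY(1)) (simp add: X_def Y_def inner_prod_def)
  have Dr: "((\<lambda>r. D bs (r, t)) has_vector_derivative D (X # bs) (r, t)) (at r)"
    and Dt: "((\<lambda>t. D bs (r, t)) has_vector_derivative D (Y # bs) (r, t)) (at t)"
    if "set bs \<subseteq> {X, Y}" "(r, t) \<in> V" for bs r t
    using has_vector_derivative_fst_slice[OF D'[OF that]] has_vector_derivative_snd_slice[OF D'[OF that]] by simp_all
  have contXY: "continuous_on V (D bs)" if "set bs \<subseteq> {X, Y}" for bs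
    using cont[of bs] that unfolding XY(1) .
  have sym: "D (Y # X # bs) (r, t) = D (X # Y # bs) (r, t)" if bs: "set bs \<subseteq> {X, Y}" and rt: "(r, t) \<in> V" for bs r t
  proof (rule mixed_partials_equal[OF V rt, where f = "\<lambda>r t. D bs (r, t)"
        and ?f1.0 = "\<lambda>r t. D (X # bs) (r, t)" and ?f2.0 = "\<lambda>r t. D (Y # bs) (r, t)"
        and ?f12.0 = "\<lambda>r t. D (Y # X # bs) (r, t)" and ?f21.0 = "\<lambda>r t. D (X # Y # bs) (r, t)"])
    have bs': "set (X # bs) \<subseteq> {X, Y}" "set (Y # bs) \<subseteq> {X, Y}" "set (X # Y # bs) \<subseteq> {X, Y}" "set (Y # X # bs) \<subseteq> {X, Y}"
      using bs by auto
    show "continuous_on V (\<lambda>x. D (Y # X # bs) (fst x, snd x))" "continuous_on V (\<lambda>x. D (X # Y # bs) (fst x, snd x))"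
      using contXY[OF bs'(4)] contXY[OF bs'(3)] by simp_all
    fix r t assume rt: "(r, t) \<in> V"
    show "((\<lambda>r. D bs (r, t)) has_vector_derivative D (X # bs) (r, t)) (at r)" by (rule Dr[OF bs rt])
    show "((\<lambda>t. D bs (r, t)) has_vector_derivative D (Y # bs) (r, t)) (at t)" by (rule Dt[OF bs rt])
    show "((\<lambda>t. D (X # bs) (r, t)) has_vector_derivative D (Y # X # bs) (r, t)) (at t)" by (rule Dt[OF bs'(1) rt])
    show "((\<lambda>r. D (Y # bs) (r, t)) has_vector_derivative D (X # Y # bs) (r, t)) (at r)" by (rule Dr[OF bs'(2) rt])
  qed
  have f_r: "((\<lambda>r. f (r, t)) has_vector_derivative D [X] (r, t)) (at r)" if rt: "(r, t) \<in> V" for r t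
  proof (rule has_vector_derivative_transform_within_open)
    show "((\<lambda>r. D [] (r, t)) has_vector_derivative D [X] (r, t)) (at r)" by (rule Dr) (use rt in auto)
    show "open ((\<lambda>r. (r, t)) -` V)" by (intro open_vimage V continuous_intros)
  qed (use rt D0 in auto)
  have f_t: "((\<lambda>t. f (r, t)) has_vector_derivative D [Y] (r, t)) (at t)" if rt: "(r, t) \<in> V" for r t
  proof (rule has_vector_derivative_transform_within_open)
    show "((\<lambda>t. D [] (r, t)) has_vector_derivative D [Y] (r, t)) (at t)" by (rule Dt) (use rt in auto)
    show "open ((\<lambda>t. (r, t)) -` V)" by (intro open_vimage V continuous_intros)
  qed (use rt D0 in auto)
  have 1: "((\<lambda>r. D [Y] (r, t)) has_vector_derivative D [Y, X] (r, t)) (at r)" if rt: "(r, t) \<in> V" for r t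
    using Dr[of "[Y]", OF _ rt] sym[of "[]", OF _ rt] by simp
  have 2: "((\<lambda>r. D [Y, X] (r, t)) has_vector_derivative D [Y, X, X] (r, t)) (at r)" if rt: "(r, t) \<in> V" for r t
    using Dr[of "[Y, X]", OF _ rt] sym[of "[X]", OF _ rt] by simp
  have "smooth_partials V (\<lambda>r t. f (r, t)) (\<lambda>r t. D [X] (r, t)) (\<lambda>r t. D [Y] (r, t)) (\<lambda>r t. D [X, X] (r, t))
      (\<lambda>r t. D [Y, X] (r, t)) (\<lambda>r t. D [X, X, X] (r, t)) (\<lambda>r t. D [Y, X, X] (r, t))"
    unfolding smooth_partials_def by (intro allI impI conjI f_r f_t 1 2 Dr Dt) auto
  then show ?thesis by blast
qed

text \<open>Local partial derivatives agree where they overlap, so they glue to functions on the whole set.\<close>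

lemma smooth_partials_glue:
  assumes loc: "\<And>x. x \<in> O' \<Longrightarrow> \<exists>V. open V \<and> x \<in> V \<and> (\<exists>fr ft frr frt frrr frrt. smooth_partials V f fr ft frr frt frrr frrt)"
  shows "\<exists>fr ft frr frt frrr frrt. smooth_partials O' f fr ft frr frt frrr frrt"
proof -
  \<comment> \<open>\<open>vector_derivative\<close> selects a derivative without reference to a
    neighbourhood, so the local families must all agree with these functions.\<close>
  define dr where "dr g r t = vector_derivative (\<lambda>r. g r t) (at r)" for g :: "real \<Rightarrow> real \<Rightarrow> complex" and r t
  define dt where "dt g r t = vector_derivative (\<lambda>t. g r t) (at t)" for g :: "real \<Rightarrow> real \<Rightarrow> complex" and r t
  have dr_local: "((\<lambda>r. g r t) has_vector_derivative d) (at r) \<longrightarrow> ((\<lambda>r. g2 r t) has_vector_derivative d) (at r)"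
    if V: "open V" "(r, t) \<in> V" and eq: "\<forall>x y. (x, y) \<in> V \<longrightarrow> g x y = g2 x y" for V r t g d and g2 :: "real \<Rightarrow> real \<Rightarrow> complex"
  proof
    assume "((\<lambda>r. g r t) has_vector_derivative d) (at r)"
    then show "((\<lambda>r. g2 r t) has_vector_derivative d) (at r)"
    proof (rule has_vector_derivative_transform_within_open)
      show "open ((\<lambda>r. (r, t)) -` V)" by (intro open_vimage V continuous_intros)
    qed (use that in auto)
  qed
  have dt_local: "((\<lambda>t. g r t) has_vector_derivative d) (at t) \<longrightarrow> ((\<lambda>t. g2 r t) has_vector_derivative d) (at t)"
    if V: "open V" "(r, t) \<in> V" and eq: "\<forall>x y. (x, y) \<in> V \<longrightarrow> g x y = g2 x y" for V r t g d and g2 :: "real \<Rightarrow> real \<Rightarrow> complex"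
  proof
    assume "((\<lambda>t. g r t) has_vector_derivative d) (at t)"
    then show "((\<lambda>t. g2 r t) has_vector_derivative d) (at t)"
    proof (rule has_vector_derivative_transform_within_open)
      show "open ((\<lambda>t. (r, t)) -` V)" by (intro open_vimage V continuous_intros)
    qed (use that in auto)
  qed
  have "smooth_partials O' f (dr f) (dt f) (dr (dr f)) (dt (dr f)) (dr (dr (dr f))) (dt (dr (dr f)))"
    unfolding smooth_partials_def
  proof (intro allI impI)
    fix r t assume "(r, t) \<in> O'"
    from loc[OF this] obtain V where V: "open V \<and> (r, t) \<in> V \<and>
        (\<exists>fr ft frr frt frrr frrt. smooth_partials V f fr ft frr frt frrr frrt)" by (rule exE)
    note sm = V[THEN conjunct2, THEN conjunct2] and V = V[THEN conjunct1] V[THEN conjunct2, THEN conjunct1]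
    from sm obtain fr ft frr frt frrr frrt where sm: "smooth_partials V f fr ft frr frt frrr frrt" by (elim exE)
    note S = sm[unfolded smooth_partials_def, rule_format]
    note S1 = S[THEN conjunct1] and S' = S[THEN conjunct2]
    note S2 = S'[THEN conjunct1] and S' = S'[THEN conjunct2]
    note S3 = S'[THEN conjunct1] and S' = S'[THEN conjunct2]
    note S4 = S'[THEN conjunct1] and S' = S'[THEN conjunct2]
    note S5 = S'[THEN conjunct1] and S' = S'[THEN conjunct2]
    note S6 = S'[THEN conjunct1] and S' = S'[THEN conjunct2]
    note S7 = S'[THEN conjunct1] and S8 = S'[THEN conjunct2]
    have E1: "\<forall>x y. (x, y) \<in> V \<longrightarrow> fr x y = dr f x y"
    proof (intro allI impI)
      fix x y assume that: "(x, y) \<in> V"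
      show "fr x y = dr f x y"
        unfolding dr_def by (rule vector_derivative_at[OF S1[OF that], symmetric])
    qed
    note e1 = E1[rule_format]
    have E2: "\<forall>x y. (x, y) \<in> V \<longrightarrow> ft x y = dt f x y"
    proof (intro allI impI)
      fix x y assume that: "(x, y) \<in> V"
      show "ft x y = dt f x y"
        unfolding dt_def by (rule vector_derivative_at[OF S2[OF that], symmetric])
    qed
    note e2 = E2[rule_format]
    have E3: "\<forall>x y. (x, y) \<in> V \<longrightarrow> frr x y = dr (dr f) x y"
    proof (intro allI impI)
      fix x y assume that: "(x, y) \<in> V"
      show "frr x y = dr (dr f) x y"
        unfolding dr_def[of "dr f"]
        by (rule vector_derivative_at[OF mp[OF dr_local[OF V(1) that E1] S3[OF that]], symmetric])
    qed
    note e3 = E3[rule_format]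
    have E4: "\<forall>x y. (x, y) \<in> V \<longrightarrow> frt x y = dt (dr f) x y"
    proof (intro allI impI)
      fix x y assume that: "(x, y) \<in> V"
      show "frt x y = dt (dr f) x y"
        unfolding dt_def[of "dr f"]
        by (rule vector_derivative_at[OF mp[OF dt_local[OF V(1) that E1] S4[OF that]], symmetric])
    qed
    note e4 = E4[rule_format]
    have E5: "\<forall>x y. (x, y) \<in> V \<longrightarrow> frrr x y = dr (dr (dr f)) x y"
    proof (intro allI impI)
      fix x y assume that: "(x, y) \<in> V"
      show "frrr x y = dr (dr (dr f)) x y"
        unfolding dr_def[of "dr (dr f)"]
        by (rule vector_derivative_at[OF mp[OF dr_local[OF V(1) that E3] S6[OF that]], symmetric])
    qed
    note e5 = E5[rule_format]
    have E6: "\<forall>x y. (x, y) \<in> V \<longrightarrow> frrt x y = dt (dr (dr f)) x y"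
    proof (intro allI impI)
      fix x y assume that: "(x, y) \<in> V"
      show "frrt x y = dt (dr (dr f)) x y"
        unfolding dt_def[of "dr (dr f)"]
        by (rule vector_derivative_at[OF mp[OF dt_local[OF V(1) that E3] S7[OF that]], symmetric])
    qed
    note e6 = E6[rule_format]
    show "((\<lambda>r. f r t) has_vector_derivative dr f r t) (at r) \<and>
      ((\<lambda>t. f r t) has_vector_derivative dt f r t) (at t) \<and>
      ((\<lambda>r. dr f r t) has_vector_derivative dr (dr f) r t) (at r) \<and>
      ((\<lambda>t. dr f r t) has_vector_derivative dt (dr f) r t) (at t) \<and>
      ((\<lambda>r. dt f r t) has_vector_derivative dt (dr f) r t) (at r) \<and>
      ((\<lambda>r. dr (dr f) r t) has_vector_derivative dr (dr (dr f)) r t) (at r) \<and>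
      ((\<lambda>t. dr (dr f) r t) has_vector_derivative dt (dr (dr f)) r t) (at t) \<and>
      ((\<lambda>r. dt (dr f) r t) has_vector_derivative dt (dr (dr f)) r t) (at r)"
      unfolding e1[OF V(2), symmetric] e2[OF V(2), symmetric] e3[OF V(2), symmetric] e4[OF V(2), symmetric]
        e5[OF V(2), symmetric] e6[OF V(2), symmetric]
      by (intro conjI S1 S2 V mp[OF dr_local[OF V E1] S3[OF V(2)]] mp[OF dt_local[OF V E1] S4[OF V(2)]]
          mp[OF dr_local[OF V E2] S5[OF V(2)]] mp[OF dr_local[OF V E3] S6[OF V(2)]]
          mp[OF dt_local[OF V E3] S7[OF V(2)]] mp[OF dr_local[OF V E4] S8[OF V(2)]])
  qed
  then show ?thesis by blast
qed

lemma Ck_on_1_partials: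
  fixes f :: "real \<times> real \<Rightarrow> complex"
  assumes "Ck_on k S f" "k \<ge> 1"
  obtains fr ft where "continuous_on S f" "continuous_on S fr" "continuous_on S ft"
    "\<And>x. x \<in> S \<Longrightarrow> (f has_derivative (\<lambda>h. fst h *\<^sub>R fr x + snd h *\<^sub>R ft x)) (at x within S)"
proof -
  have k: "enat 0 < k" "enat (Suc 0) \<le> k" using assms(2) by (cases k; simp add: one_enat_def)+
  obtain D :: "(real \<times> real) list \<Rightarrow> (real \<times> real) \<Rightarrow> complex" where D_Nil: "\<forall>x\<in>S. D [] x = f x"
    and D_der: "\<forall>bs. set bs \<subseteq> Basis \<and> enat (length bs) < k \<longrightarrow> (\<forall>x\<in>S.
      (D bs has_derivative (\<lambda>h. \<Sum>b\<in>Basis. (h \<bullet> b) *\<^sub>R D (b # bs) x)) (at x within S))"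
    and D_cont: "\<forall>bs. set bs \<subseteq> Basis \<and> enat (length bs) \<le> k \<longrightarrow> continuous_on S (D bs)"
    using assms(1) unfolding Ck_on_def by blast
  have D0: "D [] x = f x" if "x \<in> S" for x using D_Nil that by blast
  note D = D_der[rule_format, OF conjI] and cont = D_cont[rule_format, OF conjI]
  show thesis
  proof (rule that[of "D [(1, 0)]" "D [(0, 1)]"])
    show "continuous_on S (D [(1, 0)])" "continuous_on S (D [(0, 1)])"
      by (rule cont; use k in \<open>auto simp: Basis_real_pair\<close>)+
    have "continuous_on S (D [])" by (rule cont) (use k in auto)
    then show "continuous_on S f" using D0 by (simp cong: continuous_on_cong)
    show "(f has_derivative (\<lambda>h. fst h *\<^sub>R D [(1, 0)] x + snd h *\<^sub>R D [(0, 1)] x)) (at x within S)" if x: "x \<in> S" for x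
    proof -
      have "(D [] has_derivative (\<lambda>h. fst h *\<^sub>R D [(1, 0)] x + snd h *\<^sub>R D [(0, 1)] x)) (at x within S)"
        using D[of "[]", OF _ _ x] k by (simp add: Basis_real_pair inner_prod_def)
      then show ?thesis
        by (rule has_derivative_transform[OF x, rotated]) (simp add: D0)
    qed
  qed
qed

lemma Ck_on_infinity_curve:
  fixes f :: "real \<Rightarrow> complex"
  assumes "Ck_on \<infinity> S f"
  obtains f1 f2 where "continuous_on S f2"
    "\<And>x. x \<in> S \<Longrightarrow> (f has_vector_derivative f1 x) (at x within S)"
    "\<And>x. x \<in> S \<Longrightarrow> (f1 has_vector_derivative f2 x) (at x within S)"
proof -
  obtain D :: "real list \<Rightarrow> real \<Rightarrow> complex" where D_Nil: "\<forall>x\<in>S. D [] x = f x"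
    and D_der: "\<forall>bs. set bs \<subseteq> Basis \<and> enat (length bs) < \<infinity> \<longrightarrow> (\<forall>x\<in>S.
      (D bs has_derivative (\<lambda>h. \<Sum>b\<in>Basis. (h \<bullet> b) *\<^sub>R D (b # bs) x)) (at x within S))"
    and D_cont: "\<forall>bs. set bs \<subseteq> Basis \<and> enat (length bs) \<le> \<infinity> \<longrightarrow> continuous_on S (D bs)"
    using assms unfolding Ck_on_def by blast
  have D0: "D [] x = f x" if "x \<in> S" for x using D_Nil that by blast
  have D: "(D bs has_derivative (\<lambda>h. \<Sum>b\<in>Basis. (h \<bullet> b) *\<^sub>R D (b # bs) x)) (at x within S)"
    if "set bs \<subseteq> Basis" "x \<in> S" for bs x
    by (rule D_der[rule_format, OF conjI[OF that(1)] that(2)]) simp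
  have cont: "continuous_on S (D bs)" if "set bs \<subseteq> Basis" for bs
    by (rule D_cont[rule_format, OF conjI[OF that]]) simp
  show thesis
  proof (rule that[of "D [1, 1]" "D [1]"])
    show "continuous_on S (D [1, 1])" by (rule cont) auto
    show "(D [1] has_vector_derivative D [1, 1] x) (at x within S)" if "x \<in> S" for x
      using D[of "[1]" x] that by (simp add: has_vector_derivative_def)
    show "(f has_vector_derivative D [1] x) (at x within S)" if x: "x \<in> S" for x
    proof -
      have "(D [] has_vector_derivative D [1] x) (at x within S)"
        using D[of "[]" x] x by (simp add: has_vector_derivative_def)
      then show ?thesis
        unfolding has_vector_derivative_def
        by (rule has_derivative_transform[OF x, rotated]) (simp add: D0)
    qed
  qed
qed

section \<open>The curvature estimate in a conical chart\<close>

text \<open>Read u as the tangent at the vertex, w as the velocity and z as the position at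
  parameter r. Then r w / z = 1 + q with |q| \<le> 3 \<epsilon>; the positive factor r does not
  change the argument, and |Ln (1 + q)| \<le> 2 |q|.\<close>

lemma nearly_straight:
  fixes u z w :: complex
  assumes "u \<noteq> 0" "0 < r" "0 \<le> \<epsilon>" "\<epsilon> \<le> 1/8"
    and w: "norm (w - u) \<le> \<epsilon> * norm u" and z: "norm (z - of_real r * u) \<le> r * (\<epsilon> * norm u)"
  shows "z \<noteq> 0" "w \<noteq> 0" "Re (w / z) > 0" "\<bar>Im (Ln (w / z))\<bar> \<le> 8 * \<epsilon>" "norm z \<le> 2 * r * norm u"
    "r * norm u / 2 \<le> norm z" "\<bar>Im (w / z)\<bar> \<le> 4 * \<epsilon> / r" "norm u / 2 \<le> norm w" "norm w \<le> 2 * norm u"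
proof -
  have u: "norm u > 0" using assms by simp
  have \<epsilon>u: "\<epsilon> * norm u \<le> 1/8 * norm u" using assms by (intro mult_right_mono) auto
  have ru: "0 < r * norm u" using u assms by simp
  have r\<epsilon>: "r * (\<epsilon> * norm u) \<le> r * (1/8 * norm u)" using \<epsilon>u assms by (intro mult_left_mono) auto
  have nru: "norm (of_real r * u) = r * norm u" using assms by (simp add: norm_mult)
  have zlo: "7/8 * (r * norm u) \<le> norm z"
    using norm_triangle_ineq2[of "of_real r * u" "of_real r * u - z"] z r\<epsilon> nru by (simp add: norm_minus_commute)
  have zhi: "norm z \<le> 9/8 * (r * norm u)"
    using norm_triangle_ineq[of "of_real r * u" "z - of_real r * u"] z r\<epsilon> nru by simp
  show z0: "z \<noteq> 0" using zlo ru by auto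
  show "norm z \<le> 2 * r * norm u" "r * norm u / 2 \<le> norm z" using zlo zhi ru by auto
  show wlo: "norm u / 2 \<le> norm w"
  proof -
    have "norm u - norm (w - u) \<le> norm w"
      using norm_triangle_ineq2[of u "u - w"] by (simp add: norm_minus_commute)
    then show ?thesis using w \<epsilon>u u by linarith
  qed
  show "norm w \<le> 2 * norm u"
  proof -
    have "norm w \<le> norm u + norm (w - u)"
      using norm_triangle_ineq[of u "w - u"] by simp
    then show ?thesis using w \<epsilon>u u by linarith
  qed
  show w0: "w \<noteq> 0" using wlo u by auto
  define q where "q = (of_real r * w - z) / z"
  have "norm (of_real r * w - z) \<le> norm (of_real r * (w - u)) + norm (z - of_real r * u)"
    using norm_triangle_ineq4[of "of_real r * (w - u)" "z - of_real r * u"] by (simp add: algebra_simps)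
  also have "norm (of_real r * (w - u)) = r * norm (w - u)" using assms by (simp add: norm_mult)
  also have "r * norm (w - u) \<le> r * (\<epsilon> * norm u)" using w assms by (intro mult_left_mono) auto
  finally have "norm (of_real r * w - z) \<le> 2 * \<epsilon> * (r * norm u)" using z by (simp add: mult_ac)
  \<comment> \<open>From |z| \<ge> (7/8) r |u| the factor 2 grows to 16/7, which is below 3.\<close>
  also have "\<dots> \<le> 3 * \<epsilon> * norm z"
  proof -
    have "\<epsilon> * (7/8 * (r * norm u)) \<le> \<epsilon> * norm z" "0 \<le> \<epsilon> * (r * norm u)"
      using mult_left_mono[OF zlo assms(3)] assms(3) ru by simp_all
    then show ?thesis by linarith
  qed
  finally have q: "norm q \<le> 3 * \<epsilon>"
    using z0 by (simp add: q_def norm_divide pos_divide_le_eq)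
  then have q2: "norm q < 1/2" using assms by simp
  have wz: "w / z = of_real (1 / r) * (1 + q)"
    using z0 assms by (simp add: q_def field_simps)
  have "\<bar>Re q\<bar> < 1/2" using abs_Re_le_cmod[of q] q2 by linarith
  then have "0 < 1 + Re q" by linarith
  then show "Re (w / z) > 0"
    unfolding wz using assms by simp
  have "1 + q \<noteq> 0" using \<open>0 < 1 + Re q\<close> by (auto simp: complex_eq_iff)
  then have "Im (Ln (w / z)) = Im (Ln (1 + q))"
    unfolding wz using Ln_times_of_real[of "1 / r" "1 + q"] Ln_of_real[of "1 / r"] assms(2) by simp
  then have "\<bar>Im (Ln (w / z))\<bar> \<le> norm (Ln (1 + q))"
    using abs_Im_le_cmod[of "Ln (1 + q)"] by simp
  also have "\<dots> \<le> 2 * norm q" by (rule norm_Ln_le[OF q2])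
  finally show "\<bar>Im (Ln (w / z))\<bar> \<le> 8 * \<epsilon>" using q assms by simp
  have "Im (w / z) = Im q / r" unfolding wz by simp
  moreover have "\<bar>Im q\<bar> \<le> 4 * \<epsilon>" using abs_Im_le_cmod[of q] q assms by linarith
  ultimately show "\<bar>Im (w / z)\<bar> \<le> 4 * \<epsilon> / r" using assms by (simp add: divide_right_mono)
qed

lemma deviation_from_line:
  fixes f f' :: "real \<Rightarrow> complex"
  assumes f: "\<And>x. x \<in> {0..r} \<Longrightarrow> (f has_vector_derivative f' x) (at x within {0..r})"
    and "f 0 = 0" "0 \<le> r" and B: "\<And>x. x \<in> {0..r} \<Longrightarrow> norm (f' x - u) \<le> B"
  shows "norm (f r - of_real r * u) \<le> r * B"
proof -
  have "norm ((f r - r *\<^sub>R u) - (f 0 - 0 *\<^sub>R u)) \<le> B * norm (r - 0)"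
  proof (rule differentiable_bound[of "{0..r}" "\<lambda>x. f x - x *\<^sub>R u" "\<lambda>x y. y *\<^sub>R (f' x - u)"])
    show "((\<lambda>x. f x - x *\<^sub>R u) has_derivative (\<lambda>y. y *\<^sub>R (f' x - u))) (at x within {0..r})" if "x \<in> {0..r}" for x
      using f[OF that] unfolding has_vector_derivative_def
      by (auto intro!: derivative_eq_intros simp: algebra_simps)
    show "onorm (\<lambda>y. y *\<^sub>R (f' x - u)) \<le> B" if "x \<in> {0..r}" for x
      using B[OF that] order_trans[OF norm_ge_zero B[OF that]]
      by (intro onorm_bound) (auto simp: mult.commute[of B] intro!: mult_left_mono)
  qed (use assms in auto)
  then show ?thesis
    using assms by (simp add: scaleR_conv_of_real mult.commute)
qed

text \<open>Supplies the hypotheses of \<open>cone_flow_bounds\<close>. Continuity of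
  \<open>zr\<close> makes all curves nearly radial on a small rectangle; the second derivative
  \<open>a\<close> of the initial arc gives the bounds at time 0. The flow equation at time 0 is a
  separate assumption \<open>flow0\<close>, since the one for positive times does not reach
  it.\<close>

lemma vertex_estimate:
  fixes z zr zt zrr zrt zrrr zrrt :: "real \<Rightarrow> real \<Rightarrow> complex" and a :: "real \<Rightarrow> complex"
    and h B :: "complex \<Rightarrow> real" and H A :: "complex \<Rightarrow> complex"
  defines "S \<equiv> \<lambda>\<rho> \<tau> :: real. {0..\<rho>} \<times> {0..\<tau>}"
  assumes pos: "0 < \<rho>" "0 < \<tau>" and b: "0 < b" "b < 1" and \<kappa>: "0 < \<kappa>" "\<kappa> \<le> 1" "\<kappa> < 2 * b"
    and cont: "continuous_on (S \<rho> \<tau>) (\<lambda>x. z (fst x) (snd x))" "continuous_on (S \<rho> \<tau>) (\<lambda>x. zr (fst x) (snd x))"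
      "continuous_on (S \<rho> \<tau>) (\<lambda>x. zt (fst x) (snd x))"
    and z0: "\<And>t. 0 \<le> t \<Longrightarrow> t \<le> \<tau> \<Longrightarrow> z 0 t = 0"
    and zr: "\<And>r t. r \<in> {0..\<rho>} \<Longrightarrow> t \<in> {0..\<tau>} \<Longrightarrow> ((\<lambda>r. z r t) has_vector_derivative zr r t) (at r within {0..\<rho>})"
    and sm: "smooth_partials ({0<..<\<rho>} \<times> {0<..<\<tau>}) z zr zt zrr zrt zrrr zrrt"
    and v: "zr 0 0 \<noteq> 0"
    and a: "\<And>r. r \<in> {0..\<rho>} \<Longrightarrow> ((\<lambda>r. zr r 0) has_vector_derivative a r) (at r within {0..\<rho>})"
      "\<And>r. r \<in> {0..\<rho>} \<Longrightarrow> norm (a r) \<le> N"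
    and RM: "0 < R" "1 \<le> M"
    and h: "\<And>z. z \<in> ball 0 R \<Longrightarrow> (h has_derivative (\<lambda>v. Re (H z * v))) (at z)"
    and H: "\<And>z. z \<in> ball 0 R \<Longrightarrow> (H has_derivative (\<lambda>v. A z * v + of_real (B z) * cnj v)) (at z)"
    and hb: "\<And>z. z \<in> ball 0 R \<Longrightarrow> \<bar>h z\<bar> \<le> M \<and> norm (H z) \<le> M \<and> norm (A z) \<le> M \<and> \<bar>B z\<bar> \<le> M"
    and flow: "\<And>r t. 0 < r \<Longrightarrow> r < \<rho> \<Longrightarrow> 0 < t \<Longrightarrow> t < \<tau> \<Longrightarrow> z r t \<noteq> 0 \<Longrightarrow> zr r t \<noteq> 0 \<Longrightarrow> norm (z r t) < R \<Longrightarrow>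
      (exp (h (z r t)) * norm (z r t) powr (b - 1) * norm (zr r t))\<^sup>2 * Im (zt r t / zr r t) =
      Im (zrr r t / zr r t) + Im (H (z r t) * zr r t) + (b - 1) * Im (zr r t / z r t)"
    and flow0: "\<And>r. 0 < r \<Longrightarrow> r < \<rho> \<Longrightarrow> z r 0 \<noteq> 0 \<Longrightarrow> zr r 0 \<noteq> 0 \<Longrightarrow> norm (z r 0) < R \<Longrightarrow>
      (exp (h (z r 0)) * norm (z r 0) powr (b - 1) * norm (zr r 0))\<^sup>2 * Im (zt r 0 / zr r 0) =
      Im (a r / zr r 0) + Im (H (z r 0) * zr r 0) + (b - 1) * Im (zr r 0 / z r 0)"
  shows "\<exists>\<rho>' \<tau>' K. 0 < \<rho>' \<and> \<rho>' < \<rho> \<and> 0 < \<tau>' \<and> \<tau>' < \<tau> \<and> 0 \<le> K \<and>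
    (\<forall>r t. 0 < r \<and> r \<le> \<rho>' \<and> 0 \<le> t \<and> t \<le> \<tau>' \<longrightarrow> z r t \<noteq> 0 \<and> zr r t \<noteq> 0 \<and>
      exp (h (z r t)) * norm (z r t) powr (b - 1) * (norm (zr r t) * \<bar>Im (zt r t / zr r t)\<bar>) \<le> K * r powr (\<kappa> - b))"
proof -
  define \<eta> where "\<eta> = min (1/100) ((2 * b - \<kappa>) * (b + \<kappa>) / 10)"
  have "0 < (2 * b - \<kappa>) * (b + \<kappa>)" using \<kappa> b by simp
  then have \<eta>: "0 < \<eta>" "\<eta> \<le> 1/100" "10 * \<eta> \<le> (2 * b - \<kappa>) * (b + \<kappa>)"
    unfolding \<eta>_def by auto
  define v where "v = zr 0 0"
  have v0: "v \<noteq> 0" "0 < norm v" using v by (auto simp: v_def)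
  have N0: "0 \<le> N" using order_trans[OF norm_ge_zero a(2)[of 0]] pos by simp
  \<comment> \<open>\<open>nearly_straight\<close> bounds the angle by 8 times its parameter, so
    this value yields \<open>\<eta>\<close>.\<close>
  define \<epsilon>0 where "\<epsilon>0 = \<eta> / 8"
  have \<epsilon>0: "0 < \<epsilon>0" "\<epsilon>0 \<le> 1/8" using \<eta> by (auto simp: \<epsilon>0_def)
  have "\<exists>d>0. \<forall>x\<in>S \<rho> \<tau>. dist x (0, 0) < d \<longrightarrow> dist (zr (fst x) (snd x)) (zr (fst (0, 0)) (snd (0, 0))) < \<epsilon>0 * norm v"
    using cont(2) pos \<epsilon>0 v0 unfolding continuous_on_iff by (auto simp: S_def)
  then obtain d where d: "0 < d" "\<And>r t. (r, t) \<in> S \<rho> \<tau> \<Longrightarrow> dist (r, t) (0, 0) < d \<Longrightarrow> norm (zr r t - v) \<le> \<epsilon>0 * norm v"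
    by (fastforce simp: v_def dist_norm less_imp_le)
  \<comment> \<open>Upper bounds for \<open>\<rho>1\<close>: to stay in the domain, to stay where
    \<open>zr\<close> is close to v, to get M |z| \<le> \<open>\<eta>\<close>, to keep |z| below R,
    and to keep N r / |v| below 1/8 at time 0.\<close>
  define L where "L = [\<rho>, d / 3, \<eta> / (2 * norm v * M), R / (4 * norm v), norm v / (8 * (N + 1))]"
  define \<rho>1 where "\<rho>1 = Min (set L) / 2"
  define \<tau>1 where "\<tau>1 = min \<tau> (d / 3)"
  have "\<forall>x\<in>set L. 0 < x" using pos d \<eta> v0 RM N0 by (auto simp: L_def)
  then have Lpos: "0 < Min (set L)" by (subst Min_gr_iff) (auto simp: L_def)
  have L_le: "\<rho>1 < x" if "x \<in> set L" for x
  proof -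
    have "Min (set L) \<le> x" using that by (intro Min_le) auto
    then show ?thesis using Lpos by (simp add: \<rho>1_def)
  qed
  have \<rho>1: "0 < \<rho>1" "\<rho>1 < \<rho>" "\<rho>1 < d / 3" "\<rho>1 < \<eta> / (2 * norm v * M)" "\<rho>1 < R / (4 * norm v)" "\<rho>1 < norm v / (8 * (N + 1))"
  proof -
    show "0 < \<rho>1" using Lpos by (simp add: \<rho>1_def)
  qed (rule L_le; simp add: L_def)+
  have \<tau>1: "0 < \<tau>1" "\<tau>1 \<le> \<tau>" "\<tau>1 \<le> d / 3" using pos d by (auto simp: \<tau>1_def)
  have close: "norm (zr r t - v) \<le> \<epsilon>0 * norm v" if "0 \<le> r" "r \<le> \<rho>1" "0 \<le> t" "t \<le> \<tau>1" for r t
  proof (rule d(2))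
    show "(r, t) \<in> S \<rho> \<tau>" using that \<rho>1 \<tau>1 by (auto simp: S_def)
    have "dist (r, t) (0, 0) \<le> \<bar>r\<bar> + \<bar>t\<bar>"
      unfolding dist_Pair_Pair dist_real_def by (rule order_trans[OF sqrt_sum_squares_le_sum_abs]) simp
    also have "\<dots> < d" using that \<rho>1 \<tau>1 d by auto
    finally show "dist (r, t) (0, 0) < d" .
  qed
  have dev: "norm (z r t - of_real r * u) \<le> r * B'"
    if rt: "0 \<le> r" "r \<le> \<rho>1" "0 \<le> t" "t \<le> \<tau>1" and B': "\<And>x. 0 \<le> x \<Longrightarrow> x \<le> r \<Longrightarrow> norm (zr x t - u) \<le> B'" for r t u B'
  proof (rule deviation_from_line[of r "\<lambda>r. z r t" "\<lambda>r. zr r t"])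
    show "((\<lambda>r. z r t) has_vector_derivative zr x t) (at x within {0..r})" if "x \<in> {0..r}" for x
      by (rule has_vector_derivative_within_subset[OF zr]) (use that rt \<rho>1 \<tau>1 in auto)
  qed (use rt z0 B' \<tau>1 in auto)
  have ns: "norm (zr r t - v) \<le> \<epsilon>0 * norm v \<and> norm (z r t - of_real r * v) \<le> r * (\<epsilon>0 * norm v)"
    if rt: "0 < r" "r \<le> \<rho>1" "0 \<le> t" "t \<le> \<tau>1" for r t
    using close[of r t] dev[of r t v "\<epsilon>0 * norm v"] close[of _ t] rt by auto
  note nst = nearly_straight[OF v0(1) _ less_imp_le[OF \<epsilon>0(1)] \<epsilon>0(2) ns[THEN conjunct1] ns[THEN conjunct2]]
  have dom: "z r t \<noteq> 0 \<and> zr r t \<noteq> 0 \<and> Re (zr r t / z r t) > 0 \<and> \<bar>Im (Ln (zr r t / z r t))\<bar> \<le> \<eta> \<and>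
      norm (z r t) \<le> 2 * norm v * r \<and> r * norm v / 2 \<le> norm (z r t) \<and> norm v / 2 \<le> norm (zr r t) \<and> norm (zr r t) \<le> 2 * norm v"
    if rt: "0 < r" "r \<le> \<rho>1" "0 \<le> t" "t \<le> \<tau>1" for r t
    using nst[OF rt(1) rt rt] by (simp add: \<epsilon>0_def mult_ac)
  have zsm: "M * norm (z r t) \<le> \<eta> \<and> norm (z r t) < R" if rt: "0 < r" "r \<le> \<rho>1" "0 \<le> t" "t \<le> \<tau>1" for r t
  proof -
    have le: "norm (z r t) \<le> 2 * norm v * r" using dom[OF rt] by blast
    have "M * norm (z r t) \<le> M * (2 * norm v * r)" using le RM by (intro mult_left_mono) auto
    also have "\<dots> \<le> M * (2 * norm v * (\<eta> / (2 * norm v * M)))"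
      using rt \<rho>1 RM v0 by (intro mult_left_mono) auto
    also have "\<dots> = \<eta>" using RM v0 by simp
    finally have 1: "M * norm (z r t) \<le> \<eta>" .
    have "2 * norm v * r < 2 * norm v * (R / (4 * norm v))"
      using rt \<rho>1 v0 by (intro mult_strict_left_mono) auto
    then have "norm (z r t) < R" using le RM v0 by simp
    with 1 show ?thesis by simp
  qed
  then have zR: "z r t \<in> ball 0 R" if "0 < r" "r \<le> \<rho>1" "0 \<le> t" "t \<le> \<tau>1" for r t using that by simp
  \<comment> \<open>The velocity is bounded up to the vertex. This is the source of
    \<open>k_bound\<close>, as k is e^h |z|^(b - 1) times the normal part of the velocity.\<close>
  have "bounded ((\<lambda>x. zt (fst x) (snd x)) ` S \<rho> \<tau>)"
    by (intro compact_imp_bounded compact_continuous_image cont) (auto simp: S_def compact_Times)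
  then obtain Mt where Mt: "\<And>r t. (r, t) \<in> S \<rho> \<tau> \<Longrightarrow> norm (zt r t) \<le> Mt"
    unfolding bounded_iff by fastforce
  have Mt0: "0 \<le> Mt" using order_trans[OF norm_ge_zero Mt[of 0 0]] pos by (simp add: S_def)
  define P where "P r t = zr r t / z r t" for r t
  define Q where "Q r t = zt r t / z r t" for r t
  \<comment> \<open>Quotient rule for z_r / z and z_t / z. By symmetry of the mixed derivatives
    \<open>Qr\<close> is also the t-derivative of \<open>P\<close>, and \<open>Qrr\<close> that of
    \<open>Pr\<close>.\<close>
  define Pr where "Pr r t = (zrr r t - P r t * zr r t) / z r t" for r t
  define Qr where "Qr r t = (zrt r t - Q r t * zr r t) / z r t" for r t
  define Prr where "Prr r t = (zrrr r t - (P r t * zrr r t + Pr r t * zr r t) - Pr r t * zr r t) / z r t" for r t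
  define Qrr where "Qrr r t = (zrrt r t - (Q r t * zrr r t + Qr r t * zr r t) - Qr r t * zr r t) / z r t" for r t
  have sp: "((\<lambda>r. z r t) has_vector_derivative zr r t) (at r)" "((\<lambda>t. z r t) has_vector_derivative zt r t) (at t)"
    "((\<lambda>r. zr r t) has_vector_derivative zrr r t) (at r)" "((\<lambda>t. zr r t) has_vector_derivative zrt r t) (at t)"
    "((\<lambda>r. zt r t) has_vector_derivative zrt r t) (at r)"
    "((\<lambda>r. zrr r t) has_vector_derivative zrrr r t) (at r)" "((\<lambda>t. zrr r t) has_vector_derivative zrrt r t) (at t)"
    "((\<lambda>r. zrt r t) has_vector_derivative zrrt r t) (at r)"
    if "0 < r" "r < \<rho>1" "0 < t" "t < \<tau>1" for r t
    using sm[unfolded smooth_partials_def, rule_format, of r t] that \<rho>1 \<tau>1 by auto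
  have ell_eq: "exp (h (z r t) + b * ln (norm (z r t)) + ln (norm (P r t))) =
      exp (h (z r t)) * norm (z r t) powr (b - 1) * norm (zr r t)"
    if rt: "0 < r" "r \<le> \<rho>1" "0 \<le> t" "t \<le> \<tau>1" for r t
    using dom[OF rt] by (simp add: P_def exp_add norm_divide powr_def left_diff_distrib exp_diff)
  interpret cone_flow z P Q Pr Qr Prr Qrr h H A B b \<rho>1 \<tau>1
  proof
    fix r t assume rt: "0 < r" "r < \<rho>1" "0 < t" "t < \<tau>1"
    note s = sp[OF rt]
    have z: "z r t \<noteq> 0" "zr r t \<noteq> 0" "norm (z r t) < R" using dom[of r t] zsm[of r t] rt by auto
    show "((\<lambda>r. z r t) has_vector_derivative P r t * z r t) (at r)"
      using s(1) z by (simp add: P_def)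
    show "((\<lambda>t. z r t) has_vector_derivative Q r t * z r t) (at t)"
      using s(2) z by (simp add: Q_def)
    show P_r: "((\<lambda>r. P r t) has_vector_derivative Pr r t) (at r)"
      using has_vector_derivative_quotient[OF s(3,1) z(1)] by (simp add: P_def Pr_def)
    have Qr': "Qr r t = (zrt r t - P r t * zt r t) / z r t"
      by (simp add: Qr_def P_def Q_def mult.commute)
    show P_t: "((\<lambda>t. P r t) has_vector_derivative Qr r t) (at t)"
      unfolding Qr' using has_vector_derivative_quotient[OF s(4,2) z(1)] by (simp add: P_def)
    show Q_r: "((\<lambda>r. Q r t) has_vector_derivative Qr r t) (at r)"
      using has_vector_derivative_quotient[OF s(5,1) z(1)] by (simp add: Q_def Qr_def)
    show "((\<lambda>r. Pr r t) has_vector_derivative Prr r t) (at r)"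
      using has_vector_derivative_quotient[OF has_vector_derivative_diff[OF s(6) has_vector_derivative_mult[OF P_r s(3)]] s(1) z(1)]
      by (simp add: Pr_def Prr_def)
    have "P r t * zrt r t + Qr r t * zr r t + Pr r t * zt r t = Q r t * zrr r t + Qr r t * zr r t + Qr r t * zr r t"
      using z by (simp add: P_def Q_def Pr_def Qr_def field_simps)
    then have "Qrr r t = (zrrt r t - (P r t * zrt r t + Qr r t * zr r t) - Pr r t * zt r t) / z r t"
      unfolding Qrr_def by (simp only: diff_diff_eq)
    then show "((\<lambda>t. Pr r t) has_vector_derivative Qrr r t) (at t)"
      using has_vector_derivative_quotient[OF has_vector_derivative_diff[OF s(7) has_vector_derivative_mult[OF P_t s(4)]] s(2) z(1)]
      by (simp add: Pr_def)
    show "((\<lambda>r. Qr r t) has_vector_derivative Qrr r t) (at r)"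
      using has_vector_derivative_quotient[OF has_vector_derivative_diff[OF s(8) has_vector_derivative_mult[OF Q_r s(3)]] s(1) z(1)]
      by (simp add: Qr_def Qrr_def)
    show "(h has_derivative (\<lambda>v. Re (H (z r t) * v))) (at (z r t))" using h[OF zR] rt by simp
    show "(H has_derivative (\<lambda>v. A (z r t) * v + of_real (B (z r t)) * cnj v)) (at (z r t))" using H[OF zR] rt by simp
    \<comment> \<open>Passing to log z subtracts z_r / z from z_rr / z_r, which raises the
      coefficient b - 1 of the cone term to b.\<close>
    have "Pr r t / P r t = zrr r t / zr r t - zr r t / z r t"
      using z by (simp add: Pr_def P_def field_simps)
    moreover have "(of_real b + H (z r t) * z r t) * P r t = of_real b * (zr r t / z r t) + H (z r t) * zr r t"
      using z by (simp add: P_def distrib_right add_divide_distrib)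
    moreover have "Im (of_real b * (zr r t / z r t)) = b * Im (zr r t / z r t)"
      by (simp only: times_complex.sel Re_complex_of_real Im_complex_of_real mult_zero_left add_0_right)
    moreover have "Q r t / P r t = zt r t / zr r t" using z by (simp add: P_def Q_def)
    ultimately show "Im (Pr r t / P r t) + Im ((of_real b + H (z r t) * z r t) * P r t) =
      (exp (h (z r t) + b * ln (norm (z r t)) + ln (norm (P r t))))\<^sup>2 * Im (Q r t / P r t)"
      using flow[of r t] rt z \<rho>1 \<tau>1 ell_eq[of r t] by (simp add: left_diff_distrib del: times_complex.sel)
  next
    fix r t assume rt: "0 < r" "r < \<rho>1" "0 \<le> t" "t < \<tau>1"
    show "z r t \<noteq> 0" "0 < Re (P r t)" using dom[of r t] rt by (auto simp: P_def)
  qed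
  have k_eq: "\<bar>k r t\<bar> = exp (h (z r t)) * norm (z r t) powr (b - 1) * (norm (zr r t) * \<bar>Im (zt r t / zr r t)\<bar>)"
    if rt: "0 < r" "r \<le> \<rho>1" "0 \<le> t" "t \<le> \<tau>1" for r t
  proof -
    have "Q r t / P r t = zt r t / zr r t" using dom[OF rt] by (simp add: P_def Q_def)
    then show ?thesis
      unfolding k_def ell_def \<xi>_def ell_eq[OF rt] by (simp add: abs_mult)
  qed
  \<comment> \<open>At time 0 the velocity is Lipschitz in r, so \<open>nearly_straight\<close>
    applies with a parameter proportional to r. The angle is then O(r), and Im (zr / z), for which
    continuity of the velocity alone would give only o(1 / r), stays bounded.\<close>
  have init: "norm (zr r 0 - v) \<le> N * r \<and> \<bar>\<omega> r 0\<bar> \<le> 8 * (N * r / norm v) \<and> \<bar>Im (zr r 0 / z r 0)\<bar> \<le> 4 * N / norm v"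
    if r: "0 < r" "r \<le> \<rho>1" for r
  proof -
    have zr_close: "norm (zr x 0 - v) \<le> x * N" if "0 \<le> x" "x \<le> r" for x
    proof -
      have "norm ((zr x 0 - v) - of_real x * 0) \<le> x * N"
      proof (rule deviation_from_line[of x "\<lambda>x. zr x 0 - v" a])
        show "((\<lambda>x. zr x 0 - v) has_vector_derivative a y) (at y within {0..x})" if y: "y \<in> {0..x}" for y
        proof -
          have "((\<lambda>x. zr x 0) has_vector_derivative a y) (at y within {0..x})"
            by (rule has_vector_derivative_within_subset[OF a(1)]) (use y \<open>x \<le> r\<close> r \<rho>1 in auto)
          from has_vector_derivative_diff[OF this has_vector_derivative_const[of v]] show ?thesis by simp
        qed
        show "norm (a y - 0) \<le> N" if y: "y \<in> {0..x}" for y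
          using a(2)[of y] y \<open>x \<le> r\<close> r \<rho>1 by simp
      qed (use that in \<open>auto simp: v_def\<close>)
      then show ?thesis by simp
    qed
    define e where "e = N * r / norm v"
    have "N * r \<le> (N + 1) * (norm v / (8 * (N + 1)))"
      using r \<rho>1(6) N0 by (intro mult_mono) auto
    moreover have "(N + 1) * (norm v / (8 * (N + 1))) = norm v / 8"
      using N0 by (simp add: divide_simps)
    ultimately have "N * r \<le> norm v / 8" by (simp only:)
    then have "8 * (N * r) \<le> norm v" by simp
    then have e: "0 \<le> e" "e \<le> 1/8" "e * norm v = N * r"
      using r N0 v0 by (auto simp: e_def pos_divide_le_eq)
    have "norm (zr r 0 - v) \<le> e * norm v" using zr_close[of r] r e by (simp add: mult.commute)
    moreover have "norm (z r 0 - of_real r * v) \<le> r * (e * norm v)"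
    proof (rule dev)
      show "norm (zr x 0 - v) \<le> e * norm v" if "0 \<le> x" "x \<le> r" for x
        using zr_close[OF that] mult_right_mono[OF that(2) N0] e(3) by (simp add: mult.commute)
    qed (use r \<tau>1 in auto)
    ultimately have "\<bar>Im (Ln (zr r 0 / z r 0))\<bar> \<le> 8 * e" "\<bar>Im (zr r 0 / z r 0)\<bar> \<le> 4 * e / r"
      using nearly_straight(4,7)[OF v0(1) r(1) e(1,2)] by auto
    then show ?thesis
      using zr_close[of r] r by (simp add: \<omega>_def P_def e_def mult.commute)
  qed
  \<comment> \<open>The last factor bounds the right side of \<open>flow0\<close>; the factors
    before it, together with |z|^(1 - b), bound 1 / l. Since l k equals that right side up to sign,
    this gives the bound of order |z|^(1 - b) on k at time 0.\<close>
  define Ck where "Ck = exp M * (2 / norm v) * (N * (2 / norm v) + M * (2 * norm v) + 4 * N / norm v)"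
  define C where "C = 1 + 2 * norm v + 16 * N / (norm v)\<^sup>2 + exp M * Mt + Ck"
  have Cp: "0 \<le> 16 * N / (norm v)\<^sup>2" "0 \<le> exp M * Mt" "0 \<le> Ck"
    using N0 Mt0 v0 RM by (auto simp: Ck_def)
  then have C: "1 \<le> C" "2 * norm v \<le> C" "16 * N / (norm v)\<^sup>2 \<le> C" "exp M * Mt \<le> C" "Ck \<le> C"
    unfolding C_def using v0 by linarith+
  have sub: "{0<..<\<rho>1} \<times> {0..<\<tau>1} \<subseteq> S \<rho> \<tau>" using \<rho>1 \<tau>1 by (auto simp: S_def)
  note c = cont[THEN continuous_on_subset, OF sub]
  have nz: "z (fst x) (snd x) \<noteq> 0" "z (fst x) (snd x) \<in> ball 0 R" if "x \<in> {0<..<\<rho>1} \<times> {0..<\<tau>1}" for x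
    using dom[of "fst x" "snd x"] zR[of "fst x" "snd x"] that by auto
  interpret cone_flow_bounds z P Q Pr Qr Prr Qrr h H A B b \<rho>1 \<tau>1 C M \<kappa> \<eta>
  proof
    show "0 < b" "b < 1" "1 \<le> C" "1 \<le> M" "0 < \<kappa>" "\<kappa> \<le> 1" "\<kappa> < 2 * b" "0 < \<eta>" "\<eta> \<le> 1/100"
      "10 * \<eta> \<le> (2 * b - \<kappa>) * (b + \<kappa>)" by (fact b C RM \<kappa> \<eta>)+
    show "continuous_on ({0<..<\<rho>1} \<times> {0..<\<tau>1}) (\<lambda>x. z (fst x) (snd x))" by (rule c)
    show "continuous_on ({0<..<\<rho>1} \<times> {0..<\<tau>1}) (\<lambda>x. P (fst x) (snd x))"
      "continuous_on ({0<..<\<rho>1} \<times> {0..<\<tau>1}) (\<lambda>x. Q (fst x) (snd x))"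
      unfolding P_def Q_def using nz by (auto intro!: continuous_intros c)
    have "continuous_on (ball 0 R) h"
      using h by (intro has_derivative_continuous_on) (auto intro: has_derivative_at_withinI)
    then show "continuous_on ({0<..<\<rho>1} \<times> {0..<\<tau>1}) (\<lambda>x. h (z (fst x) (snd x)))"
      by (rule continuous_on_compose2[OF _ c(1)]) (use nz in auto)
  next
    fix r t assume rt: "0 < r" "r < \<rho>1" "0 \<le> t" "t < \<tau>1"
    then have rt': "0 < r" "r \<le> \<rho>1" "0 \<le> t" "t \<le> \<tau>1" by auto
    note D = dom[OF rt']
    show "M * norm (z r t) \<le> \<eta>" using zsm[OF rt'] by simp
    show "\<bar>h (z r t)\<bar> \<le> M" "norm (H (z r t)) \<le> M" "norm (A (z r t)) \<le> M" "\<bar>B (z r t)\<bar> \<le> M"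
      using hb[OF zR[OF rt']] by auto
    show "norm (z r t) \<le> C * r"
      using D mult_right_mono[OF C(2), of r] rt by linarith
    show "\<bar>\<omega> r t\<bar> \<le> \<eta>" using D by (simp add: \<omega>_def P_def)
    have "norm (zr r t) * \<bar>Im (zt r t / zr r t)\<bar> \<le> norm (zr r t) * norm (zt r t / zr r t)"
      by (intro mult_left_mono abs_Im_le_cmod) auto
    also have "\<dots> = norm (zt r t)" using D by (simp add: norm_divide)
    also have "\<dots> \<le> Mt" using Mt[of r t] rt \<rho>1 \<tau>1 by (simp add: S_def)
    finally have "\<bar>k r t\<bar> \<le> (exp M * norm (z r t) powr (b - 1)) * Mt"
      unfolding k_eq[OF rt'] using hb[OF zR[OF rt']] by (intro mult_mono) auto
    also have "\<dots> \<le> C * norm (z r t) powr (b - 1)"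
      using mult_right_mono[OF C(4), of "norm (z r t) powr (b - 1)"] by (simp add: mult_ac)
    finally show "\<bar>k r t\<bar> \<le> C * norm (z r t) powr (b - 1)" .
  next
    fix r assume r: "0 < r" "r < \<rho>1"
    then have r': "0 < r" "r \<le> \<rho>1" by auto
    have rt: "0 < r" "r \<le> \<rho>1" "0 \<le> (0::real)" "0 \<le> \<tau>1" using r \<tau>1 by auto
    note D = dom[OF rt] and I = init[OF r']
    have "8 * (N * r / norm v) = (16 * N / (norm v)\<^sup>2) * (r * norm v / 2)"
      using v0 by (simp add: power2_eq_square field_simps)
    also have "\<dots> \<le> C * norm (z r 0)"
      using C D r v0 by (intro mult_mono) auto
    finally show "\<bar>\<omega> r 0\<bar> \<le> C * norm (z r 0)" using I by linarith
    define l where "l = exp (h (z r 0)) * norm (z r 0) powr (b - 1) * norm (zr r 0)"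
    have hM: "\<bar>h (z r 0)\<bar> \<le> M" "norm (H (z r 0)) \<le> M" using hb[OF zR[OF rt]] by auto
    have lpos: "0 < l" using D by (simp add: l_def)
    have kl: "\<bar>k r 0\<bar> = l * \<bar>Im (zt r 0 / zr r 0)\<bar>"
      unfolding k_eq[OF rt] l_def by simp
    have "l\<^sup>2 * Im (zt r 0 / zr r 0) =
      Im (a r / zr r 0) + Im (H (z r 0) * zr r 0) + (b - 1) * Im (zr r 0 / z r 0)"
      unfolding l_def using flow0[of r] r \<rho>1 D zsm[OF rt] by simp
    moreover have "\<bar>Im (a r / zr r 0)\<bar> \<le> N * (2 / norm v)"
    proof -
      have "\<bar>Im (a r / zr r 0)\<bar> \<le> norm (a r) * (1 / norm (zr r 0))"
        using abs_Im_le_cmod[of "a r / zr r 0"] by (simp add: norm_divide)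
      also have "\<dots> \<le> N * (1 / (norm v / 2))"
        using a(2)[of r] r \<rho>1 D v0 N0 by (intro mult_mono divide_left_mono) auto
      finally show ?thesis by simp
    qed
    moreover have "\<bar>Im (H (z r 0) * zr r 0)\<bar> \<le> M * (2 * norm v)"
      using abs_Im_le_cmod[of "H (z r 0) * zr r 0"] mult_mono[of "norm (H (z r 0))" M "norm (zr r 0)" "2 * norm v"] hM D RM
      unfolding norm_mult by auto
    moreover have "\<bar>(b - 1) * Im (zr r 0 / z r 0)\<bar> \<le> 4 * N / norm v"
      using mult_mono[of "\<bar>b - 1\<bar>" 1 "\<bar>Im (zr r 0 / z r 0)\<bar>" "4 * N / norm v"] b I by (simp add: abs_mult)
    ultimately have "\<bar>l\<^sup>2 * Im (zt r 0 / zr r 0)\<bar> \<le> N * (2 / norm v) + M * (2 * norm v) + 4 * N / norm v"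
      by linarith
    then have "l * \<bar>k r 0\<bar> \<le> N * (2 / norm v) + M * (2 * norm v) + 4 * N / norm v"
      unfolding kl using lpos by (simp add: abs_mult power2_eq_square mult.assoc)
    then have "\<bar>k r 0\<bar> \<le> (1 / l) * (N * (2 / norm v) + M * (2 * norm v) + 4 * N / norm v)"
      using lpos by (simp add: field_simps)
    also have "\<dots> \<le> (exp M * norm (z r 0) powr (1 - b) * (2 / norm v)) * (N * (2 / norm v) + M * (2 * norm v) + 4 * N / norm v)"
    proof (rule mult_right_mono)
      have "1 / l = exp (- h (z r 0)) * norm (z r 0) powr (1 - b) * (1 / norm (zr r 0))"
        using D by (simp add: l_def exp_minus powr_diff divide_simps)
      also have "\<dots> \<le> exp M * norm (z r 0) powr (1 - b) * (1 / (norm v / 2))"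
        using hM D v0 by (intro mult_mono divide_left_mono) auto
      finally show "1 / l \<le> exp M * norm (z r 0) powr (1 - b) * (2 / norm v)" by simp
    qed (use N0 v0 RM in auto)
    also have "\<dots> = Ck * norm (z r 0) powr (1 - b)" by (simp add: Ck_def)
    also have "\<dots> \<le> C * norm (z r 0) powr (1 - b)" using C by (intro mult_right_mono) auto
    finally show "\<bar>k r 0\<bar> \<le> C * norm (z r 0) powr (1 - b)" .
  next
    fix \<delta> :: real assume "0 < \<delta>"
    define e where "e = min (1/8) (\<delta> / 16)"
    have e: "0 < e" "e \<le> 1/8" "8 * e < \<delta>" using \<open>0 < \<delta>\<close> by (auto simp: e_def)
    have "uniformly_continuous_on (S \<rho> \<tau>) (\<lambda>x. zr (fst x) (snd x))"
      by (intro compact_uniformly_continuous cont) (auto simp: S_def compact_Times)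
    then obtain d' where d': "d' > 0" "\<And>x y. x \<in> S \<rho> \<tau> \<Longrightarrow> y \<in> S \<rho> \<tau> \<Longrightarrow> dist y x < d' \<Longrightarrow>
        dist (zr (fst y) (snd y)) (zr (fst x) (snd x)) < e * (norm v / 2)"
      unfolding uniformly_continuous_on_def using e v0 by (metis half_gt_zero mult_pos_pos)
    show "\<exists>\<rho>'>0. \<forall>r t. 0 < r \<and> r < \<rho>' \<and> r < \<rho>1 \<and> 0 \<le> t \<and> t < \<tau>1 \<longrightarrow> \<bar>\<omega> r t\<bar> < \<delta>"
    proof (intro exI[of _ d'] conjI allI impI d')
      fix r t assume rt: "0 < r \<and> r < d' \<and> r < \<rho>1 \<and> 0 \<le> t \<and> t < \<tau>1"
      \<comment> \<open>The tangent at the vertex may turn with time, so the curve is compared with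
        its own tangent u at time t rather than with v. Uniform continuity makes the rate
        independent of t.\<close>
      define u where "u = zr 0 t"
      have "norm (u - v) \<le> \<epsilon>0 * norm v" using close[of 0 t] rt \<rho>1 by (simp add: u_def)
      also have "\<dots> \<le> 1/8 * norm v" using \<epsilon>0 by (intro mult_right_mono) auto
      finally have "norm (u - v) \<le> 1/8 * norm v" .
      moreover have "norm v - norm (u - v) \<le> norm u"
        using norm_triangle_ineq2[of v "v - u"] by (simp add: norm_minus_commute)
      ultimately have u: "norm v / 2 \<le> norm u" using v0(2) by linarith
      with v0(2) have u0: "u \<noteq> 0" by auto
      have near: "norm (zr x t - u) \<le> e * norm u" if "0 \<le> x" "x \<le> r" for x
      proof -
        have "(0, t) \<in> S \<rho> \<tau>" "(x, t) \<in> S \<rho> \<tau>" "dist (x, t) (0, t) < d'"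
          using that rt \<rho>1 \<tau>1 by (auto simp: S_def dist_Pair_Pair)
        from d'(2)[OF this] have "norm (zr x t - u) < e * (norm v / 2)"
          by (simp add: dist_norm u_def)
        moreover have "e * (norm v / 2) \<le> e * norm u"
          using u e by (intro mult_left_mono) auto
        ultimately show ?thesis by linarith
      qed
      have "norm (z r t - of_real r * u) \<le> r * (e * norm u)"
        by (rule dev) (use rt near in auto)
      then have "\<bar>Im (Ln (zr r t / z r t))\<bar> \<le> 8 * e"
        using nearly_straight(4)[OF u0 _ _ e(2) near[of r]] rt e by auto
      then show "\<bar>\<omega> r t\<bar> < \<delta>" using e by (simp add: \<omega>_def P_def)
    qed
  qed
  have half: "0 < \<rho>1 / 2" "\<rho>1 / 2 < \<rho>1" "0 \<le> \<tau>1 / 2" "\<tau>1 / 2 < \<tau>1" using \<rho>1 \<tau>1 by auto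
  obtain K where K: "K > 0" "\<And>r t. 0 < r \<Longrightarrow> r \<le> \<rho>1 / 2 \<Longrightarrow> 0 \<le> t \<Longrightarrow> t \<le> \<tau>1 / 2 \<Longrightarrow>
      \<bar>k r t\<bar> \<le> K * norm (z r t) powr (\<kappa> - b)"
    using curvature_estimate[OF half] by blast
  \<comment> \<open>The sign of \<open>\<kappa> - b\<close> is open; |z| lies between |v| r / 2 and
    2 |v| r, and adding both powers covers either sign.\<close>
  define K' where "K' = K * ((2 * norm v) powr (\<kappa> - b) + (norm v / 2) powr (\<kappa> - b))"
  have "0 \<le> K'" using K by (simp add: K'_def)
  show ?thesis
  proof (rule exI[of _ "\<rho>1 / 2"], rule exI[of _ "\<tau>1 / 2"], rule exI[of _ K'], intro conjI allI impI)
    show "0 < \<rho>1 / 2" "\<rho>1 / 2 < \<rho>" "0 < \<tau>1 / 2" "\<tau>1 / 2 < \<tau>" "0 \<le> K'" using \<rho>1 \<tau>1 \<open>0 \<le> K'\<close> by auto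
    fix r t assume "0 < r \<and> r \<le> \<rho>1 / 2 \<and> 0 \<le> t \<and> t \<le> \<tau>1 / 2"
    then have rt2: "0 < r" "r \<le> \<rho>1 / 2" "0 \<le> t" "t \<le> \<tau>1 / 2" by auto
    then have rt: "0 < r" "r \<le> \<rho>1" "0 \<le> t" "t \<le> \<tau>1" using \<rho>1 \<tau>1 by auto
    note D = dom[OF rt]
    show "z r t \<noteq> 0" "zr r t \<noteq> 0" using D by auto
    have "norm (z r t) powr (\<kappa> - b) \<le> (2 * norm v * r) powr (\<kappa> - b) + (norm v / 2 * r) powr (\<kappa> - b)"
    proof (cases "0 \<le> \<kappa> - b")
      case True
      have "norm (z r t) powr (\<kappa> - b) \<le> (2 * norm v * r) powr (\<kappa> - b)"
        using D True by (intro powr_mono2) auto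
      then show ?thesis by (simp add: add_increasing2)
    next
      case False
      have "norm (z r t) powr (\<kappa> - b) \<le> (norm v / 2 * r) powr (\<kappa> - b)"
        using D False rt v0 by (intro powr_mono2') (auto simp: mult.commute)
      then show ?thesis by (simp add: add_increasing)
    qed
    also have "\<dots> = ((2 * norm v) powr (\<kappa> - b) + (norm v / 2) powr (\<kappa> - b)) * r powr (\<kappa> - b)"
    proof -
      have "(2 * norm v * r) powr (\<kappa> - b) = (2 * norm v) powr (\<kappa> - b) * r powr (\<kappa> - b)"
        "(norm v / 2 * r) powr (\<kappa> - b) = (norm v / 2) powr (\<kappa> - b) * r powr (\<kappa> - b)"
        by (rule powr_mult; use rt in simp)+
      then show ?thesis by (simp only: distrib_right)
    qed
    finally have "K * norm (z r t) powr (\<kappa> - b) \<le> K' * r powr (\<kappa> - b)"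
      using K(1) by (simp add: K'_def mult.assoc)
    then show "exp (h (z r t)) * norm (z r t) powr (b - 1) * (norm (zr r t) * \<bar>Im (zt r t / zr r t)\<bar>) \<le> K' * r powr (\<kappa> - b)"
      using K(2)[OF rt2] k_eq[OF rt] by simp
  qed
qed

section \<open>The flow in an arbitrary chart\<close>

text \<open>
  The flow equation prescribes the derivative of the tangent angle for positive times; since the
  right hand side is continuous up to time zero, so is the curvature.
\<close>

lemma angle_derivative_limit:
  fixes w :: "real \<Rightarrow> real \<Rightarrow> complex" and F :: "real \<Rightarrow> real \<Rightarrow> real"
  assumes d: "0 < d"
    and w: "continuous_on ({r0..<r0 + d} \<times> {0..<d}) (\<lambda>x. w (fst x) (snd x))" "w r0 0 \<noteq> 0"
    and F: "continuous_on ({r0..<r0 + d} \<times> {0..<d}) (\<lambda>x. F (fst x) (snd x))"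
    and w_r: "\<And>r t. r0 \<le> r \<Longrightarrow> r < r0 + d \<Longrightarrow> 0 < t \<Longrightarrow> t < d \<Longrightarrow> w r t \<noteq> 0 \<Longrightarrow>
      \<exists>w'. ((\<lambda>r. w r t) has_vector_derivative w') (at r) \<and> Im (w' / w r t) = F r t"
    and a: "((\<lambda>r. w r 0) has_vector_derivative a) (at r0)"
  shows "Im (a / w r0 0) = F r0 0"
proof -
  let ?X = "{r0..<r0 + d} \<times> {0..<d}"
  \<comment> \<open>Normalised to 1 at the corner, so that nearby values stay in the right half
    plane and the principal argument is continuous.\<close>
  define q where "q r t = w r t / w r0 0" for r t
  have cq: "continuous_on ?X (\<lambda>x. q (fst x) (snd x))"
    unfolding q_def using w by (auto intro!: continuous_intros)
  define \<theta> where "\<theta> r t = Im (Ln (q r t))" for r t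
  have X0: "(r0, 0) \<in> ?X" using d by auto
  have "\<bar>Im (a / w r0 0) - F r0 0\<bar> \<le> 0 + e" if "e > 0" for e
  proof -
    obtain d1 where d1: "d1 > 0" "\<And>x. x \<in> ?X \<Longrightarrow> dist x (r0, 0) < d1 \<Longrightarrow> dist (q (fst x) (snd x)) (q r0 0) < 1"
      using cq X0 unfolding continuous_on_iff by (metis fst_conv snd_conv zero_less_one)
    obtain d2 where d2: "d2 > 0" "\<And>x. x \<in> ?X \<Longrightarrow> dist x (r0, 0) < d2 \<Longrightarrow> dist (F (fst x) (snd x)) (F r0 0) < e"
      using F X0 \<open>e > 0\<close> unfolding continuous_on_iff by (metis fst_conv snd_conv)
    define k where "k = min d (min d1 d2) / 3"
    have k: "0 < k" "k < d" "3 * k \<le> d1" "3 * k \<le> d2" using d d1 d2 by (auto simp: k_def)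
    have near: "(r, t) \<in> ?X \<and> dist (r, t) (r0, 0) < d1 \<and> dist (r, t) (r0, 0) < d2"
      if "r0 \<le> r" "r \<le> r0 + k" "0 \<le> t" "t \<le> k" for r t
    proof -
      have "dist (r, t) (r0, 0) \<le> \<bar>r - r0\<bar> + \<bar>t - 0\<bar>"
        unfolding dist_Pair_Pair dist_real_def by (rule order_trans[OF sqrt_sum_squares_le_sum_abs]) simp
      also have "\<dots> < 3 * k" using that k by auto
      finally show ?thesis using that k by auto
    qed
    have q_pos: "Re (q r t) > 0" if "r0 \<le> r" "r \<le> r0 + k" "0 \<le> t" "t \<le> k" for r t
    proof -
      have "norm (q r t - 1) < 1"
        using d1(2)[of "(r, t)"] near[OF that] w(2) by (auto simp: q_def dist_norm)
      then have "\<bar>Re (q r t) - 1\<bar> < 1" using abs_Re_le_cmod[of "q r t - 1"] by simp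
      then show ?thesis by linarith
    qed
    have Fe: "\<bar>F r t - F r0 0\<bar> < e" if "r0 \<le> r" "r \<le> r0 + k" "0 \<le> t" "t \<le> k" for r t
      using d2(2)[of "(r, t)"] near[OF that] by (auto simp: dist_real_def)
    \<comment> \<open>The difference quotient of the angle at a positive time, with an error uniform
      in that time. It survives the limit t \<rightarrow> 0, although the r-derivative of w need not
      converge.\<close>
    have step: "\<bar>\<theta> (r0 + \<eta>) t - \<theta> r0 t - \<eta> * F r0 0\<bar> \<le> \<eta> * e" if \<eta>: "0 < \<eta>" "\<eta> \<le> k" and t: "0 < t" "t \<le> k" for \<eta> t
    proof -
      have "\<exists>x>r0. x < r0 + \<eta> \<and> \<theta> (r0 + \<eta>) t - \<theta> r0 t = (r0 + \<eta> - r0) * F x t"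
      proof (rule MVT2)
        show "r0 < r0 + \<eta>" using \<eta> by simp
        fix x assume x: "r0 \<le> x" "x \<le> r0 + \<eta>"
        then have p: "Re (q x t) > 0" using q_pos[of x t] \<eta> t by simp
        then have nz: "w x t \<noteq> 0" by (auto simp: q_def)
        obtain w' where w': "((\<lambda>r. w r t) has_vector_derivative w') (at x)" "Im (w' / w x t) = F x t"
          using w_r[of x t] x \<eta> t k nz by auto
        have "((\<lambda>r. q r t) has_vector_derivative w' / w r0 0) (at x)"
          unfolding q_def using has_vector_derivative_mult_left[OF w'(1), of "inverse (w r0 0)"]
          by (simp add: divide_inverse)
        from has_real_derivative_Arg[OF this p] show "((\<lambda>x. \<theta> x t) has_real_derivative F x t) (at x)"
          using w'(2) w(2) by (simp add: \<theta>_def q_def)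
      qed
      then obtain x where x: "r0 < x" "x < r0 + \<eta>" "\<theta> (r0 + \<eta>) t - \<theta> r0 t = \<eta> * F x t" by auto
      have "\<theta> (r0 + \<eta>) t - \<theta> r0 t - \<eta> * F r0 0 = \<eta> * (F x t - F r0 0)"
        unfolding x(3) by (simp add: right_diff_distrib)
      then show ?thesis
        using Fe[of x t] x \<eta> t by (simp add: abs_mult mult_left_mono)
    qed
    have lim: "((\<lambda>t. \<theta> r t) \<longlongrightarrow> \<theta> r 0) (at_right 0)" if "r0 \<le> r" "r \<le> r0 + k" for r
    proof -
      have "continuous_on {0..k} (\<lambda>t. q (fst (r, t)) (snd (r, t)))"
        by (rule continuous_on_compose2[OF cq]) (use that k in \<open>auto intro!: continuous_intros\<close>)
      then have "continuous_on {0..k} (\<lambda>t. q r t)" by simp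
      moreover have "q r t \<notin> \<real>\<^sub>\<le>\<^sub>0" if "t \<in> {0..k}" for t
        using q_pos[of r t] that \<open>r0 \<le> r\<close> \<open>r \<le> r0 + k\<close> by (auto simp: complex_nonpos_Reals_iff)
      ultimately have "continuous_on {0..k} (\<theta> r)"
        unfolding \<theta>_def by (intro continuous_intros) auto
      then have "(\<theta> r \<longlongrightarrow> \<theta> r 0) (at 0 within {0..k})" using k by (auto simp: continuous_on_def)
      then show ?thesis using k by (simp add: at_within_Icc_at_right)
    qed
    have step0: "\<bar>\<theta> (r0 + \<eta>) 0 - \<theta> r0 0 - \<eta> * F r0 0\<bar> \<le> \<eta> * e" if \<eta>: "0 < \<eta>" "\<eta> \<le> k" for \<eta>
    proof (rule tendsto_upperbound)
      show "((\<lambda>t. \<bar>\<theta> (r0 + \<eta>) t - \<theta> r0 t - \<eta> * F r0 0\<bar>) \<longlongrightarrow> \<bar>\<theta> (r0 + \<eta>) 0 - \<theta> r0 0 - \<eta> * F r0 0\<bar>) (at_right 0)"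
        using \<eta> k by (intro tendsto_intros lim) auto
      show "\<forall>\<^sub>F t in at_right 0. \<bar>\<theta> (r0 + \<eta>) t - \<theta> r0 t - \<eta> * F r0 0\<bar> \<le> \<eta> * e"
        unfolding eventually_at_right_field using k step[OF \<eta>] by (intro exI[of _ k]) auto
    qed simp
    have "((\<lambda>r. q r 0) has_vector_derivative a / w r0 0) (at r0)"
      unfolding q_def using has_vector_derivative_mult_left[OF a, of "inverse (w r0 0)"]
      by (simp add: divide_inverse)
    from has_real_derivative_Arg[OF this q_pos] have "((\<lambda>x. \<theta> x 0) has_real_derivative Im (a / w r0 0)) (at r0)"
      using k w(2) by (simp add: \<theta>_def q_def)
    then have "((\<lambda>\<eta>. (\<theta> (r0 + \<eta>) 0 - \<theta> r0 0) / \<eta>) \<longlongrightarrow> Im (a / w r0 0)) (at 0)"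
      by (simp add: DERIV_def)
    then have L: "((\<lambda>\<eta>. \<bar>(\<theta> (r0 + \<eta>) 0 - \<theta> r0 0) / \<eta> - F r0 0\<bar>) \<longlongrightarrow> \<bar>Im (a / w r0 0) - F r0 0\<bar>) (at_right 0)"
      by (intro tendsto_intros) (rule filterlim_at_split[THEN iffD1, THEN conjunct2])
    have "\<bar>Im (a / w r0 0) - F r0 0\<bar> \<le> e"
    proof (rule tendsto_upperbound[OF L])
      have "\<bar>(\<theta> (r0 + \<eta>) 0 - \<theta> r0 0) / \<eta> - F r0 0\<bar> \<le> e" if \<eta>: "0 < \<eta>" "\<eta> < k" for \<eta>
      proof -
        have "(\<theta> (r0 + \<eta>) 0 - \<theta> r0 0) / \<eta> - F r0 0 = (\<theta> (r0 + \<eta>) 0 - \<theta> r0 0 - \<eta> * F r0 0) / \<eta>"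
          using \<eta> by (simp add: field_simps)
        then show ?thesis using step0[of \<eta>] \<eta> by (simp add: pos_divide_le_eq mult.commute)
      qed
      then show "\<forall>\<^sub>F \<eta> in at_right 0. \<bar>(\<theta> (r0 + \<eta>) 0 - \<theta> r0 0) / \<eta> - F r0 0\<bar> \<le> e"
        unfolding eventually_at_right_field using k by (intro exI[of _ k]) auto
    qed simp
    then show ?thesis by simp
  qed
  then have "\<bar>Im (a / w r0 0) - F r0 0\<bar> \<le> 0" by (rule field_le_epsilon)
  then show ?thesis by simp
qed

section \<open>Charts and conformal metrics on the surface\<close>

lemma chart_image_open:
  assumes "complex_structure A" "c \<in> A" "open W"
  shows "open (snd c ` (fst c \<inter> W))"
proof -
  have c: "open (fst c)" "open (snd c ` fst c)" "homeomorphism (fst c) (snd c ` fst c) (snd c) (inv_into (fst c) (snd c))"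
    using assms unfolding complex_structure_def is_chart_def by (auto simp: case_prod_beta)
  have "openin (top_of_set (fst c)) (fst c \<inter> W)" using assms(3) by (simp add: openin_open_Int)
  from homeomorphism_imp_open_map[OF c(3) this] show ?thesis
    using c(2) openin_open_trans by blast
qed

lemma inv_into_chart:
  assumes "complex_structure A" "c \<in> A" "q \<in> fst c"
  shows "inv_into (fst c) (snd c) (snd c q) = q"
proof -
  have "homeomorphism (fst c) (snd c ` fst c) (snd c) (inv_into (fst c) (snd c))"
    using assms unfolding complex_structure_def is_chart_def by (auto simp: case_prod_beta)
  then show ?thesis using assms(3) by (rule homeomorphism_apply1)
qed

text \<open>Invariance under multiplication by i gives 1 and i the same length, and G 1 i = G i (-1)
  = - G 1 i makes them orthogonal.\<close>

lemma hermitian_form_conformal: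
  fixes G :: "complex \<Rightarrow> complex \<Rightarrow> real"
  assumes G: "bilinear G" "\<And>u v. G u v = G v u" "\<And>u v. G (\<i> * u) (\<i> * v) = G u v"
  shows "G u v = G 1 1 * (u \<bullet> v)"
proof -
  have ii: "G \<i> \<i> = G 1 1" using G(3)[of 1 1] by simp
  have "G 1 \<i> = G \<i> (- 1)" using G(3)[of 1 \<i>] by simp
  also have "\<dots> = - G 1 \<i>" using bilinear_rneg[OF G(1), of \<i> 1] G(2)[of \<i> 1] by simp
  finally have 1: "G 1 \<i> = 0" "G \<i> 1 = 0" using G(2)[of \<i> 1] by simp_all
  have e: "w = Re w *\<^sub>R 1 + Im w *\<^sub>R \<i>" for w by (simp add: complex_eq_iff)
  have "G u v = G (Re u *\<^sub>R 1 + Im u *\<^sub>R \<i>) (Re v *\<^sub>R 1 + Im v *\<^sub>R \<i>)" using e[of u] e[of v] by simp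
  also have "\<dots> = G 1 1 * (u \<bullet> v)"
    unfolding bilinear_ladd[OF G(1)] bilinear_radd[OF G(1)] bilinear_lmul[OF G(1)] bilinear_rmul[OF G(1)] ii 1
    by (simp add: inner_complex_def algebra_simps)
  finally show ?thesis .
qed

lemma Ck_on_complex_gradient:
  fixes f :: "complex \<Rightarrow> real"
  assumes "open X" "Ck_on \<infinity> X f"
  obtains f1 f2 where "continuous_on X f" "continuous_on X f1" "continuous_on X f2"
    "\<And>x. x \<in> X \<Longrightarrow> (f has_derivative (\<lambda>h. Re h * f1 x + Im h * f2 x)) (at x)"
proof -
  obtain D :: "complex list \<Rightarrow> complex \<Rightarrow> real" where D_Nil: "\<forall>x\<in>X. D [] x = f x"
    and D_der: "\<forall>bs. set bs \<subseteq> Basis \<and> enat (length bs) < \<infinity> \<longrightarrow> (\<forall>x\<in>X.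
      (D bs has_derivative (\<lambda>h. \<Sum>b\<in>Basis. (h \<bullet> b) *\<^sub>R D (b # bs) x)) (at x within X))"
    and D_cont: "\<forall>bs. set bs \<subseteq> Basis \<and> enat (length bs) \<le> \<infinity> \<longrightarrow> continuous_on X (D bs)"
    using assms(2) unfolding Ck_on_def by blast
  show thesis
  proof (rule that[of "D [1]" "D [\<i>]"])
    show "continuous_on X (D [1])" "continuous_on X (D [\<i>])"
      by (rule D_cont[rule_format]; simp add: Basis_complex_def)+
    have "continuous_on X (D [])" by (rule D_cont[rule_format]) simp
    then show "continuous_on X f" using D_Nil by (simp cong: continuous_on_cong)
    show "(f has_derivative (\<lambda>h. Re h * D [1] x + Im h * D [\<i>] x)) (at x)" if x: "x \<in> X" for x
    proof -
      have "(D [] has_derivative (\<lambda>h. \<Sum>b\<in>Basis. (h \<bullet> b) *\<^sub>R D (b # []) x)) (at x within X)"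
        by (rule D_der[rule_format, OF _ x]) simp
      then have "(D [] has_derivative (\<lambda>h. Re h * D [1] x + Im h * D [\<i>] x)) (at x)"
        using at_within_open[OF x assms(1)] by (simp add: Basis_complex_def)
      then show ?thesis
        by (rule has_derivative_transform_within_open[OF _ assms(1) x]) (use D_Nil in auto)
    qed
  qed
qed

text \<open>\<open>g0\<close> is hermitian, and conformality passes this on to \<open>g\<close> away
  from the singular points. So in every chart the metric is one positive function times the
  Euclidean one.\<close>

lemma conformal_factor:
  assumes "riemann_surface A g0" and g: "riemannian_metric_on A (- S) g" "conformal_on A (- S) g g0"
    and c: "c \<in> A" and y: "y \<in> snd c ` (fst c \<inter> - S)"
  shows "g c y u v = g c y 1 1 * (u \<bullet> v)" "g c y 1 1 > 0"
proof -
  obtain q where q: "q \<in> fst c" "q \<in> - S" "y = snd c q" using y by auto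
  have "hermitian A g0" using assms(1) by (simp add: riemann_surface_def)
  then have h0: "g0 c y (\<i> * u) (\<i> * v) = g0 c y u v" for u v
    using c q unfolding hermitian_def by blast
  obtain \<mu> where \<mu>: "g c y u v = \<mu> q * g0 c y u v" for u v
    using g(2) c q unfolding conformal_on_def by blast
  have m: "bilinear (g c y)" "g c y u v = g c y v u" "u \<noteq> 0 \<Longrightarrow> g c y u u > 0" for u v
    using g(1) c q unfolding riemannian_metric_on_def by blast+
  show "g c y u v = g c y 1 1 * (u \<bullet> v)"
    by (rule hermitian_form_conformal[OF m(1,2)]) (simp add: \<mu> h0)
  show "g c y 1 1 > 0" by (rule m(3)) simp
qed

section \<open>One smooth arc of the flow\<close>

context
  fixes A :: "'a::{t2_space, second_countable_topology} chart set" and g0 g :: "'a metric_tensor"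
    and S :: "'a set" and a b T :: real and \<gamma> :: "real \<Rightarrow> 'a" and \<Gamma> :: "real \<times> real \<Rightarrow> 'a"
  assumes surface: "riemann_surface A g0" and S: "finite S"
    and metric: "riemannian_metric_on A (- S) g" "conformal_on A (- S) g g0"
    and C1: "Ck_map_on 1 A ({a..b} \<times> {0..T}) \<Gamma>"
    and smooth: "Ck_map_on \<infinity> A ({a<..<b} \<times> {0<..<T}) \<Gamma>"
    and flow: "flow_equation A g S a b T \<Gamma>"
    and initial: "Ck_map_on \<infinity> A {a..b} \<gamma>" "\<And>r. r \<in> {a..b} \<Longrightarrow> \<Gamma> (r, 0) = \<gamma> r"
    and regular: "\<And>r t. r \<in> {a<..<b} \<Longrightarrow> t \<in> {0..<T} \<Longrightarrow> \<Gamma> (r, t) \<notin> S"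
begin

lemma cs: "complex_structure A" using surface by (simp add: riemann_surface_def)

lemma open_X: "c \<in> A \<Longrightarrow> open (snd c ` (fst c \<inter> - S))"
  by (rule chart_image_open[OF cs]) (use S in \<open>auto intro: finite_imp_closed\<close>)

text \<open>Through the flow equation the curvature is expressed by first derivatives of the
  solution, whose continuity extends to time 0.\<close>

lemma curvature_positive_time:
  assumes c: "c \<in> A" "\<Gamma> (r, t) \<in> fst c" and rt: "r \<in> {a<..<b}" "t \<in> {0<..<T}"
    and Zr: "((\<lambda>r. snd c (\<Gamma> (r, t))) has_vector_derivative Zr) (at r)" "Zr \<noteq> 0"
    and Zt: "((\<lambda>t. snd c (\<Gamma> (r, t))) has_vector_derivative Zt) (at t)"
  shows "slice_curvature g \<Gamma> c r t = Im (Zt / Zr) *\<^sub>R (\<i> * Zr)"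
proof -
  have nS: "\<Gamma> (r, t) \<notin> S" and eq: "normal_velocity g \<Gamma> c r t = slice_curvature g \<Gamma> c r t"
    using flow rt c unfolding flow_equation_def by auto
  then have X: "snd c (\<Gamma> (r, t)) \<in> snd c ` (fst c \<inter> - S)" using c by auto
  note cf = conformal_factor[OF surface metric c(1)]
  show ?thesis
    unfolding eq[symmetric] normal_velocity_def vector_derivative_at[OF Zt]
    by (rule normal_part_conformal[where \<rho> = "\<lambda>y. g c y 1 1", OF open_X[OF c(1)] X cf(1) cf(2)[OF X] Zr])
qed

lemma curvature_formula:
  assumes c: "c \<in> A" "\<Gamma> (r, t) \<in> fst c" and nS: "\<Gamma> (r, t) \<notin> S"
    and Zr: "\<forall>\<^sub>F r in nhds r. ((\<lambda>r. snd c (\<Gamma> (r, t))) has_vector_derivative Zr r) (at r)"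
    and Zrr: "(Zr has_vector_derivative Zrr) (at r)" "Zr r \<noteq> 0"
    and D: "((\<lambda>y. g c y 1 1) has_derivative D) (at (snd c (\<Gamma> (r, t))))"
  shows "slice_curvature g \<Gamma> c r t =
    ((Im (Zrr / Zr r) - D (\<i> * Zr r) / (2 * g c (snd c (\<Gamma> (r, t))) 1 1)) /
      (g c (snd c (\<Gamma> (r, t))) 1 1 * (norm (Zr r))\<^sup>2)) *\<^sub>R (\<i> * Zr r)"
proof -
  have X: "snd c (\<Gamma> (r, t)) \<in> snd c ` (fst c \<inter> - S)" using c nS by auto
  note cf = conformal_factor[OF surface metric c(1)]
  show ?thesis
    unfolding slice_curvature_def
    by (rule geodesic_curvature_conformal[where \<rho> = "\<lambda>y. g c y 1 1" and x = "\<lambda>r. snd c (\<Gamma> (r, t))",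
        OF open_X[OF c(1)] X cf(1) cf(2)[OF X] D Zr Zrr])
qed

text \<open>Derivatives within the rectangle become two-sided in r for interior r, at every time
  including 0; in t they become two-sided only for interior times.\<close>

lemma slice_at:
  assumes W: "\<And>x. x \<in> W \<Longrightarrow> (f has_derivative (\<lambda>h. fst h *\<^sub>R fr x + snd h *\<^sub>R ft x)) (at x within W)"
    and W_def: "W = ({a..b} \<times> {0..T}) \<inter> ball w \<epsilon>" and rt: "(r, t) \<in> W"
  shows "r \<in> {a<..<b} \<Longrightarrow> ((\<lambda>r. f (r, t)) has_vector_derivative fr (r, t)) (at r)"
    and "t \<in> {0<..<T} \<Longrightarrow> ((\<lambda>t. f (r, t)) has_vector_derivative ft (r, t)) (at t)"
    and "((\<lambda>t. f (r, t)) has_vector_derivative ft (r, t)) (at t within {0..T})"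
proof -
  have "open ((\<lambda>r. (r, t)) -` ball w \<epsilon>)" "open ((\<lambda>t. (r, t)) -` ball w \<epsilon>)"
    by (intro open_vimage open_ball continuous_intros)+
  then have o1: "open {r. (r, t) \<in> ball w \<epsilon>}" and o2: "open {t. (r, t) \<in> ball w \<epsilon>}"
    unfolding vimage_def .
  have s1: "((\<lambda>r. f (r, t)) has_vector_derivative fr (r, t)) (at r within {r. (r, t) \<in> W})"
    using has_vector_derivative_fst_slice[OF W[OF rt]] by simp
  have s2: "((\<lambda>t. f (r, t)) has_vector_derivative ft (r, t)) (at t within {t. (r, t) \<in> W})"
    using has_vector_derivative_snd_slice[OF W[OF rt]] by simp
  show "((\<lambda>r. f (r, t)) has_vector_derivative fr (r, t)) (at r)" if r: "r \<in> {a<..<b}"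
  proof -
    have "((\<lambda>r. f (r, t)) has_vector_derivative fr (r, t)) (at r within {a<..<b} \<inter> {r. (r, t) \<in> ball w \<epsilon>})"
      by (rule has_vector_derivative_within_subset[OF s1]) (use rt in \<open>auto simp: W_def\<close>)
    moreover have "at r within {a<..<b} \<inter> {r. (r, t) \<in> ball w \<epsilon>} = at r"
      using r rt o1 by (intro at_within_open) (auto simp: W_def)
    ultimately show ?thesis by simp
  qed
  have t_within: "((\<lambda>t. f (r, t)) has_vector_derivative ft (r, t)) (at t within {0..T} \<inter> {t. (r, t) \<in> ball w \<epsilon>})"
    by (rule has_vector_derivative_within_subset[OF s2]) (use rt in \<open>auto simp: W_def\<close>)
  have "at t within {0..T} \<inter> {t. (r, t) \<in> ball w \<epsilon>} = at t within {0..T}"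
    by (rule at_within_nhd[OF _ o2]) (use rt in \<open>auto simp: W_def\<close>)
  with t_within show "((\<lambda>t. f (r, t)) has_vector_derivative ft (r, t)) (at t within {0..T})"
    by simp
  show "((\<lambda>t. f (r, t)) has_vector_derivative ft (r, t)) (at t)" if t: "t \<in> {0<..<T}"
  proof -
    have "((\<lambda>t. f (r, t)) has_vector_derivative ft (r, t)) (at t within {0<..<T} \<inter> {t. (r, t) \<in> ball w \<epsilon>})"
      by (rule has_vector_derivative_within_subset[OF t_within]) auto
    moreover have "at t within {0<..<T} \<inter> {t. (r, t) \<in> ball w \<epsilon>} = at t"
      using t rt o2 by (intro at_within_open) (auto simp: W_def)
    ultimately show ?thesis by simp
  qed
qed

lemma C1_chart:
  assumes c: "c \<in> A" "\<Gamma> w \<in> fst c" and w: "w \<in> {a..b} \<times> {0..T}"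
  obtains \<epsilon> fr ft where "0 < \<epsilon>" "\<Gamma> ` (({a..b} \<times> {0..T}) \<inter> ball w \<epsilon>) \<subseteq> fst c"
    "continuous_on (({a..b} \<times> {0..T}) \<inter> ball w \<epsilon>) (snd c \<circ> \<Gamma>)"
    "continuous_on (({a..b} \<times> {0..T}) \<inter> ball w \<epsilon>) fr" "continuous_on (({a..b} \<times> {0..T}) \<inter> ball w \<epsilon>) ft"
    "\<And>x. x \<in> ({a..b} \<times> {0..T}) \<inter> ball w \<epsilon> \<Longrightarrow> ((snd c \<circ> \<Gamma>) has_derivative
      (\<lambda>h. fst h *\<^sub>R fr x + snd h *\<^sub>R ft x)) (at x within ({a..b} \<times> {0..T}) \<inter> ball w \<epsilon>)"
proof -
  from C1 w c obtain \<epsilon> where \<epsilon>: "\<epsilon> > 0" "\<Gamma> ` (({a..b} \<times> {0..T}) \<inter> ball w \<epsilon>) \<subseteq> fst c"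
    "Ck_on 1 (({a..b} \<times> {0..T}) \<inter> ball w \<epsilon>) (snd c \<circ> \<Gamma>)"
    unfolding Ck_map_on_def by blast
  obtain fr ft where "continuous_on (({a..b} \<times> {0..T}) \<inter> ball w \<epsilon>) (snd c \<circ> \<Gamma>)"
    "continuous_on (({a..b} \<times> {0..T}) \<inter> ball w \<epsilon>) fr" "continuous_on (({a..b} \<times> {0..T}) \<inter> ball w \<epsilon>) ft"
    "\<And>x. x \<in> ({a..b} \<times> {0..T}) \<inter> ball w \<epsilon> \<Longrightarrow> ((snd c \<circ> \<Gamma>) has_derivative
      (\<lambda>h. fst h *\<^sub>R fr x + snd h *\<^sub>R ft x)) (at x within ({a..b} \<times> {0..T}) \<inter> ball w \<epsilon>)"
    by (rule Ck_on_1_partials[OF \<epsilon>(3) order_refl]) blast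
  with \<epsilon> show thesis by (intro that[of \<epsilon> fr ft])
qed

text \<open>The higher derivatives exist only for positive times, while the first ones are wanted up
  to the boundary. Identifying the two descriptions lets the C^1 functions \<open>fr\<close> and
  \<open>ft\<close> serve in both roles.\<close>

lemma interior_smooth:
  assumes c: "c \<in> A" and sub: "\<And>x. x \<in> V \<Longrightarrow> x \<in> {a<..<b} \<times> {0<..<T} \<and> \<Gamma> x \<in> fst c" and "open V"
    and fr: "\<And>r t. (r, t) \<in> V \<Longrightarrow> ((\<lambda>r. snd c (\<Gamma> (r, t))) has_vector_derivative fr (r, t)) (at r)"
    and ft: "\<And>r t. (r, t) \<in> V \<Longrightarrow> ((\<lambda>t. snd c (\<Gamma> (r, t))) has_vector_derivative ft (r, t)) (at t)"
  shows "\<exists>frr frt frrr frrt. smooth_partials V (\<lambda>r t. snd c (\<Gamma> (r, t))) (\<lambda>r t. fr (r, t)) (\<lambda>r t. ft (r, t)) frr frt frrr frrt"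
proof -
  have "\<exists>fr ft frr frt frrr frrt. smooth_partials V (\<lambda>r t. snd c (\<Gamma> (r, t))) fr ft frr frt frrr frrt"
  proof (rule smooth_partials_glue)
    fix x assume "x \<in> V"
    then have x: "x \<in> {a<..<b} \<times> {0<..<T}" "\<Gamma> x \<in> fst c" using sub by auto
    then obtain e where e: "e > 0" "Ck_on \<infinity> (({a<..<b} \<times> {0<..<T}) \<inter> ball x e) (snd c \<circ> \<Gamma>)"
      using smooth c unfolding Ck_map_on_def by blast
    have "open (({a<..<b} \<times> {0<..<T}) \<inter> ball x e)" by (intro open_Int open_Times) auto
    from Ck_on_smooth_partials[OF this e(2)] this x e(1)
    show "\<exists>V. open V \<and> x \<in> V \<and> (\<exists>fr ft frr frt frrr frrt. smooth_partials V (\<lambda>r t. snd c (\<Gamma> (r, t))) fr ft frr frt frrr frrt)"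
      by (intro exI[of _ "({a<..<b} \<times> {0<..<T}) \<inter> ball x e"]) (simp add: o_def)
  qed
  then obtain gr gt frr frt frrr frrt where sm: "smooth_partials V (\<lambda>r t. snd c (\<Gamma> (r, t))) gr gt frr frt frrr frrt"
    by (elim exE)
  note s = sm[unfolded smooth_partials_def, rule_format]
  have gr: "gr r t = fr (r, t)" and gt: "gt r t = ft (r, t)" if "(r, t) \<in> V" for r t
    using s[OF that] fr[OF that] ft[OF that] vector_derivative_unique_at by blast+
  have o1: "open ((\<lambda>r. (r, t)) -` V)" and o2: "open ((\<lambda>t. (r, t)) -` V)" for r t
    by (intro open_vimage \<open>open V\<close> continuous_intros)+
  have "smooth_partials V (\<lambda>r t. snd c (\<Gamma> (r, t))) (\<lambda>r t. fr (r, t)) (\<lambda>r t. ft (r, t)) frr frt frrr frrt"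
    unfolding smooth_partials_def
  proof (intro allI impI conjI)
    fix r t assume rt: "(r, t) \<in> V"
    show "((\<lambda>r. snd c (\<Gamma> (r, t))) has_vector_derivative fr (r, t)) (at r)" by (rule fr[OF rt])
    show "((\<lambda>t. snd c (\<Gamma> (r, t))) has_vector_derivative ft (r, t)) (at t)" by (rule ft[OF rt])
    show "((\<lambda>r. fr (r, t)) has_vector_derivative frr r t) (at r)"
      by (rule has_vector_derivative_transform_within_open[where f = "\<lambda>r. gr r t", OF _ o1]) (use s[OF rt] rt gr in auto)
    show "((\<lambda>t. fr (r, t)) has_vector_derivative frt r t) (at t)"
      by (rule has_vector_derivative_transform_within_open[where f = "\<lambda>t. gr r t", OF _ o2]) (use s[OF rt] rt gr in auto)
    show "((\<lambda>r. ft (r, t)) has_vector_derivative frt r t) (at r)"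
      by (rule has_vector_derivative_transform_within_open[where f = "\<lambda>r. gt r t", OF _ o1]) (use s[OF rt] rt gt in auto)
  qed (use s in blast)+
  then show ?thesis by blast
qed

text \<open>The curvature formula read backwards: it gives the derivative of the tangent angle in
  terms of first derivatives. It applies at time 0 as soon as the curvature there is known to be the
  normal velocity.\<close>

lemma flow_from_curvature:
  assumes c: "c \<in> A" "\<Gamma> (r, t) \<in> fst c" and nS: "\<Gamma> (r, t) \<notin> S"
    and Zr: "\<forall>\<^sub>F r in nhds r. ((\<lambda>r. snd c (\<Gamma> (r, t))) has_vector_derivative Zr r) (at r)"
    and Zrr: "(Zr has_vector_derivative Zrr) (at r)" "Zr r \<noteq> 0"
    and D: "((\<lambda>y. g c y 1 1) has_derivative D) (at (snd c (\<Gamma> (r, t))))"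
    and K: "slice_curvature g \<Gamma> c r t = Im (Zt / Zr r) *\<^sub>R (\<i> * Zr r)"
  shows "Im (Zrr / Zr r) = g c (snd c (\<Gamma> (r, t))) 1 1 * (norm (Zr r))\<^sup>2 * Im (Zt / Zr r)
      + D (\<i> * Zr r) / (2 * g c (snd c (\<Gamma> (r, t))) 1 1)"
proof -
  have pos: "g c (snd c (\<Gamma> (r, t))) 1 1 > 0"
    using conformal_factor(2)[OF surface metric c(1)] c nS by auto
  have "(Im (Zrr / Zr r) - D (\<i> * Zr r) / (2 * g c (snd c (\<Gamma> (r, t))) 1 1)) /
      (g c (snd c (\<Gamma> (r, t))) 1 1 * (norm (Zr r))\<^sup>2) = Im (Zt / Zr r)"
    using curvature_formula[OF c nS Zr Zrr D] Zrr(2) unfolding K scaleR_cancel_right by simp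
  then have "Im (Zrr / Zr r) - D (\<i> * Zr r) / (2 * g c (snd c (\<Gamma> (r, t))) 1 1) =
      Im (Zt / Zr r) * (g c (snd c (\<Gamma> (r, t))) 1 1 * (norm (Zr r))\<^sup>2)"
    using pos Zrr(2) by (subst (asm) nonzero_divide_eq_eq) auto
  then show ?thesis by (simp add: mult.commute)
qed

text \<open>The flow equation is available for positive times only, but time 0 is needed twice: the
  final estimate includes it, and the initial bounds at a vertex use the equation there. The case of
  time 0 is the limit in \<open>angle_derivative_limit\<close>.\<close>

lemma chart_curvature:
  assumes c: "c \<in> A" "\<Gamma> (r0, t0) \<in> fst c" and rt: "r0 \<in> {a<..<b}" "t0 \<in> {0..<T}"
    and Zr: "((\<lambda>r. snd c (\<Gamma> (r, t0))) has_vector_derivative Zr) (at r0)" "Zr \<noteq> 0"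
    and Zt: "((\<lambda>t. snd c (\<Gamma> (r0, t))) has_vector_derivative Zt) (at t0 within {0..T})"
  shows "slice_curvature g \<Gamma> c r0 t0 = Im (Zt / Zr) *\<^sub>R (\<i> * Zr)"
proof (cases "t0 = 0")
  case False
  then have t0: "t0 \<in> {0<..<T}" using rt by auto
  then have "((\<lambda>t. snd c (\<Gamma> (r0, t))) has_vector_derivative Zt) (at t0)"
    using Zt at_within_Icc_at[of 0 t0 T] by simp
  then show ?thesis by (rule curvature_positive_time[OF c rt(1) t0 Zr])
next
  case t0: True
  have T: "0 < T" using rt by auto
  have w: "(r0, 0) \<in> {a..b} \<times> {0..T}" using rt T by auto
  have c0: "\<Gamma> (r0, 0) \<in> fst c" using c t0 by simp
  obtain \<epsilon> fr ft where \<epsilon>: "0 < \<epsilon>" and sub: "\<Gamma> ` (({a..b} \<times> {0..T}) \<inter> ball (r0, 0) \<epsilon>) \<subseteq> fst c"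
    and cont: "continuous_on (({a..b} \<times> {0..T}) \<inter> ball (r0, 0) \<epsilon>) (snd c \<circ> \<Gamma>)"
    "continuous_on (({a..b} \<times> {0..T}) \<inter> ball (r0, 0) \<epsilon>) fr" "continuous_on (({a..b} \<times> {0..T}) \<inter> ball (r0, 0) \<epsilon>) ft"
    and der: "\<And>x. x \<in> ({a..b} \<times> {0..T}) \<inter> ball (r0, 0) \<epsilon> \<Longrightarrow> ((snd c \<circ> \<Gamma>) has_derivative
      (\<lambda>h. fst h *\<^sub>R fr x + snd h *\<^sub>R ft x)) (at x within ({a..b} \<times> {0..T}) \<inter> ball (r0, 0) \<epsilon>)"
    by (rule C1_chart[OF c(1) c0 w]) blast
  note at = slice_at[OF der refl, unfolded o_def]
  define d where "d = min (min (r0 - a) (b - r0)) (min T (\<epsilon> / 2))"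
  have d: "0 < d" "d \<le> r0 - a" "d \<le> b - r0" "d \<le> T" "d \<le> \<epsilon> / 2"
  proof -
    have 1: "d \<le> min (r0 - a) (b - r0)" "d \<le> min T (\<epsilon> / 2)"
      unfolding d_def by (rule min.cobounded1, rule min.cobounded2)
    show "d \<le> r0 - a" "d \<le> b - r0" "d \<le> T" "d \<le> \<epsilon> / 2"
      by (rule order_trans[OF 1(1) min.cobounded1], rule order_trans[OF 1(1) min.cobounded2],
        rule order_trans[OF 1(2) min.cobounded1], rule order_trans[OF 1(2) min.cobounded2])
    have "0 < r0 - a" "0 < b - r0" "0 < \<epsilon> / 2" using rt \<epsilon> by simp_all
    with T show "0 < d" unfolding d_def by (simp only: min_less_iff_conj)
  qed
  have box: "(r, t) \<in> ({a..b} \<times> {0..T}) \<inter> ball (r0, 0) \<epsilon> \<and> r \<in> {a<..<b}"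
    if "\<bar>r - r0\<bar> < d" "0 \<le> t" "t < d" for r t
  proof -
    have "dist (r, t) (r0, 0) \<le> \<bar>r - r0\<bar> + \<bar>t - 0\<bar>"
      unfolding dist_Pair_Pair dist_real_def by (rule order_trans[OF sqrt_sum_squares_le_sum_abs]) simp
    also have "\<dots> < \<epsilon>" using that d(5) by linarith
    finally have 1: "dist (r0, 0) (r, t) < \<epsilon>" by (simp only: dist_commute)
    have 2: "a < r" "r < b" "t \<le> T" using that d by linarith+
    show ?thesis using 1 2 that(2) by simp
  qed
  have inX: "snd c (\<Gamma> (r, t)) \<in> snd c ` (fst c \<inter> - S)" if "\<bar>r - r0\<bar> < d" "0 \<le> t" "t < d" for r t
    using box[OF that] sub regular[of r t] that d by (auto intro!: imageI)
  obtain g1 g2 where G: "continuous_on (snd c ` (fst c \<inter> - S)) (\<lambda>y. g c y 1 1)"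
    "continuous_on (snd c ` (fst c \<inter> - S)) g1" "continuous_on (snd c ` (fst c \<inter> - S)) g2"
    "\<And>y. y \<in> snd c ` (fst c \<inter> - S) \<Longrightarrow> ((\<lambda>y. g c y 1 1) has_derivative (\<lambda>h. Re h * g1 y + Im h * g2 y)) (at y)"
  proof -
    have "Ck_on \<infinity> (snd c ` (fst c \<inter> - S)) (\<lambda>y. g c y 1 1)"
      using metric(1) c(1) unfolding riemannian_metric_on_def by blast
    from Ck_on_complex_gradient[OF open_X[OF c(1)] this] that show thesis by blast
  qed
  have Gpos: "g c y 1 1 > 0" if "y \<in> snd c ` (fst c \<inter> - S)" for y
    by (rule conformal_factor(2)[OF surface metric c(1) that])
  \<comment> \<open>Written with \<open>ft * cnj fr\<close>, that is |fr|^2 times ft / fr, the right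
    side is continuous on the whole box even where \<open>fr\<close> might vanish.\<close>
  define F where "F r t = g c (snd c (\<Gamma> (r, t))) 1 1 * Im (ft (r, t) * cnj (fr (r, t))) +
      (Re (\<i> * fr (r, t)) * g1 (snd c (\<Gamma> (r, t))) + Im (\<i> * fr (r, t)) * g2 (snd c (\<Gamma> (r, t)))) / (2 * g c (snd c (\<Gamma> (r, t))) 1 1)" for r t
  have Im_cnj: "(norm u)\<^sup>2 * Im (v / u) = Im (v * cnj u)" if "u \<noteq> 0" for u v :: complex
  proof -
    have "v / u = v * cnj u / of_real ((norm u)\<^sup>2)"
      unfolding complex_norm_square using that by simp
    then have "Im (v / u) = Im (v * cnj u) / (norm u)\<^sup>2"
      by (simp only: Im_divide_of_real)
    then show ?thesis using that by simp
  qed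
  have Zr_eq: "fr (r0, 0) = Zr"
    using at(1)[of r0 0] box[of r0 0] d Zr(1) t0 vector_derivative_unique_at by fastforce
  have Zt_eq: "ft (r0, 0) = Zt"
  proof -
    have in_box: "(r0, 0) \<in> ({a..b} \<times> {0..T}) \<inter> ball (r0, 0) \<epsilon>" using box[of r0 0] d by simp
    have sub': "{0..d / 2} \<subseteq> {0..T}"
      using d by auto
    have "((\<lambda>t. snd c (\<Gamma> (r0, t))) has_vector_derivative ft (r0, 0)) (at 0 within {0..d / 2})"
      by (rule has_vector_derivative_within_subset[OF at(3)[OF _ in_box] sub'])
    moreover have "((\<lambda>t. snd c (\<Gamma> (r0, t))) has_vector_derivative Zt) (at 0 within {0..d / 2})"
      by (rule has_vector_derivative_within_subset[OF Zt[unfolded t0]]) (use d in auto)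
    ultimately show ?thesis
      using d by (intro vector_derivative_unique_within_closed_interval[of 0 "d / 2" 0]) auto
  qed
  have ev: "\<forall>\<^sub>F r in nhds r. ((\<lambda>r. snd c (\<Gamma> (r, t))) has_vector_derivative fr (r, t)) (at r)"
    if "\<bar>r - r0\<bar> < d" "0 \<le> t" "t < d" for r t
  proof -
    have "\<forall>\<^sub>F r in nhds r. r \<in> {r0 - d<..<r0 + d}"
      using that by (intro eventually_nhds_in_open) auto
    then show ?thesis
    proof eventually_elim
      case (elim x)
      then have "\<bar>x - r0\<bar> < d" by auto
      from box[OF this that(2,3)] show ?case using at(1)[of x t] by blast
    qed
  qed
  \<comment> \<open>At time 0 the solution is only known to be C^1, so the second derivative of the
    slice is taken from the smooth initial curve.\<close>
  obtain \<epsilon>2 where e2: "\<epsilon>2 > 0" "Ck_on \<infinity> ({a..b} \<inter> ball r0 \<epsilon>2) (snd c \<circ> \<gamma>)"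
  proof -
    have "r0 \<in> {a..b}" "\<gamma> r0 \<in> fst c" using rt initial(2)[of r0] c0 by auto
    then show thesis using initial(1) c(1) that unfolding Ck_map_on_def by blast
  qed
  obtain f1 f2 where f12: "\<And>x. x \<in> {a..b} \<inter> ball r0 \<epsilon>2 \<Longrightarrow> ((snd c \<circ> \<gamma>) has_vector_derivative f1 x) (at x within {a..b} \<inter> ball r0 \<epsilon>2)"
    "\<And>x. x \<in> {a..b} \<inter> ball r0 \<epsilon>2 \<Longrightarrow> (f1 has_vector_derivative f2 x) (at x within {a..b} \<inter> ball r0 \<epsilon>2)"
    by (rule Ck_on_infinity_curve[OF e2(2)]) blast
  define I where "I = {r0 - d<..<r0 + d} \<inter> ball r0 \<epsilon>2"
  have I: "open I" "r0 \<in> I" "I \<subseteq> {a..b} \<inter> ball r0 \<epsilon>2" using d e2 by (auto simp: I_def)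
  have f1_eq: "f1 x = fr (x, 0)" if "x \<in> I" for x
  proof -
    have "((snd c \<circ> \<gamma>) has_vector_derivative f1 x) (at x)"
      unfolding at_within_open[OF that I(1), symmetric]
      by (rule has_vector_derivative_within_subset[OF f12(1) I(3)]) (use I(3) that in blast)
    then have "((\<lambda>r. snd c (\<Gamma> (r, 0))) has_vector_derivative f1 x) (at x)"
      by (rule has_vector_derivative_transform_within_open[OF _ I(1) that]) (use I(3) initial(2) in auto)
    moreover have "((\<lambda>r. snd c (\<Gamma> (r, 0))) has_vector_derivative fr (x, 0)) (at x)"
      using at(1)[of x 0] box[of x 0] that d by (auto simp: I_def abs_less_iff)
    ultimately show ?thesis by (rule vector_derivative_unique_at)
  qed
  have fa: "((\<lambda>r. fr (r, 0)) has_vector_derivative f2 r0) (at r0)"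
  proof (rule has_vector_derivative_transform_within_open[OF _ I(1,2)])
    show "(f1 has_vector_derivative f2 r0) (at r0)"
      unfolding at_within_open[OF I(2,1), symmetric]
      by (rule has_vector_derivative_within_subset[OF f12(2) I(3)]) (use I(2,3) in blast)
  qed (use f1_eq in auto)
  have "Im (f2 r0 / fr (r0, 0)) = F r0 0"
  proof (rule angle_derivative_limit[OF d(1), where w = "\<lambda>r t. fr (r, t)" and F = F])
    have subV: "{r0..<r0 + d} \<times> {0..<d} \<subseteq> ({a..b} \<times> {0..T}) \<inter> ball (r0, 0) \<epsilon>"
    proof
      fix x assume x: "x \<in> {r0..<r0 + d} \<times> {0..<d}"
      obtain r t where xe: "x = (r, t)" by (cases x)
      have 1: "r0 \<le> r" "r < r0 + d" "0 \<le> t" "t < d" using x unfolding xe by simp_all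
      have 2: "\<bar>r - r0\<bar> < d" using 1 by linarith
      show "x \<in> ({a..b} \<times> {0..T}) \<inter> ball (r0, 0) \<epsilon>"
        unfolding xe by (rule box[OF 2 1(3,4), THEN conjunct1])
    qed
    have cV: "continuous_on ({r0..<r0 + d} \<times> {0..<d}) (\<lambda>x. snd c (\<Gamma> x))" "continuous_on ({r0..<r0 + d} \<times> {0..<d}) fr"
      "continuous_on ({r0..<r0 + d} \<times> {0..<d}) ft"
      using cont[THEN continuous_on_subset, OF subV] by (auto simp: o_def)
    have img: "snd c (\<Gamma> x) \<in> snd c ` (fst c \<inter> - S)" if "x \<in> {r0..<r0 + d} \<times> {0..<d}" for x
      using inX[of "fst x" "snd x"] that by auto
    note cG = G(1-3)[THEN continuous_on_compose2, OF cV(1)]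
    have cG': "continuous_on ({r0..<r0 + d} \<times> {0..<d}) (\<lambda>x. g c (snd c (\<Gamma> x)) 1 1)"
      "continuous_on ({r0..<r0 + d} \<times> {0..<d}) (\<lambda>x. g1 (snd c (\<Gamma> x)))"
      "continuous_on ({r0..<r0 + d} \<times> {0..<d}) (\<lambda>x. g2 (snd c (\<Gamma> x)))"
      using cG img by blast+
    show "continuous_on ({r0..<r0 + d} \<times> {0..<d}) (\<lambda>x. fr (fst x, snd x))" using cV by simp
    show "continuous_on ({r0..<r0 + d} \<times> {0..<d}) (\<lambda>x. F (fst x) (snd x))"
      unfolding F_def prod.collapse
    proof (intro continuous_intros cV cG' ballI)
      show "2 * g c (snd c (\<Gamma> x)) 1 1 \<noteq> 0" if "x \<in> {r0..<r0 + d} \<times> {0..<d}" for x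
        using Gpos[OF img[OF that]] by simp
    qed
    show "fr (r0, 0) \<noteq> 0" using Zr(2) Zr_eq by simp
    show "((\<lambda>r. fr (r, 0)) has_vector_derivative f2 r0) (at r0)" by (rule fa)
    fix r t assume r: "r0 \<le> r" "r < r0 + d" and t: "0 < t" "t < d" and nz: "fr (r, t) \<noteq> 0"
    have rt': "\<bar>r - r0\<bar> < d" "0 \<le> t" "t < d" using r t by auto
    let ?V = "({r0 - d<..<r0 + d} \<times> {0<..<d})"
    have V: "(x, y) \<in> ?V \<Longrightarrow> \<bar>x - r0\<bar> < d \<and> 0 \<le> y \<and> y < d \<and> 0 < y" for x y by auto
    have "\<exists>frr frt frrr frrt. smooth_partials ?V (\<lambda>r t. snd c (\<Gamma> (r, t))) (\<lambda>r t. fr (r, t)) (\<lambda>r t. ft (r, t)) frr frt frrr frrt"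
    proof (rule interior_smooth[OF c(1)])
      show "open ?V" by (intro open_Times) auto
      fix x y assume xy: "(x, y) \<in> ?V"
      note b = box[of x y]
      show "((\<lambda>r. snd c (\<Gamma> (r, y))) has_vector_derivative fr (x, y)) (at x)"
        using at(1)[of x y] b V[OF xy] by blast
      show "((\<lambda>t. snd c (\<Gamma> (x, t))) has_vector_derivative ft (x, y)) (at y)"
        using at(2)[of x y] b V[OF xy] d by auto
    next
      fix x assume x: "x \<in> ?V"
      then show "x \<in> {a<..<b} \<times> {0<..<T} \<and> \<Gamma> x \<in> fst c"
        using box[of "fst x" "snd x"] V[of "fst x" "snd x"] sub d by auto
    qed
    then obtain frr frt frrr frrt where sm: "smooth_partials ?V (\<lambda>r t. snd c (\<Gamma> (r, t))) (\<lambda>r t. fr (r, t)) (\<lambda>r t. ft (r, t)) frr frt frrr frrt"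
      by (elim exE)
    have "(r, t) \<in> ?V" using r t d(1) by simp
    then have frr: "((\<lambda>r. fr (r, t)) has_vector_derivative frr r t) (at r)"
      using sm unfolding smooth_partials_def by blast
    have cr: "\<Gamma> (r, t) \<in> fst c" using box[OF rt'] sub by auto
    have rI: "r \<in> {a<..<b}" "t \<in> {0<..<T}" using box[OF rt'] t d by auto
    have nS: "\<Gamma> (r, t) \<notin> S" using regular[of r t] rI by auto
    have fr': "((\<lambda>r. snd c (\<Gamma> (r, t))) has_vector_derivative fr (r, t)) (at r)"
      using at(1)[of r t] box[OF rt'] by blast
    have ft': "((\<lambda>t. snd c (\<Gamma> (r, t))) has_vector_derivative ft (r, t)) (at t)"
      using at(2)[of r t] box[OF rt'] rI by blast
    have "Im (frr r t / fr (r, t)) = F r t"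
      using flow_from_curvature[OF c(1) cr nS ev[OF rt'] frr nz G(4)[OF inX[OF rt']]
          curvature_positive_time[OF c(1) cr rI fr' nz ft']] Im_cnj[OF nz, of "ft (r, t)"]
      by (simp add: F_def mult.assoc)
    with frr show "\<exists>w'. ((\<lambda>r. fr (r, t)) has_vector_derivative w') (at r) \<and> Im (w' / fr (r, t)) = F r t"
      by blast
  qed
  moreover have z0: "\<bar>r0 - r0\<bar> < d" "(0::real) \<le> 0" "0 < d" using d by auto
  have nS: "\<Gamma> (r0, 0) \<notin> S" using regular[of r0 0] rt T by auto
  define y where "y = snd c (\<Gamma> (r0, 0))"
  have gp: "g c y 1 1 > 0" unfolding y_def by (rule Gpos[OF inX[OF z0]])
  have nz: "fr (r0, 0) \<noteq> 0" using Zr Zr_eq by simp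
  note cf = curvature_formula[OF c(1) c0 nS ev[OF z0] fa nz G(4)[OF inX[OF z0]], folded y_def]
  have "Im (f2 r0 / Zr) - (Re (\<i> * Zr) * g1 y + Im (\<i> * Zr) * g2 y) / (2 * g c y 1 1) =
      g c y 1 1 * ((norm Zr)\<^sup>2 * Im (Zt / Zr))"
    using calculation unfolding F_def Zr_eq Zt_eq y_def[symmetric] Im_cnj[OF Zr(2)] by linarith
  then have "(Im (f2 r0 / Zr) - (Re (\<i> * Zr) * g1 y + Im (\<i> * Zr) * g2 y) / (2 * g c y 1 1)) / (g c y 1 1 * (norm Zr)\<^sup>2) = Im (Zt / Zr)"
    using gp Zr(2) by simp
  then show ?thesis using cf unfolding Zr_eq t0 by simp
qed

text \<open>The curvature vector is Im (Zt / Zr) times i Zr: the quotient is the same in all charts,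
  and i Zr transforms as a tangent vector. The norm in any chart can therefore be computed in the
  conical one.\<close>

lemma norm_curvature:
  assumes c: "c \<in> A" "\<Gamma> (r0, t0) \<in> fst c" and c': "c' \<in> A" "\<Gamma> (r0, t0) \<in> fst c'"
    and rt: "r0 \<in> {a<..<b}" "t0 \<in> {0..<T}"
    and Zr: "((\<lambda>r. snd c (\<Gamma> (r, t0))) has_vector_derivative Zr) (at r0)" "Zr \<noteq> 0"
    and Zt: "((\<lambda>t. snd c (\<Gamma> (r0, t))) has_vector_derivative Zt) (at t0 within {0..T})"
  shows "tensor_norm (g c') (snd c' (\<Gamma> (r0, t0))) (slice_curvature g \<Gamma> c' r0 t0) =
    sqrt (g c (snd c (\<Gamma> (r0, t0))) 1 1) * (norm Zr * \<bar>Im (Zt / Zr)\<bar>)"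
proof -
  have w: "(r0, t0) \<in> {a..b} \<times> {0..T}" using rt by auto
  have nS: "\<Gamma> (r0, t0) \<notin> S" using regular rt by auto
  define y where "y = snd c (\<Gamma> (r0, t0))"
  define y' where "y' = snd c' (\<Gamma> (r0, t0))"
  define \<tau> where "\<tau> = deriv (transition c c') y"
  have hol: "transition c c' holomorphic_on (snd c ` (fst c \<inter> fst c'))"
    using cs c c' unfolding complex_structure_def compatible_def by blast
  have "open (fst c')" using cs c' unfolding complex_structure_def is_chart_def by (auto simp: case_prod_beta)
  then have "open (snd c ` (fst c \<inter> fst c'))" by (rule chart_image_open[OF cs c(1)])
  then have td: "(transition c c' has_field_derivative \<tau>) (at y)"
    unfolding \<tau>_def y_def using hol c c' by (intro holomorphic_derivI[OF hol]) auto
  have tr: "transition c c' (snd c q) = snd c' q" if "q \<in> fst c" for q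
    using inv_into_chart[OF cs c(1) that] by (simp add: transition_def)
  have met: "g c y u v = g c' y' (\<tau> * u) (\<tau> * v)" for u v
    using metric(1) c c' nS unfolding riemannian_metric_on_def \<tau>_def y_def y'_def by blast
  have X: "y \<in> snd c ` (fst c \<inter> - S)" and X': "y' \<in> snd c' ` (fst c' \<inter> - S)"
    using c c' nS by (auto simp: y_def y'_def)
  note cf = conformal_factor[OF surface metric c(1) X] and cf' = conformal_factor[OF surface metric c'(1) X']
  have \<tau>: "\<tau> \<noteq> 0" using met[of 1 1] cf(2) cf'(1)[of \<tau> \<tau>] by auto
  obtain \<epsilon> fr ft where \<epsilon>: "0 < \<epsilon>" and sub: "\<Gamma> ` (({a..b} \<times> {0..T}) \<inter> ball (r0, t0) \<epsilon>) \<subseteq> fst c"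
    by (rule C1_chart[OF c w])
  define d where "d = min \<epsilon> (min (r0 - a) (b - r0))"
  have d: "0 < d" "d \<le> \<epsilon>" "d \<le> r0 - a" "d \<le> b - r0"
  proof -
    show "d \<le> \<epsilon>" unfolding d_def by (rule min.cobounded1)
    show "d \<le> r0 - a" unfolding d_def by (rule order_trans[OF min.cobounded2 min.cobounded1])
    show "d \<le> b - r0" unfolding d_def by (rule order_trans[OF min.cobounded2 min.cobounded2])
    have "0 < r0 - a" "0 < b - r0" using rt by simp_all
    with \<epsilon> show "0 < d" unfolding d_def by (simp only: min_less_iff_conj)
  qed
  have Zr': "((\<lambda>r. snd c' (\<Gamma> (r, t0))) has_vector_derivative Zr * \<tau>) (at r0)"
  proof (rule has_vector_derivative_transform_within[OF _ d(1)])
    show "((transition c c' \<circ> (\<lambda>r. snd c (\<Gamma> (r, t0)))) has_vector_derivative Zr * \<tau>) (at r0)"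
      by (rule field_vector_diff_chain_at[OF Zr(1)]) (use td in \<open>simp add: y_def\<close>)
    show "(transition c c' \<circ> (\<lambda>r. snd c (\<Gamma> (r, t0)))) r = snd c' (\<Gamma> (r, t0))" if "dist r r0 < d" for r
    proof -
      have "(r, t0) \<in> ({a..b} \<times> {0..T}) \<inter> ball (r0, t0) \<epsilon>"
        using that d rt by (simp add: dist_Pair_Pair dist_commute[of _ r0] dist_commute[of r0] dist_real_def abs_less_iff)
      then have "\<Gamma> (r, t0) \<in> fst c" using sub by blast
      then show ?thesis using tr by simp
    qed
  qed auto
  have Zt': "((\<lambda>t. snd c' (\<Gamma> (r0, t))) has_vector_derivative Zt * \<tau>) (at t0 within {0..T})"
  proof (rule has_vector_derivative_transform_within[OF _ \<epsilon>])
    show "((transition c c' \<circ> (\<lambda>t. snd c (\<Gamma> (r0, t)))) has_vector_derivative Zt * \<tau>) (at t0 within {0..T})"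
      by (rule field_vector_diff_chain_within[OF Zt])
        (use td in \<open>auto simp: y_def intro: has_field_derivative_at_within\<close>)
    show "(transition c c' \<circ> (\<lambda>t. snd c (\<Gamma> (r0, t)))) t = snd c' (\<Gamma> (r0, t))" if "t \<in> {0..T}" "dist t t0 < \<epsilon>" for t
    proof -
      have "(r0, t) \<in> ({a..b} \<times> {0..T}) \<inter> ball (r0, t0) \<epsilon>"
        using that rt by (auto simp: dist_Pair_Pair dist_commute)
      then have "\<Gamma> (r0, t) \<in> fst c" using sub by blast
      then show ?thesis using tr by simp
    qed
  qed (use rt in auto)
  have "slice_curvature g \<Gamma> c' r0 t0 = Im (Zt * \<tau> / (Zr * \<tau>)) *\<^sub>R (\<i> * (Zr * \<tau>))"
    by (rule chart_curvature[OF c' rt Zr' _ Zt']) (use \<tau> Zr in simp)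
  also have "\<dots> = \<tau> * (Im (Zt / Zr) *\<^sub>R (\<i> * Zr))"
    using \<tau> by (simp add: mult_ac)
  finally have "tensor_norm (g c') y' (slice_curvature g \<Gamma> c' r0 t0) =
      sqrt (g c y (Im (Zt / Zr) *\<^sub>R (\<i> * Zr)) (Im (Zt / Zr) *\<^sub>R (\<i> * Zr)))"
    unfolding tensor_norm_def met by simp
  also have "\<dots> = sqrt (g c y 1 1) * norm (Im (Zt / Zr) *\<^sub>R (\<i> * Zr))"
    unfolding cf(1)[of "Im (Zt / Zr) *\<^sub>R (\<i> * Zr)"] real_sqrt_mult norm_eq_sqrt_inner ..
  also have "norm (Im (Zt / Zr) *\<^sub>R (\<i> * Zr)) = norm Zr * \<bar>Im (Zt / Zr)\<bar>"
    by (simp add: norm_mult)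
  finally show ?thesis by (simp add: y_def y'_def)
qed

text \<open>The sign \<open>\<sigma>\<close> directs the parameter away from the vertex, so that
  \<open>vertex_estimate\<close> covers both ends of an arc. Reversal changes the signs of the
  velocity in r and of the scalar curvature, but not the second r-derivative, the t-derivative or
  the norm.\<close>

lemma vertex_side:
  fixes e \<sigma> \<beta> \<kappa> :: real
  assumes ab: "a < b" "0 < T" and e: "e = a \<and> \<sigma> = 1 \<or> e = b \<and> \<sigma> = -1"
    and con: "conical_chart A g p \<beta> c0" and \<beta>: "-1 < \<beta>" "\<beta> < 0"
    and vertex: "\<And>t. t \<in> {0..T} \<Longrightarrow> \<Gamma> (e, t) = p"
    and imm: "immersion_on A {a..b} \<gamma>"
    and \<kappa>: "0 < \<kappa>" "\<kappa> \<le> 1" "\<kappa> < 2 * (1 + \<beta>)"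
  shows "\<exists>\<rho>' \<tau>' K. 0 < \<rho>' \<and> 0 < \<tau>' \<and> \<tau>' < T \<and> 0 \<le> K \<and>
    (\<forall>r t. r \<in> {a..b} \<and> 0 < \<bar>r - e\<bar> \<and> \<bar>r - e\<bar> \<le> \<rho>' \<and> 0 \<le> t \<and> t \<le> \<tau>' \<longrightarrow>
      (\<forall>c\<in>A. \<Gamma> (r, t) \<in> fst c \<longrightarrow>
        tensor_norm (g c) (snd c (\<Gamma> (r, t))) (slice_curvature g \<Gamma> c r t) \<le> K * \<bar>r - e\<bar> powr (\<kappa> - (1 + \<beta>))))"
proof -
  obtain h where c0: "c0 \<in> A" "p \<in> fst c0" "snd c0 p = 0" and h: "real_analytic_on h (snd c0 ` fst c0)"
    and gh: "\<And>x u v. x \<in> snd c0 ` fst c0 - {0} \<Longrightarrow> g c0 x u v = exp (2 * h x) * norm x powr (2 * \<beta>) * (u \<bullet> v)"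
    using con unfolding conical_chart_def by blast
  have "0 \<in> snd c0 ` fst c0" using c0 by force
  then obtain R M H A' B where RM: "0 < R" "1 \<le> M"
    and hd: "\<And>z. z \<in> ball 0 R \<Longrightarrow> (h has_derivative (\<lambda>v. Re (H z * v))) (at z)"
    and Hd: "\<And>z. z \<in> ball 0 R \<Longrightarrow> (H has_derivative (\<lambda>v. A' z * v + of_real (B z) * cnj v)) (at z)"
    and hb: "\<And>z. z \<in> ball 0 R \<Longrightarrow> \<bar>h z\<bar> \<le> M \<and> norm (H z) \<le> M \<and> norm (A' z) \<le> M \<and> \<bar>B z\<bar> \<le> M"
    by (rule real_analytic_on_second_order[OF h]) blast
  have \<sigma>: "\<sigma> * \<sigma> = 1" "\<bar>\<sigma>\<bar> = 1" "\<sigma> \<noteq> 0" "e \<in> {a..b}" using e ab by auto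
  have w: "(e, 0) \<in> {a..b} \<times> {0..T}" using \<sigma> ab by auto
  have e0: "\<Gamma> (e, 0) \<in> fst c0" "\<gamma> e = p" using vertex[of 0] c0 ab initial(2)[OF \<sigma>(4)] by auto
  obtain \<epsilon> fr ft where \<epsilon>: "0 < \<epsilon>" and sub: "\<Gamma> ` (({a..b} \<times> {0..T}) \<inter> ball (e, 0) \<epsilon>) \<subseteq> fst c0"
    and cont: "continuous_on (({a..b} \<times> {0..T}) \<inter> ball (e, 0) \<epsilon>) (snd c0 \<circ> \<Gamma>)"
    "continuous_on (({a..b} \<times> {0..T}) \<inter> ball (e, 0) \<epsilon>) fr" "continuous_on (({a..b} \<times> {0..T}) \<inter> ball (e, 0) \<epsilon>) ft"
    and der: "\<And>x. x \<in> ({a..b} \<times> {0..T}) \<inter> ball (e, 0) \<epsilon> \<Longrightarrow> ((snd c0 \<circ> \<Gamma>) has_derivative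
      (\<lambda>h. fst h *\<^sub>R fr x + snd h *\<^sub>R ft x)) (at x within ({a..b} \<times> {0..T}) \<inter> ball (e, 0) \<epsilon>)"
    by (rule C1_chart[OF c0(1) e0(1) w]) blast
  define W where "W = ({a..b} \<times> {0..T}) \<inter> ball (e, 0) \<epsilon>"
  note at = slice_at[OF der refl, unfolded o_def, folded W_def]
  obtain \<epsilon>2 where e2: "\<epsilon>2 > 0" "Ck_on \<infinity> ({a..b} \<inter> ball e \<epsilon>2) (snd c0 \<circ> \<gamma>)"
  proof -
    have "\<gamma> e \<in> fst c0" using e0(2) c0 by simp
    then show thesis using initial(1) c0(1) \<sigma>(4) that unfolding Ck_map_on_def by blast
  qed
  obtain f1 f2 where f2c: "continuous_on ({a..b} \<inter> ball e \<epsilon>2) f2"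
    and f12: "\<And>x. x \<in> {a..b} \<inter> ball e \<epsilon>2 \<Longrightarrow> ((snd c0 \<circ> \<gamma>) has_vector_derivative f1 x) (at x within {a..b} \<inter> ball e \<epsilon>2)"
    "\<And>x. x \<in> {a..b} \<inter> ball e \<epsilon>2 \<Longrightarrow> (f1 has_vector_derivative f2 x) (at x within {a..b} \<inter> ball e \<epsilon>2)"
    by (rule Ck_on_infinity_curve[OF e2(2)]) blast
  define \<rho> where "\<rho> = min ((b - a) / 2) (min (\<epsilon> / 3) (\<epsilon>2 / 2))"
  define \<tau> where "\<tau> = min (T / 2) (\<epsilon> / 3)"
  have \<rho>: "0 < \<rho>" "\<rho> \<le> (b - a) / 2" "\<rho> \<le> \<epsilon> / 3" "\<rho> \<le> \<epsilon>2 / 2" and \<tau>: "0 < \<tau>" "\<tau> \<le> T / 2" "\<tau> \<le> \<epsilon> / 3"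
  proof -
    show "0 < \<rho>" "0 < \<tau>" using ab \<epsilon> e2(1) by (auto simp: \<rho>_def \<tau>_def)
    show "\<rho> \<le> (b - a) / 2" "\<tau> \<le> T / 2" unfolding \<rho>_def \<tau>_def by (rule min.cobounded1)+
    show "\<rho> \<le> \<epsilon> / 3" unfolding \<rho>_def by (rule order_trans[OF min.cobounded2 min.cobounded1])
    show "\<rho> \<le> \<epsilon>2 / 2" unfolding \<rho>_def by (rule order_trans[OF min.cobounded2 min.cobounded2])
    show "\<tau> \<le> \<epsilon> / 3" unfolding \<tau>_def by (rule min.cobounded2)
  qed
  define X where "X r = e + \<sigma> * r" for r
  have X1: "X r \<in> {a..b} \<inter> ball e \<epsilon>2" if "0 \<le> r" "r \<le> \<rho>" for r
    using that \<rho> e e2 ab by (auto simp: X_def dist_real_def)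
  have X2: "X r \<in> {a<..<b}" if "0 < r" "r \<le> \<rho>" for r
    using that \<rho> e ab by (auto simp: X_def)
  have XW: "(X r, t) \<in> W" if "0 \<le> r" "r \<le> \<rho>" "0 \<le> t" "t \<le> \<tau>" for r t
  proof -
    have "dist (X r, t) (e, 0) \<le> \<bar>X r - e\<bar> + \<bar>t - 0\<bar>"
      unfolding dist_Pair_Pair dist_real_def by (rule order_trans[OF sqrt_sum_squares_le_sum_abs]) simp
    also have "\<dots> = r + t" using that \<sigma> by (simp add: X_def abs_mult)
    also have "\<dots> < \<epsilon>" using that \<rho> \<tau> \<epsilon> by linarith
    finally show ?thesis using that \<rho> \<tau> ab X1[of r] by (auto simp: W_def dist_commute)
  qed
  define z where "z r t = snd c0 (\<Gamma> (X r, t))" for r t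
  define zr where "zr r t = of_real \<sigma> * fr (X r, t)" for r t
  define zt where "zt r t = ft (X r, t)" for r t
  have \<sigma>c: "complex_of_real \<sigma> * of_real \<sigma> = 1" by (metis \<sigma>(1) of_real_1 of_real_mult)
  have fr_zr: "fr (X r, t) = of_real \<sigma> * zr r t" for r t
    unfolding zr_def mult.assoc[symmetric] \<sigma>c by simp
  have chain: "((\<lambda>r. F (X r)) has_vector_derivative of_real \<sigma> * d) (at r within Y)"
    if F: "(F has_vector_derivative d) (at (X r) within Y')" and Y: "X ` Y \<subseteq> Y'" for F :: "real \<Rightarrow> complex" and d r Y Y'
  proof -
    have "(X has_vector_derivative \<sigma>) (at r within Y)"
      unfolding X_def by (auto intro!: derivative_eq_intros)
    then have "((F \<circ> X) has_vector_derivative (\<sigma> *\<^sub>R d)) (at r within Y)"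
      by (rule vector_diff_chain_within) (rule has_vector_derivative_within_subset[OF F Y])
    then show ?thesis by (simp add: o_def scaleR_conv_of_real)
  qed
  have zr_der: "((\<lambda>r. z r t) has_vector_derivative zr r t) (at r within {0..\<rho>})" if "r \<in> {0..\<rho>}" "t \<in> {0..\<tau>}" for r t
  proof -
    have "((\<lambda>x. snd c0 (\<Gamma> (x, t))) has_vector_derivative fr (X r, t)) (at (X r) within {x. (x, t) \<in> W})"
      using has_vector_derivative_fst_slice[OF der[folded W_def], OF XW[of r t]] that by (simp add: o_def)
    then show ?thesis
      unfolding z_def zr_def by (rule chain) (use XW that in auto)
  qed
  have G_der: "((\<lambda>r. z r 0) has_vector_derivative of_real \<sigma> * f1 (X r)) (at r within {0..\<rho>})" if "r \<in> {0..\<rho>}" for r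
  proof -
    have "((\<lambda>r. (snd c0 \<circ> \<gamma>) (X r)) has_vector_derivative of_real \<sigma> * f1 (X r)) (at r within {0..\<rho>})"
      by (rule chain[OF f12(1)]) (use X1 that in auto)
    then show ?thesis
      by (rule has_vector_derivative_transform[OF that, rotated]) (use X1 initial(2) in \<open>auto simp: z_def\<close>)
  qed
  have zr0: "zr r 0 = of_real \<sigma> * f1 (X r)" if "r \<in> {0..\<rho>}" for r
    by (rule vector_derivative_unique_within_closed_interval[of 0 \<rho> r "\<lambda>r. z r 0"])
      (use \<rho> \<tau> that zr_der[of r 0] G_der[of r] in auto)
  have a_der: "((\<lambda>r. zr r 0) has_vector_derivative f2 (X r)) (at r within {0..\<rho>})" if r: "r \<in> {0..\<rho>}" for r
  proof -
    have "((\<lambda>r. f1 (X r)) has_vector_derivative of_real \<sigma> * f2 (X r)) (at r within {0..\<rho>})"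
      by (rule chain[OF f12(2)]) (use X1 that in auto)
    from has_vector_derivative_mult_right[OF this, of "of_real \<sigma>"]
    have "((\<lambda>r. of_real \<sigma> * f1 (X r)) has_vector_derivative f2 (X r)) (at r within {0..\<rho>})"
      unfolding mult.assoc[symmetric] \<sigma>c by simp
    then show ?thesis
      by (rule has_vector_derivative_transform[OF r, rotated]) (use zr0 in auto)
  qed
  have "bounded (f2 ` X ` {0..\<rho>})"
  proof (intro compact_imp_bounded compact_continuous_image)
    show "continuous_on (X ` {0..\<rho>}) f2" by (rule continuous_on_subset[OF f2c]) (use X1 in auto)
    show "continuous_on {0..\<rho>} X" unfolding X_def by (intro continuous_intros)
  qed auto
  then obtain N where N: "\<And>r. r \<in> {0..\<rho>} \<Longrightarrow> norm (f2 (X r)) \<le> N"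
    unfolding bounded_iff by blast
  have v: "zr 0 0 \<noteq> 0"
  proof -
    obtain f' where f': "((snd c0 \<circ> \<gamma>) has_derivative f') (at e within {a..b})" "inj f'"
      using imm \<sigma>(4) c0 e0(2) unfolding immersion_on_def by metis
    have lin: "linear f'" using f'(1) by (rule has_derivative_linear)
    have f'_eq: "(\<lambda>x. x *\<^sub>R f' 1) = f'"
    proof
      fix x show "x *\<^sub>R f' 1 = f' x" using linear_scale[OF lin, of x 1] by simp
    qed
    have X0: "X 0 = e" by (simp add: X_def)
    have "((snd c0 \<circ> \<gamma>) has_vector_derivative f' 1) (at (X 0) within {a..b})"
      using f'(1) unfolding has_vector_derivative_def f'_eq X0 .
    then have "((\<lambda>r. (snd c0 \<circ> \<gamma>) (X r)) has_vector_derivative of_real \<sigma> * f' 1) (at 0 within {0..\<rho>})"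
      by (rule chain) (use X1 in auto)
    then have "((\<lambda>r. z r 0) has_vector_derivative of_real \<sigma> * f' 1) (at 0 within {0..\<rho>})"
      by (rule has_vector_derivative_transform[rotated 2]) (use X1 initial(2) \<rho> in \<open>auto simp: z_def\<close>)
    then have "zr 0 0 = of_real \<sigma> * f' 1"
      using vector_derivative_unique_within_closed_interval[of 0 \<rho> 0 "\<lambda>r. z r 0"] zr_der[of 0 0] \<rho> \<tau> by auto
    moreover have "f' 1 \<noteq> f' 0" using injD[OF f'(2), of 1 0] by auto
    ultimately show ?thesis using \<sigma>(3) linear_0[OF lin] by simp
  qed
  let ?V = "({a<..<b} \<times> {0<..<T}) \<inter> ball (e, 0) \<epsilon>"
  have VW: "x \<in> W" if "x \<in> ?V" for x using that by (auto simp: W_def)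
  have "\<exists>frr frt frrr frrt. smooth_partials ?V (\<lambda>r t. snd c0 (\<Gamma> (r, t))) (\<lambda>r t. fr (r, t)) (\<lambda>r t. ft (r, t)) frr frt frrr frrt"
  proof (rule interior_smooth[OF c0(1)])
    show "open ?V" by (intro open_Int open_Times) auto
    show "x \<in> {a<..<b} \<times> {0<..<T} \<and> \<Gamma> x \<in> fst c0" if "x \<in> ?V" for x
      using that VW[OF that] sub unfolding W_def by blast
    fix r t assume rt: "(r, t) \<in> ?V"
    show "((\<lambda>r. snd c0 (\<Gamma> (r, t))) has_vector_derivative fr (r, t)) (at r)"
      using at(1)[of r t] VW[OF rt] rt by blast
    show "((\<lambda>t. snd c0 (\<Gamma> (r, t))) has_vector_derivative ft (r, t)) (at t)"
      using at(2)[of r t] VW[OF rt] rt by blast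
  qed
  then obtain frr frt frrr frrt where sm: "smooth_partials ?V (\<lambda>r t. snd c0 (\<Gamma> (r, t))) (\<lambda>r t. fr (r, t)) (\<lambda>r t. ft (r, t)) frr frt frrr frrt"
    by (elim exE)
  have inV: "(X r, t) \<in> ?V" if "0 < r" "r < \<rho>" "0 < t" "t < \<tau>" for r t
    using XW[of r t] X2[of r] that \<tau> ab by (auto simp: W_def)
  note chainU = chain[where Y = UNIV and Y' = UNIV, OF _ subset_UNIV]
  have sm': "smooth_partials ({0<..<\<rho>} \<times> {0<..<\<tau>}) z zr zt (\<lambda>r t. frr (X r) t) (\<lambda>r t. of_real \<sigma> * frt (X r) t)
      (\<lambda>r t. of_real \<sigma> * frrr (X r) t) (\<lambda>r t. frrt (X r) t)"
    unfolding smooth_partials_def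
  proof (intro allI impI)
    fix r t assume "(r, t) \<in> {0<..<\<rho>} \<times> {0<..<\<tau>}"
    then have rt: "(X r, t) \<in> ?V" using inV[of r t] by auto
    note S = sm[unfolded smooth_partials_def, rule_format, OF rt]
    note S1 = S[THEN conjunct1] and S' = S[THEN conjunct2]
    note S2 = S'[THEN conjunct1] and S' = S'[THEN conjunct2]
    note S3 = S'[THEN conjunct1] and S' = S'[THEN conjunct2]
    note S4 = S'[THEN conjunct1] and S' = S'[THEN conjunct2]
    note S5 = S'[THEN conjunct1] and S' = S'[THEN conjunct2]
    note S6 = S'[THEN conjunct1] and S' = S'[THEN conjunct2]
    note S7 = S'[THEN conjunct1] and S8 = S'[THEN conjunct2]
    note m = has_vector_derivative_mult_right[of _ _ _ "of_real \<sigma>"]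
    show "((\<lambda>r. z r t) has_vector_derivative zr r t) (at r) \<and>
      ((\<lambda>t. z r t) has_vector_derivative zt r t) (at t) \<and>
      ((\<lambda>r. zr r t) has_vector_derivative frr (X r) t) (at r) \<and>
      ((\<lambda>t. zr r t) has_vector_derivative of_real \<sigma> * frt (X r) t) (at t) \<and>
      ((\<lambda>r. zt r t) has_vector_derivative of_real \<sigma> * frt (X r) t) (at r) \<and>
      ((\<lambda>r. frr (X r) t) has_vector_derivative of_real \<sigma> * frrr (X r) t) (at r) \<and>
      ((\<lambda>t. frr (X r) t) has_vector_derivative frrt (X r) t) (at t) \<and>
      ((\<lambda>r. of_real \<sigma> * frt (X r) t) has_vector_derivative frrt (X r) t) (at r)"
      using chainU[OF S1] S2 m[OF chainU[OF S3]] m[OF S4] chainU[OF S5] chainU[OF S6] S7 m[OF chainU[OF S8]]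
      unfolding z_def zr_def zt_def mult.assoc[symmetric] \<sigma>c by simp
  qed
  have inS: "\<Gamma> (X r, t) \<in> fst c0 \<and> \<Gamma> (X r, t) \<notin> S" if "0 < r" "r \<le> \<rho>" "0 \<le> t" "t \<le> \<tau>" for r t
    using XW[of r t] sub regular[of "X r" t] X2[of r] that \<tau> ab unfolding W_def by (auto simp: image_subset_iff)
  have \<rho>_eq: "g c0 (z r t) 1 1 = exp (2 * h (z r t)) * norm (z r t) powr (2 * \<beta>)"
    if "0 < r" "r \<le> \<rho>" "0 \<le> t" "t \<le> \<tau>" "z r t \<noteq> 0" for r t
    using gh[of "z r t" 1 1] inS[OF that(1-4)] that(5) by (auto simp: z_def)
  have cc: "slice_curvature g \<Gamma> c0 (X r) t = Im (zt r t / fr (X r, t)) *\<^sub>R (\<i> * fr (X r, t))"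
    and fr_at: "((\<lambda>r. snd c0 (\<Gamma> (r, t))) has_vector_derivative fr (X r, t)) (at (X r))"
    and ft_at: "((\<lambda>t. snd c0 (\<Gamma> (X r, t))) has_vector_derivative ft (X r, t)) (at t within {0..T})"
    if r: "0 < r" "r \<le> \<rho>" and t: "0 \<le> t" "t \<le> \<tau>" and nz: "zr r t \<noteq> 0" for r t
  proof -
    have XWr: "(X r, t) \<in> W" using XW[of r t] r t by simp
    show f1: "((\<lambda>r. snd c0 (\<Gamma> (r, t))) has_vector_derivative fr (X r, t)) (at (X r))"
      using at(1)[of "X r" t] XWr X2[OF r] by blast
    show f2: "((\<lambda>t. snd c0 (\<Gamma> (X r, t))) has_vector_derivative ft (X r, t)) (at t within {0..T})"
      using at(3)[of "X r" t] XWr by blast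
    show "slice_curvature g \<Gamma> c0 (X r) t = Im (zt r t / fr (X r, t)) *\<^sub>R (\<i> * fr (X r, t))"
      unfolding zt_def
      by (rule chart_curvature[OF c0(1) _ X2[OF r] _ f1 _ f2])
        (use inS[of r t] r t nz \<tau> ab in \<open>auto simp: zr_def\<close>)
  qed
  have powr_square: "(x powr q)\<^sup>2 = x powr (2 * q)" for x q :: real
    by (simp only: power2_eq_square powr_add[symmetric] mult_2)
  have \<sigma>_cases: "\<sigma> = 1 \<or> \<sigma> = -1" using e by blast
  have fr_sign: "norm (fr (X r, t)) = norm (zr r t)" "Im (q / fr (X r, t)) = \<sigma> * Im (q / zr r t)"
    "Im (q * fr (X r, t)) = \<sigma> * Im (q * zr r t)" "Im (fr (X r, t) / q) = \<sigma> * Im (zr r t / q)" for q r t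
    unfolding fr_zr using \<sigma>_cases by auto
  \<comment> \<open>The conformal factor is the exponential of 2 h + 2 \<beta> ln |z|, so half of
    its logarithmic normal derivative is - Im (H z_r) - \<beta> Im (z_r / z). The second derivative
    \<open>Zrr\<close> is left free: it is \<open>frr\<close> for positive times and comes from the
    initial arc at time 0.\<close>
  have flow_z: "(exp (h (z r t)) * norm (z r t) powr ((1 + \<beta>) - 1) * norm (zr r t))\<^sup>2 * Im (zt r t / zr r t) =
      Im (Zrr / zr r t) + Im (H (z r t) * zr r t) + ((1 + \<beta>) - 1) * Im (zr r t / z r t)"
    if r: "0 < r" "r < \<rho>" and t: "0 \<le> t" "t < \<tau>" and nz: "z r t \<noteq> 0" "zr r t \<noteq> 0" "norm (z r t) < R"
      and Zrr: "((\<lambda>x. fr (x, t)) has_vector_derivative Zrr) (at (X r))" for r t Zrr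
  proof -
    define y where "y = z r t"
    define G where "G = exp (2 * h y) * norm y powr (2 * \<beta>)"
    have y: "y \<noteq> 0" "y \<in> ball 0 R" "y = snd c0 (\<Gamma> (X r, t))" using nz by (auto simp: y_def z_def)
    have G: "g c0 y 1 1 = G" "0 < G" using \<rho>_eq[of r t] r t nz by (auto simp: y_def G_def)
    have ln: "((\<lambda>y. ln (norm y)) has_derivative (\<lambda>w. Re (w / y))) (at y)"
    proof -
      have "((\<lambda>y. ln (norm y)) has_derivative (\<lambda>w. inner w (sgn y) * inverse (norm y))) (at y)"
        using y by (intro has_derivative_ln has_derivative_norm) auto
      moreover have "inner w (sgn y) * inverse (norm y) = Re (w / y)" for w
      proof -
        have "Re (w / y) = (Re w * Re y + Im w * Im y) / (norm y)\<^sup>2"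
          by (simp add: Re_divide cmod_power2)
        then show ?thesis
          by (simp add: sgn_div_norm inner_complex_def power2_eq_square divide_inverse algebra_simps)
      qed
      ultimately show ?thesis by simp
    qed
    have exp_G: "exp (2 * h y + 2 * \<beta> * ln (norm y)) = G" using y by (simp add: G_def exp_add powr_def)
    have "((\<lambda>y. 2 * h y + 2 * \<beta> * ln (norm y)) has_derivative (\<lambda>w. 2 * Re (H y * w) + 2 * \<beta> * Re (w / y))) (at y)"
      by (rule has_derivative_add[OF has_derivative_mult_right[OF hd[OF y(2)]] has_derivative_mult_right[OF ln]])
    from has_derivative_exp[OF this]
    have "((\<lambda>y. exp (2 * h y + 2 * \<beta> * ln (norm y))) has_derivative (\<lambda>w. G * (2 * Re (H y * w) + 2 * \<beta> * Re (w / y)))) (at y)"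
      unfolding exp_G mult.commute[of G] .
    then have D: "((\<lambda>y. g c0 y 1 1) has_derivative (\<lambda>w. G * (2 * Re (H y * w) + 2 * \<beta> * Re (w / y)))) (at (snd c0 (\<Gamma> (X r, t))))"
      unfolding y(3)[symmetric]
    proof (rule has_derivative_transform_within_open)
      show "open (snd c0 ` (fst c0 \<inter> UNIV) - {0})"
        by (intro open_Diff chart_image_open[OF cs c0(1)]) auto
      show "y \<in> snd c0 ` (fst c0 \<inter> UNIV) - {0}" using y inS[of r t] r t by auto
      show "exp (2 * h x + 2 * \<beta> * ln (norm x)) = g c0 x 1 1" if "x \<in> snd c0 ` (fst c0 \<inter> UNIV) - {0}" for x
        using gh[of x 1 1] that by (simp add: exp_add powr_def)
    qed
    have ev: "\<forall>\<^sub>F x in nhds (X r). ((\<lambda>r. snd c0 (\<Gamma> (r, t))) has_vector_derivative fr (x, t)) (at x)"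
    proof -
      have "open ({a<..<b} \<inter> (\<lambda>x. (x, t)) -` ball (e, 0) \<epsilon>)"
        by (intro open_Int open_vimage open_ball continuous_intros)
      moreover have "X r \<in> {a<..<b} \<inter> (\<lambda>x. (x, t)) -` ball (e, 0) \<epsilon>"
        using X2[of r] XW[of r t] r t by (auto simp: W_def)
      ultimately have "\<forall>\<^sub>F x in nhds (X r). x \<in> {a<..<b} \<inter> (\<lambda>x. (x, t)) -` ball (e, 0) \<epsilon>"
        by (rule eventually_nhds_in_open)
      then show ?thesis
      proof eventually_elim
        case (elim x)
        then have "(x, t) \<in> W" using t \<tau> ab by (auto simp: W_def)
        then show ?case using at(1)[of x t] elim by blast
      qed
    qed
    have nzf: "fr (X r, t) \<noteq> 0" using nz by (auto simp: zr_def)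
    have in0: "\<Gamma> (X r, t) \<in> fst c0" "\<Gamma> (X r, t) \<notin> S" using inS[of r t] r t by auto
    have k: "slice_curvature g \<Gamma> c0 (X r) t = Im (zt r t / fr (X r, t)) *\<^sub>R (\<i> * fr (X r, t))"
      using cc[of r t] r t nz by simp
    have "Im (Zrr / fr (X r, t)) = G * (norm (fr (X r, t)))\<^sup>2 * Im (zt r t / fr (X r, t))
        + G * (2 * Re (H y * (\<i> * fr (X r, t))) + 2 * \<beta> * Re (\<i> * fr (X r, t) / y)) / (2 * G)"
      using flow_from_curvature[OF c0(1) in0 ev Zrr nzf D k] unfolding y(3)[symmetric] G(1) .
    also have "G * (2 * Re (H y * (\<i> * fr (X r, t))) + 2 * \<beta> * Re (\<i> * fr (X r, t) / y)) / (2 * G) =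
        - Im (H y * fr (X r, t)) - \<beta> * Im (fr (X r, t) / y)"
    proof -
      have 1: "Re (H y * (\<i> * u)) = - Im (H y * u)" for u by simp
      have 2: "Re (\<i> * u / y) = - Im (u / y)" for u
        unfolding times_divide_eq_right[symmetric] by (simp del: times_divide_eq_right)
      have 3: "G * (2 * u + 2 * \<beta> * v) / (2 * G) = u + \<beta> * v" for u v using G(2) by (simp add: field_simps)
      show ?thesis unfolding 1 2 unfolding 3 unfolding mult_minus_right by (rule diff_conv_add_uminus[symmetric])
    qed
    finally have E: "Im (Zrr / fr (X r, t)) = G * (norm (fr (X r, t)))\<^sup>2 * Im (zt r t / fr (X r, t)) +
        (- Im (H y * fr (X r, t)) - \<beta> * Im (fr (X r, t) / y))" .
    \<comment> \<open>Reversing the arc multiplies each imaginary part by \<open>\<sigma>\<close>,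
      and this common factor is divided out.\<close>
    have cancel: "q * n * u = v + w + c * x" if "s * v = q * n * (s * u) + (- (s * w) - c * (s * x))" "s \<noteq> 0" for q n u v w c x s :: real
    proof -
      have "s * (q * n * u) = s * (v + w + c * x)" using that(1) by (simp add: algebra_simps)
      then show ?thesis using that(2) by simp
    qed
    have flow: "G * (norm (zr r t))\<^sup>2 * Im (zt r t / zr r t) = Im (Zrr / zr r t) + Im (H y * zr r t) + \<beta> * Im (zr r t / y)"
      by (rule cancel[OF _ \<sigma>(3)]) (rule E[unfolded fr_sign])
    have "(exp (h y) * norm y powr \<beta> * norm (zr r t))\<^sup>2 = G * (norm (zr r t))\<^sup>2"
      unfolding G_def power_mult_distrib exp_double powr_square ..
    with flow have "(exp (h y) * norm y powr \<beta> * norm (zr r t))\<^sup>2 * Im (zt r t / zr r t) =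
        Im (Zrr / zr r t) + Im (H y * zr r t) + \<beta> * Im (zr r t / y)" by (simp only:)
    moreover have "(1 + \<beta>) - 1 = \<beta>" by simp
    ultimately show ?thesis unfolding y_def by (simp only:)
  qed
  have cz: "continuous_on ({0..\<rho>} \<times> {0..\<tau>}) (\<lambda>x. f (X (fst x), snd x))" if "continuous_on W f" for f :: "real \<times> real \<Rightarrow> complex"
    unfolding X_def
    by (rule continuous_on_compose2[OF that]) (use XW in \<open>auto simp: X_def intro!: continuous_intros\<close>)
  have "\<exists>\<rho>' \<tau>' K. 0 < \<rho>' \<and> \<rho>' < \<rho> \<and> 0 < \<tau>' \<and> \<tau>' < \<tau> \<and> 0 \<le> K \<and>
    (\<forall>r t. 0 < r \<and> r \<le> \<rho>' \<and> 0 \<le> t \<and> t \<le> \<tau>' \<longrightarrow> z r t \<noteq> 0 \<and> zr r t \<noteq> 0 \<and>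
      exp (h (z r t)) * norm (z r t) powr ((1 + \<beta>) - 1) * (norm (zr r t) * \<bar>Im (zt r t / zr r t)\<bar>) \<le> K * r powr (\<kappa> - (1 + \<beta>)))"
  proof (rule vertex_estimate[where zr = zr and zt = zt and a = "\<lambda>r. f2 (X r)" and N = N and R = R and M = M and H = H and A = A' and B = B,
        OF \<rho>(1) \<tau>(1) _ _ \<kappa> _ _ _ _ zr_der sm' v a_der N RM hd Hd hb])
    show "0 < 1 + \<beta>" "1 + \<beta> < 1" using \<beta> by auto
    show "continuous_on ({0..\<rho>} \<times> {0..\<tau>}) (\<lambda>x. z (fst x) (snd x))"
      unfolding z_def using cz[OF cont(1)[folded W_def]] by (simp add: o_def)
    show "continuous_on ({0..\<rho>} \<times> {0..\<tau>}) (\<lambda>x. zr (fst x) (snd x))"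
      unfolding zr_def by (intro continuous_intros cz[OF cont(2)[folded W_def]])
    show "continuous_on ({0..\<rho>} \<times> {0..\<tau>}) (\<lambda>x. zt (fst x) (snd x))"
      unfolding zt_def by (rule cz[OF cont(3)[folded W_def]])
    show "z 0 t = 0" if "0 \<le> t" "t \<le> \<tau>" for t
      using vertex[of t] that \<tau> ab c0 by (simp add: z_def X_def)
    fix r t assume r: "0 < r" "r < \<rho>" and t: "0 < t" "t < \<tau>" and nz: "z r t \<noteq> 0" "zr r t \<noteq> 0" "norm (z r t) < R"
    have "((\<lambda>x. fr (x, t)) has_vector_derivative frr (X r) t) (at (X r))"
      using sm[unfolded smooth_partials_def, rule_format, OF inV[OF r t]] by blast
    from flow_z[OF r less_imp_le[OF t(1)] t(2) nz this]
    show "(exp (h (z r t)) * norm (z r t) powr ((1 + \<beta>) - 1) * norm (zr r t))\<^sup>2 * Im (zt r t / zr r t) =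
      Im (frr (X r) t / zr r t) + Im (H (z r t) * zr r t) + ((1 + \<beta>) - 1) * Im (zr r t / z r t)" .
  next
    fix r assume r: "0 < r" "r < \<rho>" and nz: "z r 0 \<noteq> 0" "zr r 0 \<noteq> 0" "norm (z r 0) < R"
    have Xinv: "X (\<sigma> * (x - e)) = x" for x
      using \<sigma>(1) by (simp add: X_def flip: mult.assoc)
    define J where "J = {x. 0 < \<sigma> * (x - e) \<and> \<sigma> * (x - e) < \<rho>}"
    have J: "open J" "X r \<in> J"
    proof -
      show "open J" unfolding J_def by (intro open_Collect_conj open_Collect_less continuous_intros)
      have "\<sigma> * (X r - e) = r" using \<sigma>(1) by (simp add: X_def flip: mult.assoc)
      then show "X r \<in> J" using r unfolding J_def by simp
    qed
    have J_sub: "J \<subseteq> {a..b} \<inter> ball e \<epsilon>2"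
    proof
      fix x assume "x \<in> J"
      then have "X (\<sigma> * (x - e)) \<in> {a..b} \<inter> ball e \<epsilon>2" by (intro X1) (auto simp: J_def)
      then show "x \<in> {a..b} \<inter> ball e \<epsilon>2" unfolding Xinv .
    qed
    have "(f1 has_vector_derivative f2 (X r)) (at (X r))"
      unfolding at_within_open[OF J(2,1), symmetric]
      by (rule has_vector_derivative_within_subset[OF f12(2) J_sub]) (use J J_sub in blast)
    then have "((\<lambda>x. fr (x, 0)) has_vector_derivative f2 (X r)) (at (X r))"
    proof (rule has_vector_derivative_transform_within_open[OF _ J])
      fix x assume "x \<in> J"
      then have "zr (\<sigma> * (x - e)) 0 = of_real \<sigma> * f1 (X (\<sigma> * (x - e)))" by (intro zr0) (auto simp: J_def)
      then show "f1 x = fr (x, 0)" unfolding zr_def Xinv using \<sigma>(3) by simp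
    qed
    from flow_z[OF r order_refl \<tau>(1) nz this]
    show "(exp (h (z r 0)) * norm (z r 0) powr ((1 + \<beta>) - 1) * norm (zr r 0))\<^sup>2 * Im (zt r 0 / zr r 0) =
      Im (f2 (X r) / zr r 0) + Im (H (z r 0) * zr r 0) + ((1 + \<beta>) - 1) * Im (zr r 0 / z r 0)" .
  qed
  then obtain \<rho>' \<tau>' K where pp: "0 < \<rho>'" "\<rho>' < \<rho>" "0 < \<tau>'" "\<tau>' < \<tau>" "0 \<le> K"
    and est: "\<And>r t. 0 < r \<Longrightarrow> r \<le> \<rho>' \<Longrightarrow> 0 \<le> t \<Longrightarrow> t \<le> \<tau>' \<Longrightarrow> z r t \<noteq> 0 \<and> zr r t \<noteq> 0 \<and>
      exp (h (z r t)) * norm (z r t) powr ((1 + \<beta>) - 1) * (norm (zr r t) * \<bar>Im (zt r t / zr r t)\<bar>) \<le> K * r powr (\<kappa> - (1 + \<beta>))"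
    by blast
  show ?thesis
  proof (rule exI[of _ \<rho>'], rule exI[of _ \<tau>'], rule exI[of _ K], intro conjI allI impI ballI)
    show "0 < \<rho>'" "0 < \<tau>'" "\<tau>' < T" "0 \<le> K" using pp \<tau> ab by auto
    fix x t c assume xt: "x \<in> {a..b} \<and> 0 < \<bar>x - e\<bar> \<and> \<bar>x - e\<bar> \<le> \<rho>' \<and> 0 \<le> t \<and> t \<le> \<tau>'"
      and c: "c \<in> A" "\<Gamma> (x, t) \<in> fst c"
    define r where "r = \<bar>x - e\<bar>"
    have Xr: "X r = x" using xt e by (auto simp: X_def r_def)
    have r: "0 < r" "r \<le> \<rho>'" "0 \<le> t" "t \<le> \<tau>'" using xt by (auto simp: r_def)
    then have r': "0 < r" "r \<le> \<rho>" "0 \<le> t" "t \<le> \<tau>" using pp by auto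
    have E: "z r t \<noteq> 0" "zr r t \<noteq> 0"
      "exp (h (z r t)) * norm (z r t) powr \<beta> * (norm (zr r t) * \<bar>Im (zt r t / zr r t)\<bar>) \<le> K * r powr (\<kappa> - (1 + \<beta>))"
      using est[OF r] by auto
    have tT: "t \<in> {0..<T}" using r' \<tau> ab by auto
    have "tensor_norm (g c) (snd c (\<Gamma> (X r, t))) (slice_curvature g \<Gamma> c (X r) t) =
        sqrt (g c0 (snd c0 (\<Gamma> (X r, t))) 1 1) * (norm (fr (X r, t)) * \<bar>Im (ft (X r, t) / fr (X r, t))\<bar>)"
      by (rule norm_curvature[OF c0(1) _ c(1) _ X2[OF r'(1,2)] tT fr_at[OF r' E(2)] _ ft_at[OF r' E(2)]])
        (use inS[OF r'] c(2) Xr E(2) in \<open>auto simp: zr_def\<close>)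
    also have "sqrt (g c0 (snd c0 (\<Gamma> (X r, t))) 1 1) = exp (h (z r t)) * norm (z r t) powr \<beta>"
    proof -
      have "g c0 (snd c0 (\<Gamma> (X r, t))) 1 1 = (exp (h (z r t)) * norm (z r t) powr \<beta>)\<^sup>2"
        using \<rho>_eq[OF r' E(1)] unfolding power_mult_distrib powr_square exp_double[symmetric] z_def .
      then show ?thesis by simp
    qed
    also have "norm (fr (X r, t)) * \<bar>Im (ft (X r, t) / fr (X r, t))\<bar> = norm (zr r t) * \<bar>Im (zt r t / zr r t)\<bar>"
      by (simp only: fr_sign zt_def abs_mult \<sigma>(2) mult_1_left)
    finally show "tensor_norm (g c) (snd c (\<Gamma> (x, t))) (slice_curvature g \<Gamma> c x t) \<le> K * \<bar>x - e\<bar> powr (\<kappa> - (1 + \<beta>))"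
      using E(3) unfolding Xr r_def[symmetric] by simp
  qed
qed

end

section \<open>Choice of the exponents and assembly over all vertices\<close>

theorem theorem2:
  fixes A :: "'a::{t2_space, second_countable_topology} chart set"
    and g0 g :: "'a metric_tensor"
    and S :: "'a set"
    and n :: nat
    and p :: "nat \<Rightarrow> 'a"
    and \<beta> s :: "nat \<Rightarrow> real"
    and \<gamma> :: "real \<Rightarrow> 'a"
    and T :: real
    and \<Gamma> :: "real \<times> real \<Rightarrow> 'a"
  assumes surface: "riemann_surface A g0"
    and singular_set: "finite S"
    and metric_regular: "riemannian_metric_on A (- S) g"
    and metric_conformal: "conformal_on A (- S) g g0"
    and n_ge_2: "n \<ge> 2"
    and conical: "\<And>j. j \<in> {1..n} \<Longrightarrow> p j \<in> S \<and> conical_point A g (p j) (\<beta> j)"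
    and orders: "-1 < \<beta> 1" "mono_on {1..n} \<beta>" "\<beta> n < 0"
    and partition: "s 1 = 0" "strict_mono_on {1..n} s" "s n = 1"
    and gamma_continuous: "continuous_on {0..1} \<gamma>"
    and gamma_vertices: "\<And>j. j \<in> {1..n} \<Longrightarrow> \<gamma> (s j) = p j"
    and gamma_regular: "\<gamma> ` ({0..1} - s ` {1..n}) \<inter> S = {}"
    and gamma_smooth: "\<And>j. j \<in> {1..<n} \<Longrightarrow> Ck_map_on \<infinity> A {s j..s (Suc j)} \<gamma>"
    and gamma_immersed: "\<And>j. j \<in> {1..<n} \<Longrightarrow> immersion_on A {s j..s (Suc j)} \<gamma>"
    and flow: "degenerate_csf A g S n p \<beta> s \<gamma> T \<Gamma>"
  shows "\<forall>\<epsilon>>0. \<exists>T\<epsilon>. 0 < T\<epsilon> \<and> T\<epsilon> \<le> T \<and>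
    (\<forall>j\<in>{1..n}. \<exists>C\<ge>0. \<exists>\<delta>>0. \<forall>t\<in>{0..T\<epsilon>}. \<forall>r\<in>{0..1}. 0 < \<bar>r - s j\<bar> \<and> \<bar>r - s j\<bar> < \<delta> \<longrightarrow>
      (\<forall>c\<in>A. \<Gamma> (r, t) \<in> fst c \<longrightarrow>
        tensor_norm (g c) (snd c (\<Gamma> (r, t))) (slice_curvature g \<Gamma> c r t) \<le>
          (if \<beta> n \<le> -1/2
           then C * \<bar>r - s j\<bar> powr (1 + \<beta> j - \<epsilon>)
           else C * \<bar>r - s j\<bar> powr (- \<beta> n * ((1 + \<beta> j) / (1 + \<beta> n)) - \<epsilon>))))"
proof (intro allI impI)
  fix \<epsilon> :: real
  assume \<epsilon>: "0 < \<epsilon>"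
  have \<beta>_mono: "\<beta> i \<le> \<beta> j" if "i \<in> {1..n}" "j \<in> {1..n}" "i \<le> j" for i j
    using orders(2) that by (rule mono_onD)
  have \<beta>: "-1 < \<beta> j" "\<beta> j \<le> \<beta> n" "\<beta> j < 0" if "j \<in> {1..n}" for j
    using \<beta>_mono[of 1 j] \<beta>_mono[of j n] that orders by auto
  have s_less: "s i < s j" if "i \<in> {1..n}" "j \<in> {1..n}" "i < j" for i j
    using partition(2) that by (rule strict_mono_onD)
  have s_range: "s j \<in> {0..1}" if "j \<in> {1..n}" for j
    using s_less[of 1 j] s_less[of j n] that partition(1,3) by (cases "j = 1"; cases "j = n"; force)
  define E where "E j = (if \<beta> n \<le> -1/2 then 1 + \<beta> j - \<epsilon> else - \<beta> n * ((1 + \<beta> j) / (1 + \<beta> n)) - \<epsilon>)" for j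
  define \<kappa> where "\<kappa> j = min 1 (2 * (1 + \<beta> j)) - min \<epsilon> (1 + \<beta> j) / 2" for j
  have \<kappa>: "0 < \<kappa> j" "\<kappa> j \<le> 1" "\<kappa> j < 2 * (1 + \<beta> j)"
    if j: "j \<in> {1..n}" for j
  proof -
    have N: "min 1 (2 * (1 + \<beta> j)) \<le> 1" "min 1 (2 * (1 + \<beta> j)) \<le> 2 * (1 + \<beta> j)" "1 + \<beta> j \<le> min 1 (2 * (1 + \<beta> j))"
      using \<beta>[OF j] by auto
    have M: "0 < min \<epsilon> (1 + \<beta> j)" "min \<epsilon> (1 + \<beta> j) \<le> 1 + \<beta> j" using \<beta>[OF j] \<epsilon> by auto
    have arith: "0 < N - M / 2 \<and> N - M / 2 \<le> 1 \<and> N - M / 2 < 2 * (1 + b)"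
      if "N \<le> 1" "N \<le> 2 * (1 + b)" "1 + b \<le> N" "0 < M" "M \<le> 1 + b" for N M b :: real
      using that by (intro conjI) linarith+
    note bounds = arith[OF N M]
    show "0 < \<kappa> j" unfolding \<kappa>_def by (rule bounds[THEN conjunct1])
    show "\<kappa> j \<le> 1" unfolding \<kappa>_def by (rule bounds[THEN conjunct2, THEN conjunct1])
    show "\<kappa> j < 2 * (1 + \<beta> j)" unfolding \<kappa>_def by (rule bounds[THEN conjunct2, THEN conjunct2])
  qed
  have E_le: "E j \<le> \<kappa> j - (1 + \<beta> j)" if j: "j \<in> {1..n}" for j
  proof -
    \<comment> \<open>With b = 1 + \<open>\<beta> j\<close> one has min 1 (2 b) - b = min (-
      \<open>\<beta> j\<close>) b, and only \<open>\<epsilon> / 2\<close> at most has been given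
      away.\<close>
    have k: "min (- \<beta> j) (1 + \<beta> j) - \<epsilon> \<le> \<kappa> j - (1 + \<beta> j)"
      using \<beta>[OF j] \<epsilon> by (auto simp: \<kappa>_def min_def)
    show ?thesis
    proof (cases "\<beta> n \<le> -1/2")
      case True
      then have "1 + \<beta> j \<le> - \<beta> j" using \<beta>[OF j] by simp
      then show ?thesis using k True using \<open>E \<equiv> \<lambda>j. if \<beta> n \<le> - 1 / 2 then 1 + \<beta> j - \<epsilon> else - \<beta> n * ((1 + \<beta> j) / (1 + \<beta> n)) - \<epsilon>\<close> by force
    next
      case False
      \<comment> \<open>From \<open>q\<close> (1 + \<open>\<beta> n\<close>) = 1 +
        \<open>\<beta> j\<close> follows - \<open>\<beta> n\<close> \<open>q\<close> =
        \<open>q\<close> - 1 - \<open>\<beta> j\<close>, so \<open>q\<close> \<le> 1 bounds the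
        exponent by - \<open>\<beta> j\<close>. The bound by 1 + \<open>\<beta> j\<close> comes from
        - \<open>\<beta> n\<close> \<le> 1 + \<open>\<beta> n\<close>.\<close>
      define q where "q = (1 + \<beta> j) / (1 + \<beta> n)"
      have q: "0 \<le> q" "q \<le> 1" "q * (1 + \<beta> n) = 1 + \<beta> j"
        using \<beta>[OF j] False by (auto simp: q_def divide_le_eq)
      have "- \<beta> n * q \<le> 1 + \<beta> j"
        using mult_right_mono[of "- \<beta> n" "1 + \<beta> n" q] False q by (simp add: mult.commute)
      moreover have "- \<beta> n * q \<le> - \<beta> j"
        using q by (simp add: algebra_simps)
      ultimately show ?thesis using k False using \<open>E \<equiv> \<lambda>j. if \<beta> n \<le> - 1 / 2 then 1 + \<beta> j - \<epsilon> else - \<beta> n * ((1 + \<beta> j) / (1 + \<beta> n)) - \<epsilon>\<close> q_def by auto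
    qed
  qed
  \<comment> \<open>Parameters differ by at most 1, and for such a base a smaller exponent gives a
    larger power.\<close>
  have powr_E: "x powr (\<kappa> j - (1 + \<beta> j)) \<le> x powr E j" if "j \<in> {1..n}" "0 < x" "x \<le> 1" for j x
    using E_le[OF that(1)] that by (intro powr_mono') auto
  have T: "0 < T" using flow unfolding degenerate_csf_def by blast
  \<comment> \<open>The set Y of parameters is variable because the estimate is known on one arc and
    has to be transferred to the part of [0, 1] on that side of the vertex and then to all of
    [0, 1].\<close>
  define good where "good j Y \<rho> \<tau> K \<longleftrightarrow> 0 < \<rho> \<and> 0 < \<tau> \<and> \<tau> < T \<and> 0 \<le> K \<and>
    (\<forall>r t. r \<in> Y \<and> 0 < \<bar>r - s j\<bar> \<and> \<bar>r - s j\<bar> \<le> \<rho> \<and> 0 \<le> t \<and> t \<le> \<tau> \<longrightarrow>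
      (\<forall>c\<in>A. \<Gamma> (r, t) \<in> fst c \<longrightarrow>
        tensor_norm (g c) (snd c (\<Gamma> (r, t))) (slice_curvature g \<Gamma> c r t) \<le> K * \<bar>r - s j\<bar> powr (\<kappa> j - (1 + \<beta> j))))"
    for j Y \<rho> \<tau> K
  have side: "\<exists>\<rho> \<tau> K. good j {s i..s (Suc i)} \<rho> \<tau> K"
    if i: "i \<in> {1..<n}" and j: "j = i \<or> j = Suc i" for i j
  proof -
    have i': "i \<in> {1..n}" "Suc i \<in> {1..n}" "j \<in> {1..n}" using i j by auto
    have fl: "Ck_map_on \<infinity> A ({s i<..<s (Suc i)} \<times> {0<..<T}) \<Gamma>" "Ck_map_on 1 A ({s i..s (Suc i)} \<times> {0..T}) \<Gamma>"
      "flow_equation A g S (s i) (s (Suc i)) T \<Gamma>" "\<And>t. t \<in> {0..T} \<Longrightarrow> \<Gamma> (s j, t) = p j"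
      "\<And>r. r \<in> {0..1} \<Longrightarrow> \<Gamma> (r, 0) = \<gamma> r"
      using flow i i'(3) unfolding degenerate_csf_def by auto
    have sub: "{s i..s (Suc i)} \<subseteq> {0..1}" using s_range[OF i'(1)] s_range[OF i'(2)] by auto
    have ini: "\<Gamma> (r, 0) = \<gamma> r" if "r \<in> {s i..s (Suc i)}" for r using fl(5) sub that by blast
    have not_vertex: "r \<notin> s ` {1..n}" if "r \<in> {s i<..<s (Suc i)}" for r
    proof
      assume "r \<in> s ` {1..n}"
      then obtain m where m: "m \<in> {1..n}" "r = s m" by blast
      then have "m \<noteq> i" "m \<noteq> Suc i" using that by auto
      then consider "m < i" | "Suc i < m" by linarith
      then show False
        using s_less[OF m(1) i'(1)] s_less[OF i'(2) m(1)] m that by cases auto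
    qed
    have reg: "\<Gamma> (r, t) \<notin> S" if "r \<in> {s i<..<s (Suc i)}" "t \<in> {0..<T}" for r t
    proof (cases "t = 0")
      case True
      have r: "r \<in> {s i..s (Suc i)}" using that by auto
      then have "\<gamma> r \<in> \<gamma> ` ({0..1} - s ` {1..n})" using not_vertex[OF that(1)] sub by blast
      then show ?thesis using gamma_regular ini[OF r] True by auto
    next
      case False
      then have "t \<in> {0<..<T}" using that(2) by auto
      then show ?thesis using fl(3) that(1) unfolding flow_equation_def by blast
    qed
    obtain c0 where c0: "conical_chart A g (p j) (\<beta> j) c0"
      using conical[OF i'(3)] unfolding conical_point_def by blast
    show ?thesis
      unfolding good_def
      by (rule vertex_side[where e = "s j" and \<sigma> = "if j = i then 1 else -1" and p = "p j" and ?c0.0 = c0 and ?g0.0 = g0 and \<gamma> = \<gamma> and S = S,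
          OF surface singular_set metric_regular metric_conformal fl(2,1,3) gamma_smooth[OF i] ini reg s_less[OF i'(1,2) lessI] T _ c0 \<beta>(1,3)[OF i'(3)] fl(4) gamma_immersed[OF i] \<kappa>[OF i'(3)]])
        (use j in auto)



  qed
  have vertex: "\<exists>\<rho> \<tau> K. good j {0..1} \<rho> \<tau> K" if j: "j \<in> {1..n}" for j
  proof -
    have right: "\<exists>\<rho> \<tau> K. good j {s j..1} \<rho> \<tau> K"
    proof (cases "j = n")
      case True
      \<comment> \<open>There is no arc to the right of the last vertex: the set is the single point
        1, which 0 < |r - s j| excludes, so the constants are arbitrary.\<close>
      then have "good j {s j..1} 1 (T / 2) 0" using T partition(3) by (auto simp: good_def)
      then show ?thesis by blast
    next
      case False
      then have i: "j \<in> {1..<n}" "Suc j \<in> {1..n}" using j by auto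
      obtain \<rho> \<tau> K where g: "good j {s j..s (Suc j)} \<rho> \<tau> K" using side[OF i(1)] by blast
      have "s j < s (Suc j)" using s_less[OF j i(2)] by simp
      \<comment> \<open>Capping the radius by the length of the arc keeps r inside the arc.\<close>
      then have "good j {s j..1} (min \<rho> (s (Suc j) - s j)) \<tau> K"
        using g unfolding good_def by (auto simp: abs_if split: if_splits)
      then show ?thesis by blast
    qed
    have left: "\<exists>\<rho> \<tau> K. good j {0..s j} \<rho> \<tau> K"
    proof (cases "j = 1")
      case True
      then have "good j {0..s j} 1 (T / 2) 0" using T partition(1) by (auto simp: good_def)
      then show ?thesis by blast
    next
      case False
      define i where "i = j - 1"
      have i: "i \<in> {1..<n}" "i \<in> {1..n}" "j = Suc i" using j False by (auto simp: i_def)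
      obtain \<rho> \<tau> K where g: "good j {s i..s (Suc i)} \<rho> \<tau> K" using side[OF i(1)] i(3) by blast
      have "s i < s j" using s_less[OF i(2) j] i by simp
      then have "good j {0..s j} (min \<rho> (s j - s i)) \<tau> K"
        using g unfolding good_def i(3)[symmetric] by (auto simp: abs_if split: if_splits)
      then show ?thesis by blast
    qed
    obtain \<rho>1 \<tau>1 K1 where 1: "good j {s j..1} \<rho>1 \<tau>1 K1" using right by blast
    obtain \<rho>2 \<tau>2 K2 where 2: "good j {0..s j} \<rho>2 \<tau>2 K2" using left by blast
    have "good j {0..1} (min \<rho>1 \<rho>2) (min \<tau>1 \<tau>2) (K1 + K2)"
      unfolding good_def
    proof (intro conjI allI impI ballI)
      show "0 < min \<rho>1 \<rho>2" "0 < min \<tau>1 \<tau>2" "min \<tau>1 \<tau>2 < T" "0 \<le> K1 + K2" using 1 2 by (auto simp: good_def)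
      fix r t c assume rt: "r \<in> {0..1} \<and> 0 < \<bar>r - s j\<bar> \<and> \<bar>r - s j\<bar> \<le> min \<rho>1 \<rho>2 \<and> 0 \<le> t \<and> t \<le> min \<tau>1 \<tau>2"
        and c: "c \<in> A" "\<Gamma> (r, t) \<in> fst c"
      let ?k = "tensor_norm (g c) (snd c (\<Gamma> (r, t))) (slice_curvature g \<Gamma> c r t)"
      let ?x = "\<bar>r - s j\<bar> powr (\<kappa> j - (1 + \<beta> j))"
      have "?k \<le> K1 * ?x \<or> ?k \<le> K2 * ?x"
      proof (cases "s j \<le> r")
        case True
        then have "r \<in> {s j..1} \<and> 0 < \<bar>r - s j\<bar> \<and> \<bar>r - s j\<bar> \<le> \<rho>1 \<and> 0 \<le> t \<and> t \<le> \<tau>1" using rt by auto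
        then show ?thesis using 1 c unfolding good_def by blast
      next
        case False
        then have "r \<in> {0..s j} \<and> 0 < \<bar>r - s j\<bar> \<and> \<bar>r - s j\<bar> \<le> \<rho>2 \<and> 0 \<le> t \<and> t \<le> \<tau>2" using rt by auto
        then show ?thesis using 2 c unfolding good_def by blast
      qed
      moreover have "0 \<le> K1 * ?x" "0 \<le> K2 * ?x" using 1 2 by (auto simp: good_def)
      ultimately show "?k \<le> (K1 + K2) * ?x" unfolding distrib_right by linarith
    qed
    then show ?thesis by blast
  qed
  then have "\<forall>j\<in>{1..n}. \<exists>\<tau>. \<exists>\<rho> K. good j {0..1} \<rho> \<tau> K" by blast
  then obtain \<tau> where \<tau>: "\<forall>j\<in>{1..n}. \<exists>\<rho> K. good j {0..1} \<rho> (\<tau> j) K"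
    by (rule bchoice[THEN exE])
  define T\<epsilon> where "T\<epsilon> = Min (\<tau> ` {1..n})"
  have ne: "finite (\<tau> ` {1..n})" "\<tau> ` {1..n} \<noteq> {}" using n_ge_2 by auto
  have \<tau>_pos: "0 < \<tau> j \<and> \<tau> j < T" if "j \<in> {1..n}" for j using \<tau> that unfolding good_def by blast
  show "\<exists>T\<epsilon>. 0 < T\<epsilon> \<and> T\<epsilon> \<le> T \<and>
    (\<forall>j\<in>{1..n}. \<exists>C\<ge>0. \<exists>\<delta>>0. \<forall>t\<in>{0..T\<epsilon>}. \<forall>r\<in>{0..1}. 0 < \<bar>r - s j\<bar> \<and> \<bar>r - s j\<bar> < \<delta> \<longrightarrow>
      (\<forall>c\<in>A. \<Gamma> (r, t) \<in> fst c \<longrightarrow>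
        tensor_norm (g c) (snd c (\<Gamma> (r, t))) (slice_curvature g \<Gamma> c r t) \<le>
          (if \<beta> n \<le> -1/2
           then C * \<bar>r - s j\<bar> powr (1 + \<beta> j - \<epsilon>)
           else C * \<bar>r - s j\<bar> powr (- \<beta> n * ((1 + \<beta> j) / (1 + \<beta> n)) - \<epsilon>))))"
  proof (rule exI[of _ T\<epsilon>], intro conjI ballI)
    show "0 < T\<epsilon>" unfolding T\<epsilon>_def using ne \<tau>_pos by (subst Min_gr_iff) auto
    have "T\<epsilon> \<le> \<tau> 1" unfolding T\<epsilon>_def using ne n_ge_2 by (intro Min_le) auto
    also have "\<tau> 1 \<le> T" using \<tau>_pos[of 1] n_ge_2 by simp
    finally show "T\<epsilon> \<le> T" .
    fix j assume j: "j \<in> {1..n}"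
    obtain \<rho> K where g: "good j {0..1} \<rho> (\<tau> j) K" using \<tau> j by blast
    have T\<epsilon>: "T\<epsilon> \<le> \<tau> j" unfolding T\<epsilon>_def using ne j by (intro Min_le) auto
    have K: "0 \<le> K" "0 < \<rho>" using g by (auto simp: good_def)
    show "\<exists>C\<ge>0. \<exists>\<delta>>0. \<forall>t\<in>{0..T\<epsilon>}. \<forall>r\<in>{0..1}. 0 < \<bar>r - s j\<bar> \<and> \<bar>r - s j\<bar> < \<delta> \<longrightarrow>
      (\<forall>c\<in>A. \<Gamma> (r, t) \<in> fst c \<longrightarrow>
        tensor_norm (g c) (snd c (\<Gamma> (r, t))) (slice_curvature g \<Gamma> c r t) \<le>
          (if \<beta> n \<le> -1/2
           then C * \<bar>r - s j\<bar> powr (1 + \<beta> j - \<epsilon>)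
           else C * \<bar>r - s j\<bar> powr (- \<beta> n * ((1 + \<beta> j) / (1 + \<beta> n)) - \<epsilon>)))"
    proof (rule exI[of _ K], rule conjI[OF K(1)], rule exI[of _ \<rho>], rule conjI[OF K(2)], intro ballI impI)
      fix t r c assume t: "t \<in> {0..T\<epsilon>}" and r: "r \<in> {0..1}" "0 < \<bar>r - s j\<bar> \<and> \<bar>r - s j\<bar> < \<rho>"
        and c: "c \<in> A" "\<Gamma> (r, t) \<in> fst c"
      have "r \<in> {0..1} \<and> 0 < \<bar>r - s j\<bar> \<and> \<bar>r - s j\<bar> \<le> \<rho> \<and> 0 \<le> t \<and> t \<le> \<tau> j"
        using t r T\<epsilon> by auto
      then have "tensor_norm (g c) (snd c (\<Gamma> (r, t))) (slice_curvature g \<Gamma> c r t)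
          \<le> K * \<bar>r - s j\<bar> powr (\<kappa> j - (1 + \<beta> j))"
        using g c unfolding good_def by blast
      also have "\<dots> \<le> K * \<bar>r - s j\<bar> powr E j"
        using powr_E[OF j, of "\<bar>r - s j\<bar>"] r s_range[OF j] K by (intro mult_left_mono) auto
      finally show "tensor_norm (g c) (snd c (\<Gamma> (r, t))) (slice_curvature g \<Gamma> c r t) \<le>
          (if \<beta> n \<le> -1/2
           then K * \<bar>r - s j\<bar> powr (1 + \<beta> j - \<epsilon>)
           else K * \<bar>r - s j\<bar> powr (- \<beta> n * ((1 + \<beta> j) / (1 + \<beta> n)) - \<epsilon>))"
        using E_def by auto
    qed
  qed
qed

end
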